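(* Let $\star$ be the formal product on $C^\infty(\mathfrak l)[[\hbar]]\otimes\mathrm{Pol}(\mathfrak l^* )$ obtained from the asymptotic expansion as $\hbar\to0$ of the left-invariant product $$(u\star_\hbar v)(x_0)=\int_{S\times S}u(x_1)\,v(x_2)\,A(x_1,x_2)\,e^{\frac{i}{\hbar}\Phi(x_0,x_1,x_2)}\,dx_1\,dx_2$$ on the group $S$ ("$ax+b$"). Then $\star$ admits a compatible coproduct and antipode: there exist a coproduct, a counit and an antipode which, together with the product $\star$, make $C^\infty(\mathfrak l)[[\hbar]]\otimes\mathrm{Pol}(\mathfrak l^* )$ a Hopf algebra over $\mathbb C$.
   Context: $S$ is the Lie group $\mathbb R^2=\{(a,\ell)\}$ with multiplication $(a,\ell)\cdot(a',\ell')=(a+a',e^{-a'}\ell+\ell')$ and left-invariant symplectic form $\omega=da\wedge d\ell$. For $x_i=(a_i,\ell_i)$, $$A(x_1,x_2)=\cosh(a_1-a_2),\qquad \Phi(x_0,x_1,x_2)=\sinh(a_0-a_1)\ell_2+\sinh(a_1-a_2)\ell_0+\sinh(a_2-a_0)\ell_1,$$ and $dx$ is a multiple (depending on $\hbar$) of the symplectic volume, normalized so that for $u,v\in C_c^\infty(S)$ the stationary phase expansion of $u\star_\hbar v$ as $\hbar\to0$ has leading term $uv$. The coefficients of this expansion in powers of $\hbar$ are bidifferential operators in $u,v$, so the expansion defines a $\mathbb C[[\hbar]]$-bilinear product on $C^\infty(S)[[\hbar]]$. Write $\mathbb R^2=\mathfrak a\times\mathfrak l$ with $a\in\mathfrak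 a$, $\ell\in\mathfrak l$, and identify $\mathfrak a\simeq\mathfrak l^*$ (so that $a$ is a linear coordinate on $\mathfrak l^*$); $C^\infty(\mathfrak l)[[\hbar]]\otimes\mathrm{Pol}(\mathfrak l^* )$ is the space of polynomials in $a$ with coefficients in $C^\infty(\mathfrak l)[[\hbar]]$, and the formal product is restricted to it. Functions are complex-valued. Convention: coproducts on function spaces take values in completed tensor products, with $C^\infty(\mathfrak l)[[\hbar]]\,\hat\otimes\,C^\infty(\mathfrak l)[[\hbar]]=C^\infty(\mathfrak l\times\mathfrak l)[[\hbar_1,\hbar_2]]$; in particular the structure maps are only required to be $\mathbb C$-linear, and the coproduct and antipode need not be linear over $\mathbb C[[\hbar]]$. *)

theory Defs
  imports "HOL-Analysis.Analysis" "HOL-Library.Landau_Symbols"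
begin

section \<open>Smooth functions, differential and bidifferential operators\<close>

definition partial :: "'a::euclidean_space \<Rightarrow> ('a \<Rightarrow> complex) \<Rightarrow> 'a \<Rightarrow> complex" where
  "partial b f = (\<lambda>x. frechet_derivative f (at x) b)"

definition partials :: "'a::euclidean_space list \<Rightarrow> ('a \<Rightarrow> complex) \<Rightarrow> 'a \<Rightarrow> complex" where
  "partials bs f = foldr partial bs f"

definition smooth :: "('a::euclidean_space \<Rightarrow> complex) \<Rightarrow> bool" where
  "smooth f \<longleftrightarrow> (\<forall>bs\<in>lists Basis. partials bs f differentiable_on UNIV)"

definition test_function :: "('a::euclidean_space \<Rightarrow> complex) \<Rightarrow> bool" where
  "test_function f \<longleftrightarrow> smooth f \<and> compact (closure {x. f x \<noteq> 0})"

text \<open>Convergence to zero in the Frechet space of smooth functions: all derivatives, uniformly on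
  compact sets.\<close>

definition smooth_null :: "(nat \<Rightarrow> 'a::euclidean_space \<Rightarrow> complex) \<Rightarrow> bool" where
  "smooth_null u \<longleftrightarrow> (\<forall>bs\<in>lists Basis. \<forall>K. compact K \<longrightarrow>
     uniform_limit K (\<lambda>j. partials bs (u j)) (\<lambda>_. 0) sequentially)"

text \<open>A bidifferential operator is encoded by its action on functions \<open>w\<close> of two points:
  a differential operator in both points followed by restriction to the diagonal. The
  bilinear operator in the usual sense is its value on \<open>w (x, y) = u x * v y\<close>, and it determines the
  operator on all smooth \<open>w\<close>.\<close>

definition bidifferential :: "(('a::euclidean_space \<times> 'a \<Rightarrow> complex) \<Rightarrow> 'a \<Rightarrow> complex) \<Rightarrow> bool" where
  "bidifferential D \<longleftrightarrow> (\<exists>I c. finite I \<and> I \<subseteq> lists Basis \<and> (\<forall>bs\<in>I. smooth (c bs)) \<and>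
     (\<forall>w. smooth w \<longrightarrow> D w = (\<lambda>x. \<Sum>bs\<in>I. c bs x * partials bs w (x, x))))"


section \<open>The product on the group and its asymptotic expansion\<close>

text \<open>Points \<open>(a, l)\<close> of the group \<open>S\<close>.\<close>

type_synonym S = "real \<times> real"

definition amplitude :: "S \<Rightarrow> S \<Rightarrow> real" where
  "amplitude x1 x2 = cosh (fst x1 - fst x2)"

definition phase :: "S \<Rightarrow> S \<Rightarrow> S \<Rightarrow> real" where
  "phase x0 x1 x2 = sinh (fst x0 - fst x1) * snd x2 + sinh (fst x1 - fst x2) * snd x0
     + sinh (fst x2 - fst x0) * snd x1"

text \<open>The symplectic volume of \<open>da \<and> dl\<close> is Lebesgue measure, and \<open>dx = da dl / (2 \<pi> h)\<close>. This is the
  normalization with leading term \<open>u v\<close>: the only critical point of the phase in \<open>(x1, x2)\<close> is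
  \<open>(x0, x0)\<close>, where phase and amplitude are 0 and 1 and the Hessian in \<open>(a1, l1, a2, l2)\<close> has
  determinant 1 and signature 0, so that stationary phase produces the factor \<open>(2 \<pi> h)^2\<close>.\<close>

definition star_integral :: "real \<Rightarrow> (S \<Rightarrow> complex) \<Rightarrow> (S \<Rightarrow> complex) \<Rightarrow> S \<Rightarrow> complex" where
  "star_integral h u v x0 = complex_of_real ((1 / (2 * pi * h))\<^sup>2) *
     (LINT (x1, x2)|lborel. u x1 * v x2 * complex_of_real (amplitude x1 x2) *
        exp (\<i> / complex_of_real h * complex_of_real (phase x0 x1 x2)))"

definition star_expansion :: "(nat \<Rightarrow> (S \<times> S \<Rightarrow> complex) \<Rightarrow> S \<Rightarrow> complex) \<Rightarrow> bool" where
  "star_expansion D \<longleftrightarrow> (\<forall>k. bidifferential (D k)) \<and>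
     (\<forall>u v x0 N. test_function u \<longrightarrow> test_function v \<longrightarrow>
        (\<lambda>h. star_integral h u v x0
              - (\<Sum>k<N. complex_of_real h ^ k * D k (\<lambda>(x, y). u x * v y) x0))
          \<in> O[at_right 0](\<lambda>h. complex_of_real h ^ N))"


section \<open>The function spaces\<close>

text \<open>A formal power series in \<open>h\<close> (or in several such variables) whose coefficients are functions on \<open>'x\<close>
  is the family of its coefficients, indexed by the exponents \<open>'h\<close>.\<close>

type_synonym ('h, 'x) formal = "'h \<Rightarrow> 'x \<Rightarrow> complex"

text \<open>Polynomials in \<open>a\<close> of degree at most \<open>d\<close> with coefficients in the formal power series over smooth
  functions of \<open>l\<close>. The bound on the degree is the same for all powers of \<open>h\<close>.\<close>

definition H1_deg :: "nat \<Rightarrow> (nat, S) formal set" where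
  "H1_deg d = {F. \<exists>f. (\<forall>r k. smooth (f r k)) \<and>
     F = (\<lambda>r (a, l). \<Sum>k\<le>d. complex_of_real a ^ k * f r k (l::real))}"

text \<open>The completed tensor square: two variables \<open>h1, h2\<close>, two points of \<open>S\<close>, polynomial in
  \<open>a1, a2\<close> with coefficients that are jointly smooth in \<open>(l1, l2)\<close>.\<close>

definition H2_deg :: "nat \<Rightarrow> (nat \<times> nat, S \<times> S) formal set" where
  "H2_deg d = {F. \<exists>f. (\<forall>r k m. smooth (f r k m)) \<and>
     F = (\<lambda>r ((a1, l1), (a2, l2)). \<Sum>k\<le>d. \<Sum>m\<le>d.
            complex_of_real a1 ^ k * complex_of_real a2 ^ m * f r k m (l1::real, l2::real))}"

definition H1 :: "(nat, S) formal set" where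
  "H1 = (\<Union>d. H1_deg d)"

definition H2 :: "(nat \<times> nat, S \<times> S) formal set" where
  "H2 = (\<Union>d. H2_deg d)"

text \<open>Both spaces are strict inductive limits, over the degree, of Frechet spaces (countable products
  of spaces of smooth functions). A sequence converges in such a limit iff it lies in one of the
  steps and converges there, and a linear map is continuous iff it is sequentially continuous.\<close>

definition null_seq ::
  "(nat \<Rightarrow> ('h, 'x::euclidean_space) formal set) \<Rightarrow> (nat \<Rightarrow> ('h, 'x) formal) \<Rightarrow> bool" where
  "null_seq A X \<longleftrightarrow> (\<exists>d. \<forall>j. X j \<in> A d) \<and> (\<forall>r. smooth_null (\<lambda>j. X j r))"

definition linear_continuous_map ::
  "(nat \<Rightarrow> ('h, 'x::euclidean_space) formal set) \<Rightarrow> (nat \<Rightarrow> ('k, 'y::euclidean_space) formal set)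
    \<Rightarrow> (('h, 'x) formal \<Rightarrow> ('k, 'y) formal) \<Rightarrow> bool" where
  "linear_continuous_map A B T \<longleftrightarrow>
     (\<forall>F\<in>(\<Union>d. A d). T F \<in> (\<Union>d. B d)) \<and>
     (\<forall>F\<in>(\<Union>d. A d). \<forall>G\<in>(\<Union>d. A d).
        T (\<lambda>r x. F r x + G r x) = (\<lambda>r x. T F r x + T G r x)) \<and>
     (\<forall>c. \<forall>F\<in>(\<Union>d. A d). T (\<lambda>r x. c * F r x) = (\<lambda>r x. c * T F r x)) \<and>
     (\<forall>X. null_seq A X \<longrightarrow> null_seq B (\<lambda>j. T (X j)))"

definition linear_continuous_functional ::
  "(nat \<Rightarrow> ('h, 'x::euclidean_space) formal set) \<Rightarrow> (('h, 'x) formal \<Rightarrow> complex) \<Rightarrow> bool" where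
  "linear_continuous_functional A e \<longleftrightarrow>
     (\<forall>F\<in>(\<Union>d. A d). \<forall>G\<in>(\<Union>d. A d). e (\<lambda>r x. F r x + G r x) = e F + e G) \<and>
     (\<forall>c. \<forall>F\<in>(\<Union>d. A d). e (\<lambda>r x. c * F r x) = c * e F) \<and>
     (\<forall>X. null_seq A X \<longrightarrow> (\<lambda>j. e (X j)) \<longlonglongrightarrow> 0)"


section \<open>Tensor products of elements and of maps\<close>

definition tensor :: "('h, 'x) formal \<Rightarrow> ('k, 'y) formal \<Rightarrow> ('h \<times> 'k, 'x \<times> 'y) formal" where
  "tensor F G = (\<lambda>(r, q) (x, y). F r x * G q y)"

text \<open>For continuous linear \<open>T\<close>, the maps \<open>T \<otimes> id\<close> and \<open>id \<otimes> T\<close> on the completed tensor product apply \<open>T\<close> in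
  one leg while exponent and point of the other leg are held fixed (they commute with the
  continuous functionals extracting a coefficient and evaluating at a point in the other leg).\<close>

definition left_leg ::
  "(('h, 'x) formal \<Rightarrow> ('h2, 'x2) formal) \<Rightarrow> ('h \<times> 'k, 'x \<times> 'y) formal \<Rightarrow> ('h2 \<times> 'k, 'x2 \<times> 'y) formal"
  where "left_leg T W = (\<lambda>(p, q) (x, y). T (\<lambda>r z. W (r, q) (z, y)) p x)"

definition right_leg ::
  "(('k, 'y) formal \<Rightarrow> ('k2, 'y2) formal) \<Rightarrow> ('h \<times> 'k, 'x \<times> 'y) formal \<Rightarrow> ('h \<times> 'k2, 'x \<times> 'y2) formal"
  where "right_leg T W = (\<lambda>(p, q) (x, y). T (\<lambda>r z. W (p, r) (x, z)) q y)"

definition left_eval ::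
  "(('h, 'x) formal \<Rightarrow> complex) \<Rightarrow> ('h \<times> 'k, 'x \<times> 'y) formal \<Rightarrow> ('k, 'y) formal"
  where "left_eval e W = (\<lambda>q y. e (\<lambda>r z. W (r, q) (z, y)))"

definition right_eval ::
  "(('k, 'y) formal \<Rightarrow> complex) \<Rightarrow> ('h \<times> 'k, 'x \<times> 'y) formal \<Rightarrow> ('h, 'x) formal"
  where "right_eval e W = (\<lambda>p x. e (\<lambda>r z. W (p, r) (x, z)))"

definition reassociate ::
  "(('h1 \<times> 'h2) \<times> 'h3, ('x1 \<times> 'x2) \<times> 'x3) formal \<Rightarrow> ('h1 \<times> 'h2 \<times> 'h3, 'x1 \<times> 'x2 \<times> 'x3) formal"
  where "reassociate W = (\<lambda>(p, q, r) (x, y, z). W ((p, q), r) ((x, y), z))"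

definition swap_middle ::
  "(('h1 \<times> 'h2) \<times> ('h3 \<times> 'h4), ('x1 \<times> 'x2) \<times> ('x3 \<times> 'x4)) formal
    \<Rightarrow> (('h1 \<times> 'h3) \<times> ('h2 \<times> 'h4), ('x1 \<times> 'x3) \<times> ('x2 \<times> 'x4)) formal"
  where "swap_middle W = (\<lambda>((p, r), (q, s)) ((x, z), (y, w)). W ((p, q), (r, s)) ((x, y), (z, w)))"


section \<open>The formal product and Hopf algebra structures\<close>

text \<open>The multiplication as a map on the completed tensor square: the term \<open>h1^i h2^j w(x, y)\<close> goes to the
  sum over \<open>k\<close> of \<open>h^(i+j+k) D k w\<close>.\<close>

definition mult ::
  "(nat \<Rightarrow> ('x \<times> 'x \<Rightarrow> complex) \<Rightarrow> 'x \<Rightarrow> complex) \<Rightarrow> (nat \<times> nat, 'x \<times> 'x) formal \<Rightarrow> (nat, 'x) formal" where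
  "mult D W = (\<lambda>n x. \<Sum>i\<le>n. \<Sum>j\<le>n - i. D (n - i - j) (W (i, j)) x)"

definition star ::
  "(nat \<Rightarrow> ('x \<times> 'x \<Rightarrow> complex) \<Rightarrow> 'x \<Rightarrow> complex) \<Rightarrow> (nat, 'x) formal \<Rightarrow> (nat, 'x) formal \<Rightarrow> (nat, 'x) formal"
  where "star D F G = mult D (tensor F G)"

definition star2 ::
  "(nat \<Rightarrow> ('x \<times> 'x \<Rightarrow> complex) \<Rightarrow> 'x \<Rightarrow> complex) \<Rightarrow> (nat \<times> nat, 'x \<times> 'x) formal
    \<Rightarrow> (nat \<times> nat, 'x \<times> 'x) formal \<Rightarrow> (nat \<times> nat, 'x \<times> 'x) formal" where
  "star2 D F G = left_leg (mult D) (right_leg (mult D) (swap_middle (tensor F G)))"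

definition one :: "(nat, 'x) formal" where
  "one = (\<lambda>r x. if r = 0 then 1 else 0)"

definition is_algebra :: "(nat \<Rightarrow> (S \<times> S \<Rightarrow> complex) \<Rightarrow> S \<Rightarrow> complex) \<Rightarrow> bool" where
  "is_algebra D \<longleftrightarrow>
     linear_continuous_map H2_deg H1_deg (mult D) \<and>
     (\<forall>F\<in>H1. \<forall>G\<in>H1. star D F G \<in> H1) \<and>
     (\<forall>F\<in>H1. \<forall>G\<in>H1. \<forall>K\<in>H1. star D (star D F G) K = star D F (star D G K)) \<and>
     (\<forall>F\<in>H1. star D one F = F \<and> star D F one = F)"

definition is_coalgebra ::
  "((nat, S) formal \<Rightarrow> (nat \<times> nat, S \<times> S) formal) \<Rightarrow> ((nat, S) formal \<Rightarrow> complex) \<Rightarrow> bool" where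
  "is_coalgebra \<Delta> \<epsilon> \<longleftrightarrow>
     linear_continuous_map H1_deg H2_deg \<Delta> \<and>
     linear_continuous_functional H1_deg \<epsilon> \<and>
     (\<forall>F\<in>H1. reassociate (left_leg \<Delta> (\<Delta> F)) = right_leg \<Delta> (\<Delta> F)) \<and>
     (\<forall>F\<in>H1. left_eval \<epsilon> (\<Delta> F) = F \<and> right_eval \<epsilon> (\<Delta> F) = F)"

definition is_bialgebra ::
  "(nat \<Rightarrow> (S \<times> S \<Rightarrow> complex) \<Rightarrow> S \<Rightarrow> complex) \<Rightarrow> ((nat, S) formal \<Rightarrow> (nat \<times> nat, S \<times> S) formal)
    \<Rightarrow> ((nat, S) formal \<Rightarrow> complex) \<Rightarrow> bool" where
  "is_bialgebra D \<Delta> \<epsilon> \<longleftrightarrow> is_algebra D \<and> is_coalgebra \<Delta> \<epsilon> \<and>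
     (\<forall>F\<in>H1. \<forall>G\<in>H1. \<Delta> (star D F G) = star2 D (\<Delta> F) (\<Delta> G)) \<and>
     \<Delta> one = tensor one one \<and>
     (\<forall>F\<in>H1. \<forall>G\<in>H1. \<epsilon> (star D F G) = \<epsilon> F * \<epsilon> G) \<and>
     \<epsilon> one = 1"

definition is_hopf_algebra ::
  "(nat \<Rightarrow> (S \<times> S \<Rightarrow> complex) \<Rightarrow> S \<Rightarrow> complex) \<Rightarrow> ((nat, S) formal \<Rightarrow> (nat \<times> nat, S \<times> S) formal)
    \<Rightarrow> ((nat, S) formal \<Rightarrow> complex) \<Rightarrow> ((nat, S) formal \<Rightarrow> (nat, S) formal) \<Rightarrow> bool" where
  "is_hopf_algebra D \<Delta> \<epsilon> \<sigma> \<longleftrightarrow> is_bialgebra D \<Delta> \<epsilon> \<and>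
     linear_continuous_map H1_deg H1_deg \<sigma> \<and>
     (\<forall>F\<in>H1. mult D (left_leg \<sigma> (\<Delta> F)) = (\<lambda>r x. \<epsilon> F * one r x) \<and>
              mult D (right_leg \<sigma> (\<Delta> F)) = (\<lambda>r x. \<epsilon> F * one r x))"

end

theory Submission
  imports Defs "HOL-Probability.Probability"
begin

text \<open>With \<open>D = - \<i> \<partial>\<^sub>l\<close>, put \<open>T = exp (\<i> l (sinh (h D) / h - D)) cosh (h D)\<close>, where multiplication by \<open>l\<close> stands to
  the left of \<open>D\<close>, and let \<open>R\<close> be its inverse. Doing the \<open>l\<close>-integrals first turns the oscillatory integral
  into an absolutely convergent one over Fourier variables evaluated at \<open>sinh (h P) / h\<close> and \<open>sinh (h Q) / h\<close>,
  whose expansion shows \<open>u \<star> v = T (R u * R v)\<close> with \<open>*\<close> the Moyal product. This is first obtained on products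
  of test functions and extends to all smooth functions because both sides are differential operators.

  The Moyal product multiplies the group-like elements \<open>exp (\<tau> h + \<zeta> \<bullet> x)\<close> as the complexified Heisenberg group
  does. Hence \<open>h \<mapsto> h\<^sub>1 + h\<^sub>2\<close>, \<open>x \<mapsto> x\<^sub>1 + x\<^sub>2\<close> is a coproduct for it, with antipode \<open>h \<mapsto> - h\<close>, \<open>x \<mapsto> - x\<close>, and
  conjugation by \<open>T\<close> carries this Hopf structure over to \<open>\<star>\<close>. All identities reduce to group-like elements, as a
  local operator that vanishes on exponentials vanishes.\<close>

section \<open>Calculus of smooth functions\<close>

text \<open>In the Fourier variables of l, R is the substitution of sinh (h P) / h for P in each
  argument and T reverses it in the result; the amplitude cosh is exactly the Jacobian that makes T
  the inverse of R. What is left between them, f (a + h Q) g (a - h P), is the Moyal product once P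
  and Q are read as \<open>- \<i> \<partial>\<^sub>l\<close> on the two factors. The formal
  parameter is the central coordinate of the Heisenberg Lie algebra and hence primitive, so
  coproduct and antipode move h and are linear over the complex numbers only. Two obstacles shape
  the proof. Exponentials in a are not polynomial in a, so group-like elements lie outside
  \<open>H1\<close>: all identities are proved for formal series with arbitrary smooth coefficients,
  and \<open>H1\<close> enters only through degree bounds. Exponentials also lack compact support,
  so the comparison of the given expansion with the conjugated Moyal product runs through cut-off
  exponentials. Both times it is decisive that a differential operator sees only a finite jet and
  that sums of real exponentials realize every finite jet.\<close>

lemma partials_Nil [simp]: "partials [] f = f"
  and partials_Cons [simp]: "partials (b # bs) f = partial b (partials bs f)"
  and partials_append: "partials (as @ bs) f = partials as (partials bs f)"
  by (simp_all add: partials_def)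

lemma partial_eqI:
  assumes "\<And>x. (f has_derivative f' x) (at x)"
  shows "partial b f = (\<lambda>x. f' x b)"
  using frechet_derivative_at[OF assms] by (simp add: partial_def)

lemma smooth_differentiable_on: "smooth f \<Longrightarrow> f differentiable_on UNIV"
  unfolding smooth_def by (metis lists.Nil partials_Nil)

lemma smooth_differentiable: "smooth f \<Longrightarrow> f differentiable (at x)"
  using smooth_differentiable_on[of f] by (auto simp: differentiable_on_def)

lemma smooth_partials: "smooth f \<Longrightarrow> bs \<in> lists Basis \<Longrightarrow> smooth (partials bs f)"
  unfolding smooth_def by (metis append_in_lists_conv partials_append)

lemma smooth_partial: "smooth f \<Longrightarrow> b \<in> Basis \<Longrightarrow> smooth (partial b f)"
  using smooth_partials[of f "[b]"] by simp

text \<open>Smoothness quantifies over all lists of directions; a class of differentiable functions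
  that contains \<open>f\<close> and is stable under basis partials certifies all of them at once.
  Most smoothness proofs below exhibit such a class.\<close>

lemma smooth_coinduct:
  assumes "f \<in> X" and "\<And>g. g \<in> X \<Longrightarrow> g differentiable_on UNIV"
    and "\<And>g b. g \<in> X \<Longrightarrow> b \<in> Basis \<Longrightarrow> partial b g \<in> X"
  shows "smooth f"
proof -
  have "partials bs f \<in> X" if "bs \<in> lists Basis" for bs
    using that by (induction bs) (use assms in auto)
  then show ?thesis
    unfolding smooth_def using assms(2) by blast
qed

lemma has_derivative_frechet: "f differentiable (at x) \<Longrightarrow> (f has_derivative frechet_derivative f (at x)) (at x)"
  by (simp add: frechet_derivative_works)

lemma partial_add:
  assumes "f differentiable_on UNIV" "g differentiable_on UNIV"
  shows "partial b (\<lambda>x. f x + g x) = (\<lambda>x. partial b f x + partial b g x)"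
proof -
  have "((\<lambda>x. f x + g x) has_derivative (\<lambda>v. frechet_derivative f (at x) v + frechet_derivative g (at x) v)) (at x)" for x
    using assms by (intro has_derivative_add has_derivative_frechet) (auto simp: differentiable_on_def)
  from partial_eqI[OF this] show ?thesis by (simp add: partial_def)
qed

lemma partial_mult:
  assumes "f differentiable_on UNIV" "g differentiable_on UNIV"
  shows "partial b (\<lambda>x. f x * g x) = (\<lambda>x. f x * partial b g x + partial b f x * g x)"
proof -
  have "((\<lambda>x. f x * g x) has_derivative
      (\<lambda>v. f x * frechet_derivative g (at x) v + frechet_derivative f (at x) v * g x)) (at x)" for x
    using assms by (intro has_derivative_mult has_derivative_frechet) (auto simp: differentiable_on_def)
  from partial_eqI[OF this] show ?thesis by (simp add: partial_def)
qed

lemma partial_const [simp]: "partial b (\<lambda>x. c) = (\<lambda>x. 0)"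
  by (subst partial_eqI[of _ "\<lambda>_ _. 0"]) auto

text \<open>Differentiation leads out of a set of generators but, by the Leibniz rule, not out of
  their sums and products. Once the generators are checked, \<open>alg\<close> is an invariant class
  for \<open>smooth_coinduct\<close>.\<close>

inductive_set alg :: "('a::euclidean_space \<Rightarrow> complex) set \<Rightarrow> ('a \<Rightarrow> complex) set" for G where
  base: "g \<in> G \<Longrightarrow> g \<in> alg G"
| add: "f \<in> alg G \<Longrightarrow> g \<in> alg G \<Longrightarrow> (\<lambda>x. f x + g x) \<in> alg G"
| mult: "f \<in> alg G \<Longrightarrow> g \<in> alg G \<Longrightarrow> (\<lambda>x. f x * g x) \<in> alg G"

lemma smooth_alg:
  assumes "f \<in> alg G" "\<And>g. g \<in> G \<Longrightarrow> g differentiable_on UNIV"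
    and "\<And>g b. g \<in> G \<Longrightarrow> b \<in> Basis \<Longrightarrow> partial b g \<in> alg G"
  shows "smooth f"
proof (rule smooth_coinduct[OF assms(1)])
  fix g assume "g \<in> alg G"
  then show d: "g differentiable_on UNIV"
    by induction (use assms(2) in \<open>auto intro!: derivative_intros\<close>)
next
  have d: "g differentiable_on UNIV" if "g \<in> alg G" for g
    using that by induction (use assms(2) in \<open>auto intro!: derivative_intros\<close>)
  fix g and b :: 'a assume "g \<in> alg G" and b: "b \<in> Basis"
  then show "partial b g \<in> alg G"
    by induction (use assms(3) b in \<open>auto simp: partial_add partial_mult d intro: alg.intros\<close>)
qed

lemma smooth_add: "smooth f \<Longrightarrow> smooth g \<Longrightarrow> smooth (\<lambda>x. f x + g x)"
  and smooth_mult: "smooth f \<Longrightarrow> smooth g \<Longrightarrow> smooth (\<lambda>x. f x * g x)"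
  by (rule smooth_alg[of _ "Collect smooth"];
      auto intro: alg.intros smooth_differentiable_on smooth_partial)+

lemma smooth_const [simp]: "smooth (\<lambda>x. c)"
  by (rule smooth_coinduct[of _ "range (\<lambda>c x. c)"]) auto

lemma smooth_sum: "(\<And>i. i \<in> I \<Longrightarrow> smooth (f i)) \<Longrightarrow> smooth (\<lambda>x. \<Sum>i\<in>I. f i x)"
  by (induction I rule: infinite_finite_induct) (auto intro: smooth_add)

lemma smooth_power: "smooth f \<Longrightarrow> smooth (\<lambda>x. f x ^ n)"
  by (induction n) (auto intro: smooth_mult)

lemma smooth_uminus: "smooth f \<Longrightarrow> smooth (\<lambda>x. - f x)"
  using smooth_mult[of "\<lambda>_. - 1" f] by simp

lemma smooth_diff: "smooth f \<Longrightarrow> smooth g \<Longrightarrow> smooth (\<lambda>x. f x - g x)"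
  using smooth_add[of f "\<lambda>x. - g x"] smooth_uminus[of g] by simp

lemmas smooth_intros = smooth_add smooth_mult smooth_const smooth_sum smooth_power smooth_uminus
  smooth_diff smooth_partial

text \<open>Smoothness speaks of basis directions only; expanding a vector in the basis recovers the
  full Frechet derivative, the form in which the chain rule is applied.\<close>

lemma smooth_has_derivative:
  assumes "smooth g"
  shows "(g has_derivative (\<lambda>v. \<Sum>b\<in>Basis. of_real (v \<bullet> b) * partial b g x)) (at x)"
proof -
  have d: "(g has_derivative frechet_derivative g (at x)) (at x)"
    using smooth_differentiable[OF assms] by (rule has_derivative_frechet)
  have l: "linear (frechet_derivative g (at x))"
    using has_derivative_linear[OF d] .
  have "frechet_derivative g (at x) v = (\<Sum>b\<in>Basis. of_real (v \<bullet> b) * partial b g x)" for v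
  proof -
    have "frechet_derivative g (at x) v = frechet_derivative g (at x) (\<Sum>b\<in>Basis. (v \<bullet> b) *\<^sub>R b)"
      by (simp add: euclidean_representation)
    also have "\<dots> = (\<Sum>b\<in>Basis. (v \<bullet> b) *\<^sub>R frechet_derivative g (at x) b)"
      by (simp add: linear_sum[OF l] linear_cmul[OF l])
    finally show ?thesis by (simp add: partial_def scaleR_conv_of_real)
  qed
  with d show ?thesis by (metis (no_types, lifting) ext)
qed

lemma smooth_continuous_on: "smooth f \<Longrightarrow> continuous_on A f"
  by (meson continuous_on_subset differentiable_imp_continuous_on smooth_differentiable_on subset_UNIV)

text \<open>All base point maps below (diagonal, projections, slices, sum, reflection, constants)
  are affine. For them the chain rule has constant coefficients, so pullbacks of smooth functions
  keep their shape under differentiation.\<close>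

definition affine_map :: "('a::euclidean_space \<Rightarrow> 'b::euclidean_space) \<Rightarrow> bool" where
  "affine_map \<iota> \<longleftrightarrow> (\<exists>L c. bounded_linear L \<and> \<iota> = (\<lambda>y. L y + c))"

lemma partial_affine:
  assumes "smooth g" "bounded_linear L"
  shows "partial b (\<lambda>y. g (L y + c)) = (\<lambda>y. \<Sum>b'\<in>Basis. of_real (L b \<bullet> b') * partial b' g (L y + c))"
proof (rule partial_eqI)
  fix x
  have "((\<lambda>y. L y + c) has_derivative L) (at x)"
    using assms(2) by (auto intro!: derivative_eq_intros bounded_linear_imp_has_derivative)
  from has_derivative_compose[OF this smooth_has_derivative[OF assms(1)]]
  show "((\<lambda>y. g (L y + c)) has_derivative
      (\<lambda>b. \<Sum>b'\<in>Basis. of_real (L b \<bullet> b') * partial b' g (L x + c))) (at x)"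
    by (simp add: o_def)
qed

lemma alg_const_sum:
  assumes "\<And>i. i \<in> I \<Longrightarrow> f i \<in> alg G" "(\<lambda>x. 0) \<in> alg G"
  shows "(\<lambda>x. \<Sum>i\<in>I. f i x) \<in> alg G"
  using assms by (induction I rule: infinite_finite_induct) (auto intro: alg.intros)

lemma smooth_affine:
  assumes "smooth g" "affine_map \<iota>"
  shows "smooth (\<lambda>y. g (\<iota> y))"
proof -
  obtain L c where L: "bounded_linear L" and \<iota>: "\<iota> = (\<lambda>y. L y + c)"
    using assms(2) by (auto simp: affine_map_def)
  define G where "G = range (\<lambda>c (x::'b). c :: complex) \<union> {\<lambda>y. g (L y + c) | g. smooth g}"
  have G: "(\<lambda>x. k) \<in> alg G" "smooth g \<Longrightarrow> (\<lambda>y. g (L y + c)) \<in> alg G" for k g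
    unfolding G_def by (auto intro!: alg.base)
  show ?thesis
    unfolding \<iota>
  proof (rule smooth_alg[of _ G])
    show "(\<lambda>y. g (L y + c)) \<in> alg G" using G assms(1) by blast
  next
    fix h and b :: 'b assume "h \<in> G"
    then consider k where "h = (\<lambda>x. k)" | g where "smooth g" "h = (\<lambda>y. g (L y + c))"
      by (auto simp: G_def)
    then have "h differentiable_on UNIV \<and> partial b h \<in> alg G"
    proof cases
      case 1
      then show ?thesis using G by simp
    next
      case (2 g)
      have "((\<lambda>y. L y + c) has_derivative L) (at x)" for x
        using L by (auto intro!: derivative_eq_intros bounded_linear_imp_has_derivative)
      from has_derivative_compose[OF this smooth_has_derivative[OF 2(1)]]
      have "h differentiable_on UNIV" unfolding 2(2) differentiable_on_def differentiable_def by fast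
      moreover have "partial b h \<in> alg G"
        unfolding 2(2) partial_affine[OF 2(1) L]
        by (intro alg_const_sum alg.mult G smooth_partial 2)
      ultimately show ?thesis by blast
    qed
    then show "h differentiable_on UNIV" "partial b h \<in> alg G" by blast+
  qed
qed

lemma affine_map_id: "affine_map (\<lambda>x. x)"
  and affine_map_fst: "affine_map fst"
  and affine_map_snd: "affine_map snd"
  and affine_map_uminus: "affine_map (\<lambda>x. - x)"
  and affine_map_const: "affine_map (\<lambda>x. c)"
  and affine_map_diag: "affine_map (\<lambda>x. (x, x))"
  and affine_map_add: "affine_map (\<lambda>(x, y). x + y)"
  and affine_map_pair_left: "affine_map (\<lambda>x. (x, d))"
  and affine_map_pair_right: "affine_map (\<lambda>x. (d, x))"
proof -
  have *: "affine_map f" if "bounded_linear L" "f = (\<lambda>y. L y + c)" for f and L :: "'x::euclidean_space \<Rightarrow> 'y::euclidean_space" and c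
    using that by (auto simp: affine_map_def)
  show "affine_map (\<lambda>x. x)" by (rule *[of "\<lambda>x. x" _ 0]) (auto intro: bounded_linear_ident)
  show "affine_map fst" by (rule *[of fst _ 0]) (auto intro: bounded_linear_fst)
  show "affine_map snd" by (rule *[of snd _ 0]) (auto intro: bounded_linear_snd)
  show "affine_map (\<lambda>x. - x)" by (rule *[of "\<lambda>x. - x" _ 0]) (auto intro: bounded_linear_minus bounded_linear_ident)
  show "affine_map (\<lambda>x. c)" by (rule *[of "\<lambda>x. 0" _ c]) auto
  show "affine_map (\<lambda>x. (x, x))" by (rule *[of "\<lambda>x. (x, x)" _ 0]) (auto intro: bounded_linear_Pair bounded_linear_ident simp: zero_prod_def)
  show "affine_map (\<lambda>(x, y). x + y)" by (rule *[of "\<lambda>z. fst z + snd z" _ 0])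
     (auto intro: bounded_linear_add bounded_linear_fst bounded_linear_snd)
  show "affine_map (\<lambda>x. (x, d))" by (rule *[of "\<lambda>x. (x, 0)" _ "(0, d)"]) (auto intro: bounded_linear_Pair bounded_linear_ident)
  show "affine_map (\<lambda>x. (d, x))" by (rule *[of "\<lambda>x. (0, x)" _ "(d, 0)"]) (auto intro: bounded_linear_Pair bounded_linear_ident)
qed

lemma affine_map_compose:
  assumes "affine_map f" "affine_map g"
  shows "affine_map (\<lambda>x. f (g x))"
proof -
  obtain L c M d where L: "bounded_linear L" "f = (\<lambda>y. L y + c)" and M: "bounded_linear M" "g = (\<lambda>y. M y + d)"
    using assms by (auto simp: affine_map_def)
  have "bounded_linear (\<lambda>x. L (M x))" using bounded_linear_compose L M by blast
  moreover have "(\<lambda>x. f (g x)) = (\<lambda>x. L (M x) + (L d + c))"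
    using L M by (auto simp: linear_add[OF bounded_linear.linear])
  ultimately show ?thesis unfolding affine_map_def by blast
qed

lemma affine_map_Pair:
  assumes "affine_map f" "affine_map g"
  shows "affine_map (\<lambda>x. (f x, g x))"
proof -
  obtain L c M d where L: "bounded_linear L" "f = (\<lambda>y. L y + c)" and M: "bounded_linear M" "g = (\<lambda>y. M y + d)"
    using assms by (auto simp: affine_map_def)
  have "bounded_linear (\<lambda>x. (L x, M x))" using L M bounded_linear_Pair by blast
  then show ?thesis unfolding affine_map_def using L M
    by (intro exI[of _ "\<lambda>x. (L x, M x)"] exI[of _ "(c, d)"]) auto
qed

lemma affine_map_map_prod:
  assumes "affine_map f" "affine_map g"
  shows "affine_map (\<lambda>(x, y). (f x, g y))"
  using affine_map_Pair[OF affine_map_compose[OF assms(1) affine_map_fst]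
      affine_map_compose[OF assms(2) affine_map_snd]] by (simp add: case_prod_unfold)

lemma affine_map_continuous: "affine_map \<iota> \<Longrightarrow> continuous_on A \<iota>"
  unfolding affine_map_def using bounded_linear.continuous_on[OF _ continuous_on_id]
  by (auto intro!: continuous_intros)

lemma smooth_real_linear: "bounded_linear L \<Longrightarrow> smooth (\<lambda>x. complex_of_real (L x))"
proof (rule smooth_coinduct[of _ "insert (\<lambda>x. complex_of_real (L x)) (range (\<lambda>c x. c))"])
  assume L: "bounded_linear L"
  have d: "((\<lambda>x. complex_of_real (L x)) has_derivative (\<lambda>v. of_real (L v))) (at x)" for x
    using L by (intro bounded_linear_imp_has_derivative bounded_linear_compose[OF bounded_linear_of_real])
  fix g and b :: 'a assume "g \<in> insert (\<lambda>x. complex_of_real (L x)) (range (\<lambda>c x. c))"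
  then show "g differentiable_on UNIV" "partial b g \<in> insert (\<lambda>x. complex_of_real (L x)) (range (\<lambda>c x. c))"
    using d partial_eqI[OF d] by (auto simp: differentiable_on_def intro: differentiableI)
qed simp

lemma smooth_exp_linear: "bounded_linear L \<Longrightarrow> smooth (\<lambda>x. exp (complex_of_real (L x)))"
  and partial_exp_linear: "bounded_linear L \<Longrightarrow>
    partial b (\<lambda>x. exp (complex_of_real (L x))) = (\<lambda>x. of_real (L b) * exp (of_real (L x)))"
proof -
  assume L: "bounded_linear L"
  let ?e = "\<lambda>x. exp (complex_of_real (L x))"
  have "((\<lambda>x. complex_of_real (L x)) has_derivative (\<lambda>v. of_real (L v))) (at x)" for x
    using L by (intro bounded_linear_imp_has_derivative bounded_linear_compose[OF bounded_linear_of_real])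
  note e = has_derivative_compose[OF this, of exp, OF DERIV_exp[THEN has_field_derivative_imp_has_derivative]]
  then show pe: "partial b ?e = (\<lambda>x. of_real (L b) * ?e x)" for b
    using partial_eqI[OF e] by (auto simp: o_def mult.commute)
  have de: "?e differentiable_on UNIV"
    unfolding differentiable_on_def differentiable_def using e by blast
  have c: "(\<lambda>x. c * ?e x) differentiable_on UNIV" for c using de by (intro derivative_intros)
  have "smooth (\<lambda>x. 1 * ?e x)"
  proof (rule smooth_coinduct[of _ "range (\<lambda>c x. c * ?e x)"])
    fix g and b :: 'a assume "g \<in> range (\<lambda>c x. c * ?e x)"
    then show "g differentiable_on UNIV" "partial b g \<in> range (\<lambda>c x. c * ?e x)"
      using c partial_mult[OF _ de, of "\<lambda>_. _" b] pe by (auto simp flip: mult.assoc)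
  qed (rule range_eqI[of _ _ 1], simp)
  then show "smooth ?e" by simp
qed

section \<open>Jets\<close>

text \<open>\<open>K\<close> is the order of vanishing: \<open>flat 0\<close> is no condition, and a
  differential operator of order below \<open>K\<close> sends a \<open>flat K\<close> function to 0
  at \<open>p\<close>.\<close>

definition flat :: "nat \<Rightarrow> 'a::euclidean_space \<Rightarrow> ('a \<Rightarrow> complex) \<Rightarrow> bool" where
  "flat K p w \<longleftrightarrow> (\<forall>bs\<in>lists Basis. length bs < K \<longrightarrow> partials bs w p = 0)"

lemma flat_0 [simp]: "flat 0 p w"
  by (simp add: flat_def)

text \<open>The direction split off is the last list entry, that is, the derivative taken first; the
  order of differentiation is thereby kept.\<close>

lemma flat_Suc: "flat (Suc K) p w \<longleftrightarrow> w p = 0 \<and> (\<forall>b\<in>Basis. flat K p (partial b w))"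
proof safe
  assume *: "flat (Suc K) p w"
  then show "w p = 0" by (force simp: flat_def dest: bspec[of _ _ "[]"])
  fix b :: 'a assume "b \<in> Basis"
  then show "flat K p (partial b w)"
    using * partials_append[of _ "[b]" w] unfolding flat_def
    by (metis append_in_lists_conv length_append_singleton lists.Cons lists.Nil not_less_eq partials_Cons partials_Nil)
next
  assume *: "w p = 0" "\<forall>b\<in>Basis. flat K p (partial b w)"
  show "flat (Suc K) p w"
    unfolding flat_def
  proof (intro ballI impI)
    fix bs :: "'a list" assume "bs \<in> lists Basis" "length bs < Suc K"
    then show "partials bs w p = 0"
      using * by (cases bs rule: rev_cases) (auto simp: partials_append flat_def)
  qed
qed

lemma flat_mono: "flat K p w \<Longrightarrow> M \<le> K \<Longrightarrow> flat M p w"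
  by (auto simp: flat_def)

lemma flat_add: "smooth f \<Longrightarrow> smooth g \<Longrightarrow> flat K p f \<Longrightarrow> flat K p g \<Longrightarrow> flat K p (\<lambda>x. f x + g x)"
  by (induction K arbitrary: f g) (auto simp: flat_Suc partial_add smooth_differentiable_on smooth_partial)

text \<open>The Leibniz rule lowers one of the two orders by one, so the induction runs on the order
  \<open>n\<close> claimed for the product, with \<open>K\<close> and \<open>M\<close> left
  free.\<close>

lemma flat_mult:
  assumes "smooth f" "smooth g" "flat K p f" "flat M p g"
  shows "flat (K + M) p (\<lambda>x. f x * g x)"
proof -
  have "\<forall>f g K M. smooth f \<longrightarrow> smooth g \<longrightarrow> flat K p f \<longrightarrow> flat M p g \<longrightarrow> n \<le> K + M \<longrightarrow> flat n p (\<lambda>x. f x * g x)" for n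
  proof (induction n)
    case (Suc n)
    show ?case
    proof (intro allI impI)
      fix f g K M assume *: "smooth f" "smooth g" "flat K p f" "flat M p g" "Suc n \<le> K + M"
      have "f p * g p = 0" using *(3-5) by (cases K; cases M) (auto simp: flat_Suc)
      moreover have "flat n p (partial b (\<lambda>x. f x * g x))" if b: "b \<in> Basis" for b
      proof -
        have g': "flat (M - 1) p (partial b g)" using *(4) b by (cases M) (auto simp: flat_Suc)
        have f': "flat (K - 1) p (partial b f)" using *(3) b by (cases K) (auto simp: flat_Suc)
        \<comment> \<open>If \<open>K\<close> or \<open>M\<close> is 0 the subtraction truncates,
          but then \<open>Suc n \<le> K + M\<close> still leaves one order to spare.\<close>
        have "n \<le> K + (M - 1)" "n \<le> (K - 1) + M" using *(5) by auto
        then have "flat n p (\<lambda>x. f x * partial b g x)" "flat n p (\<lambda>x. partial b f x * g x)"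
          using Suc.IH[rule_format, of f "partial b g" K "M - 1"] Suc.IH[rule_format, of "partial b f" g "K - 1" M]
            *(1-4) smooth_partial[OF *(1) b] smooth_partial[OF *(2) b] f' g' by blast+
        with * b show ?thesis
          by (simp add: partial_mult smooth_differentiable_on flat_add smooth_mult smooth_partial)
      qed
      ultimately show "flat (Suc n) p (\<lambda>x. f x * g x)" by (simp add: flat_Suc)
    qed
  qed simp
  with assms show ?thesis by blast
qed

lemma flat_mult_right: "smooth f \<Longrightarrow> smooth g \<Longrightarrow> flat K p g \<Longrightarrow> flat K p (\<lambda>x. f x * g x)"
  using flat_mult[of f g 0 p K] by simp

lemma flat_mult_left: "smooth f \<Longrightarrow> smooth g \<Longrightarrow> flat K p f \<Longrightarrow> flat K p (\<lambda>x. f x * g x)"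
  using flat_mult[of f g K p 0] by simp

lemma flat_zero [simp]: "flat K p (\<lambda>x. 0)"
  by (induction K) (auto simp: flat_Suc)

lemma flat_sum:
  assumes "\<And>i. i \<in> I \<Longrightarrow> smooth (f i)" "\<And>i. i \<in> I \<Longrightarrow> flat K p (f i)"
  shows "flat K p (\<lambda>x. \<Sum>i\<in>I. f i x)"
  using assms by (induction I rule: infinite_finite_induct) (auto intro!: flat_add smooth_sum)

lemma flat_power: "smooth f \<Longrightarrow> f p = 0 \<Longrightarrow> flat K p (\<lambda>x. f x ^ K)"
proof (induction K)
  case (Suc K)
  have "flat (Suc 0) p f" using Suc by (simp add: flat_Suc)
  from flat_mult[OF _ _ this, of "\<lambda>x. f x ^ K" K] show ?case using Suc by (simp add: smooth_power)
qed simp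

text \<open>Differentiation under the integral sign moves the derivative to \<open>g\<close> and
  releases one factor \<open>t\<close>. The weight \<open>t ^ k\<close> is there so that the family
  of all \<open>J k g\<close> is stable under partial derivatives.\<close>

lemma smooth_param_integral:
  fixes p :: "'a::euclidean_space" and k :: nat
  assumes "smooth g"
  defines "J \<equiv> \<lambda>k g z. integral (cbox 0 1) (\<lambda>t::real. complex_of_real (t ^ k) * g (p + t *\<^sub>R (z - p)))"
  shows "smooth (J k g)"
proof -
  have J: "(J k g has_derivative (\<lambda>v. \<Sum>b\<in>Basis. of_real (v \<bullet> b) * J (Suc k) (partial b g) z)) (at z)"
    if g: "smooth g" for k g z
  proof -
    \<comment> \<open>The Leibniz rule for parameter integrals wants the derivative as a bounded
      linear map that is continuous in \<open>(z, t)\<close>; the gradient is therefore assembled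
      from rank-one maps.\<close>
    define D where "D = (\<lambda>z t. \<Sum>b\<in>Basis. blinfun_scaleR_left (complex_of_real (t ^ Suc k) * partial b g (p + t *\<^sub>R (z - p)))
        o\<^sub>L blinfun_inner_left b)"
    have Dv: "blinfun_apply (D z t) v = (\<Sum>b\<in>Basis. of_real (v \<bullet> b) * (complex_of_real (t ^ Suc k) * partial b g (p + t *\<^sub>R (z - p))))" for z t v
      by (simp add: D_def blinfun.sum_left scaleR_conv_of_real inner_commute)
    have cont: "continuous_on A (\<lambda>x. partial b g (p + snd x *\<^sub>R (fst x - p)))" if "b \<in> Basis" for b A
      by (rule continuous_on_compose2[OF smooth_continuous_on[OF smooth_partial[OF g that], of UNIV]])
         (auto intro!: continuous_intros)
    have cont1: "continuous_on A (\<lambda>t. h (p + t *\<^sub>R (z - p)))" if "smooth h" for h A z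
      by (rule continuous_on_compose2[OF smooth_continuous_on[OF that, of UNIV]]) (auto intro!: continuous_intros)
    have cD: "continuous_on (UNIV \<times> cbox 0 1) (\<lambda>(z, t). D z t)"
      unfolding D_def split_beta
      by (intro continuous_intros bounded_linear.continuous_on[OF bounded_linear_blinfun_scaleR_left] cont)
    have "((\<lambda>z. integral (cbox 0 1) (\<lambda>t. complex_of_real (t ^ k) * g (p + t *\<^sub>R (z - p)))) has_derivative
        blinfun_apply (integral (cbox 0 1) (D z))) (at z within UNIV)"
    proof (rule leibniz_rule[OF _ _ cD])
      fix z t
      have "((\<lambda>z. p + t *\<^sub>R (z - p)) has_derivative (\<lambda>v. t *\<^sub>R v)) (at z)"
        by (auto intro!: derivative_eq_intros)
      from has_derivative_mult[OF has_derivative_const has_derivative_compose[OF this smooth_has_derivative[OF g]], of "complex_of_real (t ^ k)"]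
      show "((\<lambda>z. complex_of_real (t ^ k) * g (p + t *\<^sub>R (z - p))) has_derivative blinfun_apply (D z t)) (at z within UNIV)"
        unfolding Dv[abs_def] by (rule has_derivative_eq_rhs) (auto simp: sum_distrib_left mult_ac fun_eq_iff)
    next
      fix z show "(\<lambda>t. complex_of_real (t ^ k) * g (p + t *\<^sub>R (z - p))) integrable_on cbox 0 1"
        by (intro integrable_continuous continuous_intros cont1 g)
    qed auto
    moreover have "blinfun_apply (integral (cbox 0 1) (D z)) v = (\<Sum>b\<in>Basis. of_real (v \<bullet> b) * J (Suc k) (partial b g) z)" for v
    proof -
      have "D z integrable_on cbox 0 1"
        using continuous_on_compose2[OF cD, of "cbox 0 1" "\<lambda>t. (z, t)"] continuous_on_Pair[OF continuous_on_const continuous_on_id]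
        by (intro integrable_continuous) auto
      then have "blinfun_apply (integral (cbox 0 1) (D z)) v = integral (cbox 0 1) (\<lambda>t. blinfun_apply (D z t) v)"
        by (rule blinfun_apply_integral)
      also have "\<dots> = (\<Sum>b\<in>Basis. integral (cbox 0 1) (\<lambda>t. of_real (v \<bullet> b) * (complex_of_real (t ^ Suc k) * partial b g (p + t *\<^sub>R (z - p)))))"
        unfolding Dv by (intro integral_sum integrable_continuous continuous_intros cont1 smooth_partial g) auto
      finally show ?thesis by (simp add: J_def)
    qed
    ultimately show ?thesis unfolding J_def by (metis (no_types, lifting) ext UNIV_I)
  qed
  have pJ: "partial b (J k g) = J (Suc k) (partial b g)" if g: "smooth g" and b: "b \<in> Basis" for b k g
  proof -
    have "(\<Sum>c\<in>Basis. of_real (b \<bullet> c) * J (Suc k) (partial c g) z) =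
        (\<Sum>c\<in>Basis. if c = b then J (Suc k) (partial b g) z else 0)" for z
      using b by (intro sum.cong) (auto simp: inner_Basis)
    then show ?thesis using partial_eqI[OF J[OF g]] b by simp
  qed
  show ?thesis
  proof (rule smooth_coinduct[of _ "{J k g | k g. smooth g}"])
    fix h assume "h \<in> {J k g | k g. smooth g}"
    then show "h differentiable_on UNIV" using J by (auto simp: differentiable_on_def intro: differentiableI)
    fix b :: 'a assume "b \<in> Basis"
    then show "partial b h \<in> {J k g | k g. smooth g}" using pJ smooth_partial \<open>h \<in> _\<close> by blast
  qed (use assms in blast)
qed

text \<open>The fundamental theorem of calculus along the segment from \<open>p\<close> to
  \<open>z\<close>; the remainders are integrals of partial derivatives over this segment and so are
  smooth in \<open>z\<close>. It serves the induction on jets and, later, the reduction of an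
  operator commuting with the coordinates to constants.\<close>

lemma hadamard:
  fixes w :: "'a::euclidean_space \<Rightarrow> complex"
  assumes "smooth w"
  obtains r where "\<And>b. b \<in> Basis \<Longrightarrow> smooth (r b)"
    "\<And>z. w z = w p + (\<Sum>b\<in>Basis. of_real ((z - p) \<bullet> b) * r b z)"
proof
  define r where "r b z = integral (cbox 0 1) (\<lambda>t::real. complex_of_real (t ^ 0) * partial b w (p + t *\<^sub>R (z - p)))" for b z
  show "smooth (r b)" if "b \<in> Basis" for b
    using smooth_param_integral[OF smooth_partial[OF assms that]] unfolding r_def[abs_def] .
  have cont1: "continuous_on A (\<lambda>t. h (p + t *\<^sub>R (z - p)))" if "smooth h" for h A z
    by (rule continuous_on_compose2[OF smooth_continuous_on[OF that, of UNIV]]) (auto intro!: continuous_intros)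
  show "w z = w p + (\<Sum>b\<in>Basis. of_real ((z - p) \<bullet> b) * r b z)" for z
  proof -
    have "((\<lambda>t. w (p + t *\<^sub>R (z - p))) has_vector_derivative
        (\<Sum>b\<in>Basis. of_real ((z - p) \<bullet> b) * partial b w (p + t *\<^sub>R (z - p)))) (at t within {0..1})" for t
    proof -
      have "((\<lambda>t. p + t *\<^sub>R (z - p)) has_derivative (\<lambda>s. s *\<^sub>R (z - p))) (at t within {0..1})"
        by (auto intro!: derivative_eq_intros)
      from has_derivative_compose[OF this smooth_has_derivative[OF assms]]
      show ?thesis unfolding has_vector_derivative_def
        by (rule has_derivative_eq_rhs) (auto simp: fun_eq_iff scaleR_conv_of_real sum_distrib_left mult_ac)
    qed
    from fundamental_theorem_of_calculus[OF _ this]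
    have "((\<lambda>t. \<Sum>b\<in>Basis. of_real ((z - p) \<bullet> b) * partial b w (p + t *\<^sub>R (z - p))) has_integral w z - w p) {0..1}"
      by simp
    then have "w z - w p = integral {0..1} (\<lambda>t. \<Sum>b\<in>Basis. of_real ((z - p) \<bullet> b) * partial b w (p + t *\<^sub>R (z - p)))"
      by (simp add: integral_unique)
    also have "\<dots> = (\<Sum>b\<in>Basis. integral {0..1} (\<lambda>t. of_real ((z - p) \<bullet> b) * partial b w (p + t *\<^sub>R (z - p))))"
      by (intro integral_sum integrable_continuous_real continuous_intros cont1 smooth_partial assms) auto
    finally have "w z - w p = (\<Sum>b\<in>Basis. of_real ((z - p) \<bullet> b) * r b z)"
      by (simp only: r_def integral_mult_right cbox_interval power_0 of_real_1 mult_1)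
    then show ?thesis by (simp add: diff_eq_eq add.commute)
  qed
qed

section \<open>Exponential sums realize every finite jet\<close>

inductive_set exp_span :: "('a::euclidean_space \<Rightarrow> complex) set" where
  exp: "(\<lambda>z. c * exp (of_real (\<zeta> \<bullet> z))) \<in> exp_span"
| add: "f \<in> exp_span \<Longrightarrow> g \<in> exp_span \<Longrightarrow> (\<lambda>z. f z + g z) \<in> exp_span"

lemma exp_span_const: "(\<lambda>z. c) \<in> exp_span"
  using exp_span.exp[of c 0] by simp

text \<open>Frequencies add under multiplication. Polynomials in exponentials therefore stay in the
  span, which is what allows coordinates to be imitated to any order.\<close>

lemma exp_span_mult:
  assumes "f \<in> exp_span" "g \<in> exp_span"
  shows "(\<lambda>z. f z * g z) \<in> exp_span"
  using assms
proof (induction)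
  case (exp c \<zeta>)
  show ?case using \<open>g \<in> exp_span\<close>
  proof induction
    case (exp d \<eta>)
    have "(\<lambda>z. c * exp (of_real (\<zeta> \<bullet> z)) * (d * exp (complex_of_real (\<eta> \<bullet> z)))) =
        (\<lambda>z. (c * d) * exp (complex_of_real ((\<zeta> + \<eta>) \<bullet> z)))"
      by (simp add: inner_add_left exp_add mult_ac)
    then show ?case by (simp only: exp_span.exp)
  qed (simp add: distrib_left exp_span.add)
qed (simp add: distrib_right exp_span.add)

lemma exp_span_power: "f \<in> exp_span \<Longrightarrow> (\<lambda>z. f z ^ n) \<in> exp_span"
  by (induction n) (auto intro: exp_span_mult exp_span_const)

lemma exp_span_sum: "(\<And>i. i \<in> I \<Longrightarrow> f i \<in> exp_span) \<Longrightarrow> (\<lambda>z. \<Sum>i\<in>I. f i z) \<in> exp_span"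
  by (induction I rule: infinite_finite_induct) (auto intro: exp_span.add exp_span_const)

lemma smooth_exp_inner: "smooth (\<lambda>z. exp (complex_of_real (\<zeta> \<bullet> z)))"
  by (rule smooth_exp_linear) (rule bounded_linear_inner_right)

lemma smooth_exp_span: "f \<in> exp_span \<Longrightarrow> smooth f"
  by (induction rule: exp_span.induct) (auto intro!: smooth_add smooth_mult smooth_exp_inner)

text \<open>\<open>E\<close> is the truncation of
  \<open>x = - (\<Sum>j. (1 - exp x) ^ j / j)\<close>, the series of
  \<open>ln (1 - (1 - exp x))\<close>, at \<open>x = b \<bullet> (z - p)\<close>. A geometric sum
  makes the derivative of the error in \<open>x\<close> exactly \<open>(1 - exp x) ^ K\<close>,
  which vanishes to order \<open>K\<close>; the error itself then vanishes to order
  \<open>Suc K\<close>.\<close>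

lemma coordinate_jet:
  fixes p :: "'a::euclidean_space"
  assumes "b \<in> Basis"
  obtains E where "E \<in> exp_span" "E p = 0" "flat (Suc K) p (\<lambda>z. of_real ((z - p) \<bullet> b) - E z)"
proof
  define L :: "real \<Rightarrow> real" where "L x = (\<Sum>j=1..K. (1 - exp x) ^ j / j)" for x
  define E where "E z = - (\<Sum>j=1..K. (1 + complex_of_real (- exp (- (b \<bullet> p))) * exp (of_real (b \<bullet> z))) ^ j * (1 / of_nat j))" for z
  have e: "1 + complex_of_real (- exp (- (b \<bullet> p))) * exp (of_real (b \<bullet> z)) = of_real (1 - exp (b \<bullet> (z - p)))" for z
    by (simp add: inner_diff_right exp_diff exp_minus field_simps exp_of_real)
  have EL: "E z = - of_real (L (b \<bullet> (z - p)))" for z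
    unfolding E_def e L_def by simp
  have "(\<lambda>z. (- 1) * (\<Sum>j=1..K. (1 + complex_of_real (- exp (- (b \<bullet> p))) * exp (of_real (b \<bullet> z))) ^ j * (1 / of_nat j))) \<in> exp_span"
    by (intro exp_span_mult exp_span_sum exp_span_power exp_span.add exp_span.exp exp_span_const)
  then show "E \<in> exp_span" by (simp add: E_def[abs_def])
  have "L 0 = 0" unfolding L_def by (intro sum.neutral) auto
  then show Ep: "E p = 0" unfolding EL by simp
  have dL: "(L has_real_derivative (\<Sum>j<K. (1 - exp x) ^ j) * (- exp x)) (at x)" for x
  proof -
    have "(L has_real_derivative (\<Sum>j=1..K. (real j * (1 - exp x) ^ (j - 1) * (- exp x)) / j)) (at x)"
      unfolding L_def[abs_def] by (intro DERIV_sum) (auto intro!: derivative_eq_intros)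
    also have "(\<Sum>j=1..K. (real j * (1 - exp x) ^ (j - 1) * (- exp x)) / j) = (\<Sum>j=1..K. (1 - exp x) ^ (j - 1) * (- exp x))"
      by (intro sum.cong) auto
    also have "\<dots> = (\<Sum>j<K. (1 - exp x) ^ j * (- exp x))"
      by (rule sum.reindex_bij_witness[of _ Suc "\<lambda>j. j - 1"]) auto
    finally show ?thesis by (simp only: sum_distrib_right)
  qed
  define d where "d z = complex_of_real ((z - p) \<bullet> b) - E z" for z
  have dd: "(d has_derivative (\<lambda>v. of_real (v \<bullet> b) * of_real ((1 - exp (b \<bullet> (z - p))) ^ K))) (at z)" for z
  proof -
    have "((\<lambda>z. b \<bullet> (z - p)) has_derivative (\<lambda>v. b \<bullet> v)) (at z)"
      by (auto intro!: derivative_eq_intros)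
    from has_derivative_compose[OF this dL[THEN has_field_derivative_imp_has_derivative]]
    have "((\<lambda>z. (z - p) \<bullet> b + L (b \<bullet> (z - p))) has_derivative
       (\<lambda>v. v \<bullet> b + (\<Sum>j<K. (1 - exp (b \<bullet> (z - p))) ^ j) * (- exp (b \<bullet> (z - p))) * (b \<bullet> v))) (at z)"
      by (auto intro!: derivative_eq_intros)
    moreover have "v \<bullet> b + (\<Sum>j<K. (1 - exp (b \<bullet> (z - p))) ^ j) * (- exp (b \<bullet> (z - p))) * (b \<bullet> v)
       = (v \<bullet> b) * (1 - exp (b \<bullet> (z - p))) ^ K" for v
    proof -
      have "1 - (1 - exp (b \<bullet> (z - p))) ^ K = exp (b \<bullet> (z - p)) * (\<Sum>j<K. (1 - exp (b \<bullet> (z - p))) ^ j)"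
        by (subst one_diff_power_eq) simp
      then have "(1 - exp (b \<bullet> (z - p))) ^ K = 1 - exp (b \<bullet> (z - p)) * (\<Sum>j<K. (1 - exp (b \<bullet> (z - p))) ^ j)"
        by simp
      then have *: "(1 - exp (b \<bullet> (z - p))) ^ K * (b \<bullet> v) = (1 - exp (b \<bullet> (z - p)) * (\<Sum>j<K. (1 - exp (b \<bullet> (z - p))) ^ j)) * (b \<bullet> v)"
        by (rule arg_cong)
      show ?thesis unfolding inner_commute[of v b] mult.commute[of "b \<bullet> v" "_ ^ K"] * by (simp only: algebra_simps)
    qed
    ultimately have "((\<lambda>z. (z - p) \<bullet> b + L (b \<bullet> (z - p))) has_derivative
       (\<lambda>v. (v \<bullet> b) * (1 - exp (b \<bullet> (z - p))) ^ K)) (at z)" by simp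
    from has_derivative_of_real[OF this, where 'a = complex] show ?thesis
      by (simp add: d_def[abs_def] EL)
  qed
  have "flat K p (\<lambda>z. (1 + (- of_real (exp (- (b \<bullet> p)))) * exp (complex_of_real (b \<bullet> z))) ^ K)"
    by (intro flat_power smooth_add smooth_mult smooth_exp_inner smooth_const) (simp add: exp_minus flip: exp_of_real)
  moreover have "smooth (\<lambda>z. (1 + (- of_real (exp (- (b \<bullet> p)))) * exp (complex_of_real (b \<bullet> z))) ^ K)"
    by (intro smooth_intros smooth_exp_inner)
  ultimately have *: "flat K p (\<lambda>z. of_real (b' \<bullet> b) * (1 + (- of_real (exp (- (b \<bullet> p)))) * exp (complex_of_real (b \<bullet> z))) ^ K)" for b'
    by (intro flat_mult_right) auto
  have "partial b' d = (\<lambda>z. of_real (b' \<bullet> b) * (1 + (- of_real (exp (- (b \<bullet> p)))) * exp (complex_of_real (b \<bullet> z))) ^ K)" for b'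
    unfolding partial_eqI[OF dd, of b'] e[unfolded of_real_minus] of_real_power ..
  then have "flat K p (partial b' d)" for b'
    using * by metis
  moreover have "d p = 0" unfolding d_def using Ep by simp
  ultimately show "flat (Suc K) p (\<lambda>z. of_real ((z - p) \<bullet> b) - E z)"
    unfolding d_def[abs_def] flat_Suc by blast
qed

text \<open>In Hadamard's formula each coordinate is replaced by \<open>E b\<close> and each
  remainder \<open>r b\<close> by an exponential sum \<open>v b\<close> that matches it to order
  \<open>K\<close>. The error is the coordinate error times \<open>r b\<close>, flat by
  \<open>coordinate_jet\<close>, plus \<open>E b\<close> times \<open>r b - v b\<close>, where the
  zero of \<open>E b\<close> supplies the missing order.\<close>

lemma exp_jet:
  fixes w :: "'a::euclidean_space \<Rightarrow> complex"
  assumes "smooth w"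
  obtains v where "v \<in> exp_span" "flat K p (\<lambda>z. w z - v z)"
proof -
  have "\<exists>v\<in>exp_span. flat K p (\<lambda>z. w z - v z)" using assms
  proof (induction K arbitrary: w)
    case 0
    then show ?case using exp_span_const by auto
  next
    case (Suc K)
    obtain r where r: "\<And>b. b \<in> Basis \<Longrightarrow> smooth (r b)"
      and w: "\<And>z. w z = w p + (\<Sum>b\<in>Basis. of_real ((z - p) \<bullet> b) * r b z)"
      using hadamard[OF Suc.prems, of p] by metis
    have "\<forall>b\<in>Basis. \<exists>v\<in>exp_span. flat K p (\<lambda>z. r b z - v z)"
      using Suc.IH r by blast
    then obtain v where v: "\<And>b. b \<in> Basis \<Longrightarrow> v b \<in> exp_span" "\<And>b. b \<in> Basis \<Longrightarrow> flat K p (\<lambda>z. r b z - v b z)"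
      by metis
    have "\<forall>b\<in>Basis. \<exists>E\<in>exp_span. E p = 0 \<and> flat (Suc K) p (\<lambda>z. of_real ((z - p) \<bullet> b) - E z)"
      using coordinate_jet by metis
    then obtain E where E: "\<And>b. b \<in> Basis \<Longrightarrow> E b \<in> exp_span" "\<And>b. b \<in> Basis \<Longrightarrow> E b p = 0"
      "\<And>b. b \<in> Basis \<Longrightarrow> flat (Suc K) p (\<lambda>z. of_real ((z - p) \<bullet> b) - E b z)"
      by metis
    let ?v = "\<lambda>z. w p + (\<Sum>b\<in>Basis. E b z * v b z)"
    have x: "smooth (\<lambda>z. complex_of_real ((z - p) \<bullet> b) - E b z)" if "b \<in> Basis" for b
    proof -
      have "smooth (\<lambda>z. complex_of_real (z \<bullet> b) - of_real (p \<bullet> b) - E b z)"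
        by (intro smooth_diff smooth_const smooth_exp_span E that smooth_real_linear bounded_linear_inner_left)
      then show ?thesis by (simp add: inner_diff_left)
    qed
    have "flat (Suc K) p (\<lambda>z. \<Sum>b\<in>Basis. (of_real ((z - p) \<bullet> b) - E b z) * r b z + E b z * (r b z - v b z))"
    proof (intro flat_sum flat_add)
      fix b :: 'a assume b: "b \<in> Basis"
      show "smooth (\<lambda>z. (of_real ((z - p) \<bullet> b) - E b z) * r b z)" "smooth (\<lambda>z. E b z * (r b z - v b z))"
        "smooth (\<lambda>z. (of_real ((z - p) \<bullet> b) - E b z) * r b z + E b z * (r b z - v b z))"
        using b by (auto intro!: smooth_intros x r smooth_exp_span[OF E(1)] smooth_exp_span[OF v(1)])
      show "flat (Suc K) p (\<lambda>z. (of_real ((z - p) \<bullet> b) - E b z) * r b z)"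
        using b by (intro flat_mult_left x r E)
      have "flat (Suc 0) p (E b)" using E(2)[OF b] by (simp add: flat_Suc)
      from flat_mult[OF _ _ this v(2)[OF b]] show "flat (Suc K) p (\<lambda>z. E b z * (r b z - v b z))"
        using b by (auto intro: smooth_diff smooth_exp_span E v r)
    qed
    also have "(\<lambda>z. \<Sum>b\<in>Basis. (of_real ((z - p) \<bullet> b) - E b z) * r b z + E b z * (r b z - v b z)) = (\<lambda>z. w z - ?v z)"
      by (subst w) (simp add: algebra_simps sum_subtractf sum.distrib)
    finally have "flat (Suc K) p (\<lambda>z. w z - ?v z)" .
    moreover have "?v \<in> exp_span"
      by (intro exp_span.add exp_span_const exp_span_sum exp_span_mult E v)
    ultimately show ?case by (rule bexI)
  qed
  then show ?thesis using that by blast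
qed

section \<open>Local operators on formal series\<close>

definition sformal :: "('h, 'x::euclidean_space) formal \<Rightarrow> bool" where
  "sformal F \<longleftrightarrow> (\<forall>r. smooth (F r))"

definition single :: "'h \<Rightarrow> ('x \<Rightarrow> complex) \<Rightarrow> ('h, 'x) formal" where
  "single r w = (\<lambda>s x. if s = r then w x else 0)"

lemma sformal_single: "smooth w \<Longrightarrow> sformal (single r w)"
proof -
  assume "smooth w"
  then have "smooth (\<lambda>x. if s = r then w x else 0)" for s by (cases "s = r") auto
  then show ?thesis by (simp add: sformal_def single_def)
qed

lemma smooth_single: "smooth w \<Longrightarrow> smooth (single r w s)"
  using sformal_single[of w r] by (simp add: sformal_def)

text \<open>The value at \<open>y\<close> sees finitely many derivatives of finitely many
  coefficients of \<open>F\<close> at the single point \<open>\<iota> y\<close>. The rule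
  \<open>cong\<close> admits operators, such as the coefficients of a star product, that are
  prescribed on smooth functions only.\<close>

inductive local_op :: "('y::euclidean_space \<Rightarrow> 'x::euclidean_space) \<Rightarrow> (('h, 'x) formal \<Rightarrow> 'y \<Rightarrow> complex) \<Rightarrow> bool"
  for \<iota> where
  base: "bs \<in> lists Basis \<Longrightarrow> local_op \<iota> (\<lambda>F y. partials bs (F r) (\<iota> y))"
| add: "local_op \<iota> L \<Longrightarrow> local_op \<iota> M \<Longrightarrow> local_op \<iota> (\<lambda>F y. L F y + M F y)"
| mult: "smooth c \<Longrightarrow> local_op \<iota> L \<Longrightarrow> local_op \<iota> (\<lambda>F y. c y * L F y)"
| cong: "local_op \<iota> L \<Longrightarrow> (\<And>F. sformal F \<Longrightarrow> L' F = L F) \<Longrightarrow> local_op \<iota> L'"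

lemma local_op_coeff: "local_op \<iota> (\<lambda>F y. F r (\<iota> y))"
  using local_op.base[of "[]"] by simp

lemma local_op_zero: "local_op \<iota> (\<lambda>F y. 0)"
  using local_op.mult[OF smooth_const[of 0] local_op_coeff] by simp

lemma local_op_sum: "(\<And>i. i \<in> I \<Longrightarrow> local_op \<iota> (L i)) \<Longrightarrow> local_op \<iota> (\<lambda>F y. \<Sum>i\<in>I. L i F y)"
  by (induction I rule: infinite_finite_induct) (auto intro: local_op_zero local_op.add)

lemma local_op_smooth:
  assumes "affine_map \<iota>" "local_op \<iota> L" "sformal F"
  shows "smooth (L F)"
  using assms(2) by (induction) (use assms(3) in \<open>auto intro!: smooth_affine[OF _ assms(1)] smooth_partials smooth_add smooth_mult simp: sformal_def\<close>)

lemma partials_add: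
  assumes "smooth f" "smooth g" "bs \<in> lists Basis"
  shows "partials bs (\<lambda>x. f x + g x) = (\<lambda>x. partials bs f x + partials bs g x)"
  using assms(3) by (induction bs) (use assms in \<open>auto simp: partial_add smooth_differentiable_on smooth_partials\<close>)

lemma partials_cmult:
  assumes "smooth f" "bs \<in> lists Basis"
  shows "partials bs (\<lambda>x. c * f x) = (\<lambda>x. c * partials bs f x)"
  using assms(2) by (induction bs) (use assms in \<open>auto simp: partial_mult smooth_differentiable_on smooth_partials\<close>)

lemma local_op_add_arg:
  assumes "local_op \<iota> L" "sformal F" "sformal G"
  shows "L (\<lambda>r x. F r x + G r x) = (\<lambda>y. L F y + L G y)"
  using assms(1)
proof induction
  case (cong L L')
  have "sformal (\<lambda>r x. F r x + G r x)" using assms by (auto simp: sformal_def smooth_add)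
  then show ?case using cong assms by simp
qed (use assms in \<open>auto simp: partials_add sformal_def algebra_simps\<close>)

lemma local_op_cmult_arg:
  assumes "local_op \<iota> L" "sformal F"
  shows "L (\<lambda>r x. c * F r x) = (\<lambda>y. c * L F y)"
  using assms(1)
proof induction
  case (cong L L')
  have "sformal (\<lambda>r x. c * F r x)" using assms by (auto simp: sformal_def smooth_mult)
  then show ?case using cong assms by simp
qed (use assms in \<open>auto simp: partials_cmult sformal_def algebra_simps\<close>)

lemma local_op_zero_arg:
  assumes "local_op \<iota> L"
  shows "L (\<lambda>r x. 0) = (\<lambda>y. 0)"
  using local_op_cmult_arg[OF assms, of "\<lambda>r x. 0" 0] by (simp add: sformal_def)

lemma local_op_sum_arg:
  assumes "local_op \<iota> L" "\<And>i. i \<in> I \<Longrightarrow> sformal (F i)"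
  shows "L (\<lambda>r x. \<Sum>i\<in>I. F i r x) = (\<lambda>y. \<Sum>i\<in>I. L (F i) y)"
  using assms(2)
proof (induction I rule: infinite_finite_induct)
  case (insert i I)
  have "sformal (\<lambda>r x. \<Sum>i\<in>I. F i r x)" using insert by (auto simp: sformal_def intro!: smooth_sum)
  then show ?case using insert local_op_add_arg[OF assms(1), of "F i"] by simp
qed (auto simp: local_op_zero_arg[OF assms(1)])

lemma local_op_partial:
  fixes \<iota> :: "'a::euclidean_space \<Rightarrow> 'b::euclidean_space" and L :: "('c, 'b) formal \<Rightarrow> 'a \<Rightarrow> complex"
  assumes "affine_map \<iota>" "local_op \<iota> L" "b \<in> Basis"
  shows "local_op \<iota> (\<lambda>F. partial b (L F))"
  using assms(2)
proof induction
  case (base bs r)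
  obtain A c where A: "bounded_linear A" and \<iota>: "\<iota> = (\<lambda>y. A y + c)"
    using assms(1) by (auto simp: affine_map_def)
  have "local_op \<iota> (\<lambda>F y. \<Sum>b'\<in>Basis. of_real (A b \<bullet> b') * partials (b' # bs) (F r) (\<iota> y))"
    using base by (intro local_op_sum local_op.mult local_op.base) auto
  then show ?case
  proof (rule local_op.cong)
    fix F :: "('c, 'b) formal" assume "sformal F"
    then have "smooth (partials bs (F r))" using base by (simp add: sformal_def smooth_partials)
    from partial_affine[OF this A, of b c]
    show "partial b (\<lambda>y. partials bs (F r) (\<iota> y)) =
         (\<lambda>y. \<Sum>b'\<in>Basis. of_real (A b \<bullet> b') * partials (b' # bs) (F r) (\<iota> y))"
      by (simp add: \<iota>)
  qed
next
  case (add L M)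
  show ?case
    by (rule local_op.cong[OF local_op.add[OF add.IH]])
       (simp add: partial_add smooth_differentiable_on local_op_smooth[OF assms(1)] add)
next
  case (mult c L)
  have "local_op \<iota> (\<lambda>F y. c y * partial b (L F) y + partial b c y * L F y)"
    using mult assms by (intro local_op.add local_op.mult smooth_partial)
  then show ?case
    by (rule local_op.cong)
       (simp add: partial_mult smooth_differentiable_on local_op_smooth[OF assms(1)] mult)
next
  case (cong L L')
  then show ?case by (auto intro: local_op.cong)
qed

lemma local_op_partials:
  assumes "affine_map \<iota>" "local_op \<iota> L" "bs \<in> lists Basis"
  shows "local_op \<iota> (\<lambda>F. partials bs (L F))"
  using assms(3) by (induction bs) (use assms in \<open>auto intro: local_op_partial\<close>)

lemma local_op_precompose:
  assumes "affine_map \<kappa>" "local_op \<iota> L"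
  shows "local_op (\<lambda>z. \<iota> (\<kappa> z)) (\<lambda>F z. L F (\<kappa> z))"
  using assms(2)
proof induction
  case (base bs r) then show ?case by (rule local_op.base)
next
  case (add L M) show ?case using add.IH by (rule local_op.add)
next
  case (mult c L) show ?case using smooth_affine[OF mult.hyps(1) assms(1)] mult.IH by (rule local_op.mult)
next
  case (cong L L') then show ?case by (auto intro: local_op.cong)
qed

text \<open>One base point map serves all output coefficients, while the order and the number of
  input coefficients may grow with \<open>k\<close>, as they do for a power series in
  \<open>h\<close> of differential operators.\<close>

definition formal_op :: "('y::euclidean_space \<Rightarrow> 'x::euclidean_space) \<Rightarrow> (('h, 'x) formal \<Rightarrow> ('k, 'y) formal) \<Rightarrow> bool" where
  "formal_op \<iota> A \<longleftrightarrow> affine_map \<iota> \<and> (\<forall>k. local_op \<iota> (\<lambda>F. A F k))"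

lemma formal_op_sformal: "formal_op \<iota> A \<Longrightarrow> sformal F \<Longrightarrow> sformal (A F)"
  using local_op_smooth by (fastforce simp: formal_op_def sformal_def)

lemma local_op_compose:
  assumes "affine_map \<kappa>" "local_op \<kappa> M" "formal_op \<iota> A"
  shows "local_op (\<lambda>z. \<iota> (\<kappa> z)) (\<lambda>F. M (A F))"
  using assms(2)
proof induction
  case (base bs r)
  have "local_op \<iota> (\<lambda>F. partials bs (A F r))"
    using assms(3) base by (auto simp: formal_op_def intro: local_op_partials)
  then show ?case by (rule local_op_precompose[OF assms(1)])
next
  case (add L M) show ?case using add.IH by (rule local_op.add)
next
  case (mult c L) show ?case using mult.hyps(1) mult.IH by (rule local_op.mult)
next
  case (cong L L')
  show ?case by (rule local_op.cong[OF cong.IH]) (simp add: cong formal_op_sformal[OF assms(3)])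
qed

lemma formal_op_compose:
  assumes "formal_op \<kappa> B" "formal_op \<iota> A"
  shows "formal_op (\<lambda>z. \<iota> (\<kappa> z)) (\<lambda>F. B (A F))"
proof -
  have "affine_map \<kappa>" "\<And>k. local_op \<kappa> (\<lambda>F. B F k)" "affine_map \<iota>"
    using assms by (auto simp: formal_op_def)
  then show ?thesis
    using local_op_compose[OF _ _ assms(2)] affine_map_compose by (fastforce simp: formal_op_def)
qed

lemma formal_op_cong:
  assumes "formal_op \<iota> A" "\<And>F. sformal F \<Longrightarrow> B F = A F"
  shows "formal_op \<iota> B"
  using assms local_op.cong[of \<iota> "\<lambda>F. A F k" "\<lambda>F. B F k" for k] by (auto simp: formal_op_def)

subsection \<open>Testing on exponentials\<close>

text \<open>Locality in quantitative form: one finite order and one finite set of coefficients that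
  work at every point. All tests on exponentials rest on it.\<close>

lemma local_op_flat:
  assumes "local_op \<iota> L"
  shows "\<exists>K I. finite I \<and> (\<forall>F y. sformal F \<longrightarrow> (\<forall>r\<in>I. flat K (\<iota> y) (F r)) \<longrightarrow> L F y = 0)"
  using assms
proof induction
  case (base bs r)
  show ?case using base by (intro exI[of _ "Suc (length bs)"] exI[of _ "{r}"]) (auto simp: flat_def)
next
  case (add L M)
  obtain K I where "finite I" "\<forall>F y. sformal F \<longrightarrow> (\<forall>r\<in>I. flat K (\<iota> y) (F r)) \<longrightarrow> L F y = 0"
    using add.IH(1) by blast
  moreover obtain K' I' where "finite I'" "\<forall>F y. sformal F \<longrightarrow> (\<forall>r\<in>I'. flat K' (\<iota> y) (F r)) \<longrightarrow> M F y = 0"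
    using add.IH(2) by blast
  ultimately show ?case
    by (intro exI[of _ "max K K'"] exI[of _ "I \<union> I'"] conjI allI impI)
      (auto simp: flat_mono[of "max K K'"])
next
  case (mult c L)
  obtain K I where "finite I" "\<forall>F y. sformal F \<longrightarrow> (\<forall>r\<in>I. flat K (\<iota> y) (F r)) \<longrightarrow> L F y = 0"
    using mult.IH by blast
  then show ?case by (intro exI[of _ K] exI[of _ I]) auto
next
  case (cong L L')
  then show ?case by simp
qed

text \<open>At \<open>y\<close> the operator cannot distinguish \<open>w\<close> from an exponential
  sum with the same jet at \<open>\<iota> y\<close>, and on such sums it vanishes by
  linearity.\<close>

lemma local_op_exp_single:
  assumes "local_op \<iota> L" "\<And>\<zeta>. L (single r (\<lambda>x. exp (of_real (\<zeta> \<bullet> x)))) y = 0" "smooth w"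
  shows "L (single r w) y = 0"
proof -
  obtain K I where "finite I" and KI: "\<And>F y. sformal F \<Longrightarrow> (\<forall>r\<in>I. flat K (\<iota> y) (F r)) \<Longrightarrow> L F y = 0"
    using local_op_flat[OF assms(1)] by blast
  obtain v where v: "v \<in> exp_span" "flat K (\<iota> y) (\<lambda>z. w z - v z)"
    using exp_jet[OF assms(3)] by metis
  have sm: "smooth v" using v smooth_exp_span by blast
  have *: "L (single r v) y = 0" using v(1)
  proof induction
    case (exp c \<zeta>)
    have "L (\<lambda>s x. c * single r (\<lambda>x. exp (of_real (\<zeta> \<bullet> x))) s x) y = 0"
      using assms(2) by (simp add: local_op_cmult_arg[OF assms(1)] sformal_single smooth_exp_inner)
    also have "(\<lambda>s x. c * single r (\<lambda>x. exp (of_real (\<zeta> \<bullet> x))) s x) = single r (\<lambda>z. c * exp (of_real (\<zeta> \<bullet> z)))"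
      by (auto simp: single_def fun_eq_iff)
    finally show ?case .
  next
    case (add f g)
    have "L (\<lambda>s x. single r f s x + single r g s x) y = 0"
      using add by (simp add: local_op_add_arg[OF assms(1)] sformal_single smooth_exp_span)
    also have "(\<lambda>s x. single r f s x + single r g s x) = single r (\<lambda>z. f z + g z)"
      by (auto simp: single_def fun_eq_iff)
    finally show ?case .
  qed
  have s: "sformal (single r (\<lambda>z. w z - v z))" "sformal (single r v)"
    using assms(3) sm by (simp_all add: sformal_single smooth_diff)
  have "L (single r (\<lambda>z. w z - v z)) y = 0"
  proof (intro KI s ballI)
    fix s show "flat K (\<iota> y) (single r (\<lambda>z. w z - v z) s)"
      using v(2) by (cases "s = r") (simp_all add: single_def)
  qed
  moreover have "single r w = (\<lambda>s x. single r (\<lambda>z. w z - v z) s x + single r v s x)"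
    by (auto simp: single_def fun_eq_iff)
  ultimately show ?thesis using * local_op_add_arg[OF assms(1) s] by simp
qed

lemma local_op_single:
  assumes "local_op \<iota> L" "sformal F"
  obtains I where "finite I" "\<And>J. finite J \<Longrightarrow> I \<subseteq> J \<Longrightarrow> L F y = (\<Sum>r\<in>J. L (single r (F r)) y)"
proof -
  obtain K I where I: "finite I" and KI: "\<And>F y. sformal F \<Longrightarrow> (\<forall>r\<in>I. flat K (\<iota> y) (F r)) \<Longrightarrow> L F y = 0"
    using local_op_flat[OF assms(1)] by blast
  have "L F y = (\<Sum>r\<in>J. L (single r (F r)) y)" if J: "finite J" "I \<subseteq> J" for J
  proof -
    let ?G = "\<lambda>r x. \<Sum>i\<in>J. single i (F i) r x"
    let ?H = "\<lambda>r x. F r x - ?G r x"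
    have F: "smooth (F r)" for r using assms(2) by (simp add: sformal_def)
    have sG: "sformal ?G" and sH: "sformal ?H"
      unfolding sformal_def by (intro allI smooth_sum smooth_diff smooth_single F)+
    have "?H r = (\<lambda>x. 0)" if "r \<in> I" for r
      using that J by (auto simp: single_def fun_eq_iff)
    then have "L ?H y = 0" by (intro KI sH) (simp)
    moreover have "F = (\<lambda>r x. ?G r x + ?H r x)" by simp
    ultimately have "L F y = L ?G y" using local_op_add_arg[OF assms(1) sG sH] by simp
    also have "\<dots> = (\<Sum>i\<in>J. L (single i (F i)) y)"
      using assms(2) by (subst local_op_sum_arg[OF assms(1)]) (auto simp: sformal_def intro!: smooth_single)
    finally show ?thesis .
  qed
  with I show ?thesis using that by blast
qed

lemma local_op_exp:
  assumes "local_op \<iota> L" "\<And>r \<zeta>. L (single r (\<lambda>x. exp (of_real (\<zeta> \<bullet> x)))) y = 0" "sformal F"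
  shows "L F y = 0"
proof -
  obtain I where I: "finite I" "\<And>J. finite J \<Longrightarrow> I \<subseteq> J \<Longrightarrow> L F y = (\<Sum>r\<in>J. L (single r (F r)) y)"
    using local_op_single[OF assms(1,3)] by metis
  then show ?thesis
    using local_op_exp_single[OF assms(1,2)] assms(3) by (simp add: sformal_def)
qed

text \<open>\<open>\<tau>\<close> has to be complex because the cocycle of the Moyal product is
  imaginary; real \<open>\<zeta>\<close> are enough, since real exponentials already realize all
  jets.\<close>

definition grouplike :: "complex \<Rightarrow> 'x::euclidean_space \<Rightarrow> (nat, 'x) formal" where
  "grouplike \<tau> \<zeta> = (\<lambda>r x. \<tau> ^ r / fact r * exp (of_real (\<zeta> \<bullet> x)))"

lemma sformal_grouplike: "sformal (grouplike \<tau> \<zeta>)"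
  unfolding sformal_def grouplike_def by (intro allI smooth_mult smooth_const smooth_exp_inner)

text \<open>Only finitely many powers of \<open>h\<close> are seen, so the value on
  \<open>grouplike \<tau> \<zeta>\<close> is a polynomial in \<open>\<tau>\<close> with coefficients
  \<open>L (single s e) y / fact s\<close>. Vanishing for all \<open>\<tau>\<close> kills every
  coefficient, which leaves plain exponentials in a single power of \<open>h\<close>.\<close>

lemma local_op_grouplike:
  assumes "local_op \<iota> L" "\<And>\<tau> \<zeta>. L (grouplike \<tau> \<zeta>) y = 0" "sformal F"
  shows "L F y = 0"
proof (rule local_op_exp[OF assms(1) _ assms(3)])
  fix r :: nat and \<zeta> :: 'b
  define e where "e = (\<lambda>x. exp (complex_of_real (\<zeta> \<bullet> x)))"
  obtain K I where I: "finite I" and KI: "\<And>F y. sformal F \<Longrightarrow> (\<forall>r\<in>I. flat K (\<iota> y) (F r)) \<Longrightarrow> L F y = 0"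
    using local_op_flat[OF assms(1)] by blast
  obtain N where N: "I \<subseteq> {..N}" "r \<le> N"
    using I finite_nat_iff_bounded_le[of "insert r I"] by auto
  have single: "(\<lambda>s x. c * single s' e s x) = single s' (\<lambda>x. c * e x)" for c s'
    by (auto simp: single_def fun_eq_iff)
  have e: "smooth e" unfolding e_def by (rule smooth_exp_inner)
  have "(\<Sum>s\<le>N. (L (single s e) y / fact s) * \<tau> ^ s) = 0" for \<tau>
  proof -
    let ?G = "\<lambda>r x. \<Sum>i\<le>N. \<tau> ^ i / fact i * single i e r x"
    let ?H = "\<lambda>r x. grouplike \<tau> \<zeta> r x - ?G r x"
    have sG: "sformal ?G" and sH: "sformal ?H"
      using sformal_grouplike[of \<tau> \<zeta>] unfolding sformal_def
      by (intro allI smooth_sum smooth_diff smooth_mult smooth_const smooth_single e; simp)+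
    have "?H r = (\<lambda>x. 0)" if "r \<in> I" for r
      using that N by (auto simp: single_def fun_eq_iff grouplike_def e_def if_distrib cong: if_cong)
    then have "L ?H y = 0" by (intro KI sH) (simp)
    moreover have "grouplike \<tau> \<zeta> = (\<lambda>r x. ?G r x + ?H r x)" by simp
    ultimately have "L (grouplike \<tau> \<zeta>) y = L ?G y"
      using local_op_add_arg[OF assms(1) sG sH] by (metis (no_types, lifting) add.right_neutral)
    also have "\<dots> = (\<Sum>i\<le>N. \<tau> ^ i / fact i * L (single i e) y)"
    proof -
      have "sformal (\<lambda>r x. \<tau> ^ i / fact i * single i e r x)" for i
        unfolding sformal_def by (intro allI smooth_mult smooth_const smooth_single e)
      then have "L ?G = (\<lambda>y. \<Sum>i\<le>N. L (\<lambda>r x. \<tau> ^ i / fact i * single i e r x) y)"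
        by (intro local_op_sum_arg[OF assms(1)])
      then show ?thesis using local_op_cmult_arg[OF assms(1) sformal_single[OF e]] by (simp del: times_divide_eq_left)
    qed
    finally show ?thesis using assms(2)[of \<tau> \<zeta>] by (simp add: mult_ac)
  qed
  then have "L (single r e) y / fact r = 0"
    using polyfun_eq_0[of "\<lambda>s. L (single s e) y / fact s" N] N by blast
  then show "L (single r (\<lambda>x. exp (complex_of_real (\<zeta> \<bullet> x)))) y = 0" by (simp add: e_def)
qed

subsection \<open>Legs\<close>

lemma partial_slice_left:
  fixes W :: "'a::euclidean_space \<times> 'b::euclidean_space \<Rightarrow> complex"
  assumes "smooth W"
  shows "partial b (\<lambda>z. W (z, v)) = (\<lambda>z. partial (b, 0) W (z, v))"
proof (rule partial_eqI)
  fix x :: 'a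
  have "((\<lambda>z. (z, v)) has_derivative (\<lambda>h. (h, 0))) (at x)" by (auto intro!: derivative_eq_intros)
  from has_derivative_compose[OF this has_derivative_frechet[OF smooth_differentiable[OF assms]]]
  show "((\<lambda>z. W (z, v)) has_derivative (\<lambda>h. partial (h, 0) W (x, v))) (at x)" by (simp add: partial_def)
qed

lemma partial_slice_right:
  fixes W :: "'a::euclidean_space \<times> 'b::euclidean_space \<Rightarrow> complex"
  assumes "smooth W"
  shows "partial b (\<lambda>z. W (v, z)) = (\<lambda>z. partial (0, b) W (v, z))"
proof (rule partial_eqI)
  fix x :: 'b
  have "((\<lambda>z. (v, z)) has_derivative (\<lambda>h. (0, h))) (at x)" by (auto intro!: derivative_eq_intros)
  from has_derivative_compose[OF this has_derivative_frechet[OF smooth_differentiable[OF assms]]]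
  show "((\<lambda>z. W (v, z)) has_derivative (\<lambda>h. partial (0, h) W (v, x))) (at x)" by (simp add: partial_def)
qed

lemma partials_slice_left:
  fixes W :: "'a::euclidean_space \<times> 'b::euclidean_space \<Rightarrow> complex"
  assumes "smooth W" "bs \<in> lists Basis"
  shows "map (\<lambda>b. (b, 0)) bs \<in> lists (Basis :: ('a \<times> 'b) set)"
    "partials bs (\<lambda>z. W (z, v)) = (\<lambda>z. partials (map (\<lambda>b. (b, 0)) bs) W (z, v))"
proof -
  have 1: "map (\<lambda>b. (b, 0)) bs \<in> lists (Basis :: ('a \<times> 'b) set)" if "bs \<in> lists Basis" for bs :: "'a list"
    using that by (induction bs) (auto simp: Basis_prod_def)
  from 1 assms(2) show "map (\<lambda>b. (b, 0)) bs \<in> lists (Basis :: ('a \<times> 'b) set)" .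
  show "partials bs (\<lambda>z. W (z, v)) = (\<lambda>z. partials (map (\<lambda>b. (b, 0)) bs) W (z, v))"
    using assms(2) by induction (use assms 1 in \<open>auto simp: partial_slice_left smooth_partials\<close>)
qed

lemma partials_slice_right:
  fixes W :: "'a::euclidean_space \<times> 'b::euclidean_space \<Rightarrow> complex"
  assumes "smooth W" "bs \<in> lists Basis"
  shows "map (\<lambda>b. (0, b)) bs \<in> lists (Basis :: ('a \<times> 'b) set)"
    "partials bs (\<lambda>z. W (v, z)) = (\<lambda>z. partials (map (\<lambda>b. (0, b)) bs) W (v, z))"
proof -
  have 1: "map (\<lambda>b. (0, b)) bs \<in> lists (Basis :: ('a \<times> 'b) set)" if "bs \<in> lists Basis" for bs :: "'b list"
    using that by (induction bs) (auto simp: Basis_prod_def)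
  from 1 assms(2) show "map (\<lambda>b. (0, b)) bs \<in> lists (Basis :: ('a \<times> 'b) set)" .
  show "partials bs (\<lambda>z. W (v, z)) = (\<lambda>z. partials (map (\<lambda>b. (0, b)) bs) W (v, z))"
    using assms(2) by induction (use assms 1 in \<open>auto simp: partial_slice_right smooth_partials\<close>)
qed

lemma sformal_slice_left: "sformal W \<Longrightarrow> sformal (\<lambda>r z. W (r, q) (z, v))"
  unfolding sformal_def using smooth_affine[OF _ affine_map_pair_left] by blast

lemma sformal_slice_right: "sformal W \<Longrightarrow> sformal (\<lambda>r z. W (q, r) (v, z))"
  unfolding sformal_def using smooth_affine[OF _ affine_map_pair_right] by blast

text \<open>A derivative in the left leg at frozen \<open>v\<close> is a derivative of the two-point
  function in a direction \<open>(b, 0)\<close>, so locality holds jointly in both points.\<close>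

lemma local_op_left:
  assumes "local_op \<iota> L"
  shows "local_op (\<lambda>(y, v). (\<iota> y, v)) (\<lambda>W (y, v). L (\<lambda>r z. W (r, q) (z, v)) y)"
  using assms
proof induction
  case (base bs r)
  show ?case
  proof (rule local_op.cong)
    show "local_op (\<lambda>(y, v). (\<iota> y, v)) (\<lambda>W z. partials (map (\<lambda>b. (b, 0)) bs) (W (r, q)) ((\<lambda>(y, v). (\<iota> y, v)) z))"
      using base by (intro local_op.base partials_slice_left(1)) (auto intro: smooth_const)
  qed (use base in \<open>auto simp: sformal_def partials_slice_left(2) fun_eq_iff\<close>)
next
  case (add L M)
  show ?case using local_op.add[OF add.IH] by (simp add: case_prod_unfold)
next
  case (mult c L)
  show ?case using local_op.mult[OF smooth_affine[OF mult.hyps(1) affine_map_fst] mult.IH] by (simp add: case_prod_unfold)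
next
  case (cong L L')
  show ?case by (rule local_op.cong[OF cong.IH]) (simp add: cong.hyps sformal_slice_left)
qed

lemma local_op_right:
  assumes "local_op \<iota> L"
  shows "local_op (\<lambda>(v, y). (v, \<iota> y)) (\<lambda>W (v, y). L (\<lambda>r z. W (q, r) (v, z)) y)"
  using assms
proof induction
  case (base bs r)
  show ?case
  proof (rule local_op.cong)
    show "local_op (\<lambda>(v, y). (v, \<iota> y)) (\<lambda>W z. partials (map (\<lambda>b. (0, b)) bs) (W (q, r)) ((\<lambda>(v, y). (v, \<iota> y)) z))"
      using base by (intro local_op.base partials_slice_right(1)) (auto intro: smooth_const)
  qed (use base in \<open>auto simp: sformal_def partials_slice_right(2) fun_eq_iff\<close>)
next
  case (add L M)
  show ?case using local_op.add[OF add.IH] by (simp add: case_prod_unfold)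
next
  case (mult c L)
  show ?case using local_op.mult[OF smooth_affine[OF mult.hyps(1) affine_map_snd] mult.IH] by (simp add: case_prod_unfold)
next
  case (cong L L')
  show ?case by (rule local_op.cong[OF cong.IH]) (simp add: cong.hyps sformal_slice_right)
qed

lemma formal_op_left_leg:
  assumes "formal_op \<iota> A"
  shows "formal_op (\<lambda>(y, v). (\<iota> y, v)) (left_leg A)"
proof -
  have "local_op (\<lambda>(y, v). (\<iota> y, v)) (\<lambda>W (y, v). A (\<lambda>r z. W (r, q) (z, v)) p y)" for p q
    using assms local_op_left[of \<iota> "\<lambda>F. A F p"] by (auto simp: formal_op_def)
  then show ?thesis
    using assms affine_map_map_prod[OF _ affine_map_id, of \<iota>]
    by (auto simp: formal_op_def left_leg_def case_prod_unfold)
qed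

lemma formal_op_right_leg:
  assumes "formal_op \<iota> A"
  shows "formal_op (\<lambda>(v, y). (v, \<iota> y)) (right_leg A)"
proof -
  have "local_op (\<lambda>(v, y). (v, \<iota> y)) (\<lambda>W (v, y). A (\<lambda>r z. W (q, r) (v, z)) p y)" for p q
    using assms local_op_right[of \<iota> "\<lambda>F. A F p"] by (auto simp: formal_op_def)
  then show ?thesis
    using assms affine_map_map_prod[OF affine_map_id, of \<iota>]
    by (auto simp: formal_op_def right_leg_def case_prod_unfold)
qed

lemma formal_op_tensor_left:
  assumes "sformal G"
  shows "formal_op fst (\<lambda>F. tensor F G)"
proof -
  have "local_op fst (\<lambda>F z. G q (snd z) * F r (fst z))" for r q
    using assms smooth_affine[OF _ affine_map_snd] by (intro local_op.mult local_op_coeff) (auto simp: sformal_def)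
  then show ?thesis by (auto simp: formal_op_def affine_map_fst tensor_def case_prod_unfold mult.commute)
qed

lemma formal_op_tensor_right:
  assumes "sformal F"
  shows "formal_op snd (\<lambda>G. tensor F G)"
proof -
  have "local_op snd (\<lambda>G z. F r (fst z) * G q (snd z))" for r q
    using assms smooth_affine[OF _ affine_map_fst] by (intro local_op.mult local_op_coeff) (auto simp: sformal_def)
  then show ?thesis by (auto simp: formal_op_def affine_map_snd tensor_def case_prod_unfold)
qed

lemma sformal_tensor: "sformal F \<Longrightarrow> sformal G \<Longrightarrow> sformal (tensor F G)"
  using formal_op_sformal[OF formal_op_tensor_left] by blast

lemma left_leg_tensor:
  assumes "formal_op \<iota> A" "sformal F"
  shows "left_leg A (tensor F G) = tensor (A F) G"
proof -
  have "A (\<lambda>r z. F r z * G q y) p x = A F p x * G q y" for p q x y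
    using local_op_cmult_arg[of \<iota> "\<lambda>F. A F p" F "G q y"] assms
    by (auto simp: formal_op_def mult.commute fun_eq_iff)
  then show ?thesis by (simp add: left_leg_def tensor_def fun_eq_iff)
qed

lemma right_leg_tensor:
  assumes "formal_op \<iota> A" "sformal G"
  shows "right_leg A (tensor F G) = tensor F (A G)"
proof -
  have "A (\<lambda>r z. F q y * G r z) p x = F q y * A G p x" for p q x y
    using local_op_cmult_arg[of \<iota> "\<lambda>F. A F p" G "F q y"] assms
    by (auto simp: formal_op_def fun_eq_iff)
  then show ?thesis by (simp add: right_leg_def tensor_def fun_eq_iff)
qed

subsection \<open>Null sequences\<close>

lemma smooth_null_coinduct:
  assumes "u \<in> X"
    and "\<And>v K. v \<in> X \<Longrightarrow> compact K \<Longrightarrow> uniform_limit K v (\<lambda>_. 0) sequentially"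
    and "\<And>v b. v \<in> X \<Longrightarrow> b \<in> Basis \<Longrightarrow> (\<lambda>j. partial b (v j)) \<in> X"
  shows "smooth_null u"
proof -
  have "(\<lambda>j. partials bs (u j)) \<in> X" if "bs \<in> lists Basis" for bs
    using that by (induction bs) (use assms in auto)
  then show ?thesis unfolding smooth_null_def using assms(2) by blast
qed

lemma smooth_null_partials: "smooth_null u \<Longrightarrow> bs \<in> lists Basis \<Longrightarrow> smooth_null (\<lambda>j. partials bs (u j))"
  unfolding smooth_null_def by (auto simp del: in_lists_conv_set simp flip: partials_append)

lemma smooth_null_uniform_limit: "smooth_null u \<Longrightarrow> compact K \<Longrightarrow> uniform_limit K u (\<lambda>_. 0) sequentially"
  unfolding smooth_null_def by (force dest: bspec[of _ _ "[]"])

text \<open>Pullbacks of smooth null sequences with fixed smooth coefficients: the sequences that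
  local operators produce, in a class stable under partial derivatives.\<close>

inductive_set null_alg :: "('y::euclidean_space \<Rightarrow> 'x::euclidean_space) \<Rightarrow> (nat \<Rightarrow> 'y \<Rightarrow> complex) set" for \<iota> where
  base: "(\<And>j. smooth (u j)) \<Longrightarrow> smooth_null u \<Longrightarrow> (\<lambda>j y. u j (\<iota> y)) \<in> null_alg \<iota>"
| add: "u \<in> null_alg \<iota> \<Longrightarrow> v \<in> null_alg \<iota> \<Longrightarrow> (\<lambda>j y. u j y + v j y) \<in> null_alg \<iota>"
| mult: "smooth c \<Longrightarrow> u \<in> null_alg \<iota> \<Longrightarrow> (\<lambda>j y. c y * u j y) \<in> null_alg \<iota>"

lemma null_alg_sum:
  assumes "\<And>i. i \<in> I \<Longrightarrow> u i \<in> null_alg \<iota>"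
  shows "(\<lambda>j y. \<Sum>i\<in>I. u i j y) \<in> null_alg \<iota>"
proof -
  have "smooth_null (\<lambda>j y. 0)"
    by (rule smooth_null_coinduct[of _ "{\<lambda>j y. 0}"]) (auto intro!: uniform_limit_const)
  then have "(\<lambda>j y. 0) \<in> null_alg \<iota>" using null_alg.base[of "\<lambda>_ _. 0"] by simp
  then show ?thesis using assms by (induction I rule: infinite_finite_induct) (auto intro: null_alg.add)
qed

lemma smooth_null_alg:
  assumes "affine_map \<iota>" "u \<in> null_alg \<iota>"
  shows "smooth_null u"
proof (rule smooth_null_coinduct[OF assms(2)])
  obtain A d where A: "bounded_linear A" and \<iota>: "\<iota> = (\<lambda>y. A y + d)"
    using assms(1) by (auto simp: affine_map_def)
  have sm: "smooth (v j)" if "v \<in> null_alg \<iota>" for v j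
    using that by induction (use assms(1) in \<open>auto intro: smooth_affine smooth_add smooth_mult\<close>)
  fix v assume v: "v \<in> null_alg \<iota>"
  show "uniform_limit K v (\<lambda>_. 0) sequentially" if K: "compact K" for K
    using v
  proof induction
    case (base u)
    have "compact (\<iota> ` K)" using K affine_map_continuous[OF assms(1)] compact_continuous_image by blast
    from smooth_null_uniform_limit[OF base(2) this]
    show ?case by (auto simp: uniform_limit_iff)
  next
    case (add u v)
    then show ?case using uniform_limit_add[OF add.IH] by simp
  next
    case (mult c u)
    have "bounded (c ` K)"
      using mult(1) K by (intro compact_imp_bounded compact_continuous_image smooth_continuous_on)
    moreover have "bounded ((\<lambda>_. 0::complex) ` K)" by (rule finite_imp_bounded) (auto intro: finite_subset[of _ "{0}"])
    ultimately show ?case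
      using uniform_lim_mult[OF uniform_limit_const mult.IH] by simp
  qed
  show "(\<lambda>j. partial b (v j)) \<in> null_alg \<iota>" if b: "b \<in> Basis" for b
    using v
  proof induction
    case (base u)
    have "(\<lambda>j y. \<Sum>b'\<in>Basis. of_real (A b \<bullet> b') * partial b' (u j) (\<iota> y)) \<in> null_alg \<iota>"
    proof (intro null_alg_sum null_alg.mult smooth_const)
      fix b' :: 'b assume b': "b' \<in> Basis"
      show "(\<lambda>j y. partial b' (u j) (\<iota> y)) \<in> null_alg \<iota>"
        using null_alg.base[of "\<lambda>j. partial b' (u j)"] smooth_null_partials[OF base(2), of "[b']"] b'
          smooth_partial[OF base(1)] by simp
    qed
    moreover have "partial b (\<lambda>y. u j (\<iota> y)) = (\<lambda>y. \<Sum>b'\<in>Basis. of_real (A b \<bullet> b') * partial b' (u j) (\<iota> y))" for j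
      using partial_affine[OF base(1)[of j] A, of b d] by (simp add: \<iota>)
    ultimately show ?case by simp
  next
    case (add u v)
    then show ?case by (simp add: partial_add smooth_differentiable_on sm null_alg.add)
  next
    case (mult c u)
    have "(\<lambda>j y. c y * partial b (u j) y + partial b c y * u j y) \<in> null_alg \<iota>"
      using mult b by (intro null_alg.add null_alg.mult smooth_partial)
    then show ?case using mult by (simp add: partial_mult smooth_differentiable_on sm)
  qed
qed

text \<open>Continuity of multiplication, coproduct and antipode comes from here: a local operator
  turns null sequences into finite combinations of derivatives of null sequences, pulled back along
  an affine map.\<close>

lemma local_op_null:
  assumes "affine_map \<iota>" "local_op \<iota> L" "\<And>j. sformal (X j)" "\<And>r. smooth_null (\<lambda>j. X j r)"
  shows "smooth_null (\<lambda>j. L (X j))"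
proof (rule smooth_null_alg[OF assms(1)])
  show "(\<lambda>j. L (X j)) \<in> null_alg \<iota>" using assms(2)
  proof induction
    case (base bs r)
    have "smooth_null (\<lambda>j. partials bs (X j r))" using base assms(4) smooth_null_partials by blast
    moreover have "smooth (partials bs (X j r))" for j using base assms(3) by (simp add: sformal_def smooth_partials)
    ultimately show ?case by (intro null_alg.base)
  next
    case (add L M)
    show ?case using add.IH by (rule null_alg.add)
  next
    case (mult c L)
    show ?case using mult.hyps(1) mult.IH by (rule null_alg.mult)
  next
    case (cong L L')
    then show ?case using assms(3) by simp
  qed
qed

section \<open>The intertwiner with the Moyal product\<close>

definition Dl :: "(S \<Rightarrow> complex) \<Rightarrow> S \<Rightarrow> complex" where
  "Dl w = (\<lambda>x. - \<i> * partial (0, 1) w x)"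

definition lmul :: "(S \<Rightarrow> complex) \<Rightarrow> S \<Rightarrow> complex" where
  "lmul w = (\<lambda>x. complex_of_real (snd x) * w x)"

definition amul :: "(S \<Rightarrow> complex) \<Rightarrow> S \<Rightarrow> complex" where
  "amul w = (\<lambda>x. complex_of_real (fst x) * w x)"

text \<open>Polynomial differential operators in \<open>l\<close> alone. They commute with
  multiplication by \<open>a\<close> and keep the degree in \<open>a\<close>, so conjugation by
  series of them preserves polynomials in \<open>a\<close>.\<close>

inductive lop :: "((S \<Rightarrow> complex) \<Rightarrow> S \<Rightarrow> complex) \<Rightarrow> bool" where
  ident: "lop (\<lambda>w. w)"
| zero: "lop (\<lambda>w x. 0)"
| add: "lop A \<Longrightarrow> lop B \<Longrightarrow> lop (\<lambda>w x. A w x + B w x)"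
| cmult: "lop A \<Longrightarrow> lop (\<lambda>w x. c * A w x)"
| Dl: "lop A \<Longrightarrow> lop (\<lambda>w. Dl (A w))"
| lmul: "lop A \<Longrightarrow> lop (\<lambda>w. lmul (A w))"

lemma Basis_S: "(0, 1) \<in> (Basis :: S set)" "(1, 0) \<in> (Basis :: S set)"
  by (auto simp: Basis_prod_def)

lemma smooth_snd: "smooth (\<lambda>x::S. complex_of_real (snd x))"
  and smooth_fst: "smooth (\<lambda>x::S. complex_of_real (fst x))"
  by (auto intro: smooth_real_linear bounded_linear_fst bounded_linear_snd)

lemma smooth_Dl: "smooth w \<Longrightarrow> smooth (Dl w)"
  unfolding Dl_def by (intro smooth_mult smooth_const smooth_partial Basis_S)

lemma smooth_lmul: "smooth w \<Longrightarrow> smooth (lmul w)"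
  unfolding lmul_def by (intro smooth_mult smooth_snd)

lemma smooth_amul: "smooth w \<Longrightarrow> smooth (amul w)"
  unfolding amul_def by (intro smooth_mult smooth_fst)

lemma lop_local_op: "lop A \<Longrightarrow> local_op (\<lambda>x. x) (\<lambda>F. A (F (r::nat)))"
proof (induction rule: lop.induct)
  case ident
  then show ?case by (rule local_op_coeff)
next
  case zero
  then show ?case by (rule local_op_zero)
next
  case (add A B)
  show ?case using add.IH by (rule local_op.add)
next
  case (cmult A c)
  show ?case using smooth_const cmult.IH by (rule local_op.mult)
next
  case (Dl A)
  show ?case unfolding Dl_def
    by (intro local_op.mult smooth_const local_op_partial affine_map_id Dl.IH Basis_S)
next
  case (lmul A)
  show ?case unfolding lmul_def using smooth_snd lmul.IH by (rule local_op.mult)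
qed

lemma lop_smooth: "lop A \<Longrightarrow> smooth w \<Longrightarrow> smooth (A w)"
  using local_op_smooth[OF affine_map_id lop_local_op, of A "\<lambda>_. w"] by (simp add: sformal_def)

lemma lop_add_arg: "lop A \<Longrightarrow> smooth v \<Longrightarrow> smooth w \<Longrightarrow> A (\<lambda>x. v x + w x) = (\<lambda>x. A v x + A w x)"
  using local_op_add_arg[OF lop_local_op, of A "\<lambda>_. v" "\<lambda>_. w"] by (simp add: sformal_def)

lemma lop_cmult_arg: "lop A \<Longrightarrow> smooth w \<Longrightarrow> A (\<lambda>x. c * w x) = (\<lambda>x. c * A w x)"
  using local_op_cmult_arg[OF lop_local_op, of A "\<lambda>_. w"] by (simp add: sformal_def)

lemma lop_zero_arg: "lop A \<Longrightarrow> A (\<lambda>x. 0) = (\<lambda>x. 0)"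
  using lop_cmult_arg[of A "\<lambda>x. 0" 0] by simp

lemma lop_sum_arg: "lop A \<Longrightarrow> (\<And>i. i \<in> I \<Longrightarrow> smooth (w i)) \<Longrightarrow> A (\<lambda>x. \<Sum>i\<in>I. w i x) = (\<lambda>x. \<Sum>i\<in>I. A (w i) x)"
  using local_op_sum_arg[OF lop_local_op, of A I "\<lambda>i _. w i"] by (simp add: sformal_def)

lemma lop_sum: "(\<And>i. i \<in> I \<Longrightarrow> lop (A i)) \<Longrightarrow> lop (\<lambda>w x. \<Sum>i\<in>I. A i w x)"
  by (induction I rule: infinite_finite_induct) (auto intro: lop.intros)

lemma lop_compose: "lop A \<Longrightarrow> lop B \<Longrightarrow> lop (\<lambda>w. A (B w))"
  by (induction rule: lop.induct) (auto intro: lop.intros)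

lemma lop_funpow_Dl: "lop (\<lambda>w. (Dl ^^ n) w)"
  by (induction n) (auto intro: lop.intros)

lemma lop_funpow_lmul: "lop (\<lambda>w. (lmul ^^ n) w)"
  by (induction n) (auto intro: lop.intros)

lemma lmul_funpow: "(lmul ^^ n) w = (\<lambda>x. complex_of_real (snd x) ^ n * w x)"
  by (induction n) (auto simp: lmul_def fun_eq_iff)

lemma Dl_mult: "smooth f \<Longrightarrow> smooth g \<Longrightarrow> Dl (\<lambda>x. f x * g x) = (\<lambda>x. f x * Dl g x + Dl f x * g x)"
  by (simp add: Dl_def partial_mult smooth_differentiable_on algebra_simps)

lemma Dl_snd: "Dl (\<lambda>x. complex_of_real (snd x)) = (\<lambda>x. - \<i>)"
proof -
  have "((\<lambda>x. complex_of_real (snd x)) has_derivative (\<lambda>x. complex_of_real (snd x))) (at x)" for x :: S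
    by (auto intro!: derivative_eq_intros)
  from partial_eqI[OF this] show ?thesis by (simp add: Dl_def)
qed

lemma Dl_fst: "Dl (\<lambda>x. complex_of_real (fst x)) = (\<lambda>x. 0)"
proof -
  have "((\<lambda>x. complex_of_real (fst x)) has_derivative (\<lambda>x. complex_of_real (fst x))) (at x)" for x :: S
    by (auto intro!: derivative_eq_intros)
  from partial_eqI[OF this] show ?thesis by (simp add: Dl_def)
qed

lemma Dl_lmul: "smooth w \<Longrightarrow> Dl (lmul w) = (\<lambda>x. lmul (Dl w) x - \<i> * w x)"
  unfolding lmul_def by (subst Dl_mult) (auto simp: smooth_snd Dl_snd)

lemma Dl_amul: "smooth w \<Longrightarrow> Dl (amul w) = amul (Dl w)"
  unfolding amul_def by (subst Dl_mult) (auto simp: smooth_fst Dl_fst)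

lemma Dl_const: "Dl (\<lambda>x. c) = (\<lambda>x. 0)"
  by (simp add: Dl_def)

lemma lop_amul: "lop A \<Longrightarrow> smooth w \<Longrightarrow> A (amul w) = amul (A w)"
proof (induction rule: lop.induct)
  case (Dl A)
  then show ?case by (simp add: Dl_amul lop_smooth)
qed (auto simp: amul_def lmul_def algebra_simps fun_eq_iff)

text \<open>Iterated form of the commutator \<open>[D, l] = - \<i>\<close>. The factor
  \<open>of_nat n\<close> makes the truncated exponent \<open>n - 1\<close> harmless at
  \<open>n = 0\<close>.\<close>

lemma Dl_funpow_lmul:
  assumes "smooth w"
  shows "(Dl ^^ n) (lmul w) = (\<lambda>x. lmul ((Dl ^^ n) w) x - \<i> * of_nat n * (Dl ^^ (n - 1)) w x)"
proof (induction n)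
  case (Suc n)
  have s: "smooth ((Dl ^^ n) w)" for n using lop_smooth[OF lop_funpow_Dl assms] .
  define c where "c = - \<i> * of_nat n"
  have "(Dl ^^ Suc n) (lmul w) = Dl (\<lambda>x. lmul ((Dl ^^ n) w) x + c * (Dl ^^ (n - 1)) w x)"
    by (simp add: Suc c_def)
  also have "\<dots> = (\<lambda>x. Dl (lmul ((Dl ^^ n) w)) x + c * Dl ((Dl ^^ (n - 1)) w) x)"
    unfolding lop_add_arg[OF lop.Dl[OF lop.ident] smooth_lmul[OF s] smooth_mult[OF smooth_const s]]
      lop_cmult_arg[OF lop.Dl[OF lop.ident] s] ..
  also have "\<dots> = (\<lambda>x. lmul ((Dl ^^ Suc n) w) x - \<i> * of_nat (Suc n) * (Dl ^^ n) w x)"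
    by (cases n) (simp_all add: Dl_lmul s smooth_Dl assms algebra_simps fun_eq_iff c_def)
  finally show ?case by simp
qed auto

subsection \<open>Coefficients\<close>

text \<open>\<open>fps_sh\<close> and \<open>fps_ch\<close> are the series of \<open>sinh x - x\<close> and \<open>cosh x\<close>, so that
  \<open>((sinh (h x) - h x) / h)\<^sup>j / j!\<close> is the sum over \<open>n\<close> of \<open>shcoef n j h\<^sup>n x\<^sup>n\<^sup>+\<^sup>j\<close>.\<close>

definition fps_sh :: "complex fps" where
  "fps_sh = fps_const (1 / 2) * (fps_exp 1 - fps_exp (- 1)) - fps_X"

definition fps_ch :: "complex fps" where
  "fps_ch = fps_const (1 / 2) * (fps_exp 1 + fps_exp (- 1))"

definition shcoef :: "nat \<Rightarrow> nat \<Rightarrow> complex" where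
  "shcoef n j = fps_nth (fps_sh ^ j) (n + j) / fact j"

lemma fps_deriv_sh: "fps_deriv fps_sh = fps_ch - 1"
proof -
  have m: "fps_const (- 1) * f = (- f :: complex fps)" for f by (metis fps_const_neg fps_const_1_eq_1 mult_minus_left mult_1)
  have "fps_deriv fps_sh = fps_const (1 / 2) * (fps_const 1 * fps_exp 1 - fps_const (- 1) * fps_exp (- 1)) - 1"
    by (simp add: fps_sh_def)
  then show ?thesis unfolding m by (simp add: fps_ch_def)
qed

lemma fps_sh_nth: "fps_nth fps_sh 0 = 0" "fps_nth fps_sh (Suc 0) = 0"
  by (auto simp: fps_sh_def fps_X_def)

text \<open>The series of \<open>sinh x - x\<close> is divisible by \<open>x ^ 2\<close>, hence its
  power \<open>j\<close> by \<open>x ^ (2 * j)\<close>. This is why sums over \<open>j\<close> may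
  stop at \<open>n\<close>.\<close>

lemma shcoef_zero: "n < j \<Longrightarrow> shcoef n j = 0"
proof -
  assume "n < j"
  have "\<exists>f. fps_sh = fps_X ^ 2 * f"
  proof (intro exI fps_ext)
    fix n show "fps_nth fps_sh n = fps_nth (fps_X ^ 2 * fps_shift 2 fps_sh) n"
      using fps_sh_nth
      by (cases "n < 2") (auto simp: fps_X_power_mult_nth less_2_cases_iff simp del: add_2_eq_Suc')
  qed
  then obtain f where "fps_sh = fps_X ^ 2 * f" by blast
  then have "fps_sh ^ j = fps_X ^ (2 * j) * f ^ j" by (metis power_mult_distrib power_mult)
  then show ?thesis using \<open>n < j\<close> by (simp add: shcoef_def fps_X_power_mult_nth)
qed

lemma shcoef_0: "shcoef n 0 = (if n = 0 then 1 else 0)"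
  by (simp add: shcoef_def)

text \<open>Comparison of coefficients in the derivative of
  \<open>(sinh x - x) ^ Suc j / fact (Suc j)\<close>, which is \<open>cosh x - 1\<close> times
  \<open>(sinh x - x) ^ j / fact j\<close>. It drives the commutation rules of \<open>Vop\<close>
  and \<open>Rop\<close> with \<open>l\<close>.\<close>

lemma shcoef_rec:
  "shcoef n j + of_nat (n + Suc j) * shcoef n (Suc j) = (\<Sum>m\<le>n. fps_nth fps_ch m * shcoef (n - m) j)"
proof -
  have low: "fps_nth (fps_sh ^ j) k = 0" if "k < j" for k
  proof -
    have "fps_sh = fps_X * fps_shift 1 fps_sh"
      by (rule fps_ext) (simp add: fps_sh_nth)
    then have "fps_sh ^ j = fps_X ^ j * fps_shift 1 fps_sh ^ j" by (metis power_mult_distrib)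
    then show ?thesis using that by (simp add: fps_X_power_mult_nth)
  qed
  have "fps_deriv (fps_sh ^ Suc j) = of_nat (Suc j) * (fps_ch - 1) * fps_sh ^ j"
    unfolding fps_deriv_power' fps_deriv_sh by simp
  also have "\<dots> = fps_const (of_nat (Suc j)) * ((fps_ch - 1) * fps_sh ^ j)"
    by (simp only: fps_of_nat mult.assoc)
  finally have "fps_nth (fps_deriv (fps_sh ^ Suc j)) (n + j) = of_nat (Suc j) * fps_nth ((fps_ch - 1) * fps_sh ^ j) (n + j)"
    by (simp only: fps_mult_left_const_nth)
  then have "of_nat (n + Suc j) * fps_nth (fps_sh ^ Suc j) (n + Suc j) =
      of_nat (Suc j) * (fps_nth (fps_ch * fps_sh ^ j) (n + j) - fps_nth (fps_sh ^ j) (n + j))"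
    by (simp add: left_diff_distrib del: power_Suc of_nat_Suc)
  moreover have "fps_nth (fps_ch * fps_sh ^ j) (n + j) = (\<Sum>m\<le>n. fps_nth fps_ch m * fps_nth (fps_sh ^ j) (n - m + j))"
  proof -
    have "fps_nth (fps_ch * fps_sh ^ j) (n + j) = (\<Sum>m=0..n + j. fps_nth fps_ch m * fps_nth (fps_sh ^ j) (n + j - m))"
      by (simp add: fps_mult_nth)
    also have "\<dots> = (\<Sum>m\<le>n. fps_nth fps_ch m * fps_nth (fps_sh ^ j) (n + j - m))"
      by (intro sum.mono_neutral_right) (auto intro!: low)
    also have "\<dots> = (\<Sum>m\<le>n. fps_nth fps_ch m * fps_nth (fps_sh ^ j) (n - m + j))"
      by (intro sum.cong refl) (simp add: add.commute)
    finally show ?thesis .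
  qed
  ultimately have "of_nat (n + Suc j) * fps_nth (fps_sh ^ Suc j) (n + Suc j) / fact (Suc j) =
      ((\<Sum>m\<le>n. fps_nth fps_ch m * fps_nth (fps_sh ^ j) (n - m + j)) - fps_nth (fps_sh ^ j) (n + j)) / fact j"
    by (simp add: fact_Suc del: of_nat_Suc of_nat_add)
  then show ?thesis
    by (simp add: shcoef_def diff_divide_distrib sum_divide_distrib diff_eq_eq add.commute del: of_nat_Suc of_nat_add power_Suc fact_Suc)
qed

text \<open>Coefficients of \<open>h\<^sup>n\<close> in \<open>exp (\<i> l (sinh (h D) / h - D))\<close> with \<open>l\<close> to the left of \<open>D\<close>, in \<open>cosh (h D)\<close>, and in
  \<open>exp (- \<i> l (sinh (h D) / h - D))\<close> with \<open>l\<close> to the right of \<open>D\<close>. On the Fourier side the last one is the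
  substitution of \<open>sinh (h P) / h\<close> for \<open>P\<close>.\<close>

definition Vop :: "nat \<Rightarrow> (S \<Rightarrow> complex) \<Rightarrow> S \<Rightarrow> complex" where
  "Vop n w = (\<lambda>x. \<Sum>j\<le>n. shcoef n j * \<i> ^ j * (lmul ^^ j) ((Dl ^^ (n + j)) w) x)"

definition Cop :: "nat \<Rightarrow> (S \<Rightarrow> complex) \<Rightarrow> S \<Rightarrow> complex" where
  "Cop n w = (\<lambda>x. fps_nth fps_ch n * (Dl ^^ n) w x)"

definition Rop :: "nat \<Rightarrow> (S \<Rightarrow> complex) \<Rightarrow> S \<Rightarrow> complex" where
  "Rop n w = (\<lambda>x. \<Sum>j\<le>n. shcoef n j * (- \<i>) ^ j * (Dl ^^ (n + j)) ((lmul ^^ j) w) x)"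

lemma lop_Vop: "lop (Vop n)"
  unfolding Vop_def[abs_def]
  by (intro lop_sum lop.cmult lop_compose[OF lop_funpow_lmul] lop_funpow_Dl)

lemma lop_Cop: "lop (Cop n)"
  unfolding Cop_def[abs_def] by (intro lop.cmult lop_funpow_Dl)

lemma lop_Rop: "lop (Rop n)"
  unfolding Rop_def[abs_def]
  by (intro lop_sum lop.cmult lop_compose[OF lop_funpow_Dl] lop_funpow_lmul)

definition conv :: "(nat \<Rightarrow> (S \<Rightarrow> complex) \<Rightarrow> S \<Rightarrow> complex) \<Rightarrow> (nat \<Rightarrow> (S \<Rightarrow> complex) \<Rightarrow> S \<Rightarrow> complex)
    \<Rightarrow> nat \<Rightarrow> (S \<Rightarrow> complex) \<Rightarrow> S \<Rightarrow> complex" where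
  "conv A B n w = (\<lambda>x. \<Sum>k\<le>n. A k (B (n - k) w) x)"

lemma lop_conv: "(\<And>n. lop (A n)) \<Longrightarrow> (\<And>n. lop (B n)) \<Longrightarrow> lop (conv A B n)"
  unfolding conv_def[abs_def] by (rule lop_sum) (rule lop_compose)

lemma sum_triangle:
  "(\<Sum>k\<le>n. \<Sum>m\<le>n - k. f k m (n - k - m)) = (\<Sum>k\<le>n::nat. \<Sum>m\<le>k. f m (k - m) (n - k))"
  for f :: "nat \<Rightarrow> nat \<Rightarrow> nat \<Rightarrow> 'a::comm_monoid_add"
proof -
  have "(\<Sum>k\<le>n. \<Sum>m\<le>n - k. f k m (n - k - m)) = (\<Sum>(k, m)\<in>(SIGMA k:{..n}. {..n - k}). f k m (n - k - m))"
    by (simp add: sum.Sigma)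
  also have "\<dots> = (\<Sum>(k, m)\<in>(SIGMA k:{..n}. {..k}). f m (k - m) (n - k))"
    by (rule sum.reindex_bij_witness[of _ "\<lambda>(k, m). (m, k - m)" "\<lambda>(k, m). (k + m, k)"]) auto
  also have "\<dots> = (\<Sum>k\<le>n. \<Sum>m\<le>k. f m (k - m) (n - k))" by (simp add: sum.Sigma)
  finally show ?thesis .
qed

lemma conv_assoc:
  assumes "\<And>n. lop (A n)" "\<And>n. lop (B n)" "\<And>n. lop (C n)" "smooth w"
  shows "conv A (conv B C) n w = conv (conv A B) C n w"
proof -
  have "conv A (conv B C) n w = (\<lambda>x. \<Sum>k\<le>n. \<Sum>m\<le>n - k. A k (B m (C (n - k - m) w)) x)"
  proof -
    have "A k (\<lambda>x. \<Sum>m\<le>n - k. B m (C (n - k - m) w) x) = (\<lambda>x. \<Sum>m\<le>n - k. A k (B m (C (n - k - m) w)) x)" for k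
      by (rule lop_sum_arg[OF assms(1)]) (rule lop_smooth[OF assms(2) lop_smooth[OF assms(3,4)]])
    then show ?thesis by (simp only: conv_def)
  qed
  also have "\<dots> = (\<lambda>x. \<Sum>k\<le>n. \<Sum>m\<le>k. A m (B (k - m) (C (n - k) w)) x)"
    by (rule ext, rule sum_triangle)
  finally show ?thesis by (simp add: conv_def)
qed

text \<open>In operator form \<open>V l = l V C\<close>. Moving \<open>l\<close> to the left past a
  function of \<open>D\<close> adds \<open>- \<i>\<close> times its derivative; for the exponent of
  \<open>V\<close> this derivative is \<open>\<i> l (cosh (h D) - 1)\<close>, and
  \<open>l V + l V (C - 1)\<close> is the claim.\<close>

lemma Vop_lmul:
  assumes "smooth w"
  shows "Vop n (lmul w) = lmul (conv Vop Cop n w)"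
proof
  fix x
  let ?d = "\<lambda>k. (Dl ^^ k) w x" and ?l = "complex_of_real (snd x)"
  have D: "(Dl ^^ k) (Cop m w) x = fps_nth fps_ch m * (Dl ^^ (k + m)) w x" for k m
    using lop_cmult_arg[OF lop_funpow_Dl lop_smooth[OF lop_funpow_Dl assms]] unfolding Cop_def
    by (simp add: funpow_add)
  have "Vop n (lmul w) x = (\<Sum>j\<le>n. shcoef n j * \<i> ^ j * ?l ^ j * (?l * ?d (n + j) - \<i> * of_nat (n + j) * ?d (n + j - 1)))"
  proof -
    have "lmul v x = ?l * v x" for v by (simp add: lmul_def)
    then show ?thesis by (simp add: Vop_def lmul_funpow Dl_funpow_lmul[OF assms] mult.assoc)
  qed
  also have "\<dots> = (\<Sum>j\<le>n. shcoef n j * \<i> ^ j * ?l ^ j * (?l * ?d (n + j)))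
      - (\<Sum>j\<le>n. shcoef n j * \<i> ^ j * ?l ^ j * (\<i> * of_nat (n + j) * ?d (n + j - 1)))"
    by (simp only: right_diff_distrib sum_subtractf)
  \<comment> \<open>The zero term \<open>j = Suc n\<close> is added so that the index shift ends at
    \<open>n\<close> again. The term \<open>j = 0\<close> then drops out: \<open>shcoef n 0\<close>
    is nonzero only for \<open>n = 0\<close>, where the factor \<open>n + j\<close> is 0.\<close>
  also have "(\<Sum>j\<le>n. shcoef n j * \<i> ^ j * ?l ^ j * (\<i> * of_nat (n + j) * ?d (n + j - 1))) =
      (\<Sum>j\<le>Suc n. shcoef n j * \<i> ^ j * ?l ^ j * (\<i> * of_nat (n + j) * ?d (n + j - 1)))"
    by (simp add: shcoef_zero)
  also have "\<dots> = (\<Sum>j\<le>n. shcoef n (Suc j) * \<i> ^ Suc j * ?l ^ Suc j * (\<i> * of_nat (n + Suc j) * ?d (n + j)))"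
    by (subst sum.atMost_Suc_shift) (simp add: shcoef_0)
  also have "\<dots> = - (\<Sum>j\<le>n. of_nat (n + Suc j) * shcoef n (Suc j) * \<i> ^ j * ?l ^ j * ?l * ?d (n + j))"
    unfolding sum_negf[symmetric] by (intro sum.cong refl) (simp add: algebra_simps flip: power2_eq_square)
  also have "(\<Sum>j\<le>n. shcoef n j * \<i> ^ j * ?l ^ j * (?l * ?d (n + j))) - - (\<Sum>j\<le>n. of_nat (n + Suc j) * shcoef n (Suc j) * \<i> ^ j * ?l ^ j * ?l * ?d (n + j))
      = (\<Sum>j\<le>n. (shcoef n j + of_nat (n + Suc j) * shcoef n (Suc j)) * \<i> ^ j * ?l ^ j * ?l * ?d (n + j))"
    by (simp only: diff_minus_eq_add sum.distrib[symmetric] distrib_right mult.assoc)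
  also have "\<dots> = (\<Sum>j\<le>n. \<Sum>m\<le>n. fps_nth fps_ch m * shcoef (n - m) j * \<i> ^ j * ?l ^ j * ?l * ?d (n + j))"
    unfolding shcoef_rec by (simp only: sum_distrib_right)
  also have "\<dots> = (\<Sum>m\<le>n. \<Sum>j\<le>n. fps_nth fps_ch m * shcoef (n - m) j * \<i> ^ j * ?l ^ j * ?l * ?d (n + j))"
    by (rule sum.swap)
  also have "\<dots> = (\<Sum>m\<le>n. \<Sum>j\<le>n - m. fps_nth fps_ch m * shcoef (n - m) j * \<i> ^ j * ?l ^ j * ?l * ?d (n + j))"
    by (intro sum.cong refl sum.mono_neutral_right) (auto simp: shcoef_zero)
  also have "\<dots> = (\<Sum>m\<le>n. ?l * Vop (n - m) (Cop m w) x)"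
    unfolding Vop_def lmul_funpow D sum_distrib_left
    by (intro sum.cong refl) (simp add: mult_ac)
  also have "\<dots> = (\<Sum>m\<le>n. ?l * Vop m (Cop (n - m) w) x)"
    by (rule sum.reindex_bij_witness[of _ "\<lambda>m. n - m" "\<lambda>m. n - m"]) auto
  also have "\<dots> = lmul (conv Vop Cop n w) x"
    by (simp add: lmul_def conv_def sum_distrib_left)
  finally show "Vop n (lmul w) x = lmul (conv Vop Cop n w) x" .
qed

text \<open>The mirror image \<open>l R = C R l\<close>. Here \<open>l\<close> enters from the left
  and moves to the right, so the commutator contributes \<open>\<i>\<close>, which meets
  \<open>- \<i>\<close> in the exponent and again gives the factor
  \<open>cosh (h D)\<close>.\<close>

lemma lmul_Rop:
  assumes "smooth w"
  shows "lmul (Rop n w) = conv Cop Rop n (lmul w)"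
proof
  fix x
  let ?e = "\<lambda>k j. (Dl ^^ k) ((lmul ^^ j) w) x"
  have s: "smooth ((lmul ^^ j) w)" for j using lop_smooth[OF lop_funpow_lmul assms] .
  have C: "Cop m (Rop k (lmul w)) x = (\<Sum>j\<le>k. fps_nth fps_ch m * shcoef k j * (- \<i>) ^ j * ?e (m + k + j) (Suc j))" for m k
  proof -
    have "(Dl ^^ m) (Rop k (lmul w)) = (\<lambda>x. \<Sum>j\<le>k. (Dl ^^ m) (\<lambda>x. shcoef k j * (- \<i>) ^ j * (Dl ^^ (k + j)) ((lmul ^^ j) (lmul w)) x) x)"
      unfolding Rop_def
      by (rule lop_sum_arg[OF lop_funpow_Dl]) (auto intro!: smooth_mult lop_smooth[OF lop_funpow_Dl] lop_smooth[OF lop_funpow_lmul] smooth_lmul assms)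
    also have "\<dots> = (\<lambda>x. \<Sum>j\<le>k. shcoef k j * (- \<i>) ^ j * (Dl ^^ (m + k + j)) ((lmul ^^ Suc j) w) x)"
      by (subst lop_cmult_arg[OF lop_funpow_Dl])
        (auto intro!: lop_smooth[OF lop_funpow_Dl] lop_smooth[OF lop_funpow_lmul] smooth_lmul assms simp: funpow_add funpow_swap1)
    finally show ?thesis by (simp add: Cop_def sum_distrib_left mult.assoc)
  qed
  have l: "complex_of_real (snd x) * ?e k j = ?e k (Suc j) + \<i> * of_nat k * ?e (k - 1) j" for k j
    using fun_cong[OF Dl_funpow_lmul[OF s[of j], of k], of x] by (simp add: lmul_def)
  have "lmul (Rop n w) x = (\<Sum>j\<le>n. shcoef n j * (- \<i>) ^ j * (?e (n + j) (Suc j) + \<i> * of_nat (n + j) * ?e (n + j - 1) j))"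
  proof -
    have "lmul (Rop n w) x = complex_of_real (snd x) * Rop n w x" by (simp add: lmul_def)
    then show ?thesis
      unfolding Rop_def sum_distrib_left l[symmetric] by (simp add: mult_ac)
  qed
  also have "\<dots> = (\<Sum>j\<le>n. shcoef n j * (- \<i>) ^ j * ?e (n + j) (Suc j))
      + (\<Sum>j\<le>n. shcoef n j * (- \<i>) ^ j * (\<i> * of_nat (n + j) * ?e (n + j - 1) j))"
    by (simp only: distrib_left sum.distrib)
  also have "(\<Sum>j\<le>n. shcoef n j * (- \<i>) ^ j * (\<i> * of_nat (n + j) * ?e (n + j - 1) j)) =
      (\<Sum>j\<le>Suc n. shcoef n j * (- \<i>) ^ j * (\<i> * of_nat (n + j) * ?e (n + j - 1) j))"
    by (simp add: shcoef_zero)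
  also have "\<dots> = (\<Sum>j\<le>n. shcoef n (Suc j) * (- \<i>) ^ Suc j * (\<i> * of_nat (n + Suc j) * ?e (n + j) (Suc j)))"
    by (subst sum.atMost_Suc_shift) (simp add: shcoef_0)
  also have "\<dots> = (\<Sum>j\<le>n. of_nat (n + Suc j) * shcoef n (Suc j) * (- \<i>) ^ j * ?e (n + j) (Suc j))"
    by (intro sum.cong refl) (simp add: algebra_simps flip: power2_eq_square)
  also have "(\<Sum>j\<le>n. shcoef n j * (- \<i>) ^ j * ?e (n + j) (Suc j)) + \<dots> =
      (\<Sum>j\<le>n. (shcoef n j + of_nat (n + Suc j) * shcoef n (Suc j)) * (- \<i>) ^ j * ?e (n + j) (Suc j))"
    by (simp only: sum.distrib[symmetric] distrib_right mult.assoc)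
  also have "\<dots> = (\<Sum>j\<le>n. \<Sum>m\<le>n. fps_nth fps_ch m * shcoef (n - m) j * (- \<i>) ^ j * ?e (n + j) (Suc j))"
    unfolding shcoef_rec by (simp only: sum_distrib_right)
  also have "\<dots> = (\<Sum>m\<le>n. \<Sum>j\<le>n. fps_nth fps_ch m * shcoef (n - m) j * (- \<i>) ^ j * ?e (n + j) (Suc j))"
    by (rule sum.swap)
  also have "\<dots> = (\<Sum>m\<le>n. \<Sum>j\<le>n - m. fps_nth fps_ch m * shcoef (n - m) j * (- \<i>) ^ j * ?e (n + j) (Suc j))"
    by (intro sum.cong refl sum.mono_neutral_right) (auto simp: shcoef_zero)
  also have "\<dots> = (\<Sum>m\<le>n. Cop m (Rop (n - m) (lmul w)) x)"
    unfolding C by (intro sum.cong refl) simp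
  finally show "lmul (Rop n w) x = conv Cop Rop n (lmul w) x" by (simp add: conv_def)
qed

text \<open>\<open>Cop\<close> is the amplitude of the integral and at the same time the Jacobian of
  the substitution made by \<open>Rop\<close>. With it \<open>V C R l = V l R = l V C R\<close>, so
  the composite of \<open>Top\<close> and \<open>Rop\<close> commutes with \<open>l\<close>.\<close>

definition Top :: "nat \<Rightarrow> (S \<Rightarrow> complex) \<Rightarrow> S \<Rightarrow> complex" where
  "Top = conv Vop Cop"

lemma lop_Top: "lop (Top n)"
  unfolding Top_def by (intro lop_conv lop_Vop lop_Cop)

lemma Dl_funpow_lmul_const: "j < m \<Longrightarrow> (Dl ^^ m) ((lmul ^^ j) (\<lambda>x. c)) = (\<lambda>x. 0)"
proof (induction j arbitrary: m)
  case 0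
  then obtain k where "m = Suc k" by (cases m) auto
  then show ?case using lop_zero_arg[OF lop_funpow_Dl, of k] by (simp add: funpow_swap1 Dl_const)
next
  case (Suc j)
  have "smooth ((lmul ^^ j) (\<lambda>x. c))" using lop_smooth[OF lop_funpow_lmul] by simp
  moreover have "lmul (\<lambda>x. 0) = (\<lambda>x. 0)" by (simp add: lmul_def)
  ultimately show ?case
    using Dl_funpow_lmul Suc.IH[of m] Suc.IH[of "m - 1"] Suc.prems by simp
qed

lemma Rop_const: "Rop n (\<lambda>x. c) = (if n = 0 then (\<lambda>x. c) else (\<lambda>x. 0))"
  using Dl_funpow_lmul_const[of _ "n + _" c] by (auto simp: Rop_def shcoef_0)

lemma Cop_const: "Cop n (\<lambda>x. c) = (if n = 0 then (\<lambda>x. c) else (\<lambda>x. 0))"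
  using Dl_funpow_lmul_const[of 0 n c] by (auto simp: Cop_def fps_ch_def)

lemma Vop_const: "Vop n (\<lambda>x. c) = (if n = 0 then (\<lambda>x. c) else (\<lambda>x. 0))"
  using Dl_funpow_lmul_const[of 0 "n + _" c] by (auto simp: Vop_def shcoef_0 lmul_funpow)

lemma conv_const:
  assumes "\<And>n c. A n (\<lambda>x. c) = (if n = 0 then (\<lambda>x. c) else (\<lambda>x. 0))"
    "\<And>n c. B n (\<lambda>x. c) = (if n = 0 then (\<lambda>x. c) else (\<lambda>x. 0))"
  shows "conv A B n (\<lambda>x. c) = (if n = 0 then (\<lambda>x. c) else (\<lambda>x. 0))"
proof -
  have "A k (B (n - k) (\<lambda>x. c)) x = (if n = 0 then c else 0)" if "k \<le> n" for k x
    using assms that by (cases "k = n"; cases "k = 0") auto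
  then show ?thesis
    unfolding conv_def by (cases "n = 0") (auto simp: assms)
qed

lemma Top_const: "Top n (\<lambda>x. c) = (if n = 0 then (\<lambda>x. c) else (\<lambda>x. 0))"
  unfolding Top_def by (rule conv_const[OF Vop_const Cop_const])

text \<open>The composite commutes with both coordinate multiplications, so Hadamard's lemma reduces it to its
  action on constants.\<close>

lemma Top_Rop:
  assumes "smooth w"
  shows "conv Top Rop n w = (if n = 0 then w else (\<lambda>x. 0))"
proof
  fix p :: S
  let ?X = "conv Top Rop n"
  have X: "lop ?X" by (intro lop_conv lop_Top lop_Rop)
  have Xl: "?X (lmul v) = lmul (?X v)" if v: "smooth v" for v
  proof -
    have "?X (lmul v) = conv Vop (conv Cop Rop) n (lmul v)"
      unfolding Top_def using conv_assoc[OF lop_Vop lop_Cop lop_Rop smooth_lmul[OF v]] by simp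
    also have "\<dots> = (\<lambda>x. \<Sum>k\<le>n. Vop k (lmul (Rop (n - k) v)) x)"
      unfolding conv_def[of Vop] lmul_Rop[OF v] ..
    also have "\<dots> = (\<lambda>x. \<Sum>k\<le>n. lmul (Top k (Rop (n - k) v)) x)"
      unfolding Top_def using Vop_lmul[OF lop_smooth[OF lop_Rop v]] by simp
    also have "\<dots> = lmul (?X v)"
      by (simp add: conv_def lmul_def sum_distrib_left)
    finally show ?thesis .
  qed
  obtain r where r: "\<And>b. b \<in> Basis \<Longrightarrow> smooth (r b)"
    and w: "\<And>z. w z = w p + (\<Sum>b\<in>Basis. of_real ((z - p) \<bullet> b) * r b z)"
    using hadamard[OF assms, of p] by metis
  define r1 r2 where "r1 = r (1, 0)" and "r2 = r (0, 1)"
  have r12: "smooth r1" "smooth r2" using r Basis_S by (auto simp: r1_def r2_def)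
  have "w z = w p + ((amul r1 z + (- of_real (fst p)) * r1 z) + (lmul r2 z + (- of_real (snd p)) * r2 z))" for z
    by (subst w) (auto simp: Basis_prod_def sum.union_disjoint r1_def r2_def amul_def lmul_def inner_prod_def algebra_simps)
  then have w': "w = (\<lambda>z. w p + ((amul r1 z + (- of_real (fst p)) * r1 z) + (lmul r2 z + (- of_real (snd p)) * r2 z)))"
    by blast
  have "?X w = (\<lambda>z. ?X (\<lambda>_. w p) z + ((amul (?X r1) z + (- of_real (fst p)) * ?X r1 z) + (lmul (?X r2) z + (- of_real (snd p)) * ?X r2 z)))"
    by (subst w', (subst lop_add_arg[OF X]; (intro smooth_add smooth_mult smooth_const smooth_amul smooth_lmul r12)?)+)
      (simp only: lop_cmult_arg[OF X] r12 Xl lop_amul[OF X])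
  then have "?X w p = ?X (\<lambda>_. w p) p" by (simp add: amul_def lmul_def)
  also have "\<dots> = (if n = 0 then w else (\<lambda>x. 0)) p"
    by (subst conv_const[OF Top_const Rop_const]) simp
  finally show "?X w p = (if n = 0 then w else (\<lambda>x. 0)) p" .
qed

subsection \<open>Extension to formal series\<close>

definition lift_op :: "(nat \<Rightarrow> (S \<Rightarrow> complex) \<Rightarrow> S \<Rightarrow> complex) \<Rightarrow> (nat, S) formal \<Rightarrow> (nat, S) formal" where
  "lift_op A F = (\<lambda>n x. \<Sum>k\<le>n. A k (F (n - k)) x)"

lemma formal_op_lift_op:
  assumes "\<And>n. lop (A n)"
  shows "formal_op (\<lambda>x. x) (lift_op A)"
  unfolding formal_op_def lift_op_def
  by (intro conjI allI affine_map_id local_op_sum lop_local_op assms)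

lemma lift_op_lift_op:
  assumes "\<And>n. lop (A n)" "\<And>n. lop (B n)" "sformal F"
  shows "lift_op A (lift_op B F) = lift_op (conv A B) F"
proof
  fix n
  have s: "smooth (B k (F m))" for k m
    using assms lop_smooth by (auto simp: sformal_def)
  have "lift_op A (lift_op B F) n = (\<lambda>x. \<Sum>k\<le>n. \<Sum>m\<le>n - k. A k (B m (F (n - k - m))) x)"
  proof -
    have "A k (\<lambda>x. \<Sum>m\<le>n - k. B m (F (n - k - m)) x) = (\<lambda>x. \<Sum>m\<le>n - k. A k (B m (F (n - k - m))) x)" for k
      by (rule lop_sum_arg[OF assms(1)]) (rule s)
    then show ?thesis by (simp only: lift_op_def)
  qed
  also have "\<dots> = (\<lambda>x. \<Sum>k\<le>n. \<Sum>m\<le>k. A m (B (k - m) (F (n - k))) x)"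
    by (rule ext, rule sum_triangle)
  finally show "lift_op A (lift_op B F) n = lift_op (conv A B) F n"
    by (simp add: lift_op_def conv_def)
qed

abbreviation T where "T \<equiv> lift_op Top"
abbreviation R where "R \<equiv> lift_op Rop"

lemma formal_op_T: "formal_op (\<lambda>x. x) T" and formal_op_R: "formal_op (\<lambda>x. x) R"
  by (auto intro: formal_op_lift_op lop_Top lop_Rop)

lemmas sformal_T = formal_op_sformal[OF formal_op_T] and sformal_R = formal_op_sformal[OF formal_op_R]

lemma T_R: "sformal F \<Longrightarrow> T (R F) = F"
proof -
  assume F: "sformal F"
  have "(\<Sum>k\<le>n. (if k = 0 then F (n - k) else (\<lambda>x. 0)) x) = F n x" for n x
    by (subst sum.remove[of _ 0]) auto
  then show ?thesis
    using F unfolding lift_op_lift_op[OF lop_Top lop_Rop F]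
    by (simp add: lift_op_def Top_Rop sformal_def fun_eq_iff)
qed

lemma Top_0: "smooth w \<Longrightarrow> Top 0 w = w"
  by (simp add: Top_def conv_def Vop_def Cop_def shcoef_0 fps_ch_def)

text \<open>\<open>T\<close> is the identity modulo \<open>h\<close> and hence injective, since the
  lowest nonzero coefficient of a series survives. As \<open>T (R (T F)) = T F\<close> by
  \<open>T_R\<close>, the right inverse is also a left inverse.\<close>

lemma R_T: "sformal F \<Longrightarrow> R (T F) = F"
proof -
  assume F: "sformal F"
  define G where "G = (\<lambda>r x. R (T F) r x + (- 1) * F r x)"
  have G: "sformal G" using F sformal_R[OF sformal_T[OF F]] unfolding G_def sformal_def
    by (auto intro!: smooth_diff)
  have l: "local_op (\<lambda>x. x) (\<lambda>F. T F n)" for n using formal_op_T by (auto simp: formal_op_def)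
  have sF: "sformal (\<lambda>r x. (- 1) * F r x)" using F unfolding sformal_def by (auto intro: smooth_uminus)
  have "T G = (\<lambda>r x. 0)"
  proof
    fix n
    have "T G n = (\<lambda>y. T (R (T F)) n y + T (\<lambda>r x. (- 1) * F r x) n y)"
      unfolding G_def by (rule local_op_add_arg[OF l sformal_R[OF sformal_T[OF F]] sF])
    also have "\<dots> = (\<lambda>x. 0)"
      unfolding T_R[OF sformal_T[OF F]] local_op_cmult_arg[OF l F] by simp
    finally show "T G n = (\<lambda>x. 0)" .
  qed
  have "G n = (\<lambda>x. 0)" for n
  proof (induction n rule: less_induct)
    case (less n)
    have "T G n x = G n x" for x
    proof -
      have "T G n x = (\<Sum>k\<in>{0}. Top k (G (n - k)) x)"
        unfolding lift_op_def
        by (intro sum.mono_neutral_right) (auto simp: less lop_zero_arg[OF lop_Top])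
      then show ?thesis using G by (simp add: Top_0 sformal_def)
    qed
    then show ?case using \<open>T G = _\<close> by (simp add: fun_eq_iff)
  qed
  then show ?thesis unfolding G_def by (simp add: fun_eq_iff)
qed

lemma T_coeff_0: "sformal F \<Longrightarrow> T F 0 = F 0"
  by (simp add: lift_op_def Top_0 sformal_def)

lemma T_one: "T one = one"
proof -
  have o: "one k = (\<lambda>x. if k = 0 then 1 else 0)" for k by (simp add: one_def fun_eq_iff)
  have "(\<Sum>k\<le>n. Top k (one (n - k)) x) = one n x" for n x
  proof -
    have "(\<Sum>k\<le>n. Top k (one (n - k)) x) = (\<Sum>k\<in>{0}. Top k (one (n - k)) x)"
      by (intro sum.mono_neutral_right) (auto simp: o Top_const)
    then show ?thesis by (simp add: Top_const o)
  qed
  then show ?thesis by (simp add: lift_op_def)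
qed

subsection \<open>The Moyal product\<close>

text \<open>The coefficient of \<open>h ^ k\<close> in \<open>exp (- \<i> h (\<partial>a1
  \<partial>l2 - \<partial>l1 \<partial>a2))\<close>, expanded binomially with \<open>b\<close>
  factors of the first kind. The signs are those of the Taylor series of
  \<open>f (a + h Q) g (a - h P)\<close>, where \<open>P\<close> and \<open>Q\<close> act as
  \<open>- \<i> \<partial>l\<close> on the first and the second factor.\<close>

definition moyal :: "nat \<Rightarrow> (S \<times> S \<Rightarrow> complex) \<Rightarrow> S \<Rightarrow> complex" where
  "moyal k w = (\<lambda>x. \<Sum>b\<le>k. (- \<i>) ^ k * (- 1) ^ (k - b) / (fact b * fact (k - b)) *
     partials (replicate b ((1, 0), (0, 0)) @ replicate (k - b) ((0, 1), (0, 0)) @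
       replicate b ((0, 0), (0, 1)) @ replicate (k - b) ((0, 0), (1, 0))) w (x, x))"

lemma moyal_Basis: "replicate b ((1, 0), (0, 0)) @ replicate c ((0, 1), (0, 0)) @
       replicate d ((0, 0), (0, 1)) @ replicate e ((0, 0), (1, 0)) \<in> lists (Basis :: (S \<times> S) set)"
proof -
  have l: "(u, (0, 0)) \<in> (Basis :: (S \<times> S) set)" and r: "((0, 0), u) \<in> (Basis :: (S \<times> S) set)"
    if "u \<in> Basis" for u
    using that unfolding Basis_prod_def[where 'a = S and 'b = S] zero_prod_def by auto
  show ?thesis
    using l[OF Basis_S(1)] l[OF Basis_S(2)] r[OF Basis_S(1)] r[OF Basis_S(2)] by (auto simp: in_lists_conv_set)
qed

lemma local_op_moyal: "local_op (\<lambda>x. (x, x)) (\<lambda>W. moyal k (W r))"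
  unfolding moyal_def
  by (intro local_op_sum local_op.mult smooth_const local_op.base moyal_Basis)

lemma formal_op_mult_moyal: "formal_op (\<lambda>x. (x, x)) (mult moyal)"
  unfolding formal_op_def mult_def
  by (intro conjI allI affine_map_diag local_op_sum local_op_moyal)

lemma partials_exp:
  "partials bs (\<lambda>z. exp (complex_of_real (\<zeta> \<bullet> z))) = (\<lambda>z. (\<Prod>b\<leftarrow>bs. of_real (\<zeta> \<bullet> b)) * exp (complex_of_real (\<zeta> \<bullet> z)))"
proof (induction bs)
  case (Cons b bs)
  have "smooth (\<lambda>z. exp (complex_of_real (\<zeta> \<bullet> z)))" by (rule smooth_exp_inner)
  then have d: "(\<lambda>z. exp (complex_of_real (\<zeta> \<bullet> z))) differentiable_on UNIV" by (rule smooth_differentiable_on)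
  show ?case
    unfolding partials_Cons Cons partial_mult[OF differentiable_on_const d]
      partial_exp_linear[OF bounded_linear_inner_right] by (simp add: mult_ac)
qed simp

text \<open>The value of the Poisson bidifferential operator, with its factor \<open>- \<i>\<close>,
  on two exponentials. Bilinearity gives associativity; skew symmetry makes the parameters
  \<open>- \<tau>\<close>, \<open>- \<zeta>\<close> those of the inverse.\<close>

definition heis_cocycle :: "S \<Rightarrow> S \<Rightarrow> complex" where
  "heis_cocycle \<zeta> \<eta> = - \<i> * of_real (fst \<zeta> * snd \<eta> - snd \<zeta> * fst \<eta>)"

lemma exp_sum_binomial:
  "(\<Sum>i\<le>n. a ^ i / fact i * (b ^ (n - i) / fact (n - i))) = ((a + b) ^ n / fact n :: complex)"
  unfolding binomial_ring sum_divide_distrib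
  by (intro sum.cong refl) (simp add: binomial_fact field_simps)

lemma moyal_exp:
  "moyal k (\<lambda>(x, y). exp (of_real (\<zeta> \<bullet> x)) * exp (of_real (\<eta> \<bullet> y))) =
    (\<lambda>x. heis_cocycle \<zeta> \<eta> ^ k / fact k * exp (of_real ((\<zeta> + \<eta>) \<bullet> x)))"
proof
  fix x :: S
  obtain \<alpha> \<xi> where \<zeta>: "\<zeta> = (\<alpha>, \<xi>)" by force
  obtain \<beta> \<theta> where \<eta>: "\<eta> = (\<beta>, \<theta>)" by force
  have w: "(\<lambda>(x, y). exp (complex_of_real (\<zeta> \<bullet> x)) * exp (of_real (\<eta> \<bullet> y))) = (\<lambda>z. exp (of_real ((\<zeta>, \<eta>) \<bullet> z)))"
    by (auto simp: exp_add)
  have "moyal k (\<lambda>(x, y). exp (of_real (\<zeta> \<bullet> x)) * exp (of_real (\<eta> \<bullet> y))) x =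
      (\<Sum>b\<le>k. (- \<i>) ^ k * (- 1) ^ (k - b) / (fact b * fact (k - b)) *
        (of_real \<alpha> ^ b * (of_real \<xi> ^ (k - b) * (of_real \<theta> ^ b * of_real \<beta> ^ (k - b)))) *
        exp (of_real ((\<zeta> + \<eta>) \<bullet> x)))"
  proof -
    have e: "exp (complex_of_real ((\<zeta>, \<eta>) \<bullet> (x, x))) = exp (of_real ((\<zeta> + \<eta>) \<bullet> x))"
      by (simp add: inner_add_left)
    show ?thesis
      unfolding w moyal_def partials_exp e
      by (simp add: \<zeta> \<eta> map_replicate prod_list_replicate mult_ac)
  qed
  also have "\<dots> = (\<Sum>b\<le>k. (- \<i> * of_real (\<alpha> * \<theta>)) ^ b / fact b * ((\<i> * of_real (\<xi> * \<beta>)) ^ (k - b) / fact (k - b))) *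
        exp (of_real ((\<zeta> + \<eta>) \<bullet> x))"
    unfolding sum_distrib_right
  proof (intro sum.cong refl)
    fix b assume "b \<in> {..k}"
    then have "(- \<i>) ^ k = (- \<i>) ^ b * (- \<i>) ^ (k - b)" by (simp flip: power_add)
    then have h: "(- \<i>) ^ k * (- 1) ^ (k - b) = (- \<i>) ^ b * \<i> ^ (k - b)"
      by (simp flip: power_mult_distrib add: mult.assoc)
    show "(- \<i>) ^ k * (- 1) ^ (k - b) / (fact b * fact (k - b)) *
        (of_real \<alpha> ^ b * (of_real \<xi> ^ (k - b) * (of_real \<theta> ^ b * of_real \<beta> ^ (k - b)))) * exp (of_real ((\<zeta> + \<eta>) \<bullet> x)) =
      (- \<i> * of_real (\<alpha> * \<theta>)) ^ b / fact b * ((\<i> * of_real (\<xi> * \<beta>)) ^ (k - b) / fact (k - b)) *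
        exp (of_real ((\<zeta> + \<eta>) \<bullet> x))"
      unfolding h of_real_mult power_mult_distrib by (simp add: mult_ac)
  qed
  also have "\<dots> = heis_cocycle \<zeta> \<eta> ^ k / fact k * exp (of_real ((\<zeta> + \<eta>) \<bullet> x))"
    unfolding exp_sum_binomial by (simp add: heis_cocycle_def \<zeta> \<eta> algebra_simps)
  finally show "moyal k (\<lambda>(x, y). exp (of_real (\<zeta> \<bullet> x)) * exp (of_real (\<eta> \<bullet> y))) x =
      heis_cocycle \<zeta> \<eta> ^ k / fact k * exp (of_real ((\<zeta> + \<eta>) \<bullet> x))" .
qed

text \<open>Three exponential series in \<open>h\<close> are multiplied, those of the two factors
  and that of the bidifferential operator; the nested Cauchy products add their exponents.\<close>

lemma mult_moyal_grouplike:
  "mult moyal (tensor (grouplike \<sigma> \<zeta>) (grouplike \<tau> \<eta>)) = grouplike (\<sigma> + \<tau> + heis_cocycle \<zeta> \<eta>) (\<zeta> + \<eta>)"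
proof (rule ext, rule ext)
  fix n x
  let ?e = "\<lambda>(x, y). exp (complex_of_real (\<zeta> \<bullet> x)) * exp (complex_of_real (\<eta> \<bullet> y))"
  have "smooth (\<lambda>z. exp (of_real ((\<zeta>, \<eta>) \<bullet> z)))" by (rule smooth_exp_inner)
  then have e: "smooth ?e" by (simp add: exp_add case_prod_unfold inner_prod_def)
  have m: "moyal k (\<lambda>z. c * ?e z) = (\<lambda>x. c * moyal k ?e x)" for c k
    using local_op_cmult_arg[OF local_op_moyal, of "\<lambda>_. ?e"] e by (simp add: sformal_def)
  have t: "tensor (grouplike \<sigma> \<zeta>) (grouplike \<tau> \<eta>) (i, j) = (\<lambda>z. (\<sigma> ^ i / fact i * (\<tau> ^ j / fact j)) * ?e z)" for i j
    by (auto simp: tensor_def grouplike_def)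
  have "mult moyal (tensor (grouplike \<sigma> \<zeta>) (grouplike \<tau> \<eta>)) n x =
     (\<Sum>i\<le>n. \<sigma> ^ i / fact i * (\<Sum>j\<le>n - i. \<tau> ^ j / fact j * (heis_cocycle \<zeta> \<eta> ^ (n - i - j) / fact (n - i - j)))) * exp (of_real ((\<zeta> + \<eta>) \<bullet> x))"
    unfolding mult_def t m moyal_exp sum_distrib_left sum_distrib_right by (simp add: mult.assoc)
  also have "\<dots> = grouplike (\<sigma> + \<tau> + heis_cocycle \<zeta> \<eta>) (\<zeta> + \<eta>) n x"
    unfolding exp_sum_binomial by (simp add: grouplike_def add.assoc)
  finally show "mult moyal (tensor (grouplike \<sigma> \<zeta>) (grouplike \<tau> \<eta>)) n x =
    grouplike (\<sigma> + \<tau> + heis_cocycle \<zeta> \<eta>) (\<zeta> + \<eta>) n x" .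
qed

section \<open>Polynomial dependence on the first coordinate\<close>

definition P1 :: "nat \<Rightarrow> (S \<Rightarrow> complex) set" where
  "P1 d = {w. \<exists>f. (\<forall>k. smooth (f k)) \<and> w = (\<lambda>(a, l). \<Sum>k\<le>d. complex_of_real a ^ k * f k (l::real))}"

definition P2 :: "nat \<Rightarrow> (S \<times> S \<Rightarrow> complex) set" where
  "P2 d = {w. \<exists>f. (\<forall>k m. smooth (f k m)) \<and> w = (\<lambda>((a1, l1), (a2, l2)). \<Sum>k\<le>d. \<Sum>m\<le>d.
      complex_of_real a1 ^ k * complex_of_real a2 ^ m * f k m (l1::real, l2::real))}"

text \<open>The degree bound is the same for all powers of \<open>h\<close>, so membership can be
  tested on each coefficient separately; the coefficient functions are then selected by
  choice.\<close>

lemma H1_deg_iff: "F \<in> H1_deg d \<longleftrightarrow> (\<forall>r. F r \<in> P1 d)"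
proof
  assume "\<forall>r. F r \<in> P1 d"
  from choice[OF this[unfolded P1_def mem_Collect_eq]] obtain f where "\<forall>r. (\<forall>k. smooth (f r k)) \<and> F r = (\<lambda>(a, l). \<Sum>k\<le>d. complex_of_real a ^ k * f r k (l::real))"
    by blast
  then show "F \<in> H1_deg d" unfolding H1_deg_def mem_Collect_eq by (intro exI[of _ f]) auto
qed (auto simp: H1_deg_def P1_def)

lemma H2_deg_iff: "W \<in> H2_deg d \<longleftrightarrow> (\<forall>r. W r \<in> P2 d)"
proof
  assume "\<forall>r. W r \<in> P2 d"
  from choice[OF this[unfolded P2_def mem_Collect_eq]] obtain f where "\<forall>r. (\<forall>k m. smooth (f r k m)) \<and> W r = (\<lambda>((a1, l1), (a2, l2)). \<Sum>k\<le>d. \<Sum>m\<le>d.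
      complex_of_real a1 ^ k * complex_of_real a2 ^ m * f r k m (l1::real, l2::real))"
    by blast
  then show "W \<in> H2_deg d" unfolding H2_deg_def mem_Collect_eq by (intro exI[of _ f]) auto
next
  assume "W \<in> H2_deg d"
  then obtain f where f: "\<And>r k m. smooth (f r k m)" and W: "W = (\<lambda>r ((a1, l1), (a2, l2)). \<Sum>k\<le>d. \<Sum>m\<le>d.
      complex_of_real a1 ^ k * complex_of_real a2 ^ m * f r k m (l1::real, l2::real))"
    unfolding H2_deg_def by blast
  show "\<forall>r. W r \<in> P2 d"
  proof
    fix r show "W r \<in> P2 d" unfolding P2_def mem_Collect_eq W by (intro exI[of _ "f r"]) (auto simp: f)
  qed
qed

lemma P1_term: "k \<le> d \<Longrightarrow> smooth f \<Longrightarrow> (\<lambda>x. complex_of_real (fst x) ^ k * f (snd x)) \<in> P1 d"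
proof -
  assume *: "k \<le> d" "smooth f"
  let ?f = "\<lambda>j. if j = k then f else (\<lambda>_. 0)"
  have "(\<lambda>x. complex_of_real (fst x) ^ k * f (snd x)) = (\<lambda>(a, l). \<Sum>j\<le>d. complex_of_real a ^ j * ?f j l)"
    using * by (auto simp: fun_eq_iff if_distrib[of "\<lambda>f. f _"] if_distrib[of "(*) _"] cong: if_cong)
  moreover have "\<forall>j. smooth (?f j)" using * by auto
  ultimately show ?thesis unfolding P1_def mem_Collect_eq by (intro exI[of _ ?f] conjI)
qed

lemma P2_term: "k \<le> d \<Longrightarrow> m \<le> d \<Longrightarrow> smooth f \<Longrightarrow>
  (\<lambda>z. complex_of_real (fst (fst z)) ^ k * complex_of_real (fst (snd z)) ^ m * f (snd (fst z), snd (snd z))) \<in> P2 d"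
proof -
  assume *: "k \<le> d" "m \<le> d" "smooth f"
  let ?f = "\<lambda>j i z. if j = k \<and> i = m then f z else 0"
  have "(\<Sum>j\<le>d. \<Sum>i\<le>d. complex_of_real a1 ^ j * complex_of_real a2 ^ i * ?f j i (l1, l2)) =
     complex_of_real a1 ^ k * complex_of_real a2 ^ m * f (l1, l2)" for a1 a2 l1 l2
  proof -
    have "(\<Sum>j\<le>d. \<Sum>i\<le>d. complex_of_real a1 ^ j * complex_of_real a2 ^ i * ?f j i (l1, l2)) =
      (\<Sum>j\<le>d. if j = k then (\<Sum>i\<le>d. if i = m then complex_of_real a1 ^ j * complex_of_real a2 ^ i * f (l1, l2) else 0) else 0)"
      by (intro sum.cong refl) (auto simp: if_distrib[where f = "(*) _"] cong: if_cong)
    also have "\<dots> = complex_of_real a1 ^ k * complex_of_real a2 ^ m * f (l1, l2)"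
      using * by (simp only: sum.delta finite_atMost atMost_iff if_True)
    finally show ?thesis .
  qed
  then have "(\<lambda>z. complex_of_real (fst (fst z)) ^ k * complex_of_real (fst (snd z)) ^ m * f (snd (fst z), snd (snd z))) =
      (\<lambda>((a1, l1), (a2, l2)). \<Sum>j\<le>d. \<Sum>i\<le>d. complex_of_real a1 ^ j * complex_of_real a2 ^ i * ?f j i (l1, l2))"
    by (auto simp: fun_eq_iff)
  moreover have "\<forall>j i. smooth (?f j i)" 
  proof (intro allI)
    fix j i show "smooth (?f j i)" using *(3) by (cases "j = k"; cases "i = m") auto
  qed
  ultimately show ?thesis unfolding P2_def mem_Collect_eq by (intro exI[of _ ?f] conjI)
qed

lemma P1_add: "v \<in> P1 d \<Longrightarrow> w \<in> P1 d \<Longrightarrow> (\<lambda>x. v x + w x) \<in> P1 d"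
proof -
  assume "v \<in> P1 d" "w \<in> P1 d"
  then obtain f g where "\<forall>k. smooth (f k)" "v = (\<lambda>(a, l). \<Sum>k\<le>d. complex_of_real a ^ k * f k (l::real))"
    "\<forall>k. smooth (g k)" "w = (\<lambda>(a, l). \<Sum>k\<le>d. complex_of_real a ^ k * g k (l::real))"
    unfolding P1_def by blast
  then show ?thesis unfolding P1_def mem_Collect_eq
    by (intro exI[of _ "\<lambda>k x. f k x + g k x"]) (auto intro: smooth_add simp: distrib_left sum.distrib)
qed

lemma P2_add: "v \<in> P2 d \<Longrightarrow> w \<in> P2 d \<Longrightarrow> (\<lambda>x. v x + w x) \<in> P2 d"
proof -
  assume "v \<in> P2 d" "w \<in> P2 d"
  then obtain f g where "\<forall>k m. smooth (f k m)" "v = (\<lambda>((a1, l1), (a2, l2)). \<Sum>k\<le>d. \<Sum>m\<le>d.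
      complex_of_real a1 ^ k * complex_of_real a2 ^ m * f k m (l1::real, l2::real))"
    "\<forall>k m. smooth (g k m)" "w = (\<lambda>((a1, l1), (a2, l2)). \<Sum>k\<le>d. \<Sum>m\<le>d.
      complex_of_real a1 ^ k * complex_of_real a2 ^ m * g k m (l1::real, l2::real))"
    unfolding P2_def by blast
  then show ?thesis unfolding P2_def mem_Collect_eq
    by (intro exI[of _ "\<lambda>k m x. f k m x + g k m x"]) (auto intro: smooth_add simp: distrib_left sum.distrib)
qed

lemma P1_zero: "(\<lambda>x. 0) \<in> P1 d"
  using P1_term[of 0 d "\<lambda>_. 0"] by simp

lemma P2_zero: "(\<lambda>x. 0) \<in> P2 d"
  using P2_term[of 0 d 0 "\<lambda>_. 0"] by simp

lemma P1_sum: "(\<And>i. i \<in> I \<Longrightarrow> w i \<in> P1 d) \<Longrightarrow> (\<lambda>x. \<Sum>i\<in>I. w i x) \<in> P1 d"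
  by (induction I rule: infinite_finite_induct) (auto intro: P1_add P1_zero)

lemma P2_sum: "(\<And>i. i \<in> I \<Longrightarrow> w i \<in> P2 d) \<Longrightarrow> (\<lambda>x. \<Sum>i\<in>I. w i x) \<in> P2 d"
  by (induction I rule: infinite_finite_induct) (auto intro: P2_add P2_zero)

text \<open>Stability under a linear operation need only be seen on one monomial in \<open>a\<close>
  with a smooth coefficient in \<open>l\<close>.\<close>

lemma P1_induct [consumes 1, case_names mono add]:
  assumes "w \<in> P1 d"
    and t: "\<And>k f. k \<le> d \<Longrightarrow> smooth f \<Longrightarrow> Q (\<lambda>x. complex_of_real (fst x) ^ k * f (snd x))"
    and a: "\<And>u v. u \<in> P1 d \<Longrightarrow> v \<in> P1 d \<Longrightarrow> Q u \<Longrightarrow> Q v \<Longrightarrow> Q (\<lambda>x. u x + v x)"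
  shows "Q w"
proof -
  obtain f where f: "\<And>k. smooth (f k)" and w: "w = (\<lambda>(a, l). \<Sum>k\<le>d. complex_of_real a ^ k * f k (l::real))"
    using assms(1) by (auto simp: P1_def)
  have Q0: "Q (\<lambda>x. 0)" using t[of 0 "\<lambda>_. 0"] by simp
  have "Q (\<lambda>x. \<Sum>k\<in>I. complex_of_real (fst x) ^ k * f k (snd x))" if "finite I" "I \<subseteq> {..d}" for I
    using that
  proof (induction rule: finite_induct)
    case (insert i I)
    have "Q (\<lambda>x. complex_of_real (fst x) ^ i * f i (snd x) + (\<Sum>k\<in>I. complex_of_real (fst x) ^ k * f k (snd x)))"
      using insert by (intro a t f P1_sum P1_term) auto
    then show ?case using insert by simp
  qed (simp add: Q0)
  from this[of "{..d}"] show ?thesis by (simp add: w case_prod_unfold)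
qed

lemma P2_induct [consumes 1, case_names mono add]:
  assumes "w \<in> P2 d"
    and t: "\<And>k m f. k \<le> d \<Longrightarrow> m \<le> d \<Longrightarrow> smooth f \<Longrightarrow>
      Q (\<lambda>z. complex_of_real (fst (fst z)) ^ k * complex_of_real (fst (snd z)) ^ m * f (snd (fst z), snd (snd z)))"
    and a: "\<And>u v. u \<in> P2 d \<Longrightarrow> v \<in> P2 d \<Longrightarrow> Q u \<Longrightarrow> Q v \<Longrightarrow> Q (\<lambda>x. u x + v x)"
  shows "Q w"
proof -
  obtain f where f: "\<And>k m. smooth (f k m)" and w: "w = (\<lambda>((a1, l1), (a2, l2)). \<Sum>k\<le>d. \<Sum>m\<le>d.
      complex_of_real a1 ^ k * complex_of_real a2 ^ m * f k m (l1::real, l2::real))"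
    using assms(1) by (auto simp: P2_def)
  have Q0: "Q (\<lambda>x. 0)" using t[of 0 0 "\<lambda>_. 0"] by simp
  have "Q (\<lambda>z. \<Sum>i\<in>I. complex_of_real (fst (fst z)) ^ fst i * complex_of_real (fst (snd z)) ^ snd i * f (fst i) (snd i) (snd (fst z), snd (snd z)))"
    if "finite I" "I \<subseteq> {..d} \<times> {..d}" for I
    using that
  proof (induction rule: finite_induct)
    case (insert i I)
    have "Q (\<lambda>z. complex_of_real (fst (fst z)) ^ fst i * complex_of_real (fst (snd z)) ^ snd i * f (fst i) (snd i) (snd (fst z), snd (snd z))
      + (\<Sum>i\<in>I. complex_of_real (fst (fst z)) ^ fst i * complex_of_real (fst (snd z)) ^ snd i * f (fst i) (snd i) (snd (fst z), snd (snd z))))"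
      using insert by (intro a t f P2_sum P2_term) auto
    then show ?case using insert by simp
  qed (simp add: Q0)
  from this[of "{..d} \<times> {..d}"] show ?thesis by (simp add: w case_prod_unfold sum.cartesian_product)
qed

lemma affine_map_snd_snd: "affine_map (\<lambda>z::S \<times> S. (snd (fst z), snd (snd z)))"
  by (intro affine_map_Pair affine_map_compose[OF affine_map_snd] affine_map_fst affine_map_snd)

lemma smooth_P1: "w \<in> P1 d \<Longrightarrow> smooth w"
  by (induction rule: P1_induct)
    (auto intro!: smooth_add smooth_mult smooth_power smooth_fst smooth_affine[OF _ affine_map_snd])

lemma smooth_fst_fst: "smooth (\<lambda>z::S \<times> S. complex_of_real (fst (fst z)))"
  and smooth_fst_snd: "smooth (\<lambda>z::S \<times> S. complex_of_real (fst (snd z)))"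
  by (intro smooth_real_linear bounded_linear_compose[OF bounded_linear_fst] bounded_linear_fst bounded_linear_snd)+

lemma smooth_P2: "w \<in> P2 d \<Longrightarrow> smooth w"
  by (induction rule: P2_induct)
    (auto intro!: smooth_add smooth_mult smooth_power smooth_fst_fst smooth_fst_snd smooth_affine[OF _ affine_map_snd_snd])

lemma P1_cmult: "w \<in> P1 d \<Longrightarrow> (\<lambda>x. c * w x) \<in> P1 d"
proof (induction rule: P1_induct)
  case (mono k f)
  then show ?case using P1_term[of k d "\<lambda>l. c * f l"] by (simp add: smooth_mult mult_ac)
qed (auto simp: distrib_left intro: P1_add)

lemma P2_cmult: "w \<in> P2 d \<Longrightarrow> (\<lambda>x. c * w x) \<in> P2 d"
proof (induction rule: P2_induct)
  case (mono k m f)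
  then show ?case using P2_term[of k d m "\<lambda>l. c * f l"] by (simp add: smooth_mult mult_ac)
qed (auto simp: distrib_left intro: P2_add)

lemma P1_mono: "w \<in> P1 d \<Longrightarrow> d \<le> e \<Longrightarrow> w \<in> P1 e"
  by (induction rule: P1_induct) (auto intro: P1_term P1_add)

lemma partial_power_linear:
  assumes "bounded_linear L"
  shows "partial b (\<lambda>x. complex_of_real (L x) ^ k) = (\<lambda>x. of_nat k * of_real (L b) * of_real (L x) ^ (k - 1))"
proof -
  have "((\<lambda>x. complex_of_real (L x)) has_derivative (\<lambda>v. of_real (L v))) (at x)" for x
    using assms by (intro bounded_linear_imp_has_derivative bounded_linear_compose[OF bounded_linear_of_real])
  from has_derivative_power[OF this, of k] have "((\<lambda>x. complex_of_real (L x) ^ k) has_derivative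
      (\<lambda>v. of_nat k * of_real (L v) * of_real (L x) ^ (k - 1))) (at x)" for x
    by (rule has_derivative_eq_rhs) (auto simp: mult_ac)
  from partial_eqI[OF this] show ?thesis .
qed

lemma P1_partial: "w \<in> P1 d \<Longrightarrow> partial b w \<in> P1 d"
proof (induction rule: P1_induct)
  case (mono k f)
  have s: "smooth (\<lambda>x::S. f (snd x))" using mono smooth_affine affine_map_snd by blast
  have p: "partial b (\<lambda>x::S. f (snd x)) = (\<lambda>x. of_real (snd b) * partial 1 f (snd x))"
    using partial_affine[OF mono(2) bounded_linear_snd, of b 0] by simp
  have "partial b (\<lambda>x. complex_of_real (fst x) ^ k * f (snd x)) =
    (\<lambda>x. of_real (snd b) * (complex_of_real (fst x) ^ k * partial 1 f (snd x))
      + of_nat k * of_real (fst b) * (complex_of_real (fst x) ^ (k - 1) * f (snd x)))"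
    by (subst partial_mult)
      (auto intro!: smooth_differentiable_on smooth_power smooth_fst s simp: p partial_power_linear[OF bounded_linear_fst] mult_ac)
  also have "\<dots> \<in> P1 d"
    using mono by (intro P1_add P1_cmult P1_term smooth_partial) auto
  finally show ?case .
qed (auto simp: partial_add smooth_P1 smooth_differentiable_on intro: P1_add)

lemma P2_partial: "w \<in> P2 d \<Longrightarrow> partial b w \<in> P2 d"
proof (induction rule: P2_induct)
  case (mono k m f)
  let ?M = "\<lambda>z::S \<times> S. (snd (fst z), snd (snd z))"
  have M: "bounded_linear ?M"
    by (intro bounded_linear_Pair bounded_linear_compose[OF bounded_linear_snd] bounded_linear_fst bounded_linear_snd)
  have s: "smooth (\<lambda>z::S \<times> S. f (?M z))" using mono smooth_affine affine_map_snd_snd by blast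
  have p: "partial b (\<lambda>z::S \<times> S. f (?M z)) = (\<lambda>z. \<Sum>b'\<in>Basis. of_real (?M b \<bullet> b') * partial b' f (?M z))"
    using partial_affine[OF mono(3) M, of b 0] by (simp add: zero_prod_def)
  have L: "bounded_linear (\<lambda>z::S \<times> S. fst (fst z))" "bounded_linear (\<lambda>z::S \<times> S. fst (snd z))"
    by (intro bounded_linear_compose[OF bounded_linear_fst] bounded_linear_fst bounded_linear_snd)+
  have "partial b (\<lambda>z. complex_of_real (fst (fst z)) ^ k * complex_of_real (fst (snd z)) ^ m * f (?M z)) =
    (\<lambda>z. (\<Sum>b'\<in>Basis. of_real (?M b \<bullet> b') * (complex_of_real (fst (fst z)) ^ k * complex_of_real (fst (snd z)) ^ m * partial b' f (?M z)))
      + (of_nat m * of_real (fst (snd b)) * (complex_of_real (fst (fst z)) ^ k * complex_of_real (fst (snd z)) ^ (m - 1) * f (?M z))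
      + of_nat k * of_real (fst (fst b)) * (complex_of_real (fst (fst z)) ^ (k - 1) * complex_of_real (fst (snd z)) ^ m * f (?M z))))"
    by (subst partial_mult, (intro smooth_differentiable_on smooth_mult smooth_power smooth_fst_fst smooth_fst_snd s)+,
        subst partial_mult, (intro smooth_differentiable_on smooth_power smooth_fst_fst smooth_fst_snd)+)
      (simp add: p partial_power_linear[OF L(1)] partial_power_linear[OF L(2)] sum_distrib_left algebra_simps)
  also have "\<dots> \<in> P2 d"
    using mono by (intro P2_add P2_sum P2_cmult P2_term smooth_partial) auto
  finally show ?case .
qed (auto simp: partial_add smooth_P2 smooth_differentiable_on intro: P2_add)

lemma P2_partials: "w \<in> P2 d \<Longrightarrow> partials bs w \<in> P2 d"
  by (induction bs) (auto intro: P2_partial)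

section \<open>Degree in the first coordinate under the structure operators\<close>

lemma lop_P1: "lop A \<Longrightarrow> w \<in> P1 d \<Longrightarrow> A w \<in> P1 d"
proof (induction rule: lop.induct)
  case (lmul A)
  have "lmul v \<in> P1 d" if "v \<in> P1 d" for v using that
  proof (induction rule: P1_induct)
    case (mono k f)
    have "smooth (\<lambda>l. complex_of_real l * f l)"
      using smooth_real_linear[OF bounded_linear_ident] mono by (intro smooth_mult)
    then show ?case using P1_term[of k d "\<lambda>l. complex_of_real l * f l"] mono
      by (simp add: lmul_def mult_ac)
  qed (auto simp: lmul_def distrib_left intro: P1_add)
  then show ?case using lmul by blast
next
  case (Dl A)
  then show ?case unfolding Dl_def by (intro P1_cmult P1_partial) blast
qed (auto intro: P1_add P1_zero P1_cmult)

lemma P2_lmul: "w \<in> P2 d \<Longrightarrow> (\<lambda>(x, y). complex_of_real (snd x) * w (x, y)) \<in> P2 d"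
  "w \<in> P2 d \<Longrightarrow> (\<lambda>(x, y). complex_of_real (snd y) * w (x, y)) \<in> P2 d"
proof -
  show "(\<lambda>(x, y). complex_of_real (snd x) * w (x, y)) \<in> P2 d" if "w \<in> P2 d" using that
  proof (induction rule: P2_induct)
    case (mono k m f)
    have "smooth (\<lambda>l. complex_of_real (fst l) * f l)"
      using smooth_fst mono by (intro smooth_mult)
    then show ?case using P2_term[of k d m "\<lambda>l. complex_of_real (fst l) * f l"] mono
      by (simp add: case_prod_unfold mult_ac)
  qed (use P2_add in \<open>fastforce simp: case_prod_unfold distrib_left\<close>)
  show "(\<lambda>(x, y). complex_of_real (snd y) * w (x, y)) \<in> P2 d" if "w \<in> P2 d" using that
  proof (induction rule: P2_induct)
    case (mono k m f)
    have "smooth (\<lambda>l. complex_of_real (snd l) * f l)"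
      using smooth_snd mono by (intro smooth_mult)
    then show ?case using P2_term[of k d m "\<lambda>l. complex_of_real (snd l) * f l"] mono
      by (simp add: case_prod_unfold mult_ac)
  qed (use P2_add in \<open>fastforce simp: case_prod_unfold distrib_left\<close>)
qed

lemma lop_P2_left: "lop A \<Longrightarrow> w \<in> P2 d \<Longrightarrow> (\<lambda>(x, y). A (\<lambda>z. w (z, y)) x) \<in> P2 d"
proof (induction rule: lop.induct)
  case (Dl A)
  let ?u = "\<lambda>(x, y). A (\<lambda>z. w (z, y)) x"
  have u: "?u \<in> P2 d" using Dl by blast
  have "(\<lambda>x. - \<i> * partial ((0, 1), 0) ?u x) \<in> P2 d" by (intro P2_cmult P2_partial u)
  moreover have "partial (0, 1) (A (\<lambda>z. w (z, y))) x = partial ((0, 1), 0) ?u (x, y)" for x y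
    using fun_cong[OF partial_slice_left[OF smooth_P2[OF u], of "(0, 1)" y], of x] by simp
  ultimately show ?case by (simp add: Dl_def case_prod_unfold)
next
  case (lmul A)
  then show ?case using P2_lmul(1)[of "\<lambda>(x, y). A (\<lambda>z. w (z, y)) x"] by (simp add: lmul_def case_prod_unfold)
qed (use P2_add P2_cmult P2_zero in \<open>fastforce simp: case_prod_unfold\<close>)+

lemma lop_P2_right: "lop A \<Longrightarrow> w \<in> P2 d \<Longrightarrow> (\<lambda>(x, y). A (\<lambda>z. w (x, z)) y) \<in> P2 d"
proof (induction rule: lop.induct)
  case (Dl A)
  let ?u = "\<lambda>(x, y). A (\<lambda>z. w (x, z)) y"
  have u: "?u \<in> P2 d" using Dl by blast
  have "(\<lambda>x. - \<i> * partial (0, (0, 1)) ?u x) \<in> P2 d" by (intro P2_cmult P2_partial u)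
  moreover have "partial (0, 1) (A (\<lambda>z. w (x, z))) y = partial (0, (0, 1)) ?u (x, y)" for x y
    using fun_cong[OF partial_slice_right[OF smooth_P2[OF u], of "(0, 1)" x], of y] by simp
  ultimately show ?case by (simp add: Dl_def case_prod_unfold)
next
  case (lmul A)
  then show ?case using P2_lmul(2)[of "\<lambda>(x, y). A (\<lambda>z. w (x, z)) y"] by (simp add: lmul_def case_prod_unfold)
qed (use P2_add P2_cmult P2_zero in \<open>fastforce simp: case_prod_unfold\<close>)+

lemma lift_op_H1: "(\<And>n. lop (A n)) \<Longrightarrow> F \<in> H1_deg d \<Longrightarrow> lift_op A F \<in> H1_deg d"
proof -
  assume "\<And>n. lop (A n)" "F \<in> H1_deg d"
  then have "(\<lambda>x. \<Sum>k\<le>n. A k (F (n - k)) x) \<in> P1 d" for n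
    by (intro P1_sum) (rule lop_P1, simp_all add: H1_deg_iff)
  then show ?thesis by (simp add: H1_deg_iff lift_op_def)
qed

lemma left_leg_lift_op_H2: "(\<And>n. lop (A n)) \<Longrightarrow> W \<in> H2_deg d \<Longrightarrow> left_leg (lift_op A) W \<in> H2_deg d"
proof -
  assume "\<And>n. lop (A n)" "W \<in> H2_deg d"
  then have "(\<lambda>v. \<Sum>k\<le>p. (\<lambda>(x, y). A k (\<lambda>z. W (p - k, q) (z, y)) x) v) \<in> P2 d" for p q
    by (intro P2_sum) (rule lop_P2_left, simp_all add: H2_deg_iff)
  then show ?thesis by (auto simp: H2_deg_iff left_leg_def lift_op_def case_prod_unfold)
qed

lemma right_leg_lift_op_H2: "(\<And>n. lop (A n)) \<Longrightarrow> W \<in> H2_deg d \<Longrightarrow> right_leg (lift_op A) W \<in> H2_deg d"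
proof -
  assume "\<And>n. lop (A n)" "W \<in> H2_deg d"
  then have "(\<lambda>v. \<Sum>k\<le>q. (\<lambda>(x, y). A k (\<lambda>z. W (p, q - k) (x, z)) y) v) \<in> P2 d" for p q
    by (intro P2_sum) (rule lop_P2_right, simp_all add: H2_deg_iff)
  then show ?thesis by (auto simp: H2_deg_iff right_leg_def lift_op_def case_prod_unfold)
qed

text \<open>Restriction to the diagonal merges the powers of \<open>a1\<close> and
  \<open>a2\<close>. Among the maps that make up the product it is the one that raises the degree
  bound.\<close>

lemma P2_diag: "w \<in> P2 d \<Longrightarrow> (\<lambda>x. w (x, x)) \<in> P1 (2 * d)"
proof (induction rule: P2_induct)
  case (mono k m f)
  have "smooth (\<lambda>l. f (l, l))" using mono smooth_affine affine_map_diag by blast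
  then show ?case using P1_term[of "k + m" "2 * d" "\<lambda>l. f (l, l)"] mono by (simp add: power_add)
qed (auto intro: P1_add)

lemma mult_moyal_H2: "W \<in> H2_deg d \<Longrightarrow> mult moyal W \<in> H1_deg (2 * d)"
proof -
  assume W: "W \<in> H2_deg d"
  have "moyal k (W r) \<in> P1 (2 * d)" for k r
    unfolding moyal_def by (intro P1_sum P1_cmult P2_diag P2_partials) (use W in \<open>simp add: H2_deg_iff del: split_paired_All\<close>)
  then show ?thesis by (auto simp: H1_deg_iff mult_def intro!: P1_sum)
qed

lemma H1_deg_sformal: "F \<in> H1_deg d \<Longrightarrow> sformal F"
  by (auto simp: H1_deg_iff sformal_def intro: smooth_P1)

lemma H2_deg_sformal: "W \<in> H2_deg d \<Longrightarrow> sformal W"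
  by (auto simp: H2_deg_iff sformal_def intro: smooth_P2)

lemma H1_sformal: "F \<in> H1 \<Longrightarrow> sformal F"
  by (auto simp: H1_def intro: H1_deg_sformal)

section \<open>The Hopf algebra structure\<close>

lemma formal_op_composeI:
  "formal_op \<kappa> B \<Longrightarrow> formal_op \<iota> A \<Longrightarrow> (\<And>z. \<iota> (\<kappa> z) = \<mu> z) \<Longrightarrow> formal_op \<mu> (\<lambda>F. B (A F))"
proof -
  assume "formal_op \<kappa> B" "formal_op \<iota> A" "\<And>z. \<iota> (\<kappa> z) = \<mu> z"
  moreover from this(3) have "(\<lambda>z. \<iota> (\<kappa> z)) = \<mu>" by blast
  ultimately show ?thesis using formal_op_compose[of \<kappa> B \<iota> A] by simp
qed

lemma linear_continuous_mapI:
  assumes A: "formal_op \<iota> A" and X: "\<And>d F. F \<in> X d \<Longrightarrow> sformal F"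
    and XY: "\<And>d. \<exists>e. \<forall>F\<in>X d. A F \<in> Y e"
  shows "linear_continuous_map X Y A"
proof -
  have \<iota>: "affine_map \<iota>" and l: "local_op \<iota> (\<lambda>F. A F k)" for k
    using A by (auto simp: formal_op_def)
  have 1: "A (\<lambda>r x. F r x + G r x) = (\<lambda>r x. A F r x + A G r x)" if "sformal F" "sformal G" for F G
    using local_op_add_arg[OF l that] by (simp add: fun_eq_iff)
  have 2: "A (\<lambda>r x. c * F r x) = (\<lambda>r x. c * A F r x)" if "sformal F" for c F
    using local_op_cmult_arg[OF l that] by (simp add: fun_eq_iff)
  have 3: "null_seq Y (\<lambda>j. A (Z j))" if Z: "null_seq X Z" for Z
  proof -
    obtain d where d: "\<And>j. Z j \<in> X d" and n: "\<And>r. smooth_null (\<lambda>j. Z j r)"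
      using Z by (auto simp: null_seq_def)
    have "smooth_null (\<lambda>j. A (Z j) k)" for k
      by (rule local_op_null[OF \<iota> l X[OF d] n])
    moreover obtain e where "\<forall>F\<in>X d. A F \<in> Y e" using XY by blast
    ultimately show ?thesis using d by (auto simp: null_seq_def)
  qed
  have 4: "sformal F" if "F \<in> (\<Union>d. X d)" for F
    using that X by blast
  have 5: "A F \<in> (\<Union>e. Y e)" if "F \<in> (\<Union>d. X d)" for F
  proof -
    from that obtain d where d: "F \<in> X d" by blast
    obtain e where "\<forall>F\<in>X d. A F \<in> Y e" using XY by blast
    then show ?thesis using d by blast
  qed
  show ?thesis
    unfolding linear_continuous_map_def
    by (intro conjI ballI allI impI 1 2 3 4 5)
qed

text \<open>The binomial coefficient is that of \<open>h1 ^ p * h2 ^ q\<close> in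
  \<open>(h1 + h2) ^ (p + q)\<close>.\<close>

definition coproduct0 :: "(nat, S) formal \<Rightarrow> (nat \<times> nat, S \<times> S) formal" where
  "coproduct0 F = (\<lambda>(p, q) (x, y). of_nat ((p + q) choose p) * F (p + q) (x + y))"

definition antipode0 :: "(nat, S) formal \<Rightarrow> (nat, S) formal" where
  "antipode0 F = (\<lambda>r x. (- 1) ^ r * F r (- x))"

definition coproduct :: "(nat, S) formal \<Rightarrow> (nat \<times> nat, S \<times> S) formal" where
  "coproduct F = left_leg T (right_leg T (coproduct0 (R F)))"

text \<open>The same functional before and after conjugation, because \<open>T\<close> is the
  identity modulo \<open>h\<close>.\<close>

definition counit :: "(nat, S) formal \<Rightarrow> complex" where
  "counit F = F 0 0"

definition antipode :: "(nat, S) formal \<Rightarrow> (nat, S) formal" where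
  "antipode F = T (antipode0 (R F))"

lemma formal_op_coproduct0: "formal_op (\<lambda>(x, y). x + y) coproduct0"
proof -
  have "local_op (\<lambda>(x, y). x + y) (\<lambda>F z. of_nat ((p + q) choose p) * F (p + q) ((\<lambda>(x, y). x + y) z))" for p q
    by (intro local_op.mult smooth_const local_op_coeff)
  then show ?thesis
    using affine_map_add by (auto simp: formal_op_def coproduct0_def case_prod_unfold)
qed

lemma formal_op_antipode0: "formal_op (\<lambda>x. - x) antipode0"
  unfolding formal_op_def antipode0_def
  by (intro conjI allI affine_map_uminus local_op.mult smooth_const local_op_coeff)

lemma formal_op_coproduct: "formal_op (\<lambda>(x, y). x + y) coproduct"
  unfolding coproduct_def[abs_def]
  by (rule formal_op_composeI[OF formal_op_left_leg[OF formal_op_T]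
      formal_op_composeI[OF formal_op_right_leg[OF formal_op_T]
      formal_op_composeI[OF formal_op_coproduct0 formal_op_R refl] refl]]) auto

lemma formal_op_antipode: "formal_op (\<lambda>x. - x) antipode"
  unfolding antipode_def[abs_def]
  by (rule formal_op_composeI[OF formal_op_T formal_op_composeI[OF formal_op_antipode0 formal_op_R refl] refl])

lemma coproduct0_H: "F \<in> H1_deg d \<Longrightarrow> coproduct0 F \<in> H2_deg d"
proof -
  have "(\<lambda>z. w (fst z + snd z)) \<in> P2 d" if "w \<in> P1 d" for w
    using that
  proof (induction rule: P1_induct)
    case (mono k f)
    have s: "smooth (\<lambda>l::real \<times> real. f (fst l + snd l))"
      using smooth_affine[OF mono(2) affine_map_add] by (simp add: case_prod_unfold)
    have "(\<lambda>z::S \<times> S. complex_of_real (fst (fst z + snd z)) ^ k * f (snd (fst z + snd z))) =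
      (\<lambda>z. \<Sum>i\<le>k. of_nat (k choose i) * (complex_of_real (fst (fst z)) ^ i * complex_of_real (fst (snd z)) ^ (k - i) * f (snd (fst z) + snd (snd z))))"
      by (simp add: binomial_ring sum_distrib_right mult.assoc)
    also have "\<dots> \<in> P2 d"
      using P2_term[OF _ _ s] mono by (intro P2_sum P2_cmult) auto
    finally show ?case .
  qed (auto intro: P2_add)
  then show "F \<in> H1_deg d \<Longrightarrow> coproduct0 F \<in> H2_deg d"
    by (auto simp: H1_deg_iff H2_deg_iff coproduct0_def case_prod_unfold intro!: P2_cmult)
qed

lemma antipode0_H: "F \<in> H1_deg d \<Longrightarrow> antipode0 F \<in> H1_deg d"
proof -
  have "(\<lambda>z. w (- z)) \<in> P1 d" if "w \<in> P1 d" for w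
    using that
  proof (induction rule: P1_induct)
    case (mono k f)
    have s: "smooth (\<lambda>l::real. f (- l))"
      using smooth_affine[OF mono(2) affine_map_uminus] .
    have "(\<lambda>z::S. complex_of_real (fst (- z)) ^ k * f (snd (- z))) =
      (\<lambda>z. (- 1) ^ k * (complex_of_real (fst z) ^ k * f (- snd z)))"
      by (simp add: power_minus[of "complex_of_real _"] mult.assoc)
    also have "\<dots> \<in> P1 d"
      using P1_term[OF _ s] mono by (intro P1_cmult) auto
    finally show ?case .
  qed (auto intro: P1_add)
  then show "F \<in> H1_deg d \<Longrightarrow> antipode0 F \<in> H1_deg d"
    by (auto simp: H1_deg_iff antipode0_def intro!: P1_cmult)
qed

lemma coproduct_H: "F \<in> H1_deg d \<Longrightarrow> coproduct F \<in> H2_deg d"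
  unfolding coproduct_def
  by (intro left_leg_lift_op_H2 right_leg_lift_op_H2 coproduct0_H lift_op_H1 lop_Top lop_Rop)

lemma antipode_H: "F \<in> H1_deg d \<Longrightarrow> antipode F \<in> H1_deg d"
  unfolding antipode_def by (intro antipode0_H lift_op_H1 lop_Top lop_Rop)

lemma coproduct0_grouplike: "coproduct0 (grouplike \<tau> \<zeta>) = tensor (grouplike \<tau> \<zeta>) (grouplike \<tau> \<zeta>)"
  by (auto simp: coproduct0_def grouplike_def tensor_def fun_eq_iff binomial_fact power_add exp_add inner_add_right field_simps)

lemma antipode0_grouplike: "antipode0 (grouplike \<tau> \<zeta>) = grouplike (- \<tau>) (- \<zeta>)"
  by (auto simp: antipode0_def grouplike_def fun_eq_iff power_minus[of \<tau>])

lemma grouplike_one: "grouplike 0 0 = one"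
  by (auto simp: grouplike_def one_def fun_eq_iff)

text \<open>Conjugated group-like elements: the structure maps act on them as in the group algebra of the
  complexified Heisenberg group.\<close>

definition tgrouplike :: "complex \<Rightarrow> S \<Rightarrow> (nat, S) formal" where
  "tgrouplike \<tau> \<zeta> = T (grouplike \<tau> \<zeta>)"

lemma sformal_tgrouplike: "sformal (tgrouplike \<tau> \<zeta>)"
  unfolding tgrouplike_def by (intro sformal_T sformal_grouplike)

lemma R_tgrouplike: "R (tgrouplike \<tau> \<zeta>) = grouplike \<tau> \<zeta>"
  unfolding tgrouplike_def by (rule R_T[OF sformal_grouplike])

lemma tgrouplike_one: "tgrouplike 0 0 = one"
  by (simp add: tgrouplike_def grouplike_one T_one)

lemma coproduct_tgrouplike: "coproduct (tgrouplike \<tau> \<zeta>) = tensor (tgrouplike \<tau> \<zeta>) (tgrouplike \<tau> \<zeta>)"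
  by (simp add: coproduct_def R_tgrouplike coproduct0_grouplike right_leg_tensor[OF formal_op_T]
      left_leg_tensor[OF formal_op_T] sformal_grouplike flip: tgrouplike_def)

lemma antipode_tgrouplike: "antipode (tgrouplike \<tau> \<zeta>) = tgrouplike (- \<tau>) (- \<zeta>)"
  by (simp add: antipode_def R_tgrouplike antipode0_grouplike flip: tgrouplike_def)

lemma tgrouplike_coeff_0: "tgrouplike \<tau> \<zeta> 0 = (\<lambda>x. exp (of_real (\<zeta> \<bullet> x)))"
  unfolding tgrouplike_def T_coeff_0[OF sformal_grouplike] by (simp add: grouplike_def)

text \<open>Composition with \<open>T\<close> turns the test on conjugated group-like elements into
  \<open>local_op_grouplike\<close>, and \<open>T (R F) = F\<close> brings the result back to
  arbitrary \<open>F\<close>. Both operators must read their argument at the same point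
  \<open>\<iota> y\<close>.\<close>

lemma formal_op_eqI:
  assumes A: "formal_op \<iota> A" and B: "formal_op \<iota> B"
    and eq: "\<And>\<tau> \<zeta>. A (tgrouplike \<tau> \<zeta>) = B (tgrouplike \<tau> \<zeta>)" and F: "sformal F"
  shows "A F = B F"
proof (rule ext, rule ext)
  fix k y
  have "local_op \<iota> (\<lambda>F y. A (T F) k y + (- 1) * B (T F) k y)"
    using formal_op_compose[OF A formal_op_T] formal_op_compose[OF B formal_op_T]
    by (intro local_op.add local_op.mult smooth_const) (auto simp: formal_op_def)
  from local_op_grouplike[OF this _ sformal_R[OF F], of y]
  show "A F k y = B F k y"
    using eq T_R[OF F] by (simp add: tgrouplike_def)
qed

lemma heis_cocycle_0 [simp]: "heis_cocycle 0 \<zeta> = 0" "heis_cocycle \<zeta> 0 = 0" "heis_cocycle \<zeta> (- \<zeta>) = 0"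
    "heis_cocycle (- \<zeta>) \<zeta> = 0"
  by (auto simp: heis_cocycle_def)

lemma heis_cocycle_add: "heis_cocycle (\<zeta> + \<eta>) \<theta> = heis_cocycle \<zeta> \<theta> + heis_cocycle \<eta> \<theta>"
    "heis_cocycle \<theta> (\<zeta> + \<eta>) = heis_cocycle \<theta> \<zeta> + heis_cocycle \<theta> \<eta>"
  by (auto simp: heis_cocycle_def algebra_simps)

lemma formal_op_swap_middle:
  "formal_op (\<lambda>((x, z), (y, w)). ((x, y), (z, w))) (swap_middle ::
     (('h1 \<times> 'h2) \<times> ('h3 \<times> 'h4), ('x1::euclidean_space \<times> 'x2::euclidean_space) \<times> ('x3::euclidean_space \<times> 'x4::euclidean_space)) formal \<Rightarrow> _)"
proof -
  have "affine_map (\<lambda>v::('x1 \<times> 'x3) \<times> ('x2 \<times> 'x4). ((fst (fst v), fst (snd v)), (snd (fst v), snd (snd v))))"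
    by (intro affine_map_Pair affine_map_compose[OF affine_map_fst] affine_map_compose[OF affine_map_snd]
        affine_map_fst affine_map_snd)
  then have a: "affine_map (\<lambda>((x::'x1, z::'x3), (y::'x2, w::'x4)). ((x, y), (z, w)))" by (simp add: case_prod_unfold)
  have "local_op (\<lambda>((x, z), (y, w)). ((x, y), (z, w))) (\<lambda>W v. W ((p, q), (r, s)) ((\<lambda>((x::'x1, z::'x3), (y::'x2, w::'x4)). ((x, y), (z, w))) v))" for p :: 'h1 and q :: 'h2 and r :: 'h3 and s :: 'h4
    by (rule local_op_coeff)
  then show ?thesis using a unfolding formal_op_def swap_middle_def case_prod_unfold by auto
qed

lemma formal_op_reassociate:
  "formal_op (\<lambda>(x, y, z). ((x, y), z)) (reassociate ::
     (('h1 \<times> 'h2) \<times> 'h3, ('x1::euclidean_space \<times> 'x2::euclidean_space) \<times> 'x3::euclidean_space) formal \<Rightarrow> _)"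
proof -
  have "affine_map (\<lambda>v::'x1 \<times> 'x2 \<times> 'x3. ((fst v, fst (snd v)), snd (snd v)))"
    by (intro affine_map_Pair affine_map_compose[OF affine_map_fst] affine_map_compose[OF affine_map_snd]
        affine_map_fst affine_map_snd)
  then have a: "affine_map (\<lambda>(x::'x1, y::'x2, z::'x3). ((x, y), z))" by (simp add: case_prod_unfold)
  have "local_op (\<lambda>(x, y, z). ((x, y), z)) (\<lambda>W v. W ((p, q), r) ((\<lambda>(x::'x1, y::'x2, z::'x3). ((x, y), z)) v))" for p :: 'h1 and q :: 'h2 and r :: 'h3
    by (rule local_op_coeff)
  then show ?thesis using a unfolding formal_op_def reassociate_def case_prod_unfold by auto
qed

lemma reassociate_tensor: "reassociate (tensor (tensor F G) K) = tensor F (tensor G K)"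
  by (auto simp: reassociate_def tensor_def fun_eq_iff mult.assoc)

lemma swap_middle_tensor: "swap_middle (tensor (tensor F G) (tensor K L)) = tensor (tensor F K) (tensor G L)"
  by (auto simp: swap_middle_def tensor_def fun_eq_iff mult_ac)

lemma affine_map_slice: "formal_op (\<lambda>y. (v, y)) (\<lambda>W q y. W (p, q) (v, y))"
  "formal_op (\<lambda>y. (y, v)) (\<lambda>W q y. W (q, p) (y, v))"
  by (auto simp: formal_op_def affine_map_pair_left affine_map_pair_right local_op_coeff)

lemma formal_op_id: "formal_op (\<lambda>x. x) (\<lambda>F. F)"
  by (auto simp: formal_op_def affine_map_id local_op_coeff)

text \<open>Every identity among the axioms is local and linear in each argument with the others
  held fixed. The arguments are therefore freed one at a time by \<open>formal_op_eqI\<close>,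
  starting from conjugated group-like elements, where the axioms are the group law of the Heisenberg
  group.\<close>

theorem is_hopf_algebra_intertwined:
  assumes D: "\<And>W. sformal W \<Longrightarrow> mult D W = T (mult moyal (left_leg R (right_leg R W)))"
  shows "is_hopf_algebra D coproduct counit antipode"
proof -
  have mD: "formal_op (\<lambda>x. (x, x)) (mult D)"
    by (rule formal_op_cong[OF formal_op_composeI[OF formal_op_T
        formal_op_composeI[OF formal_op_mult_moyal formal_op_composeI[OF formal_op_left_leg[OF formal_op_R]
          formal_op_right_leg[OF formal_op_R] refl] refl]] D]) auto
  have mD_H: "mult D W \<in> H1_deg (2 * d)" if "W \<in> H2_deg d" for W d
    unfolding D[OF H2_deg_sformal[OF that]] using that
    by (intro lift_op_H1 mult_moyal_H2 left_leg_lift_op_H2 right_leg_lift_op_H2 lop_Top lop_Rop)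
  have star_l: "formal_op (\<lambda>x. x) (\<lambda>F. star D F G)" if "sformal G" for G
    unfolding star_def by (rule formal_op_composeI[OF mD formal_op_tensor_left[OF that]]) simp
  have star_r: "formal_op (\<lambda>x. x) (\<lambda>G. star D F G)" if "sformal F" for F
    unfolding star_def by (rule formal_op_composeI[OF mD formal_op_tensor_right[OF that]]) simp
  have star_s: "sformal (star D F G)" if "sformal F" "sformal G" for F G
    using formal_op_sformal[OF star_l] that by blast
  have star_g: "star D (tgrouplike \<sigma> \<zeta>) (tgrouplike \<tau> \<eta>) = tgrouplike (\<sigma> + \<tau> + heis_cocycle \<zeta> \<eta>) (\<zeta> + \<eta>)" for \<sigma> \<zeta> \<tau> \<eta>
    unfolding star_def D[OF sformal_tensor[OF sformal_tgrouplike sformal_tgrouplike]]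
    by (simp add: right_leg_tensor[OF formal_op_R] left_leg_tensor[OF formal_op_R] sformal_tgrouplike
        R_tgrouplike mult_moyal_grouplike flip: tgrouplike_def)
  have one: "sformal (one :: (nat, S) formal)" using sformal_tgrouplike[of 0 0] by (simp add: tgrouplike_one)
  have star_H: "star D F G \<in> H1" if F: "F \<in> H1" and G: "G \<in> H1" for F G
  proof -
    obtain d e where d: "F \<in> H1_deg d" "G \<in> H1_deg e" using F G by (auto simp: H1_def)
    have "tensor F G (r, q) \<in> P2 (max d e)" for r q
    proof -
      have v: "F r \<in> P1 (max d e)" and w: "G q \<in> P1 (max d e)"
        using d P1_mono[of _ d "max d e"] P1_mono[of _ e "max d e"] by (auto simp: H1_deg_iff)
      have "(\<lambda>z. F r (fst z) * G q (snd z)) \<in> P2 (max d e)"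
        using v
      proof (induction rule: P1_induct)
        case (mono k f)
        show ?case using w
        proof (induction rule: P1_induct)
          case (mono m g)
          have s: "smooth (\<lambda>l::real \<times> real. f (fst l) * g (snd l))"
            using smooth_affine[OF \<open>smooth f\<close> affine_map_fst] smooth_affine[OF \<open>smooth g\<close> affine_map_snd]
            by (rule smooth_mult)
          from P2_term[OF \<open>k \<le> _\<close> \<open>m \<le> _\<close> s] show ?case by (simp add: mult_ac)
        qed (auto simp: distrib_left intro: P2_add)
      qed (auto simp: distrib_right intro: P2_add)
      then show ?thesis by (simp add: tensor_def case_prod_unfold)
    qed
    then have "tensor F G \<in> H2_deg (max d e)" by (auto simp: H2_deg_iff)
    from mD_H[OF this] show ?thesis by (auto simp: H1_def star_def)
  qed
  have assoc: "star D (star D F G) K = star D F (star D G K)"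
    if F: "sformal F" and G: "sformal G" and K: "sformal K" for F G K
  proof -
    let ?g = tgrouplike
    \<comment> \<open>The arguments are freed from left to right. On three conjugated group-like
      elements both bracketings agree because the cocycle is additive in each slot.\<close>
    have 1: "star D (star D F (?g \<sigma> \<zeta>)) (?g \<tau> \<eta>) = star D F (star D (?g \<sigma> \<zeta>) (?g \<tau> \<eta>))" if "sformal F" for F \<sigma> \<zeta> \<tau> \<eta>
      by (rule formal_op_eqI[OF formal_op_composeI[OF star_l star_l] star_l])
        (simp_all add: that sformal_tgrouplike star_s star_g heis_cocycle_add add_ac)
    have 2: "star D (star D F G) (?g \<tau> \<eta>) = star D F (star D G (?g \<tau> \<eta>))" if "sformal F" "sformal G" for F G \<tau> \<eta>
      by (rule formal_op_eqI[OF formal_op_composeI[OF star_l star_r] formal_op_composeI[OF star_r star_l]])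
        (simp_all add: that sformal_tgrouplike 1)
    show ?thesis
      by (rule formal_op_eqI[OF star_r formal_op_composeI[OF star_r star_r]])
        (simp_all add: that star_s 2)
  qed
  have unit_l: "star D one F = F" if F: "sformal F" for F
    by (rule formal_op_eqI[OF star_r[OF one] formal_op_id _ F]) (simp add: star_g flip: tgrouplike_one)
  have unit_r: "star D F one = F" if F: "sformal F" for F
    by (rule formal_op_eqI[OF star_l[OF one] formal_op_id _ F]) (simp add: star_g flip: tgrouplike_one)
  have "is_algebra D"
    unfolding is_algebra_def
  proof (intro conjI ballI)
    show "linear_continuous_map H2_deg H1_deg (mult D)"
      by (rule linear_continuous_mapI[OF mD H2_deg_sformal]) (use mD_H in blast)+
  qed (simp_all add: star_H assoc unit_l unit_r H1_sformal)

  moreover have coassoc: "reassociate (left_leg coproduct (coproduct F)) = right_leg coproduct (coproduct F)"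
    if "sformal F" for F
    by (rule formal_op_eqI[OF formal_op_composeI[OF formal_op_reassociate
          formal_op_composeI[OF formal_op_left_leg[OF formal_op_coproduct] formal_op_coproduct refl]]
          formal_op_composeI[OF formal_op_right_leg[OF formal_op_coproduct] formal_op_coproduct refl]])
       (auto simp: that coproduct_tgrouplike left_leg_tensor[OF formal_op_coproduct] right_leg_tensor[OF formal_op_coproduct]
        sformal_tgrouplike reassociate_tensor add.assoc)
  have counit: "left_eval counit (coproduct F) = F" "right_eval counit (coproduct F) = F" if "sformal F" for F
  proof -
    \<comment> \<open>The counit in one leg sets that leg's parameter and point to 0. This is a
      slice along an affine embedding, so the composite with the coproduct is again a formal
      operator with the identity as base point map.\<close>
    have "(\<lambda>q y. coproduct F (0, q) (0, y)) = F"
      by (rule formal_op_eqI[OF formal_op_composeI[OF affine_map_slice(1) formal_op_coproduct] formal_op_id])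
        (auto simp: that coproduct_tgrouplike tensor_def tgrouplike_coeff_0)
    moreover have "(\<lambda>q y. coproduct F (q, 0) (y, 0)) = F"
      by (rule formal_op_eqI[OF formal_op_composeI[OF affine_map_slice(2) formal_op_coproduct] formal_op_id])
        (auto simp: that coproduct_tgrouplike tensor_def tgrouplike_coeff_0)
    ultimately show "left_eval counit (coproduct F) = F" "right_eval counit (coproduct F) = F"
      by (simp_all add: left_eval_def right_eval_def counit_def)
  qed
  have counit_cont: "linear_continuous_functional H1_deg counit"
    unfolding linear_continuous_functional_def counit_def null_seq_def
  proof (intro conjI ballI allI impI refl)
    fix X :: "nat \<Rightarrow> (nat, S) formal" assume X: "(\<exists>d. \<forall>j. X j \<in> H1_deg d) \<and> (\<forall>r. smooth_null (\<lambda>j. X j r))"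
    then have "uniform_limit {0} (\<lambda>j. X j 0) (\<lambda>_. 0) sequentially"
      by (intro smooth_null_uniform_limit) auto
    from tendsto_uniform_limitI[OF this, of 0] show "(\<lambda>j. X j 0 0) \<longlonglongrightarrow> 0" by simp
  qed
  have "is_coalgebra coproduct counit"
    unfolding is_coalgebra_def
  proof (intro conjI ballI)
    show "linear_continuous_map H1_deg H2_deg coproduct"
      by (rule linear_continuous_mapI[OF formal_op_coproduct H1_deg_sformal]) (use coproduct_H in blast)+
  qed (simp_all add: coassoc counit counit_cont H1_sformal)

  moreover have hom: "coproduct (star D F G) = star2 D (coproduct F) (coproduct G)"
    if F: "sformal F" and G: "sformal G" for F G
  proof -
    have cop_s: "sformal (coproduct F)" if "sformal F" for F
      using formal_op_sformal[OF formal_op_coproduct that] .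
    have l: "formal_op (\<lambda>(x, y). x + y) (\<lambda>F. star2 D (coproduct F) (coproduct G))" if "sformal G" for G
      unfolding star2_def
      by (rule formal_op_composeI[OF formal_op_left_leg[OF mD] formal_op_composeI[OF formal_op_right_leg[OF mD]
            formal_op_composeI[OF formal_op_swap_middle formal_op_composeI[OF formal_op_tensor_left[OF cop_s[OF that]]
            formal_op_coproduct refl] refl] refl]]) auto
    have r: "formal_op (\<lambda>(x, y). x + y) (\<lambda>G. star2 D (coproduct F) (coproduct G))" if "sformal F" for F
      unfolding star2_def
      by (rule formal_op_composeI[OF formal_op_left_leg[OF mD] formal_op_composeI[OF formal_op_right_leg[OF mD]
            formal_op_composeI[OF formal_op_swap_middle formal_op_composeI[OF formal_op_tensor_right[OF cop_s[OF that]]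
            formal_op_coproduct refl] refl] refl]]) auto
    have g: "coproduct (star D (tgrouplike \<sigma> \<zeta>) (tgrouplike \<tau> \<eta>)) =
        star2 D (coproduct (tgrouplike \<sigma> \<zeta>)) (coproduct (tgrouplike \<tau> \<eta>))" for \<sigma> \<zeta> \<tau> \<eta>
      by (simp add: star2_def star_g coproduct_tgrouplike swap_middle_tensor right_leg_tensor[OF mD] left_leg_tensor[OF mD]
          sformal_tensor sformal_tgrouplike flip: star_def)
    have 1: "coproduct (star D F (tgrouplike \<tau> \<eta>)) = star2 D (coproduct F) (coproduct (tgrouplike \<tau> \<eta>))"
      if "sformal F" for F \<tau> \<eta>
      by (rule formal_op_eqI[OF formal_op_composeI[OF formal_op_coproduct star_l[OF sformal_tgrouplike] refl]
            l[OF sformal_tgrouplike] g that])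
    show ?thesis
      by (rule formal_op_eqI[OF formal_op_composeI[OF formal_op_coproduct star_r[OF F] refl]
            r[OF F] 1[OF F] G])
  qed
  have cop_one: "coproduct one = tensor one one"
    using coproduct_tgrouplike[of 0 0] by (simp add: tgrouplike_one)
  have star_0: "counit (star D F G) = counit F * counit G" if F: "sformal F" and G: "sformal G" for F G
  proof -
    \<comment> \<open>A single coefficient is regarded as a formal series over the index type
      \<open>unit\<close>, so that \<open>formal_op_eqI\<close> applies. What gets proved is more
      than multiplicativity of the counit: the leading coefficient of the star product is the
      pointwise product.\<close>
    have coeff: "formal_op \<iota> (\<lambda>F (k::unit). A F 0)" if "formal_op \<iota> A" for \<iota> and A :: "(nat, S) formal \<Rightarrow> (nat, S) formal"
      using that by (auto simp: formal_op_def)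
    have l: "formal_op (\<lambda>x. x) (\<lambda>F (k::unit) y. F 0 y * G 0 y)" if "sformal G" for G :: "(nat, S) formal"
      using that local_op.mult[OF _ local_op_coeff, of "G 0" "\<lambda>x. x" 0]
      by (auto simp: formal_op_def affine_map_id sformal_def mult.commute)
    have r: "formal_op (\<lambda>x. x) (\<lambda>G (k::unit) y. F 0 y * G 0 y)" if "sformal F" for F :: "(nat, S) formal"
      using that local_op.mult[OF _ local_op_coeff, of "F 0" "\<lambda>x. x" 0]
      by (auto simp: formal_op_def affine_map_id sformal_def)
    have 1: "(\<lambda>k::unit. star D F (tgrouplike \<tau> \<eta>) 0) = (\<lambda>k y. F 0 y * tgrouplike \<tau> \<eta> 0 y)" if "sformal F" for F \<tau> \<eta>
      by (rule formal_op_eqI[OF coeff[OF star_l] l])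
        (simp_all add: that sformal_tgrouplike star_g tgrouplike_coeff_0 exp_add inner_add_left)
    have "(\<lambda>k::unit. star D F G 0) = (\<lambda>k y. F 0 y * G 0 y)"
      by (rule formal_op_eqI[OF coeff[OF star_r] r 1]) (simp_all add: that)
    then have "star D F G 0 = (\<lambda>y. F 0 y * G 0 y)" by (rule fun_cong)
    then show ?thesis by (simp add: counit_def)
  qed
  have counit_one: "counit one = 1" by (simp add: counit_def one_def)
  ultimately have bialg: "is_bialgebra D coproduct counit"
    unfolding is_bialgebra_def using hom cop_one star_0 counit_one H1_sformal by simp

  \<comment> \<open>The base point map is the constant 0. It agrees with that of the antipode
    identities: the diagonal, the reflection in one leg and the sum compose to
    \<open>x \<mapsto> - x + x\<close>.\<close>
  have c: "formal_op (\<lambda>_::S. 0) (\<lambda>F r x. counit F * one r x)"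
  proof -
    have "local_op (\<lambda>_::S. 0) (\<lambda>(F::(nat, S) formal) y. one r y * F 0 ((\<lambda>_. 0) y))" for r
      using one by (intro local_op.mult local_op_coeff) (auto simp: sformal_def)
    then show ?thesis by (auto simp: formal_op_def affine_map_const counit_def mult.commute)
  qed
  have inv: "counit (tgrouplike \<tau> \<zeta>) = 1" for \<tau> \<zeta> by (simp add: counit_def tgrouplike_coeff_0)
  have "mult D (left_leg antipode (coproduct F)) = (\<lambda>r x. counit F * one r x)" if "sformal F" for F
    by (rule formal_op_eqI[OF formal_op_composeI[OF mD formal_op_composeI[OF formal_op_left_leg[OF formal_op_antipode]
          formal_op_coproduct refl]] c])
      (auto simp: that coproduct_tgrouplike left_leg_tensor[OF formal_op_antipode] sformal_tgrouplike antipode_tgrouplike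
        star_g inv simp flip: star_def simp add: tgrouplike_one)
  moreover have "mult D (right_leg antipode (coproduct F)) = (\<lambda>r x. counit F * one r x)" if "sformal F" for F
    by (rule formal_op_eqI[OF formal_op_composeI[OF mD formal_op_composeI[OF formal_op_right_leg[OF formal_op_antipode]
          formal_op_coproduct refl]] c])
      (auto simp: that coproduct_tgrouplike right_leg_tensor[OF formal_op_antipode] sformal_tgrouplike antipode_tgrouplike
        star_g inv simp flip: star_def simp add: tgrouplike_one)
  moreover have "linear_continuous_map H1_deg H1_deg antipode"
    by (rule linear_continuous_mapI[OF formal_op_antipode H1_deg_sformal]) (use antipode_H in blast)+
  ultimately show ?thesis
    unfolding is_hopf_algebra_def using bialg H1_sformal by simp
qed

section \<open>Fourier transform of test functions on the line\<close>

lemma smooth_has_vector_derivative: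
  fixes \<phi> :: "real \<Rightarrow> complex"
  assumes "smooth \<phi>"
  shows "(\<phi> has_vector_derivative partial 1 \<phi> x) (at x within A)"
  using has_derivative_at_withinI[OF smooth_has_derivative[OF assms, of x]]
  by (simp add: has_vector_derivative_def scaleR_conv_of_real)

lemma partial_eq_vector_derivative:
  fixes \<phi> :: "real \<Rightarrow> complex"
  assumes "\<And>x. (\<phi> has_vector_derivative \<phi>' x) (at x)"
  shows "partial 1 \<phi> = \<phi>'"
  using partial_eqI[of \<phi> "\<lambda>x v. v *\<^sub>R \<phi>' x" 1] assms by (simp add: has_vector_derivative_def)

lemma test_function_smooth: "test_function u \<Longrightarrow> smooth u"
  by (simp add: test_function_def)

lemma test_function_support:
  assumes "test_function u"
  obtains A where "A > 0" "\<And>x. A \<le> norm x \<Longrightarrow> u x = 0"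
proof -
  have "bounded (closure {x. u x \<noteq> 0})"
    using assms by (simp add: test_function_def compact_imp_bounded)
  then obtain B where B: "\<And>x. u x \<noteq> 0 \<Longrightarrow> norm x \<le> B"
    using closure_subset by (force simp: bounded_iff)
  show ?thesis
    by (rule that[of "max 1 (B + 1)"]) (use B in fastforce)+
qed

lemma test_functionI:
  assumes "smooth u" "\<And>x. A \<le> norm x \<Longrightarrow> u x = 0"
  shows "test_function u"
proof -
  have "{x. u x \<noteq> 0} \<subseteq> cball 0 A"
    using assms(2) by (force simp: not_le dist_norm)
  then have "bounded {x. u x \<noteq> 0}" by (rule bounded_subset[OF bounded_cball])
  then show ?thesis using assms(1) by (simp add: test_function_def compact_closure)
qed

lemma partial_eq_zero:
  assumes "open X" "x \<in> X" "\<And>y. y \<in> X \<Longrightarrow> f y = 0"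
  shows "partial b f x = 0"
proof -
  have "((\<lambda>_. 0) has_derivative (\<lambda>_. 0)) (at x)" by simp
  from has_derivative_transform_within_open[OF this assms(1,2), of f] have "(f has_derivative (\<lambda>_. 0)) (at x)"
    using assms(3) by simp
  from frechet_derivative_at[OF this] show ?thesis by (simp add: partial_def fun_eq_iff)
qed

lemma test_function_partial:
  assumes "test_function u" "b \<in> Basis"
  shows "test_function (partial b u)"
proof -
  obtain A where A: "A > 0" "\<And>x. A \<le> norm x \<Longrightarrow> u x = 0" using test_function_support[OF assms(1)] by metis
  show ?thesis
  proof (rule test_functionI[of _ "A + 1"])
    show "smooth (partial b u)" using assms test_function_smooth smooth_partial by blast
    fix x :: 'a assume "A + 1 \<le> norm x"
    moreover have "open {x :: 'a. A < norm x}" by (intro open_Collect_less continuous_intros)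
    ultimately show "partial b u x = 0"
      by (intro partial_eq_zero[of "{x. A < norm x}"]) (use A in auto)
  qed
qed

lemma test_function_mult:
  assumes "test_function u" "smooth c"
  shows "test_function (\<lambda>x. c x * u x)"
proof -
  obtain A where A: "A > 0" "\<And>x. A \<le> norm x \<Longrightarrow> u x = 0" using test_function_support[OF assms(1)] by metis
  show ?thesis
    using A(2) by (intro test_functionI[of _ A] smooth_mult assms(2) test_function_smooth[OF assms(1)]) auto
qed

lemma test_function_cmult: "test_function u \<Longrightarrow> test_function (\<lambda>x. c * u x)"
  by (rule test_function_mult[OF _ smooth_const])

lemma test_function_add:
  assumes "test_function u" "test_function v"
  shows "test_function (\<lambda>x. u x + v x)"
proof -
  obtain A where A: "A > 0" "\<And>x. A \<le> norm x \<Longrightarrow> u x = 0" using test_function_support[OF assms(1)] by metis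
  obtain B where B: "B > 0" "\<And>x. B \<le> norm x \<Longrightarrow> v x = 0" using test_function_support[OF assms(2)] by metis
  show ?thesis
    using A(2) B(2) by (intro test_functionI[of _ "max A B"] smooth_add test_function_smooth[OF assms(1)]
      test_function_smooth[OF assms(2)]) auto
qed

lemma test_function_zero: "test_function (\<lambda>x. 0)"
  by (rule test_functionI) auto

lemma test_function_sum: "(\<And>i. i \<in> I \<Longrightarrow> test_function (u i)) \<Longrightarrow> test_function (\<lambda>x. \<Sum>i\<in>I. u i x)"
  by (induction I rule: infinite_finite_induct) (auto intro: test_function_add test_function_zero)

lemma integrable_compact_support:
  fixes f :: "'a::euclidean_space \<Rightarrow> complex"
  assumes "continuous_on UNIV f" "\<And>x. A \<le> norm x \<Longrightarrow> f x = 0"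
  shows "integrable lborel f"
proof -
  have "integrable lborel (\<lambda>x. indicator (cball 0 A) x *\<^sub>R f x)"
    using assms(1) by (intro borel_integrable_compact) (auto intro: continuous_on_subset)
  also have "(\<lambda>x. indicator (cball 0 A) x *\<^sub>R f x) = f"
    using assms(2) by (force simp: indicator_def dist_norm)
  finally show ?thesis .
qed

lemma integrable_test_function:
  assumes "test_function u" "continuous_on UNIV c"
  shows "integrable lborel (\<lambda>x. u x * c x)"
proof -
  obtain A where A: "A > 0" "\<And>x. A \<le> norm x \<Longrightarrow> u x = 0" using test_function_support[OF assms(1)] by metis
  show ?thesis
  proof (rule integrable_compact_support[of _ A])
    show "continuous_on UNIV (\<lambda>x. u x * c x)"
      by (intro continuous_intros smooth_continuous_on[OF test_function_smooth[OF assms(1)]] assms(2))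
  qed (use A in auto)
qed

text \<open>This unnormalized kernel is what the phase leaves for an \<open>l\<close>-integration.
  The constants \<open>2 * pi\<close> reappear in the inversion formula and cancel against the
  normalization of the star integral.\<close>

definition ft :: "(real \<Rightarrow> complex) \<Rightarrow> real \<Rightarrow> complex" where
  "ft \<phi> \<xi> = (LINT l|lborel. \<phi> l * cis (- (\<xi> * l)))"

lemma ft_integrable: "test_function \<phi> \<Longrightarrow> integrable lborel (\<lambda>l. \<phi> l * cis (- (\<xi> * l)))"
  by (intro integrable_test_function continuous_intros)

lemma ft_add: "test_function \<phi> \<Longrightarrow> test_function \<psi> \<Longrightarrow> ft (\<lambda>l. \<phi> l + \<psi> l) \<xi> = ft \<phi> \<xi> + ft \<psi> \<xi>"
  by (simp add: ft_def distrib_right ft_integrable)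

lemma ft_cmult: "ft (\<lambda>l. c * \<phi> l) \<xi> = c * ft \<phi> \<xi>"
  by (simp add: ft_def mult.assoc)

lemma ft_sum:
  assumes "\<And>i. i \<in> I \<Longrightarrow> test_function (\<phi> i)"
  shows "ft (\<lambda>l. \<Sum>i\<in>I. \<phi> i l) \<xi> = (\<Sum>i\<in>I. ft (\<phi> i) \<xi>)"
  using assms
proof (induction I rule: infinite_finite_induct)
  case (insert i I)
  then show ?case by (simp add: ft_add test_function_sum)
qed (auto simp: ft_def)

lemma ft_bound: "test_function \<phi> \<Longrightarrow> norm (ft \<phi> \<xi>) \<le> (LINT l|lborel. norm (\<phi> l))"
  unfolding ft_def by (rule order_trans[OF integral_norm_bound]) (simp add: norm_mult)

text \<open>Compact support turns the Lebesgue integral into a gauge integral over a fixed box,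
  where the fundamental theorem of calculus and differentiation under the integral sign are
  available.\<close>

lemma ft_eq_integral:
  assumes "test_function \<phi>" "\<And>x. A \<le> norm x \<Longrightarrow> \<phi> x = 0"
  shows "ft \<phi> \<xi> = integral (cbox (- A) A) (\<lambda>l. \<phi> l * cis (- (\<xi> * l)))"
proof -
  have "(\<lambda>l. indicator (cbox (- A) A) l *\<^sub>R (\<phi> l * cis (- (\<xi> * l)))) = (\<lambda>l. \<phi> l * cis (- (\<xi> * l)))"
    using assms(2) by (force simp: indicator_def)
  then have "set_integrable lborel (cbox (- A) A) (\<lambda>l. \<phi> l * cis (- (\<xi> * l)))"
    "ft \<phi> \<xi> = (LINT l : cbox (- A) A | lborel. \<phi> l * cis (- (\<xi> * l)))"
    using ft_integrable[OF assms(1)] by (simp_all add: set_integrable_def set_lebesgue_integral_def ft_def)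
  then show ?thesis using set_borel_integral_eq_integral(2) by metis
qed

lemma has_vector_derivative_cis:
  "((\<lambda>x. cis (- (c * x))) has_vector_derivative - \<i> * of_real c * cis (- (c * x))) (at x within A)"
  unfolding has_vector_derivative_def
  by (rule derivative_eq_intros refl | simp add: scaleR_conv_of_real fun_eq_iff)+

lemma ft_partial:
  assumes "test_function \<phi>"
  shows "ft (partial 1 \<phi>) \<xi> = \<i> * of_real \<xi> * ft \<phi> \<xi>"
proof -
  obtain A where A: "A > 0" "\<And>x. A \<le> norm x \<Longrightarrow> \<phi> x = 0" using test_function_support[OF assms] by metis
  have t: "test_function (partial 1 \<phi>)" by (rule test_function_partial[OF assms]) simp
  obtain B where B: "B > 0" "\<And>x. B \<le> norm x \<Longrightarrow> partial 1 \<phi> x = 0" using test_function_support[OF t] by metis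
  define C where "C = max A B"
  have C: "C > 0" "\<And>x. C \<le> norm x \<Longrightarrow> \<phi> x = 0" "\<And>x. C \<le> norm x \<Longrightarrow> partial 1 \<phi> x = 0"
    using A B by (auto simp: C_def)
  have "((\<lambda>l. \<phi> l * (- \<i> * of_real \<xi> * cis (- (\<xi> * l))) + partial 1 \<phi> l * cis (- (\<xi> * l))) has_integral
      \<phi> C * cis (- (\<xi> * C)) - \<phi> (- C) * cis (- (\<xi> * - C))) {- C..C}"
    using C(1) by (intro fundamental_theorem_of_calculus has_vector_derivative_mult
        smooth_has_vector_derivative test_function_smooth[OF assms] has_vector_derivative_cis) auto
  then have 1: "integral {- C..C} (\<lambda>l. \<phi> l * (- \<i> * of_real \<xi> * cis (- (\<xi> * l))) + partial 1 \<phi> l * cis (- (\<xi> * l))) = 0"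
    using C by (simp add: integral_unique)
  have cont: "continuous_on X (\<lambda>l. \<psi> l * cis (- (\<xi> * l)))" if "test_function \<psi>" for \<psi> X
    using that by (intro continuous_intros smooth_continuous_on test_function_smooth)
  have "integral {- C..C} (\<lambda>l. (- \<i> * of_real \<xi>) * (\<phi> l * cis (- (\<xi> * l))) + partial 1 \<phi> l * cis (- (\<xi> * l))) =
      (- \<i> * of_real \<xi>) * integral {- C..C} (\<lambda>l. \<phi> l * cis (- (\<xi> * l))) + integral {- C..C} (\<lambda>l. partial 1 \<phi> l * cis (- (\<xi> * l)))"
    by (subst integral_add) (simp_all only: integral_mult_right, (intro integrable_continuous_real continuous_on_mult_left cont assms t)+)
  also have "\<dots> = - \<i> * of_real \<xi> * ft \<phi> \<xi> + ft (partial 1 \<phi>) \<xi>"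
    using ft_eq_integral[OF assms C(2)] ft_eq_integral[OF t C(3)] by simp
  finally show ?thesis using 1 by (simp add: mult_ac eq_neg_iff_add_eq_0 add.commute)
qed

lemma test_function_id_mult: "test_function \<phi> \<Longrightarrow> test_function (\<lambda>l::real. of_real l * \<phi> l)"
  by (rule test_function_mult[OF _ smooth_real_linear[OF bounded_linear_ident]])

lemma ft_has_vector_derivative:
  assumes "test_function \<phi>"
  shows "(ft \<phi> has_vector_derivative ft (\<lambda>l. - \<i> * (of_real l * \<phi> l)) \<xi>) (at \<xi>)"
proof -
  obtain A where A: "A > 0" "\<And>x. A \<le> norm x \<Longrightarrow> \<phi> x = 0" using test_function_support[OF assms] by metis
  have t: "test_function (\<lambda>l. - \<i> * (of_real l * \<phi> l))"
    by (intro test_function_cmult test_function_id_mult assms)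
  have cont: "continuous_on X (\<lambda>x. \<phi> (f x))" if "continuous_on X f" for X :: "'a::topological_space set" and f
    by (rule continuous_on_compose2[OF smooth_continuous_on[OF test_function_smooth[OF assms], of UNIV] that]) auto
  have "((\<lambda>\<xi>. integral (cbox (- A) A) (\<lambda>l. \<phi> l * cis (- (\<xi> * l)))) has_vector_derivative
      integral (cbox (- A) A) (\<lambda>l. \<phi> l * (- \<i> * of_real l * cis (- (\<xi> * l))))) (at \<xi> within UNIV)"
  proof (rule leibniz_rule_vector_derivative)
    fix x l :: real
    have "((\<lambda>x. \<phi> l * cis (- (l * x))) has_vector_derivative \<phi> l * (- \<i> * of_real l * cis (- (l * x)))) (at x within UNIV)"
      by (intro has_vector_derivative_mult_right has_vector_derivative_cis)
    then show "((\<lambda>x. \<phi> l * cis (- (x * l))) has_vector_derivative \<phi> l * (- \<i> * of_real l * cis (- (x * l)))) (at x within UNIV)"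
      by (simp add: mult.commute)
  next
    show "(\<lambda>l. \<phi> l * cis (- (x * l))) integrable_on cbox (- A) A" for x
      by (intro integrable_continuous continuous_intros cont)
    show "continuous_on (UNIV \<times> cbox (- A) A) (\<lambda>(x, l). \<phi> l * (- \<i> * of_real l * cis (- (x * l))))"
      unfolding case_prod_unfold by (intro continuous_intros cont)
  qed auto
  moreover have "integral (cbox (- A) A) (\<lambda>l. \<phi> l * (- \<i> * of_real l * cis (- (\<xi> * l)))) = ft (\<lambda>l. - \<i> * (of_real l * \<phi> l)) \<xi>"
    by (subst ft_eq_integral[OF t]) (use A in \<open>auto simp: mult_ac\<close>)
  moreover have "ft \<phi> = (\<lambda>\<xi>. integral (cbox (- A) A) (\<lambda>l. \<phi> l * cis (- (\<xi> * l))))"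
    using ft_eq_integral[OF assms A(2)] by blast
  ultimately show ?thesis by simp
qed

lemma continuous_on_ft: "test_function \<phi> \<Longrightarrow> continuous_on A (ft \<phi>)"
  by (intro continuous_at_imp_continuous_on ballI has_vector_derivative_continuous[OF ft_has_vector_derivative])

text \<open>Subtracting the second derivative from a test function gives a test function again and
  multiplies the transform by \<open>1 + \<xi>\<^sup>2\<close>; each application buys one
  factor.\<close>

lemma ft_decay:
  assumes "test_function \<phi>"
  shows "\<exists>B. \<forall>\<xi>. norm (ft \<phi> \<xi>) * (1 + \<xi>\<^sup>2) ^ k \<le> B"
  using assms
proof (induction k arbitrary: \<phi>)
  case 0
  then show ?case using ft_bound by auto
next
  case (Suc k)
  let ?\<psi> = "\<lambda>l. \<phi> l + (- 1) * partial 1 (partial 1 \<phi>) l"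
  have p: "test_function (partial 1 \<phi>)" "test_function (partial 1 (partial 1 \<phi>))"
    using Suc.prems test_function_partial[of _ "1 :: real"] by auto
  have t: "test_function ?\<psi>"
    by (rule test_function_add[OF Suc.prems test_function_cmult[OF p(2)]])
  have "ft ?\<psi> \<xi> = ft \<phi> \<xi> * of_real (1 + \<xi>\<^sup>2)" for \<xi>
    unfolding ft_add[OF Suc.prems test_function_cmult[OF p(2)]] ft_cmult ft_partial[OF p(1)] ft_partial[OF Suc.prems]
    by (simp add: algebra_simps power2_eq_square)
  then have "norm (ft ?\<psi> \<xi>) = norm (ft \<phi> \<xi>) * (1 + \<xi>\<^sup>2)" for \<xi>
    by (simp add: norm_mult del: of_real_add)
  then show ?case using Suc.IH[OF t] by (simp add: mult.assoc)
qed

lemma integrable_inverse_quadratic: "integrable lborel (\<lambda>x::real. 1 / (1 + x\<^sup>2))"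
  using integrable_inverse_1_plus_square by (simp add: set_integrable_def inverse_eq_divide)

lemma integrable_ft:
  assumes "test_function \<phi>"
  shows "integrable lborel (ft \<phi>)"
proof -
  obtain B where B: "\<And>\<xi>. norm (ft \<phi> \<xi>) * (1 + \<xi>\<^sup>2) ^ 1 \<le> B" using ft_decay[OF assms] by metis
  show ?thesis
  proof (rule Bochner_Integration.integrable_bound)
    show "integrable lborel (\<lambda>x::real. B * (1 / (1 + x\<^sup>2)))"
      by (intro integrable_mult_right integrable_inverse_quadratic)
    show "ft \<phi> \<in> borel_measurable lborel"
      using borel_measurable_continuous_onI[OF continuous_on_ft[OF assms]] by simp
    show "AE x in lborel. norm (ft \<phi> x) \<le> norm (B * (1 / (1 + x\<^sup>2)))"
    proof (rule AE_I2)
      fix x :: real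
      have p: "1 + x\<^sup>2 > 0" by (simp add: add_pos_nonneg)
      then have "norm (ft \<phi> x) \<le> B / (1 + x\<^sup>2)" using B[of x] by (simp add: field_simps)
      also have "\<dots> \<le> norm (B * (1 / (1 + x\<^sup>2)))" using p by (simp add: divide_right_mono)
      finally show "norm (ft \<phi> x) \<le> norm (B * (1 / (1 + x\<^sup>2)))" .
    qed
  qed
qed

section \<open>Gaussian regularization and Fourier inversion\<close>

lemma integrable_lborel_pair:
  fixes f g :: "real \<Rightarrow> complex"
  assumes "integrable lborel f" "integrable lborel g"
  shows "integrable (lborel \<Otimes>\<^sub>M lborel) (\<lambda>(x, y). f x * g y)"
proof (rule lborel_pair.Fubini_integrable)
  have [measurable]: "f \<in> borel_measurable lborel" "g \<in> borel_measurable lborel"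
    using assms by auto
  show "(\<lambda>(x, y). f x * g y) \<in> borel_measurable (lborel \<Otimes>\<^sub>M lborel)" by measurable
  show "integrable lborel (\<lambda>x. \<integral>y. norm (case (x, y) of (x, y) \<Rightarrow> f x * g y) \<partial>lborel)"
    using assms by (simp add: norm_mult)
  show "AE x in lborel. integrable lborel (\<lambda>y. case (x, y) of (x, y) \<Rightarrow> f x * g y)"
    using assms by simp
qed

lemma gaussian_ft:
  assumes "\<sigma> > 0"
  shows "(LINT P|lborel. cis (P * s) * of_real (exp (- (P / \<sigma>)\<^sup>2 / 2))) =
    of_real (\<sigma> * sqrt (2 * pi) * exp (- (\<sigma> * s)\<^sup>2 / 2))"
proof -
  have "complex_of_real (exp (- ((\<sigma> * s)\<^sup>2) / 2)) = char std_normal_distribution (\<sigma> * s)"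
    by (simp add: char_std_normal_distribution)
  also have "\<dots> = (LINT x|lborel. std_normal_density x *\<^sub>R iexp (\<sigma> * s * x))"
    unfolding char_def by (subst integral_density) (auto simp: normal_density_nonneg)
  also have "\<dots> = (LINT x|lborel. of_real (1 / sqrt (2 * pi)) * (cis ((0 + \<sigma> * x) * s) * of_real (exp (- ((0 + \<sigma> * x) / \<sigma>)\<^sup>2 / 2))))"
    using assms by (intro Bochner_Integration.integral_cong)
      (auto simp: std_normal_density_def scaleR_conv_of_real cis_conv_exp mult_ac)
  also have "\<dots> = of_real (1 / sqrt (2 * pi)) * (LINT x|lborel. (cis ((0 + \<sigma> * x) * s) * of_real (exp (- ((0 + \<sigma> * x) / \<sigma>)\<^sup>2 / 2))))"
    by simp
  finally have *: "(LINT x|lborel. (cis ((0 + \<sigma> * x) * s) * of_real (exp (- ((0 + \<sigma> * x) / \<sigma>)\<^sup>2 / 2)))) =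
      of_real (sqrt (2 * pi) * exp (- (\<sigma> * s)\<^sup>2 / 2))"
    by (simp add: field_simps)
  show ?thesis
    using assms by (subst lborel_integral_real_affine[of \<sigma> _ 0])
      (simp_all only: * abs_of_pos scaleR_conv_of_real, simp_all)
qed

text \<open>A Gaussian factor of width \<open>Suc n\<close> makes the double integral absolutely
  convergent. After Fubini it is an average of \<open>\<phi>\<close> against a normal density that
  shrinks to \<open>l\<close>. Both forms converge by dominated convergence, and the limit is
  unique.\<close>

lemma fourier_inversion:
  fixes \<phi> :: "real \<Rightarrow> complex"
  assumes "test_function \<phi>"
  shows "(LINT P|lborel. ft \<phi> P * cis (P * l)) = 2 * pi * \<phi> l"
proof (rule LIMSEQ_unique)
  define \<gamma> where "\<gamma> n P = exp (- (P / real (Suc n))\<^sup>2 / 2)" for n P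
  have cont: "continuous_on X \<phi>" for X :: "real set" by (rule smooth_continuous_on[OF test_function_smooth[OF assms]])
  have [measurable]: "\<phi> \<in> borel_measurable borel" by (rule borel_measurable_continuous_onI[OF cont])
  have [measurable]: "ft \<phi> \<in> borel_measurable borel" by (rule borel_measurable_continuous_onI[OF continuous_on_ft[OF assms]])
  have [measurable]: "cis \<in> borel_measurable borel"
    by (rule borel_measurable_continuous_onI) (rule continuous_on_cis[OF continuous_on_id])
  show "(\<lambda>n. LINT P|lborel. ft \<phi> P * cis (P * l) * of_real (\<gamma> n P)) \<longlonglongrightarrow> (LINT P|lborel. ft \<phi> P * cis (P * l))"
  proof (rule integral_dominated_convergence)
    show "integrable lborel (\<lambda>P. norm (ft \<phi> P))" using integrable_ft[OF assms] by (rule integrable_norm)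
    show "AE P in lborel. (\<lambda>n. ft \<phi> P * cis (P * l) * of_real (\<gamma> n P)) \<longlonglongrightarrow> ft \<phi> P * cis (P * l)"
    proof (rule AE_I2)
      fix P
      have "(\<lambda>n. P / real (Suc n)) \<longlonglongrightarrow> 0" using LIMSEQ_Suc[OF lim_const_over_n[of P]] by simp
      then have "(\<lambda>n. \<gamma> n P) \<longlonglongrightarrow> exp (- 0\<^sup>2 / 2)" unfolding \<gamma>_def by (intro tendsto_intros) auto
      then have "(\<lambda>n. ft \<phi> P * cis (P * l) * of_real (\<gamma> n P)) \<longlonglongrightarrow> ft \<phi> P * cis (P * l) * of_real (exp (- 0\<^sup>2 / 2))"
        by (intro tendsto_intros)
      then show "(\<lambda>n. ft \<phi> P * cis (P * l) * of_real (\<gamma> n P)) \<longlonglongrightarrow> ft \<phi> P * cis (P * l)" by simp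
    qed
    show "AE P in lborel. norm (ft \<phi> P * cis (P * l) * of_real (\<gamma> n P)) \<le> norm (ft \<phi> P)" for n
      by (rule AE_I2) (auto simp: norm_mult \<gamma>_def intro!: mult_left_le)
  qed (auto simp: \<gamma>_def)
  have "(LINT P|lborel. ft \<phi> P * cis (P * l) * of_real (\<gamma> n P)) =
      (LINT s|lborel. \<phi> (l + s / real (Suc n)) * of_real (2 * pi * std_normal_density s))" for n
  proof -
    define \<sigma> where "\<sigma> = real (Suc n)"
    have \<sigma>: "\<sigma> > 0" by (simp add: \<sigma>_def)
    have g: "integrable lborel (\<lambda>P. complex_of_real (\<gamma> n P))"
    proof -
      have "integrable lborel (\<lambda>P. sqrt (2 * pi) * std_normal_density (0 + (1 / \<sigma>) * P))"
        using \<sigma> integrable_normal_moment[of 1 0 0] by (intro integrable_mult_right lborel_integrable_real_affine) auto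
      also have "(\<lambda>P. sqrt (2 * pi) * std_normal_density (0 + (1 / \<sigma>) * P)) = \<gamma> n"
        by (auto simp: std_normal_density_def \<gamma>_def \<sigma>_def fun_eq_iff)
      finally show ?thesis by simp
    qed
    have i: "integrable (lborel \<Otimes>\<^sub>M lborel) (\<lambda>(t, P). \<phi> t * (cis (P * (l - t)) * of_real (\<gamma> n P)))"
    proof (rule Bochner_Integration.integrable_bound)
      show "integrable (lborel \<Otimes>\<^sub>M lborel) (\<lambda>(t, P). \<phi> t * of_real (\<gamma> n P))"
        using integrable_test_function[OF assms, of "\<lambda>_. 1"] g by (intro integrable_lborel_pair) auto
      show "(\<lambda>(t, P). \<phi> t * (cis (P * (l - t)) * of_real (\<gamma> n P))) \<in> borel_measurable (lborel \<Otimes>\<^sub>M lborel)"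
        unfolding \<gamma>_def by measurable
    qed (auto simp: norm_mult)
    have "(LINT P|lborel. ft \<phi> P * cis (P * l) * of_real (\<gamma> n P)) =
        (LINT P|lborel. LINT t|lborel. \<phi> t * (cis (P * (l - t)) * of_real (\<gamma> n P)))"
    proof (intro Bochner_Integration.integral_cong refl)
      fix P
      have "ft \<phi> P * cis (P * l) * of_real (\<gamma> n P) = (LINT t|lborel. \<phi> t * cis (- (P * t)) * (cis (P * l) * of_real (\<gamma> n P)))"
        by (simp only: ft_def mult.assoc flip: integral_mult_left_zero)
      also have "\<dots> = (LINT t|lborel. \<phi> t * (cis (P * (l - t)) * of_real (\<gamma> n P)))"
      proof (intro Bochner_Integration.integral_cong refl)
        fix t
        have "cis (- (P * t)) * cis (P * l) = cis (P * (l - t))" by (simp add: cis_mult algebra_simps)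
        then show "\<phi> t * cis (- (P * t)) * (cis (P * l) * of_real (\<gamma> n P)) = \<phi> t * (cis (P * (l - t)) * of_real (\<gamma> n P))"
          by (simp flip: mult.assoc)
      qed
      finally show "ft \<phi> P * cis (P * l) * of_real (\<gamma> n P) = (LINT t|lborel. \<phi> t * (cis (P * (l - t)) * of_real (\<gamma> n P)))" .
    qed
    also have "\<dots> = (LINT t|lborel. LINT P|lborel. \<phi> t * (cis (P * (l - t)) * of_real (\<gamma> n P)))"
      by (rule lborel_pair.Fubini_integral[OF i])
    also have "\<dots> = (LINT t|lborel. \<phi> t * of_real (\<sigma> * sqrt (2 * pi) * exp (- (\<sigma> * (l - t))\<^sup>2 / 2)))"
      unfolding \<gamma>_def \<sigma>_def[symmetric] by (simp only: integral_mult_right_zero gaussian_ft[OF \<sigma>])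
    \<comment> \<open>The substitution \<open>t = l + s / \<sigma>\<close> rescales the shrinking
      density to the standard one, so that the index remains only in the argument of
      \<open>\<phi>\<close>.\<close>
    also have "\<dots> = (1 / \<sigma>) *\<^sub>R (LINT s|lborel. \<phi> (l + (1 / \<sigma>) * s) * of_real (\<sigma> * sqrt (2 * pi) * exp (- (\<sigma> * (l - (l + (1 / \<sigma>) * s)))\<^sup>2 / 2)))"
      using \<sigma> by (subst lborel_integral_real_affine[of "1 / \<sigma>" _ l]) auto
    also have "\<dots> = (LINT s|lborel. \<phi> (l + s / \<sigma>) * of_real (2 * pi * std_normal_density s))"
    proof -
      have "1 / \<sigma> * (\<sigma> * sqrt (2 * pi) * exp (- (\<sigma> * (l - (l + (1 / \<sigma>) * s)))\<^sup>2 / 2)) = 2 * pi * std_normal_density s" for s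
        using \<sigma> by (simp add: std_normal_density_def field_simps real_sqrt_mult)
      then have "(1 / \<sigma>) *\<^sub>R (\<phi> (l + (1 / \<sigma>) * s) * of_real (\<sigma> * sqrt (2 * pi) * exp (- (\<sigma> * (l - (l + (1 / \<sigma>) * s)))\<^sup>2 / 2)))
          = \<phi> (l + s / \<sigma>) * of_real (2 * pi * std_normal_density s)" for s
        by (metis (no_types, lifting) mult.left_commute mult_1 of_real_mult scaleR_conv_of_real times_divide_eq_left)
      then show ?thesis unfolding integral_scaleR_right[symmetric] by simp
    qed
    finally show ?thesis by (simp add: \<sigma>_def)
  qed
  moreover have "(\<lambda>n. LINT s|lborel. \<phi> (l + s / real (Suc n)) * of_real (2 * pi * std_normal_density s)) \<longlonglongrightarrow>
      (LINT s|lborel. \<phi> l * of_real (2 * pi * std_normal_density s))"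
  proof -
    obtain A where A: "A > 0" "\<And>x. A \<le> norm x \<Longrightarrow> \<phi> x = 0" using test_function_support[OF assms] by metis
    have "bounded (\<phi> ` cball 0 A)" by (intro compact_imp_bounded compact_continuous_image cont compact_cball)
    then obtain B where B: "\<forall>x\<in>cball 0 A. norm (\<phi> x) \<le> B" unfolding bounded_iff by blast
    have B: "norm (\<phi> x) \<le> max B 0" for x
      using A(2)[of x] B[rule_format, of x] by (cases "norm x \<le> A") auto
    show ?thesis
    proof (rule integral_dominated_convergence)
      show "integrable lborel (\<lambda>s. max B 0 * (2 * pi * std_normal_density s))"
        using integrable_normal_moment[of 1 0 0] by (intro integrable_mult_right) auto
      show "AE s in lborel. (\<lambda>n. \<phi> (l + s / real (Suc n)) * of_real (2 * pi * std_normal_density s))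
          \<longlonglongrightarrow> \<phi> l * of_real (2 * pi * std_normal_density s)"
      proof (rule AE_I2)
        fix s
        have "(\<lambda>n. l + s / real (Suc n)) \<longlonglongrightarrow> l + 0"
          using LIMSEQ_Suc[OF lim_const_over_n[of s]] by (intro tendsto_intros) simp
        then have "(\<lambda>n. \<phi> (l + s / real (Suc n))) \<longlonglongrightarrow> \<phi> l"
          using continuous_on_tendsto_compose[OF cont[of UNIV]] by simp
        then show "(\<lambda>n. \<phi> (l + s / real (Suc n)) * of_real (2 * pi * std_normal_density s))
          \<longlonglongrightarrow> \<phi> l * of_real (2 * pi * std_normal_density s)" by (intro tendsto_intros)
      qed
      show "AE s in lborel. norm (\<phi> (l + s / real (Suc n)) * of_real (2 * pi * std_normal_density s))
          \<le> max B 0 * (2 * pi * std_normal_density s)" for n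
        by (rule AE_I2) (auto simp: norm_mult normal_density_nonneg intro!: mult_mono B)
    qed auto
  qed
  moreover have "(LINT s|lborel. \<phi> l * of_real (2 * pi * std_normal_density s)) = 2 * pi * \<phi> l"
  proof -
    have "(LINT s|lborel. complex_of_real (2 * pi * std_normal_density s)) = of_real (2 * pi)"
      using integral_normal_moment_even[of 1 0 0] by (simp del: of_real_mult)
    then show ?thesis by simp
  qed
  ultimately show "(\<lambda>n. LINT P|lborel. ft \<phi> P * cis (P * l) * of_real (\<gamma> n P)) \<longlonglongrightarrow> 2 * pi * \<phi> l"
    by (simp add: mult_ac)
qed

section \<open>Uniform asymptotic expansions\<close>

text \<open>Remainders carry explicit weights on a prescribed set of \<open>h\<close> in place of
  Landau symbols, because the weights will depend on the Fourier variables and have to be integrated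
  over them.\<close>

definition expn :: "real set \<Rightarrow> (real \<Rightarrow> complex) \<Rightarrow> complex fps \<Rightarrow> (nat \<Rightarrow> real) \<Rightarrow> bool" where
  "expn H F Fs W \<longleftrightarrow> (\<forall>N. \<forall>h\<in>H. norm (F h - (\<Sum>n<N. of_real h ^ n * fps_nth Fs n)) \<le> h ^ N * W N)"

lemma expnD: "expn H F Fs W \<Longrightarrow> h \<in> H \<Longrightarrow> norm (F h - (\<Sum>n<N. of_real h ^ n * fps_nth Fs n)) \<le> h ^ N * W N"
  by (simp add: expn_def)

lemma expn_nonneg:
  assumes "expn H F Fs W" "h \<in> H" "H \<subseteq> {0<..1}"
  shows "0 \<le> W N"
proof -
  have "0 \<le> h ^ N * W N" using expnD[OF assms(1,2)] norm_ge_zero by (rule order_trans[rotated])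
  moreover have "h ^ N > 0" using assms by auto
  ultimately show ?thesis by (simp add: zero_le_mult_iff)
qed

text \<open>The term of order \<open>n\<close> is the difference of two consecutive remainders, and
  \<open>h \<le> 1\<close> absorbs the extra power of \<open>h\<close>.\<close>

lemma expn_coeff:
  assumes "expn H F Fs W" "h \<in> H" "H \<subseteq> {0<..1}"
  shows "norm (fps_nth Fs n) \<le> W n + W (Suc n)"
proof -
  have h: "0 < h" "h \<le> 1" using assms by auto
  have "of_real h ^ n * fps_nth Fs n = (F h - (\<Sum>i<n. of_real h ^ i * fps_nth Fs i)) - (F h - (\<Sum>i<Suc n. of_real h ^ i * fps_nth Fs i))"
    by simp
  also have "norm \<dots> \<le> h ^ n * W n + h ^ Suc n * W (Suc n)"
    by (intro order_trans[OF norm_triangle_ineq4] add_mono expnD[OF assms(1,2)])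
  also have "\<dots> \<le> h ^ n * (W n + W (Suc n))"
    using h expn_nonneg[OF assms, of "Suc n"] by (simp add: distrib_left mult_left_le_one_le mult.assoc)
  finally show ?thesis using h by (simp add: norm_mult norm_power)
qed

text \<open>The error is \<open>F\<close> times the error of \<open>G\<close>, plus the terms of
  order \<open>j\<close> in \<open>G\<close> times the errors of \<open>F\<close> at order
  \<open>N - j\<close>; the weight lists exactly these contributions, with \<open>expn_coeff\<close>
  bounding the terms of \<open>G\<close>.\<close>

lemma expn_mult:
  assumes F: "expn H F Fs W" and G: "expn H G Gs V" and H: "H \<subseteq> {0<..1}"
  shows "expn H (\<lambda>h. F h * G h) (Fs * Gs) (\<lambda>N. W 0 * V N + (\<Sum>j<N. (V j * W (N - j) + V (Suc j) * W (N - j))))"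
  unfolding expn_def
proof (intro allI ballI)
  fix N h assume h: "h \<in> H"
  then have h0: "0 < h" "h \<le> 1" using H by auto
  let ?f = "\<lambda>n. of_real h ^ n * fps_nth Fs n" and ?g = "\<lambda>n. of_real h ^ n * fps_nth Gs n"
  have "(\<Sum>n<N. of_real h ^ n * fps_nth (Fs * Gs) n) = (\<Sum>n<N. \<Sum>j\<le>n. ?g j * ?f (n - j))"
  proof (intro sum.cong refl)
    fix n
    have "of_real h ^ n * fps_nth (Fs * Gs) n = (\<Sum>j\<le>n. of_real h ^ n * (fps_nth Gs j * fps_nth Fs (n - j)))"
      by (simp add: mult.commute[of Fs] fps_mult_nth atLeast0AtMost sum_distrib_left)
    also have "\<dots> = (\<Sum>j\<le>n. ?g j * ?f (n - j))"
    proof (intro sum.cong refl)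
      fix j assume "j \<in> {..n}"
      then have "complex_of_real h ^ n = of_real h ^ j * of_real h ^ (n - j)" by (simp flip: power_add)
      then show "of_real h ^ n * (fps_nth Gs j * fps_nth Fs (n - j)) = ?g j * ?f (n - j)" by simp
    qed
    finally show "of_real h ^ n * fps_nth (Fs * Gs) n = (\<Sum>j\<le>n. ?g j * ?f (n - j))" .
  qed
  also have "\<dots> = (\<Sum>(n, j)\<in>(SIGMA n:{..<N}. {..n}). ?g j * ?f (n - j))"
    by (simp add: sum.Sigma)
  also have "\<dots> = (\<Sum>(j, m)\<in>(SIGMA j:{..<N}. {..<N - j}). ?g j * ?f m)"
    by (rule sum.reindex_bij_witness[of _ "\<lambda>(j, m). (j + m, j)" "\<lambda>(n, j). (j, n - j)"]) auto
  also have "\<dots> = (\<Sum>j<N. ?g j * (\<Sum>m<N - j. ?f m))"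
    by (simp add: sum.Sigma sum_distrib_left)
  finally have eq: "F h * G h - (\<Sum>n<N. of_real h ^ n * fps_nth (Fs * Gs) n) =
      F h * (G h - (\<Sum>j<N. ?g j)) + (\<Sum>j<N. ?g j * (F h - (\<Sum>m<N - j. ?f m)))"
    by (simp add: right_diff_distrib sum_subtractf sum_distrib_left sum_distrib_right mult.commute)
  have F0: "norm (F h) \<le> W 0" using expnD[OF F h, of 0] by simp
  have "norm (F h * (G h - (\<Sum>j<N. ?g j))) \<le> W 0 * (h ^ N * V N)"
    unfolding norm_mult by (intro mult_mono F0 expnD[OF G h]) (auto intro: order_trans[OF norm_ge_zero F0])
  moreover have "norm (\<Sum>j<N. ?g j * (F h - (\<Sum>m<N - j. ?f m))) \<le> (\<Sum>j<N. h ^ N * (V j * W (N - j) + V (Suc j) * W (N - j)))"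
  proof (rule sum_norm_le)
    fix j assume j: "j \<in> {..<N}"
    have "norm (?g j * (F h - (\<Sum>m<N - j. ?f m))) \<le> (h ^ j * (V j + V (Suc j))) * (h ^ (N - j) * W (N - j))"
      unfolding norm_mult norm_power using h0 expn_coeff[OF G h H, of j] expn_nonneg[OF G h H]
      by (intro mult_mono expnD[OF F h]) (auto simp: mult_left_mono)
    also have "\<dots> = (h ^ j * h ^ (N - j)) * (V j * W (N - j) + V (Suc j) * W (N - j))"
      by (simp add: algebra_simps)
    also have "h ^ j * h ^ (N - j) = h ^ N" using j by (simp flip: power_add)
    finally show "norm (?g j * (F h - (\<Sum>m<N - j. ?f m))) \<le> h ^ N * (V j * W (N - j) + V (Suc j) * W (N - j))" .
  qed
  ultimately have "norm (F h * G h - (\<Sum>n<N. of_real h ^ n * fps_nth (Fs * Gs) n)) \<le>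
      W 0 * (h ^ N * V N) + (\<Sum>j<N. h ^ N * (V j * W (N - j) + V (Suc j) * W (N - j)))"
    unfolding eq by (intro order_trans[OF norm_triangle_ineq] add_mono)
  then show "norm (F h * G h - (\<Sum>n<N. of_real h ^ n * fps_nth (Fs * Gs) n)) \<le>
      h ^ N * (W 0 * V N + (\<Sum>j<N. (V j * W (N - j) + V (Suc j) * W (N - j))))"
    by (simp add: algebra_simps sum_distrib_left)
qed

text \<open>The range \<open>H z\<close> of \<open>h\<close> depends on \<open>z\<close>; the remainder weights are restricted to the class \<open>\<W>\<close>.\<close>

definition uexp :: "('z \<Rightarrow> real set) \<Rightarrow> ('z \<Rightarrow> real) set \<Rightarrow> (real \<Rightarrow> 'z \<Rightarrow> complex) \<Rightarrow> ('z \<Rightarrow> complex fps) \<Rightarrow> bool" where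
  "uexp H \<W> F Fs \<longleftrightarrow> (\<exists>W. (\<forall>N. W N \<in> \<W>) \<and> (\<forall>z. expn (H z) (\<lambda>h. F h z) (Fs z) (\<lambda>N. W N z)))"

definition add_closed :: "('z \<Rightarrow> real) set \<Rightarrow> bool" where
  "add_closed \<W> \<longleftrightarrow> (\<lambda>z. 0) \<in> \<W> \<and> (\<forall>v\<in>\<W>. \<forall>w\<in>\<W>. (\<lambda>z. v z + w z) \<in> \<W>)"

lemma add_closed_sum:
  assumes "add_closed \<W>" "\<And>i. i \<in> I \<Longrightarrow> w i \<in> \<W>"
  shows "(\<lambda>z. \<Sum>i\<in>I. w i z) \<in> \<W>"
  using assms(2) by (induction I rule: infinite_finite_induct) (use assms(1) in \<open>auto simp: add_closed_def\<close>)

lemma uexp_mult: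
  assumes "uexp H \<W> F Fs" "uexp H \<V> G Gs" and H: "\<And>z. H z \<subseteq> {0<..1}"
    and mul: "\<And>w v. w \<in> \<W> \<Longrightarrow> v \<in> \<V> \<Longrightarrow> (\<lambda>z. w z * v z) \<in> \<X>" and add: "add_closed \<X>"
  shows "uexp H \<X> (\<lambda>h z. F h z * G h z) (\<lambda>z. Fs z * Gs z)"
proof -
  obtain W where W: "\<And>N. W N \<in> \<W>" "\<And>z. expn (H z) (\<lambda>h. F h z) (Fs z) (\<lambda>N. W N z)"
    using assms(1) by (auto simp: uexp_def)
  obtain V where V: "\<And>N. V N \<in> \<V>" "\<And>z. expn (H z) (\<lambda>h. G h z) (Gs z) (\<lambda>N. V N z)"
    using assms(2) by (auto simp: uexp_def)
  let ?X = "\<lambda>N z. W 0 z * V N z + (\<Sum>j<N. (V j z * W (N - j) z + V (Suc j) z * W (N - j) z))"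
  have a: "(\<lambda>z. v z + w z) \<in> \<X>" if "v \<in> \<X>" "w \<in> \<X>" for v w
    using add that by (auto simp: add_closed_def)
  have m: "(\<lambda>z. V i z * W j z) \<in> \<X>" "(\<lambda>z. W j z * V i z) \<in> \<X>" for i j
    using mul[OF W(1) V(1), of j i] by (simp_all add: mult.commute)
  have "?X N \<in> \<X>" for N
    by (intro a add_closed_sum[OF add] m)
  moreover have "expn (H z) (\<lambda>h. F h z * G h z) (Fs z * Gs z) (\<lambda>N. ?X N z)" for z
    by (rule expn_mult[OF W(2) V(2) H])
  ultimately show ?thesis unfolding uexp_def by (intro exI[of _ ?X]) auto
qed

text \<open>Division by \<open>h ^ j\<close> uses up \<open>j\<close> orders: the new remainder of
  order \<open>N\<close> is the old one of order \<open>N + j\<close>.\<close>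

lemma uexp_shift:
  assumes "uexp H \<W> F Fs" and H: "\<And>z. H z \<subseteq> {0<..1}" and low: "\<And>z n. n < j \<Longrightarrow> fps_nth (Fs z) n = 0"
  shows "uexp H \<W> (\<lambda>h z. F h z / of_real h ^ j) (\<lambda>z. fps_shift j (Fs z))"
proof -
  obtain W where W: "\<And>N. W N \<in> \<W>" "\<And>z. expn (H z) (\<lambda>h. F h z) (Fs z) (\<lambda>N. W N z)"
    using assms(1) by (auto simp: uexp_def)
  have "expn (H z) (\<lambda>h. F h z / of_real h ^ j) (fps_shift j (Fs z)) (\<lambda>N. W (N + j) z)" for z
    unfolding expn_def
  proof (intro allI ballI)
    fix N h assume h: "h \<in> H z"
    then have h0: "0 < h" using H[of z] by auto
    have "(\<Sum>n<N + j. of_real h ^ n * fps_nth (Fs z) n) = (\<Sum>n\<in>{j..<N + j}. of_real h ^ n * fps_nth (Fs z) n)"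
      by (rule sum.mono_neutral_right) (auto simp: low)
    also have "\<dots> = (\<Sum>n<N. of_real h ^ (n + j) * fps_nth (Fs z) (n + j))"
      using sum.shift_bounds_nat_ivl[of "\<lambda>n. of_real h ^ n * fps_nth (Fs z) n" 0 j N] by (simp add: atLeast0LessThan)
    also have "\<dots> = of_real h ^ j * (\<Sum>n<N. of_real h ^ n * fps_nth (Fs z) (n + j))"
      by (simp add: sum_distrib_left power_add mult_ac)
    finally have eq: "F h z / of_real h ^ j - (\<Sum>n<N. of_real h ^ n * fps_nth (fps_shift j (Fs z)) n) =
        (F h z - (\<Sum>n<N + j. of_real h ^ n * fps_nth (Fs z) n)) / of_real h ^ j"
      using h0 by (simp add: diff_divide_distrib)
    show "norm (F h z / of_real h ^ j - (\<Sum>n<N. of_real h ^ n * fps_nth (fps_shift j (Fs z)) n)) \<le> h ^ N * W (N + j) z"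
      using expnD[OF W(2) h, of "N + j"] h0 unfolding eq
      by (simp add: norm_divide norm_power field_simps power_add)
  qed
  with W(1) show ?thesis unfolding uexp_def by (intro exI[of _ "\<lambda>N. W (N + j)"]) auto
qed

text \<open>Substitution of \<open>Y\<close> into an expansion in powers of \<open>Y\<close>, with
  each power expanded in \<open>h\<close> on its own. Since power \<open>j\<close> starts at order
  \<open>j\<close>, \<open>Y\<close> itself is of order \<open>h\<close>; so the remainder in
  \<open>Y\<close> is of order \<open>h ^ N\<close>, and only \<open>j \<le> n\<close> reach
  coefficient \<open>n\<close>.\<close>

lemma uexp_compose:
  assumes H: "\<And>z. H z \<subseteq> {0<..1}"
    and Y: "\<And>j. uexp H \<P> (\<lambda>h z. Y h z ^ j) (Ys j)" and low: "\<And>j z n. n < j \<Longrightarrow> fps_nth (Ys j z) n = 0"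
    and \<W>: "add_closed \<W>" and mul: "\<And>w p. w \<in> \<W> \<Longrightarrow> p \<in> \<P> \<Longrightarrow> (\<lambda>z. w z * p z) \<in> \<W>"
    and a: "\<And>j. (\<lambda>z. norm (a j z)) \<in> \<W>" and r: "\<And>N. r N \<in> \<W>" and r0: "\<And>N z. 0 \<le> r N z"
    and A: "\<And>N z h. h \<in> H z \<Longrightarrow> norm (A h z - (\<Sum>j<N. a j z * Y h z ^ j)) \<le> r N z * norm (Y h z) ^ N"
  shows "uexp H \<W> A (\<lambda>z. Abs_fps (\<lambda>n. \<Sum>j\<le>n. a j z * fps_nth (Ys j z) n))"
proof -
  have "\<exists>W. \<forall>j. (\<forall>N. W j N \<in> \<P>) \<and> (\<forall>z. expn (H z) (\<lambda>h. Y h z ^ j) (Ys j z) (\<lambda>N. W j N z))"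
    using Y unfolding uexp_def by (intro choice allI) blast
  then obtain W where W: "\<And>j N. W j N \<in> \<P>" "\<And>j z. expn (H z) (\<lambda>h. Y h z ^ j) (Ys j z) (\<lambda>N. W j N z)"
    by blast
  have rw: "(\<lambda>z. w z * W (Suc 0) (Suc 0) z ^ N) \<in> \<W>" if "w \<in> \<W>" for w N
  proof (induction N)
    case (Suc N)
    from mul[OF Suc W(1)[of "Suc 0" "Suc 0"]] show ?case by (simp add: mult_ac)
  qed (simp add: that)
  let ?V = "\<lambda>N z. r N z * W (Suc 0) (Suc 0) z ^ N + (\<Sum>j<N. norm (a j z) * W j N z)"
  have add: "(\<lambda>z. v z + w z) \<in> \<W>" if "v \<in> \<W>" "w \<in> \<W>" for v w
    using \<W> that by (auto simp: add_closed_def)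
  have "?V N \<in> \<W>" for N
    by (intro add rw r add_closed_sum[OF \<W>] mul a W)
  moreover have "expn (H z) (\<lambda>h. A h z) (Abs_fps (\<lambda>n. \<Sum>j\<le>n. a j z * fps_nth (Ys j z) n)) (\<lambda>N. ?V N z)" for z
    unfolding expn_def
  proof (intro allI ballI)
    fix N h assume h: "h \<in> H z"
    then have h0: "0 < h" using H[of z] by auto
    have Y1: "norm (Y h z) \<le> h * W (Suc 0) (Suc 0) z"
      using expnD[OF W(2)[of z "Suc 0"] h, of "Suc 0"] low[of 0 "Suc 0" z] by simp
    have "(\<Sum>n<N. of_real h ^ n * (\<Sum>j\<le>n. a j z * fps_nth (Ys j z) n)) =
        (\<Sum>n<N. of_real h ^ n * (\<Sum>j<N. a j z * fps_nth (Ys j z) n))"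
    proof (rule sum.cong[OF refl])
      fix n assume "n \<in> {..<N}"
      then have "(\<Sum>j\<le>n. a j z * fps_nth (Ys j z) n) = (\<Sum>j<N. a j z * fps_nth (Ys j z) n)"
        by (intro sum.mono_neutral_left) (auto simp: low)
      then show "of_real h ^ n * (\<Sum>j\<le>n. a j z * fps_nth (Ys j z) n) = of_real h ^ n * (\<Sum>j<N. a j z * fps_nth (Ys j z) n)"
        by simp
    qed
    also have "\<dots> = (\<Sum>j<N. a j z * (\<Sum>n<N. of_real h ^ n * fps_nth (Ys j z) n))"
      unfolding sum_distrib_left by (subst sum.swap) (simp add: mult_ac)
    finally have eq: "A h z - (\<Sum>n<N. of_real h ^ n * fps_nth (Abs_fps (\<lambda>n. \<Sum>j\<le>n. a j z * fps_nth (Ys j z) n)) n) =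
       (A h z - (\<Sum>j<N. a j z * Y h z ^ j)) + (\<Sum>j<N. a j z * (Y h z ^ j - (\<Sum>n<N. of_real h ^ n * fps_nth (Ys j z) n)))"
      by (simp add: right_diff_distrib sum_subtractf)
    have "norm (A h z - (\<Sum>j<N. a j z * Y h z ^ j)) \<le> r N z * (h * W (Suc 0) (Suc 0) z) ^ N"
      using Y1 r0 by (intro order_trans[OF A[OF h]] mult_left_mono power_mono) auto
    moreover have "norm (\<Sum>j<N. a j z * (Y h z ^ j - (\<Sum>n<N. of_real h ^ n * fps_nth (Ys j z) n))) \<le>
        (\<Sum>j<N. norm (a j z) * (h ^ N * W j N z))"
      by (intro sum_norm_le) (auto simp: norm_mult intro!: mult_left_mono expnD[OF W(2) h])
    ultimately have "norm (A h z - (\<Sum>n<N. of_real h ^ n * fps_nth (Abs_fps (\<lambda>n. \<Sum>j\<le>n. a j z * fps_nth (Ys j z) n)) n)) \<le>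
        r N z * (h * W (Suc 0) (Suc 0) z) ^ N + (\<Sum>j<N. norm (a j z) * (h ^ N * W j N z))"
      unfolding eq by (intro order_trans[OF norm_triangle_ineq] add_mono)
    then show "norm (A h z - (\<Sum>n<N. of_real h ^ n * fps_nth (Abs_fps (\<lambda>n. \<Sum>j\<le>n. a j z * fps_nth (Ys j z) n)) n)) \<le> h ^ N * ?V N z"
      by (simp add: distrib_left sum_distrib_left power_mult_distrib mult_ac)
  qed
  ultimately show ?thesis unfolding uexp_def by (intro exI[of _ ?V]) auto
qed

subsection \<open>Weights\<close>

text \<open>The two weight classes of the integrand. Phase, amplitude and Taylor factors cost powers
  of \<open>\<rho>\<close>, whereas Fourier transforms of test functions gain every power;
  \<open>sch\<close> is stable under multiplication by \<open>pol\<close>.\<close>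

definition pol :: "('z \<Rightarrow> real) \<Rightarrow> ('z \<Rightarrow> real) set" where
  "pol \<rho> = {w. \<exists>B M. \<forall>z. \<bar>w z\<bar> \<le> B * \<rho> z ^ M}"

definition sch :: "('z \<Rightarrow> real) \<Rightarrow> ('z \<Rightarrow> real) set" where
  "sch \<rho> = {w. \<forall>k. \<exists>B. \<forall>z. \<bar>w z\<bar> * \<rho> z ^ k \<le> B}"

context
  fixes \<rho> :: "'z \<Rightarrow> real"
  assumes \<rho>: "\<And>z. 1 \<le> \<rho> z"
begin

lemma pol_E:
  assumes "w \<in> pol \<rho>"
  obtains B M where "B \<ge> 0" "\<And>z. \<bar>w z\<bar> \<le> B * \<rho> z ^ M"
proof -
  obtain B M where B: "\<And>z. \<bar>w z\<bar> \<le> B * \<rho> z ^ M" using assms by (auto simp: pol_def)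
  have "\<bar>w z\<bar> \<le> \<bar>B\<bar> * \<rho> z ^ M" for z
    using \<rho>[of z] by (intro order_trans[OF B] mult_right_mono) auto
  then show ?thesis using that[of "\<bar>B\<bar>" M] by simp
qed

lemma pol_mult: "v \<in> pol \<rho> \<Longrightarrow> w \<in> pol \<rho> \<Longrightarrow> (\<lambda>z. v z * w z) \<in> pol \<rho>"
proof -
  assume "v \<in> pol \<rho>" "w \<in> pol \<rho>"
  then obtain B M C N where B: "B \<ge> 0" "\<And>z. \<bar>v z\<bar> \<le> B * \<rho> z ^ M" and C: "C \<ge> 0" "\<And>z. \<bar>w z\<bar> \<le> C * \<rho> z ^ N"
    by (metis pol_E)
  have "\<bar>v z * w z\<bar> \<le> (B * C) * \<rho> z ^ (M + N)" for z
  proof -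
    have "\<bar>v z * w z\<bar> \<le> (B * \<rho> z ^ M) * (C * \<rho> z ^ N)"
      unfolding abs_mult by (intro mult_mono B C) (use B \<rho>[of z] in auto)
    then show ?thesis by (simp add: power_add mult_ac)
  qed
  then show ?thesis unfolding pol_def by blast
qed

lemma add_closed_pol: "add_closed (pol \<rho>)"
  unfolding add_closed_def
proof (intro conjI ballI)
  show "(\<lambda>z. 0) \<in> pol \<rho>" unfolding pol_def by (auto intro!: exI[of _ 0])
  fix v w assume "v \<in> pol \<rho>" "w \<in> pol \<rho>"
  then obtain B M C N where B: "B \<ge> 0" "\<And>z. \<bar>v z\<bar> \<le> B * \<rho> z ^ M" and C: "C \<ge> 0" "\<And>z. \<bar>w z\<bar> \<le> C * \<rho> z ^ N"
    by (metis pol_E)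
  have "\<bar>v z + w z\<bar> \<le> (B + C) * \<rho> z ^ (M + N)" for z
  proof -
    have "\<rho> z ^ M \<le> \<rho> z ^ (M + N)" "\<rho> z ^ N \<le> \<rho> z ^ (M + N)" using \<rho>[of z] by (auto intro: power_increasing)
    then have "B * \<rho> z ^ M + C * \<rho> z ^ N \<le> (B + C) * \<rho> z ^ (M + N)"
      using B(1) C(1) by (simp add: distrib_right add_mono mult_left_mono)
    then show ?thesis using B(2)[of z] C(2)[of z] by linarith
  qed
  then show "(\<lambda>z. v z + w z) \<in> pol \<rho>" unfolding pol_def by blast
qed

lemma pol_const: "(\<lambda>z. c) \<in> pol \<rho>"
  unfolding pol_def mem_Collect_eq by (rule exI[of _ "\<bar>c\<bar>"], rule exI[of _ 0]) simp

lemma sch_pol_mult: "v \<in> sch \<rho> \<Longrightarrow> w \<in> pol \<rho> \<Longrightarrow> (\<lambda>z. v z * w z) \<in> sch \<rho>"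
proof -
  assume v: "v \<in> sch \<rho>" and "w \<in> pol \<rho>"
  then obtain C N where C: "C \<ge> 0" "\<And>z. \<bar>w z\<bar> \<le> C * \<rho> z ^ N"
    by (metis pol_E)
  have "\<exists>B. \<forall>z. \<bar>v z * w z\<bar> * \<rho> z ^ k \<le> B" for k
  proof -
    obtain B where B: "\<And>z. \<bar>v z\<bar> * \<rho> z ^ (N + k) \<le> B" using v by (auto simp: sch_def)
    have "\<bar>v z * w z\<bar> * \<rho> z ^ k \<le> C * B" for z
    proof -
      have "\<bar>v z * w z\<bar> * \<rho> z ^ k \<le> (\<bar>v z\<bar> * (C * \<rho> z ^ N)) * \<rho> z ^ k"
        unfolding abs_mult using \<rho>[of z] C(1) by (intro mult_mono mult_left_mono C) auto
      also have "\<dots> = C * (\<bar>v z\<bar> * \<rho> z ^ (N + k))" by (simp add: power_add mult_ac)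
      also have "\<dots> \<le> C * B" using C(1) B by (intro mult_left_mono)
      finally show ?thesis .
    qed
    then show ?thesis by blast
  qed
  then show ?thesis by (simp add: sch_def)
qed

lemma add_closed_sch: "add_closed (sch \<rho>)"
  unfolding add_closed_def
proof (intro conjI ballI)
  show "(\<lambda>z. 0) \<in> sch \<rho>" unfolding sch_def by auto
  fix v w assume v: "v \<in> sch \<rho>" and w: "w \<in> sch \<rho>"
  have "\<exists>B. \<forall>z. \<bar>v z + w z\<bar> * \<rho> z ^ k \<le> B" for k
  proof -
    obtain B C where B: "\<And>z. \<bar>v z\<bar> * \<rho> z ^ k \<le> B" and C: "\<And>z. \<bar>w z\<bar> * \<rho> z ^ k \<le> C"
      using v w unfolding sch_def by blast
    have "\<bar>v z + w z\<bar> * \<rho> z ^ k \<le> B + C" for z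
    proof -
      have "\<bar>v z + w z\<bar> * \<rho> z ^ k \<le> (\<bar>v z\<bar> + \<bar>w z\<bar>) * \<rho> z ^ k"
        using \<rho>[of z] by (intro mult_right_mono abs_triangle_ineq) auto
      then show ?thesis using B[of z] C[of z] by (simp add: distrib_right)
    qed
    then show ?thesis by blast
  qed
  then show "(\<lambda>z. v z + w z) \<in> sch \<rho>" by (simp add: sch_def)
qed

lemma uexp_power:
  assumes F: "uexp H (pol \<rho>) F Fs" and H: "\<And>z. H z \<subseteq> {0<..1}"
  shows "uexp H (pol \<rho>) (\<lambda>h z. F h z ^ j) (\<lambda>z. Fs z ^ j)"
proof (induction j)
  case 0
  have "expn (H z) (\<lambda>h. 1) 1 (\<lambda>N. 1)" for z
    unfolding expn_def
  proof (intro allI ballI)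
    fix N h assume "h \<in> H z"
    have "(\<Sum>n<N. of_real h ^ n * fps_nth 1 n) = (if N = 0 then 0 else (1 :: complex))"
      by (cases N) (auto simp: sum.lessThan_Suc_shift simp del: sum.lessThan_Suc)
    then show "norm (1 - (\<Sum>n<N. of_real h ^ n * fps_nth 1 n) :: complex) \<le> h ^ N * 1"
      using H[of z] \<open>h \<in> H z\<close> by auto
  qed
  then show ?case using pol_const[of 1] unfolding uexp_def by (intro exI[of _ "\<lambda>N z. 1"]) simp
next
  case (Suc j)
  show ?case unfolding power_Suc by (rule uexp_mult[OF F Suc H pol_mult add_closed_pol])
qed

end

text \<open>Induction on the order with the mean value inequality for vector-valued functions,
  applied to the remainder as a function of its endpoint. Compared with Lagrange's form the bound
  lacks the factor \<open>1 / fact N\<close>.\<close>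

lemma taylor_bound:
  fixes G :: "nat \<Rightarrow> real \<Rightarrow> complex"
  assumes "\<And>i x. (G i has_vector_derivative G (Suc i) x) (at x)"
    and "\<And>s. s \<in> closed_segment x y \<Longrightarrow> norm (G N s) \<le> B"
  shows "norm (G 0 y - (\<Sum>j<N. G j x / fact j * of_real (y - x) ^ j)) \<le> B * \<bar>y - x\<bar> ^ N"
  using assms
proof (induction N arbitrary: G y)
  case 0
  then show ?case by auto
next
  case (Suc N)
  let ?r = "\<lambda>s. G 0 s - (\<Sum>j<Suc N. G j x / fact j * of_real (s - x) ^ j)"
  let ?r' = "\<lambda>s. G 1 s - (\<Sum>j<N. G (Suc j) x / fact j * of_real (s - x) ^ j)"
  have d: "(?r has_vector_derivative ?r' s) (at s)" for s
  proof -
    have p: "((\<lambda>s. G j x / fact j * of_real (s - x) ^ j) has_vector_derivative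
        G j x / fact j * (of_nat j * of_real (s - x) ^ (j - 1))) (at s)" for j
    proof -
      have "((\<lambda>s. (s - x) ^ j) has_real_derivative of_nat j * (s - x) ^ (j - 1)) (at s)"
        by (auto intro!: derivative_eq_intros)
      from has_vector_derivative_mult_right[OF has_vector_derivative_of_real[OF this], of "G j x / fact j"]
      show ?thesis by simp
    qed
    have "((\<lambda>s. \<Sum>j<Suc N. G j x / fact j * of_real (s - x) ^ j) has_vector_derivative
        (\<Sum>j<Suc N. G j x / fact j * (of_nat j * of_real (s - x) ^ (j - 1)))) (at s)"
      by (intro has_vector_derivative_sum p)
    also have "(\<Sum>j<Suc N. G j x / fact j * (of_nat j * of_real (s - x) ^ (j - 1))) =
        (\<Sum>j<N. G (Suc j) x / fact j * of_real (s - x) ^ j)"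
      unfolding sum.lessThan_Suc_shift by (simp add: fact_Suc del: of_nat_Suc)
    finally show ?thesis using Suc.prems(1)[of 0 s] by (auto intro: has_vector_derivative_diff)
  qed
  have "B \<ge> 0" using order_trans[OF norm_ge_zero Suc.prems(2)[of x]] by simp
  have b: "norm (?r' s) \<le> B * \<bar>y - x\<bar> ^ N" if s: "s \<in> closed_segment x y" for s
  proof -
    have sub: "closed_segment x s \<subseteq> closed_segment x y"
      using s by (simp add: subset_closed_segment)
    have "norm (?r' s) \<le> B * \<bar>s - x\<bar> ^ N"
      using Suc.IH[of "\<lambda>i. G (Suc i)" s] Suc.prems sub by auto
    also have "\<dots> \<le> B * \<bar>y - x\<bar> ^ N"
      using \<open>B \<ge> 0\<close> segment_bound1[OF s] by (intro mult_left_mono power_mono) (auto simp: abs_minus_commute)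
    finally show ?thesis .
  qed
  have "norm (?r y - ?r x) \<le> (B * \<bar>y - x\<bar> ^ N) * norm (y - x)"
  proof (rule differentiable_bound[of "closed_segment x y" ?r "\<lambda>s h. h *\<^sub>R ?r' s"])
    show "(?r has_derivative (\<lambda>h. h *\<^sub>R ?r' s)) (at s within closed_segment x y)" for s
      using d[of s] by (auto simp: has_vector_derivative_def intro: has_derivative_at_withinI)
    show "onorm (\<lambda>h. h *\<^sub>R ?r' s) \<le> B * \<bar>y - x\<bar> ^ N" if "s \<in> closed_segment x y" for s
      using b[OF that] \<open>B \<ge> 0\<close> by (intro onorm_bound) (auto intro!: mult_left_mono simp: mult.commute)
  qed auto
  moreover have "?r x = 0" by (simp add: sum.lessThan_Suc_shift del: sum.lessThan_Suc)
  ultimately show ?case by (simp add: mult_ac)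
qed

section \<open>Expansions of the factors of the integrand in one Fourier variable\<close>

definition rho1 :: "real \<Rightarrow> real" where "rho1 x = 1 + x\<^sup>2"

text \<open>\<open>sinh (h * x)\<close> and \<open>cosh (h * x)\<close> grow exponentially, so
  weights polynomial in \<open>x\<close> are possible only while \<open>h * x\<close> stays in a
  compact set.\<close>

definition reg :: "real \<Rightarrow> real \<Rightarrow> real set" where
  "reg C x = {h. 0 < h \<and> h \<le> 1 \<and> h * \<bar>x\<bar> \<le> C}"

lemma rho1: "1 \<le> rho1 x" by (simp add: rho1_def)

lemma abs_le_rho1: "\<bar>x\<bar> \<le> rho1 x"
proof -
  have "0 \<le> (\<bar>x\<bar> - 1)\<^sup>2" by simp
  then have "2 * \<bar>x\<bar> \<le> 1 + x\<^sup>2" by (simp add: power2_diff)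
  then show ?thesis by (simp add: rho1_def)
qed

lemma reg_subset: "reg C x \<subseteq> {0<..1}" by (auto simp: reg_def)

lemma pol_abs_power: "(\<lambda>x. B * \<bar>x\<bar> ^ N) \<in> pol rho1"
  unfolding pol_def mem_Collect_eq
  by (rule exI[of _ "\<bar>B\<bar>"], rule exI[of _ N]) (auto simp: abs_mult abs_le_rho1 intro!: mult_left_mono power_mono)

lemma uexp_taylor:
  fixes G :: "nat \<Rightarrow> real \<Rightarrow> complex"
  assumes G: "\<And>i x. (G i has_vector_derivative G (Suc i) x) (at x)"
  shows "uexp (reg C) (pol rho1) (\<lambda>h x. G 0 (c + h * x)) (\<lambda>x. Abs_fps (\<lambda>n. G n c / fact n * of_real x ^ n))"
proof -
  have "\<exists>B. \<forall>N. \<forall>s\<in>cball c C. norm (G N s) \<le> B N"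
  proof (rule choice, rule allI)
    fix N
    have "continuous_on (cball c C) (G N)"
      by (intro continuous_at_imp_continuous_on ballI has_vector_derivative_continuous[OF G])
    then have "bounded (G N ` cball c C)" by (intro compact_imp_bounded compact_continuous_image compact_cball)
    then show "\<exists>B. \<forall>s\<in>cball c C. norm (G N s) \<le> B" unfolding bounded_iff by blast
  qed
  then obtain B where B: "\<And>N s. s \<in> cball c C \<Longrightarrow> norm (G N s) \<le> B N" by blast
  have "expn (reg C x) (\<lambda>h. G 0 (c + h * x)) (Abs_fps (\<lambda>n. G n c / fact n * of_real x ^ n)) (\<lambda>N. B N * \<bar>x\<bar> ^ N)" for x
    unfolding expn_def
  proof (intro allI ballI)
    fix N h assume h: "h \<in> reg C x"
    have "norm (G 0 (c + h * x) - (\<Sum>j<N. G j c / fact j * of_real (c + h * x - c) ^ j)) \<le> B N * \<bar>c + h * x - c\<bar> ^ N"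
    proof (rule taylor_bound[where G = G, OF G])
      fix s assume "s \<in> closed_segment c (c + h * x)"
      then have "norm (s - c) \<le> norm (c + h * x - c)" by (rule segment_bound1)
      also have "\<dots> \<le> C" using h by (simp add: reg_def abs_mult)
      finally show "norm (G N s) \<le> B N" by (intro B) (simp add: dist_norm norm_minus_commute)
    qed
    also have "(\<Sum>j<N. G j c / fact j * of_real (c + h * x - c) ^ j) =
        (\<Sum>n<N. of_real h ^ n * fps_nth (Abs_fps (\<lambda>n. G n c / fact n * of_real x ^ n)) n)"
      by (simp add: power_mult_distrib mult_ac)
    also have "B N * \<bar>c + h * x - c\<bar> ^ N = h ^ N * (B N * \<bar>x\<bar> ^ N)"
      using h by (simp add: reg_def abs_mult power_mult_distrib mult_ac)
    finally show "norm (G 0 (c + h * x) - (\<Sum>n<N. of_real h ^ n * fps_nth (Abs_fps (\<lambda>n. G n c / fact n * of_real x ^ n)) n))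
        \<le> h ^ N * (B N * \<bar>x\<bar> ^ N)" .
  qed
  then show ?thesis using pol_abs_power unfolding uexp_def by (intro exI[of _ "\<lambda>N x. B N * \<bar>x\<bar> ^ N"]) blast
qed

lemma uexp_smooth:
  assumes "smooth f"
  shows "uexp (reg C) (pol rho1) (\<lambda>h x. f (c + h * x)) (\<lambda>x. Abs_fps (\<lambda>n. (partial 1 ^^ n) f c / fact n * of_real x ^ n))"
proof -
  have s: "smooth ((partial 1 ^^ n) f)" for n
    by (induction n) (auto intro: assms smooth_partial)
  have "((partial 1 ^^ i) f has_vector_derivative (partial 1 ^^ Suc i) f x) (at x)" for i x
    using smooth_has_vector_derivative[OF s] by simp
  from uexp_taylor[of "\<lambda>i. (partial 1 ^^ i) f", OF this] show ?thesis by simp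
qed

lemma exp_vector_derivative:
  "((\<lambda>x. complex_of_real (exp x)) has_vector_derivative of_real (exp x)) (at x)"
  "((\<lambda>x. complex_of_real (exp (- x))) has_vector_derivative - of_real (exp (- x))) (at x)"
proof -
  have "(exp has_real_derivative exp x) (at x)" "((\<lambda>x. exp (- x)) has_real_derivative - exp (- x)) (at x)"
    by (auto intro!: derivative_eq_intros)
  from this[THEN has_vector_derivative_of_real]
  show "((\<lambda>x. complex_of_real (exp x)) has_vector_derivative of_real (exp x)) (at x)"
    "((\<lambda>x. complex_of_real (exp (- x))) has_vector_derivative - of_real (exp (- x))) (at x)" by simp_all
qed

lemma uexp_cosh:
  "uexp (reg C) (pol rho1) (\<lambda>h x. of_real (cosh (h * x))) (\<lambda>x. Abs_fps (\<lambda>n. fps_nth fps_ch n * of_real x ^ n))"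
proof -
  define G where "G i x = 1 / 2 * (complex_of_real (exp x) + (- 1) ^ i * of_real (exp (- x)))" for i :: nat and x :: real
  have "(G i has_vector_derivative G (Suc i) x) (at x)" for i x
    unfolding G_def
    by (rule has_vector_derivative_eq_rhs[OF has_vector_derivative_mult_right[OF has_vector_derivative_add[OF
        exp_vector_derivative(1) has_vector_derivative_mult_right[OF exp_vector_derivative(2)]]]]) simp
  from uexp_taylor[where G = G, OF this, of C 0]
  have "uexp (reg C) (pol rho1) (\<lambda>h x. G 0 (h * x)) (\<lambda>x. Abs_fps (\<lambda>n. G n 0 / fact n * of_real x ^ n))" by simp
  moreover have "G 0 y = of_real (cosh y)" for y
    by (simp add: G_def cosh_def scaleR_conv_of_real)
  moreover have "G n 0 / fact n = fps_nth fps_ch n" for n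
    by (auto simp: G_def fps_ch_def add_divide_distrib mult.commute[of 2])
  ultimately show ?thesis by simp
qed

lemma uexp_sinh:
  "uexp (reg C) (pol rho1) (\<lambda>h x. of_real (sinh (h * x) - h * x)) (\<lambda>x. Abs_fps (\<lambda>n. fps_nth fps_sh n * of_real x ^ n))"
proof -
  define p where "p i x = (if i = 0 then complex_of_real x else if i = 1 then 1 else 0)" for i :: nat and x :: real
  define G where "G i x = 1 / 2 * (complex_of_real (exp x) + (- ((- 1) ^ i)) * of_real (exp (- x))) - p i x" for i :: nat and x :: real
  have p: "(p i has_vector_derivative p (Suc i) x) (at x)" for i x
    using has_vector_derivative_of_real[OF DERIV_ident] unfolding p_def by (cases i) auto
  have "(G i has_vector_derivative G (Suc i) x) (at x)" for i x
    unfolding G_def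
    by (rule has_vector_derivative_eq_rhs[OF has_vector_derivative_diff[OF has_vector_derivative_mult_right[OF has_vector_derivative_add[OF
        exp_vector_derivative(1) has_vector_derivative_mult_right[OF exp_vector_derivative(2)]]] p]]) simp
  from uexp_taylor[where G = G, OF this, of C 0]
  have "uexp (reg C) (pol rho1) (\<lambda>h x. G 0 (h * x)) (\<lambda>x. Abs_fps (\<lambda>n. G n 0 / fact n * of_real x ^ n))" by simp
  moreover have "G 0 y = of_real (sinh y - y)" for y
    by (simp add: G_def p_def sinh_def scaleR_conv_of_real)
  moreover have "G n 0 / fact n = fps_nth fps_sh n" for n
    by (auto simp: G_def p_def fps_sh_def fps_X_def diff_divide_distrib mult.commute[of 2])
  ultimately show ?thesis by simp
qed

text \<open>Rescaling the variable is composition with the series \<open>c X\<close>, a ring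
  homomorphism.\<close>

lemma scale_fps_power:
  "Abs_fps (\<lambda>n. fps_nth f n * c ^ n) ^ j = Abs_fps (\<lambda>n. fps_nth (f ^ j) n * c ^ n)" for c :: complex
proof -
  have "Abs_fps (\<lambda>n. fps_nth f n * c ^ n) = f oo (fps_const c * fps_X)" for f
    unfolding fps_compose_linear by (simp add: mult.commute)
  then show ?thesis by (simp add: fps_compose_power)
qed

text \<open>The displacement of the frequency \<open>x\<close> under the substitution of
  \<open>sinh (h * x) / h\<close>.\<close>

definition yfun :: "real \<Rightarrow> real \<Rightarrow> real" where
  "yfun h x = (sinh (h * x) - h * x) / h"

text \<open>Power \<open>j\<close> of \<open>sinh (h * x) - h * x\<close> starts at order
  \<open>j\<close> or later, so \<open>h ^ j\<close> can be divided out; the scaling of the series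
  by \<open>x\<close> attaches \<open>x ^ (n + j)\<close> to \<open>shcoef n j\<close>.\<close>

lemma uexp_yfun:
  "uexp (reg C) (pol rho1) (\<lambda>h x. of_real (yfun h x) ^ j) (\<lambda>x. Abs_fps (\<lambda>n. fact j * shcoef n j * of_real x ^ (n + j)))"
proof -
  let ?F = "\<lambda>x. Abs_fps (\<lambda>n. fps_nth (fps_sh ^ j) n * complex_of_real x ^ n)"
  have low: "fps_nth (?F x) n = 0" if "n < j" for n x
  proof -
    have "fps_sh = fps_X * fps_shift 1 fps_sh"
      by (rule fps_ext) (simp add: fps_sh_nth)
    then have "fps_sh ^ j = fps_X ^ j * fps_shift 1 fps_sh ^ j" by (metis power_mult_distrib)
    then show ?thesis using that by (simp add: fps_X_power_mult_nth)
  qed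
  have "uexp (reg C) (pol rho1) (\<lambda>h x. of_real (sinh (h * x) - h * x) ^ j / of_real h ^ j) (\<lambda>x. fps_shift j (?F x))"
    using uexp_power[OF rho1 uexp_sinh reg_subset, of C j] unfolding scale_fps_power
    by (rule uexp_shift[OF _ reg_subset low])
  moreover have "fps_shift j (?F x) = Abs_fps (\<lambda>n. fact j * shcoef n j * of_real x ^ (n + j))" for x
    by (rule fps_ext) (simp add: shcoef_def)
  ultimately show ?thesis by (simp add: yfun_def power_divide)
qed

lemma uexp_cis:
  "uexp (reg C) (pol rho1) (\<lambda>h x. cis (l * yfun h x))
    (\<lambda>x. Abs_fps (\<lambda>n. \<Sum>j\<le>n. shcoef n j * (\<i> * of_real l) ^ j * of_real x ^ (n + j)))"
proof -
  have "uexp (reg C) (pol rho1) (\<lambda>h x. cis (l * yfun h x))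
    (\<lambda>x. Abs_fps (\<lambda>n. \<Sum>j\<le>n. (\<i> * of_real l) ^ j / fact j * fps_nth (Abs_fps (\<lambda>n. fact j * shcoef n j * of_real x ^ (n + j))) n))"
  proof (rule uexp_compose[OF reg_subset uexp_yfun])
    fix N x h
    have d: "((\<lambda>y. (\<i> * of_real l) ^ i * cis (l * y)) has_vector_derivative (\<i> * of_real l) ^ Suc i * cis (l * s)) (at s)" for i s
    proof -
      have "((\<lambda>y. cis (l * y)) has_vector_derivative \<i> * of_real l * cis (l * s)) (at s)"
        using has_vector_derivative_cis[of "- l" s UNIV] by simp
      from has_vector_derivative_mult_right[OF this, of "(\<i> * of_real l) ^ i"]
      show ?thesis by (rule has_vector_derivative_eq_rhs) simp
    qed
    show "norm (cis (l * yfun h x) - (\<Sum>j<N. (\<i> * of_real l) ^ j / fact j * of_real (yfun h x) ^ j)) \<le>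
        \<bar>l\<bar> ^ N * norm (complex_of_real (yfun h x)) ^ N"
      using taylor_bound[of "\<lambda>i y. (\<i> * of_real l) ^ i * cis (l * y)", OF d, of 0 "yfun h x" N "\<bar>l\<bar> ^ N"]
      by (simp add: norm_mult norm_power)
  qed (auto simp: shcoef_zero add_closed_pol[OF rho1] pol_const[OF rho1] intro: pol_mult[OF rho1])
  moreover have "(\<i> * of_real l) ^ j / fact j * (fact j * shcoef n j * of_real x ^ (n + j)) =
      shcoef n j * (\<i> * of_real l) ^ j * of_real x ^ (n + j)" for j n x by simp
  ultimately show ?thesis by (simp add: mult_ac)
qed

text \<open>On the Fourier side this is the derivative of order \<open>j\<close> of the transform.
  The factor \<open>(- \<i>) ^ j\<close> is included for that reason.\<close>

definition lpow :: "nat \<Rightarrow> (real \<Rightarrow> complex) \<Rightarrow> real \<Rightarrow> complex" where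
  "lpow j \<phi> = ((\<lambda>\<psi> l. - \<i> * (of_real l * \<psi> l)) ^^ j) \<phi>"

lemma lpow_simps: "lpow 0 \<phi> = \<phi>" "lpow (Suc j) \<phi> = (\<lambda>l. - \<i> * (of_real l * lpow j \<phi> l))"
  by (simp_all add: lpow_def)

lemma test_function_lpow: "test_function \<phi> \<Longrightarrow> test_function (lpow j \<phi>)"
proof (induction j)
  case (Suc j)
  then show ?case unfolding lpow_simps(2) by (intro test_function_cmult test_function_id_mult)
qed (simp add: lpow_simps)

lemma sinh_ge_self: "0 \<le> x \<Longrightarrow> x \<le> sinh (x::real)"
proof -
  assume "0 \<le> x"
  have "sinh 0 - 0 \<le> sinh x - x"
    using \<open>0 \<le> x\<close>
  proof (rule DERIV_nonneg_imp_nondecreasing)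
    fix y :: real
    have "((\<lambda>x. sinh x - x) has_real_derivative cosh y - 1) (at y)" by (auto intro!: derivative_eq_intros)
    then show "\<exists>d. ((\<lambda>x. sinh x - x) has_real_derivative d) (at y) \<and> 0 \<le> d"
      using cosh_real_ge_1[of y] by auto
  qed
  then show ?thesis by simp
qed

text \<open>The substitution moves frequencies away from the origin. Decay of a transform anywhere
  between \<open>x\<close> and \<open>sinh (h * x) / h\<close> is therefore at least as strong as
  decay at \<open>x\<close>, uniformly in \<open>h\<close>.\<close>

lemma abs_le_segment_sinh:
  fixes h x s :: real
  assumes "h > 0" "s \<in> closed_segment x (sinh (h * x) / h)"
  shows "\<bar>x\<bar> \<le> \<bar>s\<bar>"
proof (cases "x \<ge> 0")
  case True
  then have "x \<le> sinh (h * x) / h" using assms(1) sinh_ge_self[of "h * x"] by (simp add: field_simps)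
  then show ?thesis using True assms(2) by (auto simp: closed_segment_eq_real_ivl)
next
  case False
  then have "h * x \<le> 0" using assms(1) by (simp add: mult_pos_neg less_imp_le)
  then have "sinh (h * x) / h \<le> x" using assms(1) sinh_ge_self[of "- (h * x)"] by (simp add: field_simps)
  then show ?thesis using False assms(2) by (auto simp: closed_segment_eq_real_ivl split: if_splits)
qed

definition Dx :: "(real \<Rightarrow> complex) \<Rightarrow> real \<Rightarrow> complex" where
  "Dx \<psi> = (\<lambda>x. - \<i> * partial 1 \<psi> x)"

lemma test_function_Dx: "test_function \<psi> \<Longrightarrow> test_function (Dx \<psi>)"
  unfolding Dx_def by (intro test_function_cmult test_function_partial) auto

lemma test_function_Dx_funpow: "test_function \<psi> \<Longrightarrow> test_function ((Dx ^^ n) \<psi>)"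
  by (induction n) (auto intro: test_function_Dx)

lemma ft_Dx: "test_function \<psi> \<Longrightarrow> ft (Dx \<psi>) \<xi> = of_real \<xi> * ft \<psi> \<xi>"
  unfolding Dx_def ft_cmult by (simp add: ft_partial flip: mult.assoc)

lemma ft_Dx_funpow: "test_function \<psi> \<Longrightarrow> ft ((Dx ^^ n) \<psi>) \<xi> = of_real \<xi> ^ n * ft \<psi> \<xi>"
  by (induction n) (auto simp: ft_Dx test_function_Dx_funpow)

text \<open>\<open>Rop\<close> in the single variable \<open>l\<close>; its factor
  \<open>(- \<i>) ^ j\<close> sits in \<open>lpow\<close>.\<close>

definition rop :: "nat \<Rightarrow> (real \<Rightarrow> complex) \<Rightarrow> real \<Rightarrow> complex" where
  "rop n \<phi> = (\<lambda>l. \<Sum>j\<le>n. shcoef n j * (Dx ^^ (n + j)) (lpow j \<phi>) l)"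

lemma test_function_rop: "test_function \<phi> \<Longrightarrow> test_function (rop n \<phi>)"
  unfolding rop_def
  by (intro test_function_sum test_function_cmult test_function_Dx_funpow test_function_lpow)

text \<open>Taylor expansion of the transform at \<open>x\<close> with increment
  \<open>yfun h x\<close>. Derivatives of the transform are transforms of \<open>lpow\<close>,
  powers of \<open>x\<close> are powers of \<open>Dx\<close>, and collecting order \<open>n\<close>
  gives \<open>rop n\<close>: the substitution is the operator series \<open>R\<close>.\<close>

lemma uexp_ft:
  assumes \<phi>: "test_function \<phi>"
  shows "uexp (reg C) (sch rho1) (\<lambda>h x. ft \<phi> (sinh (h * x) / h)) (\<lambda>x. Abs_fps (\<lambda>n. ft (rop n \<phi>) x))"
proof -
  have G: "(ft (lpow i \<phi>) has_vector_derivative ft (lpow (Suc i) \<phi>) x) (at x)" for i x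
    unfolding lpow_simps(2) by (rule ft_has_vector_derivative[OF test_function_lpow[OF \<phi>]])
  \<comment> \<open>The derivative must be bounded on a segment whose far end depends on
    \<open>h\<close>. The supremum over all \<open>s\<close> with
    \<open>\<bar>x\<bar> \<le> \<bar>s\<bar>\<close> covers it for every \<open>h\<close> and still
    decreases rapidly in \<open>x\<close>.\<close>
  define r where "r N x = (SUP s\<in>{s. \<bar>x\<bar> \<le> \<bar>s\<bar>}. norm (ft (lpow N \<phi>) s))" for N and x :: real
  have bdd: "bdd_above ((\<lambda>s. norm (ft (lpow N \<phi>) s)) ` X)" for N X
    using ft_decay[OF test_function_lpow[OF \<phi>], of N 0] by (auto intro: bdd_aboveI2)
  have r0: "0 \<le> r N x" for N x
    unfolding r_def by (rule cSUP_upper2[OF bdd, of x]) auto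
  have r: "r N \<in> sch rho1" for N
    unfolding sch_def mem_Collect_eq
  proof
    fix k
    obtain B where B: "\<And>s. norm (ft (lpow N \<phi>) s) * (1 + s\<^sup>2) ^ k \<le> B"
      using ft_decay[OF test_function_lpow[OF \<phi>], of N k] by blast
    have "\<bar>r N x\<bar> * rho1 x ^ k \<le> B" for x
    proof -
      have p: "rho1 x ^ k > 0" using rho1[of x] by simp
      have "r N x \<le> B / rho1 x ^ k"
        unfolding r_def
      proof (rule cSUP_least)
        fix s assume "s \<in> {s. \<bar>x\<bar> \<le> \<bar>s\<bar>}"
        then have "x\<^sup>2 \<le> s\<^sup>2" by (simp add: abs_le_square_iff)
        then have "rho1 x ^ k \<le> (1 + s\<^sup>2) ^ k" using rho1[of x] by (intro power_mono) (auto simp: rho1_def)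
        then have "norm (ft (lpow N \<phi>) s) * rho1 x ^ k \<le> B"
          by (intro order_trans[OF mult_left_mono B]) auto
        then show "norm (ft (lpow N \<phi>) s) \<le> B / rho1 x ^ k" using p by (simp add: field_simps)
      qed (auto intro: exI[of _ x])
      then show ?thesis using p r0[of N x] by (simp add: field_simps)
    qed
    then show "\<exists>B. \<forall>x. \<bar>r N x\<bar> * rho1 x ^ k \<le> B" by blast
  qed
  have "uexp (reg C) (sch rho1) (\<lambda>h x. ft \<phi> (sinh (h * x) / h))
    (\<lambda>x. Abs_fps (\<lambda>n. \<Sum>j\<le>n. ft (lpow j \<phi>) x / fact j * fps_nth (Abs_fps (\<lambda>n. fact j * shcoef n j * of_real x ^ (n + j))) n))"
  proof (rule uexp_compose[OF reg_subset uexp_yfun _ add_closed_sch[OF rho1] sch_pol_mult[OF rho1] _ r r0])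
    fix j
    have "\<exists>B. \<forall>x. \<bar>norm (ft (lpow j \<phi>) x / fact j)\<bar> * rho1 x ^ k \<le> B" for k
    proof -
      obtain B where B: "\<And>s. norm (ft (lpow j \<phi>) s) * (1 + s\<^sup>2) ^ k \<le> B"
        using ft_decay[OF test_function_lpow[OF \<phi>], of j k] by blast
      have "\<bar>norm (ft (lpow j \<phi>) x / fact j)\<bar> * rho1 x ^ k \<le> B / fact j" for x
        using B[of x] by (simp add: norm_divide rho1_def divide_right_mono)
      then show ?thesis by blast
    qed
    then show "(\<lambda>x. norm (ft (lpow j \<phi>) x / fact j)) \<in> sch rho1" by (simp add: sch_def)
  next
    fix N x h assume h: "h \<in> reg C x"
    then have h0: "h > 0" by (simp add: reg_def)
    have y: "sinh (h * x) / h - x = yfun h x" using h0 by (simp add: yfun_def diff_divide_distrib)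
    have "norm (ft (lpow 0 \<phi>) (sinh (h * x) / h) - (\<Sum>j<N. ft (lpow j \<phi>) x / fact j * of_real (sinh (h * x) / h - x) ^ j))
        \<le> r N x * \<bar>sinh (h * x) / h - x\<bar> ^ N"
    proof (rule taylor_bound[where G = "\<lambda>i. ft (lpow i \<phi>)", OF G])
      fix s assume "s \<in> closed_segment x (sinh (h * x) / h)"
      then show "norm (ft (lpow N \<phi>) s) \<le> r N x"
        unfolding r_def using abs_le_segment_sinh[OF h0] by (intro cSUP_upper bdd) auto
    qed
    then show "norm (ft \<phi> (sinh (h * x) / h) - (\<Sum>j<N. ft (lpow j \<phi>) x / fact j * of_real (yfun h x) ^ j)) \<le>
        r N x * norm (complex_of_real (yfun h x)) ^ N"
      unfolding y by (simp add: lpow_simps)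
  qed (auto simp: shcoef_zero)
  moreover have "(\<Sum>j\<le>n. ft (lpow j \<phi>) x / fact j * (fact j * shcoef n j * of_real x ^ (n + j))) = ft (rop n \<phi>) x" for n x
    unfolding rop_def
    by (subst ft_sum) (auto intro!: test_function_cmult test_function_Dx_funpow test_function_lpow \<phi>
      simp: ft_cmult ft_Dx_funpow[OF test_function_lpow[OF \<phi>]] mult_ac)
  ultimately show ?thesis by simp
qed

section \<open>The coefficients of the expansion\<close>

lemma smooth_Dx: "smooth \<psi> \<Longrightarrow> smooth (Dx \<psi>)"
  unfolding Dx_def by (intro smooth_mult smooth_const smooth_partial) auto

lemma smooth_Dx_funpow: "smooth \<psi> \<Longrightarrow> smooth ((Dx ^^ n) \<psi>)"
  by (induction n) (auto intro: smooth_Dx)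

lemma Dx_add: "smooth f \<Longrightarrow> smooth g \<Longrightarrow> Dx (\<lambda>x. f x + g x) = (\<lambda>x. Dx f x + Dx g x)"
  by (simp add: Dx_def partial_add smooth_differentiable_on algebra_simps)

lemma Dx_mult: "smooth f \<Longrightarrow> smooth g \<Longrightarrow> Dx (\<lambda>x. f x * g x) = (\<lambda>x. f x * Dx g x + Dx f x * g x)"
  by (simp add: Dx_def partial_mult smooth_differentiable_on algebra_simps)

lemma Dx_funpow_add: "smooth f \<Longrightarrow> smooth g \<Longrightarrow> (Dx ^^ n) (\<lambda>x. f x + g x) = (\<lambda>x. (Dx ^^ n) f x + (Dx ^^ n) g x)"
  by (induction n) (simp_all add: Dx_add smooth_Dx_funpow)

lemma Dx_cmult: "smooth f \<Longrightarrow> Dx (\<lambda>x. c * f x) = (\<lambda>x. c * Dx f x)"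
  using Dx_mult[of "\<lambda>_. c" f] by (simp add: Dx_def)

lemma Dx_funpow_cmult: "smooth f \<Longrightarrow> (Dx ^^ n) (\<lambda>x. c * f x) = (\<lambda>x. c * (Dx ^^ n) f x)"
  by (induction n) (simp_all add: Dx_cmult smooth_Dx_funpow)

lemma Dx_funpow: "smooth f \<Longrightarrow> (Dx ^^ n) f = (\<lambda>x. (- \<i>) ^ n * (partial 1 ^^ n) f x)"
proof (induction n)
  case (Suc n)
  have "smooth ((partial 1 ^^ n) f)" by (induction n) (auto intro: Suc smooth_partial)
  then show ?case using Suc by (simp add: Dx_cmult) (simp add: Dx_def mult_ac)
qed simp

text \<open>For \<open>m = 0\<close> this is Fourier inversion in both variables. A factor
  \<open>P + Q\<close> splits into \<open>Dx\<close> on \<open>\<alpha>\<close> plus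
  \<open>Dx\<close> on \<open>\<beta>\<close>, which by the Leibniz rule is \<open>Dx\<close> on the
  product.\<close>

lemma ft_pair_integral:
  assumes "test_function \<alpha>" "test_function \<beta>"
  shows "integrable (lborel \<Otimes>\<^sub>M lborel) (\<lambda>(P, Q). cis (l * (P + Q)) * of_real (P + Q) ^ m * (ft \<alpha> P * ft \<beta> Q)) \<and>
    (LINT (P, Q)|(lborel \<Otimes>\<^sub>M lborel). cis (l * (P + Q)) * of_real (P + Q) ^ m * (ft \<alpha> P * ft \<beta> Q)) =
      of_real ((2 * pi)\<^sup>2) * (Dx ^^ m) (\<lambda>l. \<alpha> l * \<beta> l) l"
  using assms
proof (induction m arbitrary: \<alpha> \<beta>)
  case 0
  have eq: "(\<lambda>(P, Q). cis (l * (P + Q)) * of_real (P + Q) ^ 0 * (ft \<alpha> P * ft \<beta> Q)) =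
      (\<lambda>(P, Q). (ft \<alpha> P * cis (P * l)) * (ft \<beta> Q * cis (Q * l)))"
    by (auto simp: fun_eq_iff distrib_left mult.commute[of l] mult_ac simp flip: cis_mult)
  have i: "integrable lborel (\<lambda>P. ft \<gamma> P * cis (P * l))" if "test_function \<gamma>" for \<gamma>
  proof (rule Bochner_Integration.integrable_bound[OF integrable_ft[OF that]])
    have "continuous_on UNIV (\<lambda>P. ft \<gamma> P * cis (P * l))"
      by (intro continuous_intros continuous_on_ft that)
    then show "(\<lambda>P. ft \<gamma> P * cis (P * l)) \<in> borel_measurable lborel"
      by (simp add: borel_measurable_continuous_onI)
  qed (simp add: norm_mult)
  have int: "integrable (lborel \<Otimes>\<^sub>M lborel) (\<lambda>(P, Q). (ft \<alpha> P * cis (P * l)) * (ft \<beta> Q * cis (Q * l)))"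
    by (rule integrable_lborel_pair[OF i i]) (rule 0)+
  have "(LINT (P, Q)|(lborel \<Otimes>\<^sub>M lborel). (ft \<alpha> P * cis (P * l)) * (ft \<beta> Q * cis (Q * l))) =
      (LINT P|lborel. LINT Q|lborel. (ft \<alpha> P * cis (P * l)) * (ft \<beta> Q * cis (Q * l)))"
    using lborel_pair.integral_fst'[OF int] by simp
  also have "\<dots> = (2 * pi * \<alpha> l) * (2 * pi * \<beta> l)"
    unfolding integral_mult_right_zero integral_mult_left_zero fourier_inversion[OF 0(1)] fourier_inversion[OF 0(2)] ..
  finally show ?case
    unfolding eq using int by (simp add: power2_eq_square)
next
  case (Suc m)
  let ?F = "\<lambda>\<alpha> \<beta> (P, Q). cis (l * (P + Q)) * of_real (P + Q) ^ m * (ft \<alpha> P * ft \<beta> Q)"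
  have eq: "(\<lambda>(P, Q). cis (l * (P + Q)) * of_real (P + Q) ^ Suc m * (ft \<alpha> P * ft \<beta> Q)) =
      (\<lambda>z. ?F (Dx \<alpha>) \<beta> z + ?F \<alpha> (Dx \<beta>) z)"
    by (auto simp: fun_eq_iff ft_Dx Suc.prems algebra_simps)
  have s: "smooth \<alpha>" "smooth \<beta>" using Suc.prems test_function_smooth by auto
  have D: "(Dx ^^ Suc m) (\<lambda>l. \<alpha> l * \<beta> l) = (\<lambda>l. (Dx ^^ m) (\<lambda>l. \<alpha> l * Dx \<beta> l) l + (Dx ^^ m) (\<lambda>l. Dx \<alpha> l * \<beta> l) l)"
    using s by (simp add: funpow_swap1 Dx_mult Dx_funpow_add smooth_mult smooth_Dx)
  note 1 = Suc.IH[OF test_function_Dx[OF Suc.prems(1)] Suc.prems(2)]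
  note 2 = Suc.IH[OF Suc.prems(1) test_function_Dx[OF Suc.prems(2)]]
  show ?case
    unfolding eq D using 1 2 by (simp add: distrib_left)
qed

definition topx :: "nat \<Rightarrow> (real \<Rightarrow> complex) \<Rightarrow> real \<Rightarrow> complex" where
  "topx k \<psi> l = (\<Sum>k'\<le>k. \<Sum>j\<le>k'. shcoef k' j * (\<i> * of_real l) ^ j * fps_nth fps_ch (k - k') * (Dx ^^ (k' + j + (k - k'))) \<psi> l)"

text \<open>The symbol of \<open>Top\<close> with \<open>l\<close> to the left of \<open>D\<close>
  and \<open>x\<close> in place of \<open>D\<close>. In the integral it is taken at
  \<open>x = P + Q\<close>, the frequency of the product of the two factors.\<close>

definition tsym :: "real \<Rightarrow> real \<Rightarrow> complex fps" where
  "tsym l x = Abs_fps (\<lambda>n. \<Sum>j\<le>n. shcoef n j * (\<i> * of_real l) ^ j * of_real x ^ (n + j)) *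
    Abs_fps (\<lambda>n. fps_nth fps_ch n * of_real x ^ n)"

lemma tsym_nth:
  "fps_nth (tsym l x) k = (\<Sum>k'\<le>k. \<Sum>j\<le>k'. shcoef k' j * (\<i> * of_real l) ^ j * fps_nth fps_ch (k - k') *
    of_real x ^ (k' + j + (k - k')))"
  unfolding tsym_def fps_mult_nth atLeast0AtMost fps_nth_Abs_fps sum_distrib_right
  by (intro sum.cong refl) (simp only: power_add mult_ac)

lemma tsym_integral:
  assumes "test_function \<alpha>" "test_function \<beta>"
  shows "integrable (lborel \<Otimes>\<^sub>M lborel) (\<lambda>(P, Q). cis (l * (P + Q)) * fps_nth (tsym l (P + Q)) k * (ft \<alpha> P * ft \<beta> Q))" (is ?I)
    and "(LINT (P, Q)|(lborel \<Otimes>\<^sub>M lborel). cis (l * (P + Q)) * fps_nth (tsym l (P + Q)) k * (ft \<alpha> P * ft \<beta> Q)) =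
      of_real ((2 * pi)\<^sup>2) * topx k (\<lambda>l. \<alpha> l * \<beta> l) l" (is ?E)
proof -
  let ?c = "\<lambda>k' j. shcoef k' j * (\<i> * of_real l) ^ j * fps_nth fps_ch (k - k')"
  let ?F = "\<lambda>m (P, Q). cis (l * (P + Q)) * of_real (P + Q) ^ m * (ft \<alpha> P * ft \<beta> Q)"
  have eq: "(\<lambda>(P, Q). cis (l * (P + Q)) * fps_nth (tsym l (P + Q)) k * (ft \<alpha> P * ft \<beta> Q)) =
      (\<lambda>z. \<Sum>k'\<le>k. \<Sum>j\<le>k'. ?c k' j * ?F (k' + j + (k - k')) z)"
    unfolding tsym_nth case_prod_unfold sum_distrib_left sum_distrib_right by (simp add: mult_ac)
  note J = ft_pair_integral[OF assms, of l]
  show ?I ?E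
    unfolding eq using J by (simp_all add: topx_def sum_distrib_left mult_ac)
qed

definition tail_fps :: "(real \<Rightarrow> complex) \<Rightarrow> (real \<Rightarrow> complex) \<Rightarrow> (nat \<Rightarrow> complex) \<Rightarrow> (nat \<Rightarrow> complex) \<Rightarrow> real \<times> real \<Rightarrow> complex fps" where
  "tail_fps \<phi> \<psi> fs gs = (\<lambda>(P, Q). Abs_fps (\<lambda>n. ft (rop n \<phi>) P) * (Abs_fps (\<lambda>n. ft (rop n \<psi>) Q) *
     (Abs_fps (\<lambda>n. fs n * of_real Q ^ n) * Abs_fps (\<lambda>n. gs n * of_real (- P) ^ n))))"

text \<open>How order \<open>n\<close> is distributed: \<open>k\<close> to \<open>T\<close>,
  \<open>i\<close> and \<open>j\<close> to \<open>R\<close> on the two factors, \<open>b\<close> to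
  the Taylor series of \<open>f\<close> with its power of \<open>Q\<close>, and the rest to that of
  \<open>g\<close> with its power of \<open>- P\<close>. The powers of \<open>P\<close> and
  \<open>Q\<close> have become \<open>Dx\<close> on the factor of the other function.\<close>

definition coef_val :: "(real \<Rightarrow> complex) \<Rightarrow> (real \<Rightarrow> complex) \<Rightarrow> (nat \<Rightarrow> complex) \<Rightarrow> (nat \<Rightarrow> complex) \<Rightarrow> real \<Rightarrow> nat \<Rightarrow> complex" where
  "coef_val \<phi> \<psi> fs gs l n = (\<Sum>k\<le>n. \<Sum>i\<le>n - k. \<Sum>j\<le>n - k - i. \<Sum>b\<le>n - k - i - j.
     fs b * gs (n - k - i - j - b) * (- 1) ^ (n - k - i - j - b) *
     topx k (\<lambda>l. (Dx ^^ (n - k - i - j - b)) (rop i \<phi>) l * (Dx ^^ b) (rop j \<psi>) l) l)"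

lemma coef_integral:
  assumes "test_function \<phi>" "test_function \<psi>"
  shows "(LINT z|(lborel \<Otimes>\<^sub>M lborel). cis (l * (fst z + snd z)) * fps_nth (tsym l (fst z + snd z) * tail_fps \<phi> \<psi> fs gs z) n) =
      of_real ((2 * pi)\<^sup>2) * coef_val \<phi> \<psi> fs gs l n"
proof -
  let ?c = "\<lambda>k i j b. fs b * gs (n - k - i - j - b) * (- 1) ^ (n - k - i - j - b)"
  let ?F = "\<lambda>k i j b (P, Q). cis (l * (P + Q)) * fps_nth (tsym l (P + Q)) k *
    (ft ((Dx ^^ (n - k - i - j - b)) (rop i \<phi>)) P * ft ((Dx ^^ b) (rop j \<psi>)) Q)"
  have eq: "(\<lambda>z. cis (l * (fst z + snd z)) * fps_nth (tsym l (fst z + snd z) * tail_fps \<phi> \<psi> fs gs z) n) =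
      (\<lambda>z. \<Sum>k\<le>n. \<Sum>i\<le>n - k. \<Sum>j\<le>n - k - i. \<Sum>b\<le>n - k - i - j. ?c k i j b * ?F k i j b z)"
  proof
    fix z :: "real \<times> real"
    obtain P Q where z: "z = (P, Q)" by force
    have m: "of_real (- P) ^ c = (- 1) ^ c * complex_of_real P ^ c" for c
      using power_minus[of "complex_of_real P" c] by simp
    show "cis (l * (fst z + snd z)) * fps_nth (tsym l (fst z + snd z) * tail_fps \<phi> \<psi> fs gs z) n =
      (\<Sum>k\<le>n. \<Sum>i\<le>n - k. \<Sum>j\<le>n - k - i. \<Sum>b\<le>n - k - i - j. ?c k i j b * ?F k i j b z)"
      unfolding z tail_fps_def prod.case fps_mult_nth[of "tsym _ _"] fps_mult_nth[of "Abs_fps (_ :: nat \<Rightarrow> complex)"]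
      by (simp add: atLeast0AtMost sum_distrib_left ft_Dx_funpow test_function_rop assms m mult_ac del: of_real_minus)
  qed
  have t: "test_function ((Dx ^^ m) (rop i \<phi>))" "test_function ((Dx ^^ m) (rop i \<psi>))" for m i
    using assms by (auto intro: test_function_Dx_funpow test_function_rop)
  define F where "F k i j b = ?F k i j b" for k i j b
  define E where "E k i j b = topx k (\<lambda>l. (Dx ^^ (n - k - i - j - b)) (rop i \<phi>) l * (Dx ^^ b) (rop j \<psi>) l) l" for k i j b
  have F: "integrable (lborel \<Otimes>\<^sub>M lborel) (F k i j b)"
    "(LINT z|(lborel \<Otimes>\<^sub>M lborel). F k i j b z) = of_real ((2 * pi)\<^sup>2) * E k i j b" for k i j b
    unfolding F_def E_def by (rule tsym_integral[OF t])+
  have "(LINT z|(lborel \<Otimes>\<^sub>M lborel). (\<Sum>k\<le>n. \<Sum>i\<le>n - k. \<Sum>j\<le>n - k - i. \<Sum>b\<le>n - k - i - j. ?c k i j b * F k i j b z)) =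
      (\<Sum>k\<le>n. \<Sum>i\<le>n - k. \<Sum>j\<le>n - k - i. \<Sum>b\<le>n - k - i - j. ?c k i j b * (of_real ((2 * pi)\<^sup>2) * E k i j b))"
    by (simp add: F del: of_real_power of_real_mult)
  then show ?thesis
    unfolding eq coef_val_def F_def[symmetric] E_def[symmetric] sum_distrib_left
    by (simp only: mult.left_commute)
qed

section \<open>The operator series on functions that separate the coordinates\<close>

lemma lift_op_single: "(\<And>n. lop (A n)) \<Longrightarrow> lift_op A (single 0 w) = (\<lambda>n. A n w)"
proof (rule ext, rule ext)
  fix n x assume A: "\<And>n. lop (A n)"
  have "lift_op A (single 0 w) n x = (\<Sum>k\<in>{n}. A k (single 0 w (n - k)) x)"
    unfolding lift_op_def by (rule sum.mono_neutral_right) (auto simp: single_def lop_zero_arg[OF A])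
  then show "lift_op A (single 0 w) n x = A n w x" by (simp add: single_def)
qed

lemma smooth_prod2: "smooth f \<Longrightarrow> smooth g \<Longrightarrow> smooth (\<lambda>x::S. f (fst x) * g (snd x))"
  by (intro smooth_mult smooth_affine[OF _ affine_map_fst] smooth_affine[OF _ affine_map_snd])

lemma Dl_prod2:
  assumes "smooth f" "smooth g"
  shows "Dl (\<lambda>x. f (fst x) * g (snd x)) = (\<lambda>x. f (fst x) * Dx g (snd x))"
proof -
  have s: "smooth (\<lambda>x::S. f (fst x))" "smooth (\<lambda>x::S. g (snd x))"
    using smooth_affine[OF assms(1) affine_map_fst] smooth_affine[OF assms(2) affine_map_snd] by auto
  have "partial (0, 1) (\<lambda>x::S. f (fst x)) = (\<lambda>x. 0)"
    using partial_affine[OF assms(1) bounded_linear_fst, of "(0, 1)" 0] by simp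
  moreover have "partial (0, 1) (\<lambda>x::S. g (snd x)) = (\<lambda>x. partial 1 g (snd x))"
    using partial_affine[OF assms(2) bounded_linear_snd, of "(0, 1)" 0] by simp
  ultimately show ?thesis
    unfolding Dl_mult[OF s] by (simp add: Dl_def Dx_def)
qed

lemma Dl_funpow_prod2:
  "smooth f \<Longrightarrow> smooth g \<Longrightarrow> (Dl ^^ n) (\<lambda>x. f (fst x) * g (snd x)) = (\<lambda>x. f (fst x) * (Dx ^^ n) g (snd x))"
  by (induction n) (simp_all add: Dl_prod2 smooth_Dx_funpow)

lemma lpow_eq: "lpow j \<phi> = (\<lambda>l. (- \<i>) ^ j * (of_real l ^ j * \<phi> l))"
  by (induction j) (auto simp: lpow_simps fun_eq_iff)

lemma Rop_prod2:
  assumes "smooth f" "smooth \<phi>"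
  shows "Rop n (\<lambda>x. f (fst x) * \<phi> (snd x)) = (\<lambda>x. f (fst x) * rop n \<phi> (snd x))"
proof
  fix x :: S
  have s: "smooth (\<lambda>l. complex_of_real l ^ j * \<phi> l)" for j
    using assms smooth_real_linear[OF bounded_linear_ident] by (intro smooth_mult smooth_power)
  have e: "(lmul ^^ j) (\<lambda>x. f (fst x) * \<phi> (snd x)) = (\<lambda>x. f (fst x) * (\<lambda>l. complex_of_real l ^ j * \<phi> l) (snd x))" for j
    by (simp add: lmul_funpow fun_eq_iff mult_ac)
  have "(Dl ^^ m) ((lmul ^^ j) (\<lambda>x. f (fst x) * \<phi> (snd x))) = (\<lambda>x. f (fst x) * (Dx ^^ m) (\<lambda>l. complex_of_real l ^ j * \<phi> l) (snd x))" for j m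
    unfolding e by (rule Dl_funpow_prod2[OF assms(1) s])
  moreover have "(Dx ^^ m) (lpow j \<phi>) l = (- \<i>) ^ j * (Dx ^^ m) (\<lambda>l. complex_of_real l ^ j * \<phi> l) l" for m j l
    unfolding lpow_eq Dx_funpow_cmult[OF s] ..
  ultimately show "Rop n (\<lambda>x. f (fst x) * \<phi> (snd x)) x = f (fst x) * rop n \<phi> (snd x)"
    by (simp add: Rop_def rop_def sum_distrib_left mult_ac)
qed

lemma Top_prod2:
  assumes "smooth f" "smooth \<psi>"
  shows "Top k (\<lambda>x. f (fst x) * \<psi> (snd x)) = (\<lambda>x. f (fst x) * topx k \<psi> (snd x))"
proof
  fix x :: S
  have s: "smooth (\<lambda>x. f (fst x) * (Dx ^^ m) \<psi> (snd x))" for m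
    using assms smooth_Dx_funpow by (intro smooth_prod2)
  have "(Dl ^^ m) (Cop c (\<lambda>x. f (fst x) * \<psi> (snd x))) x = fps_nth fps_ch c * (f (fst x) * (Dx ^^ (m + c)) \<psi> (snd x))" for m c
    unfolding Cop_def Dl_funpow_prod2[OF assms] lop_cmult_arg[OF lop_funpow_Dl s]
    by (simp add: Dl_funpow_prod2 assms smooth_Dx_funpow funpow_add)
  then show "Top k (\<lambda>x. f (fst x) * \<psi> (snd x)) x = f (fst x) * topx k \<psi> (snd x)"
    by (simp add: Top_def conv_def Vop_def lmul_funpow topx_def sum_distrib_left power_mult_distrib mult_ac)
qed

definition prod4 :: "(real \<Rightarrow> complex) \<Rightarrow> (real \<Rightarrow> complex) \<Rightarrow> (real \<Rightarrow> complex) \<Rightarrow> (real \<Rightarrow> complex) \<Rightarrow> S \<times> S \<Rightarrow> complex" where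
  "prod4 f \<alpha> g \<beta> = (\<lambda>(x, y). (f (fst x) * \<alpha> (snd x)) * (g (fst y) * \<beta> (snd y)))"

lemma partial_prod4:
  assumes "smooth f" "smooth \<alpha>" "smooth g" "smooth \<beta>"
  shows "partial ((1, 0), (0, 0)) (prod4 f \<alpha> g \<beta>) = prod4 (partial 1 f) \<alpha> g \<beta>"
    "partial ((0, 1), (0, 0)) (prod4 f \<alpha> g \<beta>) = prod4 f (partial 1 \<alpha>) g \<beta>"
    "partial ((0, 0), (1, 0)) (prod4 f \<alpha> g \<beta>) = prod4 f \<alpha> (partial 1 g) \<beta>"
    "partial ((0, 0), (0, 1)) (prod4 f \<alpha> g \<beta>) = prod4 f \<alpha> g (partial 1 \<beta>)"
proof -
  have L: "bounded_linear (\<lambda>z::S \<times> S. fst (fst z))" "bounded_linear (\<lambda>z::S \<times> S. snd (fst z))"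
    "bounded_linear (\<lambda>z::S \<times> S. fst (snd z))" "bounded_linear (\<lambda>z::S \<times> S. snd (snd z))"
    by (intro bounded_linear_compose[OF bounded_linear_fst] bounded_linear_compose[OF bounded_linear_snd] bounded_linear_fst bounded_linear_snd)+
  have d: "((\<lambda>z. h (M z)) has_derivative (\<lambda>v. of_real (M v) * partial 1 h (M z))) (at z)"
    if "smooth h" "bounded_linear M" for h :: "real \<Rightarrow> complex" and M :: "S \<times> S \<Rightarrow> real" and z
    using has_derivative_compose[OF bounded_linear_imp_has_derivative[OF that(2)] smooth_has_derivative[OF that(1)]] by simp
  have D: "(prod4 f \<alpha> g \<beta> has_derivative (\<lambda>v.
     of_real (fst (fst v)) * prod4 (partial 1 f) \<alpha> g \<beta> z + of_real (snd (fst v)) * prod4 f (partial 1 \<alpha>) g \<beta> z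
     + of_real (fst (snd v)) * prod4 f \<alpha> (partial 1 g) \<beta> z + of_real (snd (snd v)) * prod4 f \<alpha> g (partial 1 \<beta>) z)) (at z)" for z
    unfolding prod4_def case_prod_unfold
    by (rule has_derivative_eq_rhs[OF has_derivative_mult[OF has_derivative_mult[OF d[OF assms(1) L(1)] d[OF assms(2) L(2)]]
         has_derivative_mult[OF d[OF assms(3) L(3)] d[OF assms(4) L(4)]]]])
      (simp add: fun_eq_iff algebra_simps)
  show "partial ((1, 0), (0, 0)) (prod4 f \<alpha> g \<beta>) = prod4 (partial 1 f) \<alpha> g \<beta>"
    "partial ((0, 1), (0, 0)) (prod4 f \<alpha> g \<beta>) = prod4 f (partial 1 \<alpha>) g \<beta>"
    "partial ((0, 0), (1, 0)) (prod4 f \<alpha> g \<beta>) = prod4 f \<alpha> (partial 1 g) \<beta>"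
    "partial ((0, 0), (0, 1)) (prod4 f \<alpha> g \<beta>) = prod4 f \<alpha> g (partial 1 \<beta>)"
    by (simp_all add: partial_eqI[OF D])
qed

lemma smooth_partial1_funpow: "smooth f \<Longrightarrow> smooth ((partial (1::real) ^^ n) f)"
  by (induction n) (auto intro: smooth_partial)

lemma partials_prod4:
  assumes "smooth f" "smooth \<alpha>" "smooth g" "smooth \<beta>"
  shows "partials (replicate m ((1, 0), (0, 0)) @ replicate n ((0, 1), (0, 0)) @
       replicate p ((0, 0), (0, 1)) @ replicate q ((0, 0), (1, 0))) (prod4 f \<alpha> g \<beta>) =
    prod4 ((partial 1 ^^ m) f) ((partial 1 ^^ n) \<alpha>) ((partial 1 ^^ q) g) ((partial 1 ^^ p) \<beta>)"
proof -
  have "partials (replicate q ((0, 0), (1, 0))) (prod4 f \<alpha> g \<beta>) = prod4 f \<alpha> ((partial 1 ^^ q) g) \<beta>"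
    if "smooth f" "smooth \<alpha>" "smooth g" "smooth \<beta>" for f \<alpha> g \<beta>
    using that by (induction q) (simp_all add: partial_prod4 smooth_partial1_funpow)
  moreover have "partials (replicate p ((0, 0), (0, 1))) (prod4 f \<alpha> g \<beta>) = prod4 f \<alpha> g ((partial 1 ^^ p) \<beta>)"
    if "smooth f" "smooth \<alpha>" "smooth g" "smooth \<beta>" for f \<alpha> g \<beta>
    using that by (induction p) (simp_all add: partial_prod4 smooth_partial1_funpow)
  moreover have "partials (replicate n ((0, 1), (0, 0))) (prod4 f \<alpha> g \<beta>) = prod4 f ((partial 1 ^^ n) \<alpha>) g \<beta>"
    if "smooth f" "smooth \<alpha>" "smooth g" "smooth \<beta>" for f \<alpha> g \<beta>
    using that by (induction n) (simp_all add: partial_prod4 smooth_partial1_funpow)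
  moreover have "partials (replicate m ((1, 0), (0, 0))) (prod4 f \<alpha> g \<beta>) = prod4 ((partial 1 ^^ m) f) \<alpha> g \<beta>"
    if "smooth f" "smooth \<alpha>" "smooth g" "smooth \<beta>" for f \<alpha> g \<beta>
    using that by (induction m) (simp_all add: partial_prod4 smooth_partial1_funpow)
  ultimately show ?thesis using assms by (simp add: partials_append smooth_partial1_funpow)
qed

lemma moyal_prod4:
  assumes "smooth f" "smooth \<alpha>" "smooth g" "smooth \<beta>"
  shows "moyal k (prod4 f \<alpha> g \<beta>) = (\<lambda>x. \<Sum>b\<le>k. (- 1) ^ (k - b) / (fact b * fact (k - b)) *
    (((partial 1 ^^ b) f (fst x) * (partial 1 ^^ (k - b)) g (fst x)) * ((Dx ^^ (k - b)) \<alpha> (snd x) * (Dx ^^ b) \<beta> (snd x))))"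
  unfolding moyal_def partials_prod4[OF assms] Dx_funpow[OF assms(2)] Dx_funpow[OF assms(4)]
proof (rule ext, rule sum.cong[OF refl])
  fix x :: S and b assume "b \<in> {..k}"
  then have "(- \<i>) ^ k = (- \<i>) ^ b * (- \<i>) ^ (k - b)" by (simp flip: power_add)
  then show "(- \<i>) ^ k * (- 1) ^ (k - b) / (fact b * fact (k - b)) *
      prod4 ((partial 1 ^^ b) f) ((partial 1 ^^ (k - b)) \<alpha>) ((partial 1 ^^ (k - b)) g) ((partial 1 ^^ b) \<beta>) (x, x) =
     (- 1) ^ (k - b) / (fact b * fact (k - b)) * (((partial 1 ^^ b) f (fst x) * (partial 1 ^^ (k - b)) g (fst x)) *
      ((- \<i>) ^ (k - b) * (partial 1 ^^ (k - b)) \<alpha> (snd x) * ((- \<i>) ^ b * (partial 1 ^^ b) \<beta> (snd x))))"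
    by (simp add: prod4_def mult_ac)
qed

text \<open>On products of a function of \<open>a\<close> and a function of \<open>l\<close>,
  \<open>R\<close> and \<open>T\<close> act on the \<open>l\<close>-factor only, and the Moyal terms
  pair derivatives of \<open>f\<close> and \<open>g\<close> with powers of \<open>Dx\<close> on the
  opposite \<open>l\<close>-factors. The resulting sums coincide index by index with those read off
  from the integral.\<close>

lemma coef_val_eq:
  assumes "smooth f" "test_function \<phi>" "smooth g" "test_function \<psi>"
  defines "u \<equiv> \<lambda>x. f (fst x) * \<phi> (snd x)" and "v \<equiv> \<lambda>x. g (fst x) * \<psi> (snd x)"
  shows "T (mult moyal (left_leg R (right_leg R (tensor (single 0 u) (single 0 v))))) n (a, l) =
    coef_val \<phi> \<psi> (\<lambda>n. (partial 1 ^^ n) f a / fact n) (\<lambda>n. (partial 1 ^^ n) g a / fact n) l n"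
proof -
  have s: "smooth \<phi>" "smooth \<psi>" using assms test_function_smooth by auto
  have su: "sformal (single (0::nat) u)" "sformal (single (0::nat) v)"
    unfolding u_def v_def by (intro sformal_single smooth_prod2 assms s)+
  have r: "smooth (rop i \<phi>)" "smooth (rop i \<psi>)" for i
    using assms by (auto intro: test_function_smooth test_function_rop)
  have Ru: "R (single 0 u) = (\<lambda>n x. f (fst x) * rop n \<phi> (snd x))" "R (single 0 v) = (\<lambda>n x. g (fst x) * rop n \<psi> (snd x))"
    unfolding lift_op_single[OF lop_Rop] u_def v_def by (simp_all add: Rop_prod2 assms s)
  have L: "left_leg R (right_leg R (tensor (single 0 u) (single 0 v))) = (\<lambda>(i, j). prod4 f (rop i \<phi>) g (rop j \<psi>))"
    unfolding right_leg_tensor[OF formal_op_R su(2)] left_leg_tensor[OF formal_op_R su(1)] Ru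
    by (auto simp: tensor_def prod4_def fun_eq_iff)
  let ?F = "\<lambda>b c a. (partial 1 ^^ b) f a * (partial 1 ^^ c) g a"
  let ?G = "\<lambda>i j b c l. (Dx ^^ c) (rop i \<phi>) l * (Dx ^^ b) (rop j \<psi>) l"
  let ?c = "\<lambda>b c. (- 1) ^ c / (fact b * fact c) :: complex"
  have M: "mult moyal (\<lambda>(i, j). prod4 f (rop i \<phi>) g (rop j \<psi>)) m = (\<lambda>x. \<Sum>i\<le>m. \<Sum>j\<le>m - i. \<Sum>b\<le>m - i - j.
      ?c b (m - i - j - b) * (?F b (m - i - j - b) (fst x) * ?G i j b (m - i - j - b) (snd x)))" for m
    by (simp add: mult_def moyal_prod4 assms r)
  have sF: "smooth (\<lambda>x::S. ?F b c (fst x) * ?G i j b c (snd x))" for i j b c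
    by (rule smooth_prod2[of "?F b c" "?G i j b c"]) (intro smooth_mult smooth_partial1_funpow smooth_Dx_funpow assms r)+
  have sc: "smooth (\<lambda>x::S. ?c b c * (?F b c (fst x) * ?G i j b c (snd x)))" for i j b c
    by (rule smooth_mult[OF smooth_const sF])
  have TP: "Top k (\<lambda>x. ?c b c * (?F b c (fst x) * ?G i j b c (snd x))) = (\<lambda>x. ?c b c * (?F b c (fst x) * topx k (?G i j b c) (snd x)))" for k i j b c
    unfolding lop_cmult_arg[OF lop_Top sF]
    by (subst Top_prod2[of "?F b c" "?G i j b c"]) (intro smooth_mult smooth_partial1_funpow smooth_Dx_funpow assms r refl)+
  have TS: "Top k (mult moyal (\<lambda>(i, j). prod4 f (rop i \<phi>) g (rop j \<psi>)) m) = (\<lambda>x. \<Sum>i\<le>m. \<Sum>j\<le>m - i. \<Sum>b\<le>m - i - j.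
      ?c b (m - i - j - b) * (?F b (m - i - j - b) (fst x) * topx k (?G i j b (m - i - j - b)) (snd x)))" for k m
    unfolding M
    by (subst lop_sum_arg[OF lop_Top], (intro smooth_sum sc)[1], subst lop_sum_arg[OF lop_Top], (intro smooth_sum sc)[1],
        subst lop_sum_arg[OF lop_Top], (intro sc)[1]) (simp only: TP)
  show ?thesis
    unfolding L lift_op_def TS coef_val_def
    by (intro sum.cong refl) (simp add: mult_ac)
qed

section \<open>Stationary phase for products of test functions\<close>

definition rho2 :: "real \<times> real \<Rightarrow> real" where "rho2 z = rho1 (fst z) * rho1 (snd z)"

definition reg2 :: "real \<Rightarrow> real \<times> real \<Rightarrow> real set" where
  "reg2 C z = {h. 0 < h \<and> h \<le> 1 \<and> h * \<bar>fst z\<bar> \<le> C \<and> h * \<bar>snd z\<bar> \<le> C}"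

lemma rho2: "1 \<le> rho2 z"
  unfolding rho2_def using mult_mono[OF rho1 rho1, of "fst z" "snd z"] rho1[of "fst z"] by simp

lemma rho1_le_rho2: "rho1 (fst z) \<le> rho2 z" "rho1 (snd z) \<le> rho2 z"
  unfolding rho2_def using rho1[of "fst z"] rho1[of "snd z"] by (simp_all add: mult_le_cancel_left1 mult_le_cancel_right1)

text \<open>The symbol of \<open>T\<close> depends on \<open>P + Q\<close> only; its weights have to
  be dominated by powers of the product weight.\<close>

lemma rho1_sum: "rho1 (fst z + snd z) \<le> 2 * rho2 z"
proof -
  have "0 \<le> (fst z - snd z)\<^sup>2" "0 \<le> 2 * ((fst z)\<^sup>2 * (snd z)\<^sup>2)" by simp_all
  then have "1 + (fst z + snd z)\<^sup>2 \<le> 2 * ((1 + (fst z)\<^sup>2) * (1 + (snd z)\<^sup>2))"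
    by (simp add: power2_eq_square algebra_simps)
  then show ?thesis by (simp add: rho1_def rho2_def)
qed

lemma reg2_subset: "reg2 C z \<subseteq> {0<..1}" by (auto simp: reg2_def)

text \<open>Coefficients do not involve \<open>h\<close>, but their bounds are extracted from an
  expansion at some admissible \<open>h\<close>. So every \<open>z\<close> has to have one.\<close>

lemma reg2_nonempty: "C > 0 \<Longrightarrow> \<exists>h. h \<in> reg2 C z"
proof (intro exI)
  assume C: "C > 0"
  let ?m = "1 + \<bar>fst z\<bar> + \<bar>snd z\<bar>"
  let ?h = "min 1 (C / ?m)"
  have "?h * \<bar>x\<bar> \<le> C" if "\<bar>x\<bar> \<le> ?m" for x
  proof -
    have "?h * \<bar>x\<bar> \<le> C / ?m * ?m" using C that by (intro mult_mono) auto
    then show ?thesis by simp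
  qed
  then show "?h \<in> reg2 C z" using C by (simp add: reg2_def)
qed

lemma uexp_pull:
  assumes "uexp (reg C') \<W> F Fs" "\<And>z. reg2 C z \<subseteq> reg C' (m z)" "\<And>w. w \<in> \<W> \<Longrightarrow> (\<lambda>z. w (m z)) \<in> \<V>"
  shows "uexp (reg2 C) \<V> (\<lambda>h z. F h (m z)) (\<lambda>z. Fs (m z))"
proof -
  obtain W where W: "\<And>N. W N \<in> \<W>" "\<And>z. expn (reg C' z) (\<lambda>h. F h z) (Fs z) (\<lambda>N. W N z)"
    using assms(1) by (auto simp: uexp_def)
  have "expn (reg2 C z) (\<lambda>h. F h (m z)) (Fs (m z)) (\<lambda>N. W N (m z))" for z
    using W(2)[of "m z"] assms(2)[of z] by (auto simp: expn_def)
  then show ?thesis unfolding uexp_def using assms(3)[OF W(1)]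
    by (intro exI[of _ "\<lambda>N z. W N (m z)"]) auto
qed

lemma pol_pull:
  assumes "w \<in> pol rho1" "\<And>z. rho1 (m z) \<le> 2 * rho2 z"
  shows "(\<lambda>z. w (m z)) \<in> pol rho2"
proof -
  obtain B M where B: "B \<ge> 0" "\<And>z. \<bar>w z\<bar> \<le> B * rho1 z ^ M" using pol_E[OF rho1 assms(1)] by metis
  have "\<bar>w (m z)\<bar> \<le> (B * 2 ^ M) * rho2 z ^ M" for z
  proof -
    have "\<bar>w (m z)\<bar> \<le> B * (2 * rho2 z) ^ M"
      using B(1) rho1[of "m z"] by (intro order_trans[OF B(2)] mult_left_mono power_mono assms(2)) auto
    then show ?thesis by (simp add: power_mult_distrib)
  qed
  then show ?thesis unfolding pol_def by blast
qed

lemma sch_prod: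
  assumes "v \<in> sch rho1" "w \<in> sch rho1"
  shows "(\<lambda>z. v (fst z) * w (snd z)) \<in> sch rho2"
  unfolding sch_def mem_Collect_eq
proof
  fix k
  obtain B C where B: "\<And>z. \<bar>v z\<bar> * rho1 z ^ k \<le> B" and C: "\<And>z. \<bar>w z\<bar> * rho1 z ^ k \<le> C"
    using assms unfolding sch_def by blast
  have "\<bar>v (fst z) * w (snd z)\<bar> * rho2 z ^ k \<le> B * C" for z
  proof -
    have "(\<bar>v (fst z)\<bar> * rho1 (fst z) ^ k) * (\<bar>w (snd z)\<bar> * rho1 (snd z) ^ k) \<le> B * C"
    proof (rule mult_mono[OF B C])
      have "0 \<le> \<bar>v 0\<bar> * rho1 0 ^ k" using rho1[of 0] by simp
      then show "0 \<le> B" using B[of 0] by linarith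
      show "0 \<le> \<bar>w (snd z)\<bar> * rho1 (snd z) ^ k" using rho1[of "snd z"] by simp
    qed
    then show ?thesis by (simp add: rho2_def abs_mult power_mult_distrib mult_ac)
  qed
  then show "\<exists>B. \<forall>z. \<bar>v (fst z) * w (snd z)\<bar> * rho2 z ^ k \<le> B" by blast
qed

text \<open>The integrand after the substitution \<open>a\<^sub>1 = a + h Q\<close>, \<open>a\<^sub>2 = a - h P\<close> with \<open>z = (P, Q)\<close>, without its factor
  \<open>exp (\<i> l (P + Q))\<close>.\<close>

definition theta :: "(real \<Rightarrow> complex) \<Rightarrow> (real \<Rightarrow> complex) \<Rightarrow> (real \<Rightarrow> complex) \<Rightarrow> (real \<Rightarrow> complex) \<Rightarrow> real \<Rightarrow> real \<Rightarrow>
    real \<Rightarrow> real \<times> real \<Rightarrow> complex" where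
  "theta f \<phi> g \<psi> a l h z = (ft \<phi> (sinh (h * fst z) / h) * ft \<psi> (sinh (h * snd z) / h)) *
    ((cis (l * yfun h (fst z + snd z)) * of_real (cosh (h * (fst z + snd z)))) * (f (a + h * snd z) * g (a + h * (- fst z))))"

definition theta_fps :: "(real \<Rightarrow> complex) \<Rightarrow> (real \<Rightarrow> complex) \<Rightarrow> (real \<Rightarrow> complex) \<Rightarrow> (real \<Rightarrow> complex) \<Rightarrow> real \<Rightarrow> real \<Rightarrow>
    real \<times> real \<Rightarrow> complex fps" where
  "theta_fps f \<phi> g \<psi> a l z = tsym l (fst z + snd z) *
    tail_fps \<phi> \<psi> (\<lambda>n. (partial 1 ^^ n) f a / fact n) (\<lambda>n. (partial 1 ^^ n) g a / fact n) z"

lemma uexp_theta: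
  assumes "test_function \<phi>" "test_function \<psi>" "smooth f" "smooth g"
  shows "uexp (reg2 C) (sch rho2) (theta f \<phi> g \<psi> a l) (theta_fps f \<phi> g \<psi> a l)"
proof -
  have H: "reg2 C z \<subseteq> {0<..1}" for z by (rule reg2_subset)
  \<comment> \<open>A weight that decays in one variable alone is not in \<open>sch rho2\<close>.
    The two transforms therefore keep separate weight classes until they are multiplied.\<close>
  let ?V1 = "{\<lambda>z. w (fst z) | w. w \<in> sch rho1}" and ?V2 = "{\<lambda>z. w (snd z) | w. w \<in> sch rho1}"
  have 1: "uexp (reg2 C) ?V1 (\<lambda>h z. ft \<phi> (sinh (h * fst z) / h)) (\<lambda>z. Abs_fps (\<lambda>n. ft (rop n \<phi>) (fst z)))"
    by (rule uexp_pull[OF uexp_ft[OF assms(1), of C]]) (auto simp: reg2_def reg_def)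
  have 2: "uexp (reg2 C) ?V2 (\<lambda>h z. ft \<psi> (sinh (h * snd z) / h)) (\<lambda>z. Abs_fps (\<lambda>n. ft (rop n \<psi>) (snd z)))"
    by (rule uexp_pull[OF uexp_ft[OF assms(2), of C]]) (auto simp: reg2_def reg_def)
  have 12: "uexp (reg2 C) (sch rho2) (\<lambda>h z. ft \<phi> (sinh (h * fst z) / h) * ft \<psi> (sinh (h * snd z) / h))
      (\<lambda>z. Abs_fps (\<lambda>n. ft (rop n \<phi>) (fst z)) * Abs_fps (\<lambda>n. ft (rop n \<psi>) (snd z)))"
    by (rule uexp_mult[OF 1 2 H _ add_closed_sch[OF rho2]]) (auto intro: sch_prod)
  have sub: "reg2 C z \<subseteq> reg (2 * C) (fst z + snd z)" for z
  proof
    fix h assume h: "h \<in> reg2 C z"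
    then have "h * \<bar>fst z + snd z\<bar> \<le> h * (\<bar>fst z\<bar> + \<bar>snd z\<bar>)"
      by (intro mult_left_mono abs_triangle_ineq) (simp add: reg2_def)
    then show "h \<in> reg (2 * C) (fst z + snd z)" using h by (simp add: reg2_def reg_def distrib_left)
  qed
  have r: "rho1 (fst z) \<le> 2 * rho2 z" "rho1 (snd z) \<le> 2 * rho2 z" "rho1 (- fst z) \<le> 2 * rho2 z" for z
    using rho1_le_rho2[of z] rho2[of z] by (auto simp: rho1_def)
  have 3: "uexp (reg2 C) (pol rho2) (\<lambda>h z. cis (l * yfun h (fst z + snd z)))
     (\<lambda>z. Abs_fps (\<lambda>n. \<Sum>j\<le>n. shcoef n j * (\<i> * of_real l) ^ j * of_real (fst z + snd z) ^ (n + j)))"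
    by (rule uexp_pull[OF uexp_cis sub]) (auto intro: pol_pull rho1_sum)
  have 4: "uexp (reg2 C) (pol rho2) (\<lambda>h z. of_real (cosh (h * (fst z + snd z))))
     (\<lambda>z. Abs_fps (\<lambda>n. fps_nth fps_ch n * of_real (fst z + snd z) ^ n))"
    by (rule uexp_pull[OF uexp_cosh sub]) (auto intro: pol_pull rho1_sum)
  have 5: "uexp (reg2 C) (pol rho2) (\<lambda>h z. f (a + h * snd z))
     (\<lambda>z. Abs_fps (\<lambda>n. (partial 1 ^^ n) f a / fact n * of_real (snd z) ^ n))"
    by (rule uexp_pull[OF uexp_smooth[OF assms(3), of C]]) (auto intro: pol_pull r simp: reg2_def reg_def)
  have 6: "uexp (reg2 C) (pol rho2) (\<lambda>h z. g (a + h * (- fst z)))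
     (\<lambda>z. Abs_fps (\<lambda>n. (partial 1 ^^ n) g a / fact n * of_real (- fst z) ^ n))"
    by (rule uexp_pull[OF uexp_smooth[OF assms(4), of C]]) (auto intro: pol_pull r simp: reg2_def reg_def)
  note P = H pol_mult[OF rho2] add_closed_pol[OF rho2]
  have "uexp (reg2 C) (sch rho2) (theta f \<phi> g \<psi> a l)
    (\<lambda>z. (Abs_fps (\<lambda>n. ft (rop n \<phi>) (fst z)) * Abs_fps (\<lambda>n. ft (rop n \<psi>) (snd z))) *
      (tsym l (fst z + snd z) * (Abs_fps (\<lambda>n. (partial 1 ^^ n) f a / fact n * of_real (snd z) ^ n) *
        Abs_fps (\<lambda>n. (partial 1 ^^ n) g a / fact n * of_real (- fst z) ^ n))))"
    unfolding theta_def[abs_def] tsym_def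
    by (rule uexp_mult[OF 12 uexp_mult[OF uexp_mult[OF 3 4 P] uexp_mult[OF 5 6 P] P] H sch_pol_mult[OF rho2] add_closed_sch[OF rho2]])
  moreover have "(p * q) * (t * r) = t * (p * (q * r))" for p q r t :: "complex fps" by (simp add: mult_ac)
  ultimately show ?thesis unfolding theta_fps_def[abs_def] tail_fps_def case_prod_unfold by simp
qed

text \<open>Outside of \<open>reg2\<close> the compact supports make \<open>theta\<close> vanish, and there \<open>h\<close> is so large that \<open>1 \<le> (h rho2 / C)\<^sup>N\<close>
  absorbs the partial sum.\<close>

lemma theta_bound:
  assumes t: "test_function \<phi>" "test_function \<psi>" "test_function f" "test_function g"
  shows "\<exists>B. \<forall>h z. 0 < h \<longrightarrow> h \<le> 1 \<longrightarrow>
    norm (theta f \<phi> g \<psi> a l h z - (\<Sum>n<N. of_real h ^ n * fps_nth (theta_fps f \<phi> g \<psi> a l z) n)) \<le> h ^ N * (B / rho2 z)"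
    and "\<exists>B. \<forall>z. norm (fps_nth (theta_fps f \<phi> g \<psi> a l z) n) \<le> B / rho2 z"
proof -
  obtain A1 where A1: "A1 > 0" "\<And>x. A1 \<le> norm x \<Longrightarrow> f x = 0" using test_function_support[OF t(3)] by metis
  obtain A2 where A2: "A2 > 0" "\<And>x. A2 \<le> norm x \<Longrightarrow> g x = 0" using test_function_support[OF t(4)] by metis
  \<comment> \<open>If \<open>h * \<bar>snd z\<bar>\<close> exceeds \<open>C\<close>, the point
    \<open>a + h * snd z\<close> has left the support of \<open>f\<close>; for \<open>fst z\<close>
    the same happens with \<open>g\<close>. Adding \<open>\<bar>a\<bar>\<close> accounts for the
    shift by \<open>a\<close>.\<close>
  define C where "C = max A1 A2 + \<bar>a\<bar>"
  have C: "C > 0" using A1 by (simp add: C_def)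
  have zero: "theta f \<phi> g \<psi> a l h z = 0" if "0 < h" "h \<le> 1" "h \<notin> reg2 C z" for h z
  proof -
    have "C < \<bar>h * fst z\<bar> \<or> C < \<bar>h * snd z\<bar>" using that by (auto simp: reg2_def abs_mult)
    then have "A2 \<le> \<bar>a + h * (- fst z)\<bar> \<or> A1 \<le> \<bar>a + h * snd z\<bar>" unfolding C_def by auto
    then show ?thesis using A1(2) A2(2) by (auto simp: theta_def)
  qed
  obtain W where W: "\<And>N. W N \<in> sch rho2"
    "\<And>z. expn (reg2 C z) (\<lambda>h. theta f \<phi> g \<psi> a l h z) (theta_fps f \<phi> g \<psi> a l z) (\<lambda>N. W N z)"
    using uexp_theta[OF t(1,2) test_function_smooth[OF t(3)] test_function_smooth[OF t(4)], of C a l]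
    by (auto simp: uexp_def)
  have coef: "norm (fps_nth (theta_fps f \<phi> g \<psi> a l z) n) \<le> W n z + W (Suc n) z" for n z
    using reg2_nonempty[OF C, of z] expn_coeff[OF W(2) _ reg2_subset] by blast
  have Wn: "0 \<le> W N z" for N z
    using reg2_nonempty[OF C, of z] expn_nonneg[OF W(2) _ reg2_subset] by blast
  have le: "\<exists>B. \<forall>z. w z \<le> B / rho2 z" if "w \<in> sch rho2" for w
  proof -
    obtain B where B: "\<And>z. \<bar>w z\<bar> * rho2 z ^ 1 \<le> B" using \<open>w \<in> sch rho2\<close> unfolding sch_def by blast
    have "w z \<le> B / rho2 z" for z
    proof -
      have "w z * rho2 z \<le> \<bar>w z\<bar> * rho2 z ^ 1" using rho2[of z] by (auto intro: mult_right_mono)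
      then have "w z * rho2 z \<le> B" using B[of z] by linarith
      then show ?thesis using rho2[of z] by (subst pos_le_divide_eq) auto
    qed
    then show ?thesis by blast
  qed
  have add: "(\<lambda>z. v z + w z) \<in> sch rho2" if "v \<in> sch rho2" "w \<in> sch rho2" for v w
    using add_closed_sch[of rho2, OF rho2] that unfolding add_closed_def by blast
  show "\<exists>B. \<forall>z. norm (fps_nth (theta_fps f \<phi> g \<psi> a l z) n) \<le> B / rho2 z"
  proof -
    obtain B where "\<And>z. W n z + W (Suc n) z \<le> B / rho2 z" using le[OF add[OF W(1)[of n] W(1)[of "Suc n"]]] by blast
    then show ?thesis by (intro exI[of _ B] allI order_trans[OF coef])
  qed
  let ?w = "\<lambda>z. W N z + (\<Sum>n<N. W n z + W (Suc n) z) * ((1 / C) ^ N * rho2 z ^ N)"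
  have p: "(\<lambda>z. (1 / C) ^ N * rho2 z ^ N) \<in> pol rho2"
    unfolding pol_def mem_Collect_eq
  proof (intro exI allI)
    fix z show "\<bar>(1 / C) ^ N * rho2 z ^ N\<bar> \<le> (1 / C) ^ N * rho2 z ^ N" using C rho2[of z] by simp
  qed
  have w: "?w \<in> sch rho2"
    by (intro add W sch_pol_mult[OF rho2] p add_closed_sum[OF add_closed_sch[OF rho2]])
  have main: "norm (theta f \<phi> g \<psi> a l h z - (\<Sum>n<N. of_real h ^ n * fps_nth (theta_fps f \<phi> g \<psi> a l z) n)) \<le> h ^ N * ?w z"
    if h: "0 < h" "h \<le> 1" for h z
  proof (cases "h \<in> reg2 C z")
    case True
    have "norm (theta f \<phi> g \<psi> a l h z - (\<Sum>n<N. of_real h ^ n * fps_nth (theta_fps f \<phi> g \<psi> a l z) n)) \<le> h ^ N * W N z"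
      by (rule expnD[OF W(2) True])
    also have "\<dots> \<le> h ^ N * ?w z"
    proof (rule mult_left_mono)
      have "0 \<le> (\<Sum>n<N. W n z + W (Suc n) z) * ((1 / C) ^ N * rho2 z ^ N)"
        using C rho2[of z] by (intro mult_nonneg_nonneg sum_nonneg add_nonneg_nonneg Wn) auto
      then show "W N z \<le> ?w z" by simp
    qed (use h in auto)
    finally show ?thesis .
  next
    case False
    have "1 \<le> (h * rho2 z / C) ^ N"
    proof (rule one_le_power)
      have "C \<le> h * \<bar>fst z\<bar> \<or> C \<le> h * \<bar>snd z\<bar>" using False h by (auto simp: reg2_def)
      moreover have "\<bar>fst z\<bar> \<le> rho2 z" "\<bar>snd z\<bar> \<le> rho2 z"
        using abs_le_rho1 rho1_le_rho2 order_trans by blast+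
      then have "h * \<bar>fst z\<bar> \<le> h * rho2 z" "h * \<bar>snd z\<bar> \<le> h * rho2 z" using h by (auto intro: mult_left_mono)
      ultimately show "1 \<le> h * rho2 z / C" using C by (auto simp: field_simps)
    qed
    then have one: "1 \<le> h ^ N * ((1 / C) ^ N * rho2 z ^ N)" by (simp add: power_mult_distrib power_divide field_simps)
    have "norm (theta f \<phi> g \<psi> a l h z - (\<Sum>n<N. of_real h ^ n * fps_nth (theta_fps f \<phi> g \<psi> a l z) n)) \<le>
        (\<Sum>n<N. W n z + W (Suc n) z)"
      unfolding zero[OF h False]
    proof (simp, rule sum_norm_le)
      fix n
      have "norm (of_real h ^ n * fps_nth (theta_fps f \<phi> g \<psi> a l z) n) \<le> 1 * (W n z + W (Suc n) z)"
        unfolding norm_mult norm_power using h by (intro mult_mono coef) (auto intro: power_le_one)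
      then show "norm (of_real h ^ n * fps_nth (theta_fps f \<phi> g \<psi> a l z) n) \<le> W n z + W (Suc n) z" by simp
    qed
    also have "\<dots> \<le> (\<Sum>n<N. W n z + W (Suc n) z) * (h ^ N * ((1 / C) ^ N * rho2 z ^ N))"
      using mult_left_mono[OF one, of "\<Sum>n<N. W n z + W (Suc n) z"] by (simp add: sum_nonneg Wn)
    also have "\<dots> \<le> h ^ N * ?w z"
      using Wn[of N z] h by (simp add: distrib_left mult_ac)
    finally show ?thesis .
  qed
  obtain B where B: "\<And>z. ?w z \<le> B / rho2 z" using le[OF w] by blast
  have "norm (theta f \<phi> g \<psi> a l h z - (\<Sum>n<N. of_real h ^ n * fps_nth (theta_fps f \<phi> g \<psi> a l z) n)) \<le> h ^ N * (B / rho2 z)"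
    if "0 < h" "h \<le> 1" for h z
  proof -
    have "h ^ N * ?w z \<le> h ^ N * (B / rho2 z)" using B that by (intro mult_left_mono) auto
    then show ?thesis by (rule order_trans[OF main[OF that]])
  qed
  then show "\<exists>B. \<forall>h z. 0 < h \<longrightarrow> h \<le> 1 \<longrightarrow>
    norm (theta f \<phi> g \<psi> a l h z - (\<Sum>n<N. of_real h ^ n * fps_nth (theta_fps f \<phi> g \<psi> a l z) n)) \<le> h ^ N * (B / rho2 z)"
    by blast
qed

section \<open>Evaluation of the oscillatory integral\<close>

lemma continuous_on_fps_mult:
  assumes "\<And>n. continuous_on X (\<lambda>z. fps_nth (F z) n)" "\<And>n. continuous_on X (\<lambda>z. fps_nth (G z :: complex fps) n)"
  shows "continuous_on X (\<lambda>z. fps_nth (F z * G z) n)"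
  unfolding fps_mult_nth by (intro continuous_intros assms)

lemma continuous_on_ft_compose: "test_function \<phi> \<Longrightarrow> continuous_on X m \<Longrightarrow> continuous_on X (\<lambda>z. ft \<phi> (m z))"
  by (rule continuous_on_compose2[OF continuous_on_ft[of \<phi> UNIV]]) auto

lemma continuous_on_smooth_compose: "smooth f \<Longrightarrow> continuous_on X m \<Longrightarrow> continuous_on X (\<lambda>z. f (m z))"
  by (rule continuous_on_compose2[OF smooth_continuous_on[of f UNIV]]) auto

lemma continuous_on_theta:
  assumes t: "test_function \<phi>" "test_function \<psi>" "smooth f" "smooth g" "h \<noteq> 0"
  shows "continuous_on X (theta f \<phi> g \<psi> a l h)" "continuous_on X (\<lambda>z. fps_nth (theta_fps f \<phi> g \<psi> a l z) n)"
proof -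
  show "continuous_on X (theta f \<phi> g \<psi> a l h)"
    unfolding theta_def[abs_def] yfun_def using assms(5)
    by (intro continuous_intros continuous_on_ft_compose[OF t(1)] continuous_on_ft_compose[OF t(2)]
        continuous_on_smooth_compose[OF t(3)] continuous_on_smooth_compose[OF t(4)]) auto
  have "continuous_on X (\<lambda>z. fps_nth (tsym l (fst z + snd z)) n)" for n
    unfolding tsym_nth by (intro continuous_intros)
  moreover have "continuous_on X (\<lambda>z. fps_nth (tail_fps \<phi> \<psi> fs gs z) n)" for fs gs n
    unfolding tail_fps_def case_prod_unfold
    by (intro continuous_on_fps_mult) (auto intro!: continuous_intros
        continuous_on_ft_compose[OF test_function_rop[OF t(1)]] continuous_on_ft_compose[OF test_function_rop[OF t(2)]])
  ultimately show "continuous_on X (\<lambda>z. fps_nth (theta_fps f \<phi> g \<psi> a l z) n)"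
    unfolding theta_fps_def by (intro continuous_on_fps_mult)
qed

lemma integrable_rho2: "integrable (lborel \<Otimes>\<^sub>M lborel) (\<lambda>z. 1 / rho2 z)"
proof -
  have "integrable lborel (\<lambda>x::real. complex_of_real (1 / (1 + x\<^sup>2)))"
    using integrable_inverse_quadratic by (rule integrable_of_real)
  from integrable_norm[OF integrable_lborel_pair[OF this this]]
  have "integrable (lborel \<Otimes>\<^sub>M lborel) (\<lambda>z. norm (case z of (x, y) \<Rightarrow> complex_of_real (1 / (1 + x\<^sup>2)) * complex_of_real (1 / (1 + y\<^sup>2))))" .
  also have "(\<lambda>z. norm (case z of (x, y) \<Rightarrow> complex_of_real (1 / (1 + x\<^sup>2)) * complex_of_real (1 / (1 + y\<^sup>2)))) = (\<lambda>z. 1 / rho2 z)"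
    by (auto simp: fun_eq_iff rho2_def rho1_def norm_mult norm_divide add_nonneg_nonneg simp flip: of_real_mult of_real_divide)
  finally show ?thesis .
qed

lemma integrable_rho2_bound:
  fixes F :: "real \<times> real \<Rightarrow> complex"
  assumes "continuous_on UNIV F" "\<And>z. norm (F z) \<le> B / rho2 z"
  shows "integrable (lborel \<Otimes>\<^sub>M lborel) F"
proof (rule Bochner_Integration.integrable_bound)
  show "integrable (lborel \<Otimes>\<^sub>M lborel) (\<lambda>z. B * (1 / rho2 z))"
    by (intro integrable_mult_right integrable_rho2)
  show "F \<in> borel_measurable (lborel \<Otimes>\<^sub>M lborel)"
    unfolding lborel_prod using borel_measurable_continuous_onI[OF assms(1)] by simp
  show "AE z in lborel \<Otimes>\<^sub>M lborel. norm (F z) \<le> norm (B * (1 / rho2 z))"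
  proof (rule AE_I2)
    fix z
    have "norm (F z) \<le> B * (1 / rho2 z)" using assms(2)[of z] by simp
    then show "norm (F z) \<le> norm (B * (1 / rho2 z))" unfolding real_norm_def by linarith
  qed
qed

lemma integral_lborel_prod:
  fixes F :: "'a::euclidean_space \<times> 'b::euclidean_space \<Rightarrow> complex"
  assumes "integrable lborel F"
  shows "(LINT z|lborel. F z) = (LINT x|lborel. LINT y|lborel. F (x, y))"
    and "integrable lborel (\<lambda>x. LINT y|lborel. F (x, y))"
proof -
  have F: "integrable (lborel \<Otimes>\<^sub>M lborel) F" using assms by (simp add: lborel_prod)
  show "(LINT z|lborel. F z) = (LINT x|lborel. LINT y|lborel. F (x, y))"
    using lborel_pair.integral_fst'[OF F] by (simp add: lborel_prod)
  show "integrable lborel (\<lambda>x. LINT y|lborel. F (x, y))"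
    by (rule lborel_pair.integrable_fst'[OF F])
qed

lemma integral_dilation:
  fixes G :: "real \<Rightarrow> complex"
  assumes "c \<noteq> 0"
  shows "(LINT x|lborel. G x) = of_real \<bar>c\<bar> * (LINT x|lborel. G (a + c * x))"
  using lborel_integral_real_affine[OF assms, of G a] by (simp add: scaleR_conv_of_real)

text \<open>The phase is linear in \<open>l1\<close> and in \<open>l2\<close>, so these integrations
  give Fourier transforms at \<open>sinh (a1 - a) / h\<close> and \<open>sinh (a - a2) / h\<close>.
  The interchanges take place while the integrand is continuous with compact support. The Jacobian
  \<open>h\<^sup>2\<close> of the final substitution cancels the powers of \<open>h\<close> in the
  normalization.\<close>

lemma star_integral_eq:
  assumes t: "test_function f" "test_function \<phi>" "test_function g" "test_function \<psi>" and h: "0 < h" "h \<le> 1"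
  shows "star_integral h (\<lambda>x. f (fst x) * \<phi> (snd x)) (\<lambda>x. g (fst x) * \<psi> (snd x)) (a, l) =
    of_real ((1 / (2 * pi))\<^sup>2) * (LINT z|(lborel \<Otimes>\<^sub>M lborel). cis (l * (fst z + snd z)) * theta f \<phi> g \<psi> a l h z)"
proof -
  note s = t[THEN test_function_smooth]
  note cont = continuous_on_smooth_compose[OF s(1)] continuous_on_smooth_compose[OF s(2)]
    continuous_on_smooth_compose[OF s(3)] continuous_on_smooth_compose[OF s(4)]
    continuous_on_ft_compose[OF t(2)] continuous_on_ft_compose[OF t(4)]
  obtain A1 where A1: "A1 > 0" "\<And>x. A1 \<le> norm x \<Longrightarrow> f x = 0" using test_function_support[OF t(1)] by metis
  obtain A2 where A2: "A2 > 0" "\<And>x. A2 \<le> norm x \<Longrightarrow> \<phi> x = 0" using test_function_support[OF t(2)] by metis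
  obtain A3 where A3: "A3 > 0" "\<And>x. A3 \<le> norm x \<Longrightarrow> g x = 0" using test_function_support[OF t(3)] by metis
  obtain A4 where A4: "A4 > 0" "\<And>x. A4 \<le> norm x \<Longrightarrow> \<psi> x = 0" using test_function_support[OF t(4)] by metis
  define e where "e a1 a2 = f a1 * g a2 * of_real (cosh (a1 - a2)) * cis (sinh (a1 - a2) / h * l)" for a1 a2
  define k where "k a1 l1 a2 = e a1 a2 * ft \<psi> (sinh (a1 - a) / h) * (\<phi> l1 * cis (- (sinh (a - a2) / h * l1)))" for a1 l1 a2
  define F where "F = (\<lambda>((a1, l1), (a2, l2)). e a1 a2 * (\<phi> l1 * cis (- (sinh (a - a2) / h * l1))) *
    (\<psi> l2 * cis (- (sinh (a1 - a) / h * l2))))"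
  have cF: "continuous_on UNIV F"
    unfolding F_def e_def case_prod_unfold using h by (intro continuous_intros cont) auto
  have sF: "F z = 0" if "A1 + A2 + A3 + A4 \<le> norm z" for z
  proof -
    obtain a1 l1 a2 l2 where z: "z = ((a1, l1), (a2, l2))" by (metis surj_pair)
    have "norm z \<le> norm (a1, l1) + norm (a2, l2)" unfolding z by (rule norm_Pair_le)
    also have "\<dots> \<le> norm a1 + norm l1 + (norm a2 + norm l2)" by (intro add_mono norm_Pair_le)
    finally have "A1 \<le> norm a1 \<or> A2 \<le> norm l1 \<or> A3 \<le> norm a2 \<or> A4 \<le> norm l2" using that by linarith
    then show ?thesis unfolding z F_def e_def using A1 A2 A3 A4 by auto
  qed
  have iF: "integrable lborel F" by (rule integrable_compact_support[OF cF sF])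
  have ph: "exp (\<i> / complex_of_real h * complex_of_real (phase (a, l) (a1, l1) (a2, l2))) =
      cis (sinh (a1 - a2) / h * l) * cis (- (sinh (a - a2) / h * l1)) * cis (- (sinh (a1 - a) / h * l2))" for a1 l1 a2 l2
  proof -
    have "sinh (a - a1) = - sinh (a1 - a)" "sinh (a2 - a) = - sinh (a - a2)"
      by (metis minus_diff_eq sinh_minus)+
    then have "phase (a, l) (a1, l1) (a2, l2) / h =
        sinh (a1 - a2) / h * l + - (sinh (a - a2) / h * l1) + - (sinh (a1 - a) / h * l2)"
      by (simp add: phase_def add_divide_distrib diff_divide_distrib)
    moreover have "\<i> / complex_of_real h * complex_of_real x = \<i> * complex_of_real (x / h)" for x by simp
    ultimately show ?thesis by (simp only: cis_mult cis_conv_exp[of "_ + _ + _"])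
  qed
  have "(LINT (x1, x2)|lborel. (f (fst x1) * \<phi> (snd x1)) * (g (fst x2) * \<psi> (snd x2)) * complex_of_real (amplitude x1 x2) *
        exp (\<i> / complex_of_real h * complex_of_real (phase (a, l) x1 x2))) = (LINT z|lborel. F z)"
  proof (rule Bochner_Integration.integral_cong)
    fix z :: "S \<times> S"
    obtain a1 l1 a2 l2 where z: "z = ((a1, l1), (a2, l2))" by (metis surj_pair)
    show "(case z of (x1, x2) \<Rightarrow> (f (fst x1) * \<phi> (snd x1)) * (g (fst x2) * \<psi> (snd x2)) * complex_of_real (amplitude x1 x2) *
        exp (\<i> / complex_of_real h * complex_of_real (phase (a, l) x1 x2))) = F z"
      unfolding z by (simp only: ph F_def e_def amplitude_def prod.case fst_conv snd_conv mult_ac)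
  qed simp
  also have "\<dots> = (LINT x1|lborel. LINT x2|lborel. F (x1, x2))" by (rule integral_lborel_prod(1)[OF iF])
  also have "\<dots> = (LINT x1|lborel. LINT a2|lborel. k (fst x1) (snd x1) a2)"
  proof (rule Bochner_Integration.integral_cong)
    fix x1 :: S
    have "integrable lborel (\<lambda>x2. F (x1, x2))"
    proof (rule integrable_compact_support)
      show "continuous_on UNIV (\<lambda>x2. F (x1, x2))"
        by (rule continuous_on_compose2[OF cF]) (auto intro!: continuous_intros)
      show "F (x1, x2) = 0" if "A1 + A2 + A3 + A4 \<le> norm x2" for x2
        by (rule sF[OF order_trans[OF that norm_snd_le]])
    qed
    from integral_lborel_prod(1)[OF this]
    have "(LINT x2|lborel. F (x1, x2)) = (LINT a2|lborel. LINT l2|lborel. F (x1, (a2, l2)))" .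
    moreover have "(LINT l2|lborel. F (x1, (a2, l2))) = k (fst x1) (snd x1) a2" for a2
    proof -
      have "(LINT l2|lborel. F (x1, (a2, l2))) = e (fst x1) a2 * (\<phi> (snd x1) * cis (- (sinh (a - a2) / h * snd x1))) *
          ft \<psi> (sinh (fst x1 - a) / h)"
        unfolding F_def case_prod_unfold ft_def fst_conv snd_conv by (rule integral_mult_right_zero)
      then show ?thesis unfolding k_def by (simp only: mult_ac)
    qed
    ultimately show "(LINT x2|lborel. F (x1, x2)) = (LINT a2|lborel. k (fst x1) (snd x1) a2)" by simp
  qed simp
  also have "\<dots> = (LINT a1|lborel. LINT l1|lborel. LINT a2|lborel. k a1 l1 a2)"
  proof -
    have "integrable lborel (\<lambda>z. k (fst (fst z)) (snd (fst z)) (snd z))" 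
    proof (rule integrable_compact_support)
      show "continuous_on UNIV (\<lambda>z. k (fst (fst z)) (snd (fst z)) (snd z))"
        unfolding k_def e_def using h by (intro continuous_intros cont) auto
      fix z :: "(real \<times> real) \<times> real" assume z: "A1 + A2 + A3 \<le> norm z"
      obtain a1 l1 a2 where z': "z = ((a1, l1), a2)" by (metis surj_pair)
      have "norm z \<le> norm (a1, l1) + norm a2" unfolding z' by (rule norm_Pair_le)
      also have "norm (a1, l1) \<le> norm a1 + norm l1" by (rule norm_Pair_le)
      finally have "A1 \<le> norm a1 \<or> A2 \<le> norm l1 \<or> A3 \<le> norm a2" using z by linarith
      then show "k (fst (fst z)) (snd (fst z)) (snd z) = 0" unfolding z' k_def e_def using A1 A2 A3 by auto
    qed
    from integral_lborel_prod(2)[OF this] have "integrable lborel (\<lambda>x1. LINT a2|lborel. k (fst x1) (snd x1) a2)" by simp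
    from integral_lborel_prod(1)[OF this] show ?thesis by simp
  qed
  also have "\<dots> = (LINT a1|lborel. LINT a2|lborel. e a1 a2 * ft \<psi> (sinh (a1 - a) / h) * ft \<phi> (sinh (a - a2) / h))"
  proof (rule Bochner_Integration.integral_cong)
    fix a1 :: real
    have "integrable lborel (\<lambda>z. k a1 (fst z) (snd z))" 
    proof (rule integrable_compact_support)
      show "continuous_on UNIV (\<lambda>z. k a1 (fst z) (snd z))"
        unfolding k_def e_def using h by (intro continuous_intros cont) auto
      fix z :: "real \<times> real" assume z: "A2 + A3 \<le> norm z"
      obtain l1 a2 where z': "z = (l1, a2)" by (metis surj_pair)
      have "norm z \<le> norm l1 + norm a2" unfolding z' by (rule norm_Pair_le)
      then have "A2 \<le> norm l1 \<or> A3 \<le> norm a2" using z by linarith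
      then show "k a1 (fst z) (snd z) = 0" unfolding z' k_def e_def using A2 A3 by auto
    qed
    then have "integrable (lborel \<Otimes>\<^sub>M lborel) (\<lambda>(l1, a2). k a1 l1 a2)" by (simp add: lborel_prod case_prod_unfold)
    from lborel_pair.Fubini_integral[OF this]
    have "(LINT l1|lborel. LINT a2|lborel. k a1 l1 a2) = (LINT a2|lborel. LINT l1|lborel. k a1 l1 a2)" by simp
    moreover have "(LINT l1|lborel. k a1 l1 a2) = e a1 a2 * ft \<psi> (sinh (a1 - a) / h) * ft \<phi> (sinh (a - a2) / h)" for a2
      unfolding k_def ft_def by (rule integral_mult_right_zero)
    ultimately show "(LINT l1|lborel. LINT a2|lborel. k a1 l1 a2) =
      (LINT a2|lborel. e a1 a2 * ft \<psi> (sinh (a1 - a) / h) * ft \<phi> (sinh (a - a2) / h))" by simp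
  qed simp
  also have "\<dots> =
    of_real h * (LINT Q|lborel. of_real h * (LINT P|lborel.
      e (a + h * Q) (a + (- h) * P) * ft \<psi> (sinh ((a + h * Q) - a) / h) * ft \<phi> (sinh (a - (a + (- h) * P)) / h)))"
    using h by (subst integral_dilation[of h _ a], simp, subst integral_dilation[of "- h" _ a]) simp_all
  also have "\<dots> = of_real (h\<^sup>2) * (LINT Q|lborel. LINT P|lborel. cis (l * (P + Q)) * theta f \<phi> g \<psi> a l h (P, Q))"
  proof -
    have "e (a + h * Q) (a + (- h) * P) * ft \<psi> (sinh ((a + h * Q) - a) / h) * ft \<phi> (sinh (a - (a + (- h) * P)) / h)
        = cis (l * (P + Q)) * theta f \<phi> g \<psi> a l h (P, Q)" for P Q
    proof -
      have 1: "a + h * Q - (a + (- h) * P) = h * (P + Q)" "a + h * Q - a = h * Q" "a - (a + - h * P) = h * P"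
        by (simp_all add: algebra_simps)
      have "l * (P + Q) + l * yfun h (P + Q) = sinh (h * (P + Q)) / h * l"
        using h by (simp add: yfun_def field_simps)
      then have 2: "cis (sinh (h * (P + Q)) / h * l) = cis (l * (P + Q)) * cis (l * yfun h (P + Q))"
        by (simp add: cis_mult)
      show ?thesis unfolding e_def 1 2 theta_def by (simp add: mult_ac)
    qed
    then show ?thesis by (simp add: power2_eq_square)
  qed
  also have "(LINT Q|lborel. LINT P|lborel. cis (l * (P + Q)) * theta f \<phi> g \<psi> a l h (P, Q)) =
    (LINT z|(lborel \<Otimes>\<^sub>M lborel). cis (l * (fst z + snd z)) * theta f \<phi> g \<psi> a l h z)"
  proof -
    \<comment> \<open>For \<open>N = 0\<close> the remainder estimate is a bound on
      \<open>theta\<close> itself, and \<open>1 / rho2\<close> is integrable; this justifies the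
      last interchange.\<close>
    obtain B where B: "\<And>z. norm (theta f \<phi> g \<psi> a l h z) \<le> B / rho2 z"
      using theta_bound(1)[OF t(2,4,1,3), of a l 0] h by auto
    have "integrable (lborel \<Otimes>\<^sub>M lborel) (\<lambda>z. cis (l * (fst z + snd z)) * theta f \<phi> g \<psi> a l h z)"
    proof (rule integrable_rho2_bound)
      show "continuous_on UNIV (\<lambda>z. cis (l * (fst z + snd z)) * theta f \<phi> g \<psi> a l h z)"
        using h continuous_on_theta(1)[OF t(2,4) s(1,3)] by (intro continuous_intros) auto
      show "norm (cis (l * (fst z + snd z)) * theta f \<phi> g \<psi> a l h z) \<le> B / rho2 z" for z
        using B[of z] by (simp add: norm_mult)
    qed
    then have "integrable (lborel \<Otimes>\<^sub>M lborel) (\<lambda>(P, Q). cis (l * (P + Q)) * theta f \<phi> g \<psi> a l h (P, Q))"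
      by (simp add: case_prod_unfold)
    from lborel_pair.integral_snd[OF this] show ?thesis by (simp add: case_prod_unfold)
  qed
  finally show ?thesis using h unfolding star_integral_def by (simp add: power_divide power_mult_distrib)
qed

text \<open>The pointwise remainder bound has the integrable weight \<open>1 / rho2\<close>, so it
  can be integrated over both Fourier variables; the factor \<open>cis\<close> has modulus 1. The
  constants \<open>(2 * pi)\<^sup>2\<close> from inversion cancel the remaining
  normalization.\<close>

lemma star_integral_asymptotics:
  assumes t: "test_function f" "test_function \<phi>" "test_function g" "test_function \<psi>"
  shows "(\<lambda>h. star_integral h (\<lambda>x. f (fst x) * \<phi> (snd x)) (\<lambda>x. g (fst x) * \<psi> (snd x)) (a, l) -
      (\<Sum>n<N. complex_of_real h ^ n * coef_val \<phi> \<psi> (\<lambda>n. (partial 1 ^^ n) f a / fact n) (\<lambda>n. (partial 1 ^^ n) g a / fact n) l n))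
    \<in> O[at_right 0](\<lambda>h. complex_of_real h ^ N)"
proof -
  note s = t[THEN test_function_smooth]
  let ?c = "of_real ((1 / (2 * pi))\<^sup>2) :: complex"
  let ?k = "coef_val \<phi> \<psi> (\<lambda>n. (partial 1 ^^ n) f a / fact n) (\<lambda>n. (partial 1 ^^ n) g a / fact n) l"
  let ?e = "\<lambda>z. cis (l * (fst z + snd z))"
  obtain B where B: "\<And>h z. 0 < h \<Longrightarrow> h \<le> 1 \<Longrightarrow>
    norm (theta f \<phi> g \<psi> a l h z - (\<Sum>n<N. of_real h ^ n * fps_nth (theta_fps f \<phi> g \<psi> a l z) n)) \<le> h ^ N * (B / rho2 z)"
    using theta_bound(1)[OF t(2,4,1,3), of a l N] by blast
  define K where "K = norm ?c * (LINT z|(lborel \<Otimes>\<^sub>M lborel). B * (1 / rho2 z))"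
  have int: "integrable (lborel \<Otimes>\<^sub>M lborel) (\<lambda>z. ?e z * fps_nth (theta_fps f \<phi> g \<psi> a l z) n)" for n
  proof -
    obtain B where B: "\<And>z. norm (fps_nth (theta_fps f \<phi> g \<psi> a l z) n) \<le> B / rho2 z"
      using theta_bound(2)[OF t(2,4,1,3), of a l n] by blast
    show ?thesis
    proof (rule integrable_rho2_bound)
      show "continuous_on UNIV (\<lambda>z. ?e z * fps_nth (theta_fps f \<phi> g \<psi> a l z) n)"
        using continuous_on_theta(2)[OF t(2,4) s(1,3) zero_neq_one[symmetric]] by (intro continuous_intros) auto
      show "norm (?e z * fps_nth (theta_fps f \<phi> g \<psi> a l z) n) \<le> B / rho2 z" for z
        using B[of z] by (simp add: norm_mult)
    qed
  qed
  have k: "?c * (LINT z|(lborel \<Otimes>\<^sub>M lborel). ?e z * fps_nth (theta_fps f \<phi> g \<psi> a l z) n) = ?k n" for n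
    unfolding theta_fps_def coef_integral[OF t(2,4)] by (simp add: power_divide power_mult_distrib)
  have "norm (star_integral h (\<lambda>x. f (fst x) * \<phi> (snd x)) (\<lambda>x. g (fst x) * \<psi> (snd x)) (a, l) -
      (\<Sum>n<N. complex_of_real h ^ n * ?k n)) \<le> K * norm (complex_of_real h ^ N)" if h: "0 < h" "h \<le> 1" for h
  proof -
    let ?d = "\<lambda>z. ?e z * (theta f \<phi> g \<psi> a l h z - (\<Sum>n<N. of_real h ^ n * fps_nth (theta_fps f \<phi> g \<psi> a l z) n))"
    have 1: "integrable (lborel \<Otimes>\<^sub>M lborel) (\<lambda>z. ?e z * theta f \<phi> g \<psi> a l h z)"
    proof -
      obtain B where B: "\<And>z. norm (theta f \<phi> g \<psi> a l h z) \<le> B / rho2 z"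
        using theta_bound(1)[OF t(2,4,1,3), of a l 0] h by auto
      show ?thesis
      proof (rule integrable_rho2_bound)
        show "continuous_on UNIV (\<lambda>z. ?e z * theta f \<phi> g \<psi> a l h z)"
          using h continuous_on_theta(1)[OF t(2,4) s(1,3)] by (intro continuous_intros) auto
        show "norm (?e z * theta f \<phi> g \<psi> a l h z) \<le> B / rho2 z" for z
          using B[of z] by (simp add: norm_mult)
      qed
    qed
    have 2: "integrable (lborel \<Otimes>\<^sub>M lborel) (\<lambda>z. \<Sum>n<N. of_real h ^ n * (?e z * fps_nth (theta_fps f \<phi> g \<psi> a l z) n))"
      using int by auto
    have d: "?d = (\<lambda>z. ?e z * theta f \<phi> g \<psi> a l h z - (\<Sum>n<N. of_real h ^ n * (?e z * fps_nth (theta_fps f \<phi> g \<psi> a l z) n)))"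
      by (simp add: right_diff_distrib sum_distrib_left mult.left_commute)
    have "(LINT z|(lborel \<Otimes>\<^sub>M lborel). ?d z) = (LINT z|(lborel \<Otimes>\<^sub>M lborel). ?e z * theta f \<phi> g \<psi> a l h z) -
        (\<Sum>n<N. of_real h ^ n * (LINT z|(lborel \<Otimes>\<^sub>M lborel). ?e z * fps_nth (theta_fps f \<phi> g \<psi> a l z) n))"
      unfolding d by (simp add: Bochner_Integration.integral_diff[OF 1 2] int Bochner_Integration.integral_sum)
    then have "?c * (LINT z|(lborel \<Otimes>\<^sub>M lborel). ?d z) = ?c * (LINT z|(lborel \<Otimes>\<^sub>M lborel). ?e z * theta f \<phi> g \<psi> a l h z) -
        (\<Sum>n<N. of_real h ^ n * (?c * (LINT z|(lborel \<Otimes>\<^sub>M lborel). ?e z * fps_nth (theta_fps f \<phi> g \<psi> a l z) n)))"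
      by (simp add: right_diff_distrib sum_distrib_left mult.left_commute)
    also have "\<dots> = star_integral h (\<lambda>x. f (fst x) * \<phi> (snd x)) (\<lambda>x. g (fst x) * \<psi> (snd x)) (a, l) -
      (\<Sum>n<N. complex_of_real h ^ n * ?k n)"
      unfolding k star_integral_eq[OF t h] ..
    finally have "norm (star_integral h (\<lambda>x. f (fst x) * \<phi> (snd x)) (\<lambda>x. g (fst x) * \<psi> (snd x)) (a, l) -
      (\<Sum>n<N. complex_of_real h ^ n * ?k n)) = norm ?c * norm (LINT z|(lborel \<Otimes>\<^sub>M lborel). ?d z)"
      by (simp only: norm_mult[symmetric])
    also have "\<dots> \<le> norm ?c * (LINT z|(lborel \<Otimes>\<^sub>M lborel). h ^ N * (B * (1 / rho2 z)))"
    proof (intro mult_left_mono norm_ge_zero, rule Bochner_Integration.integral_norm_bound_integral)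
      show "integrable (lborel \<Otimes>\<^sub>M lborel) ?d" unfolding d by (rule Bochner_Integration.integrable_diff[OF 1 2])
      show "integrable (lborel \<Otimes>\<^sub>M lborel) (\<lambda>z. h ^ N * (B * (1 / rho2 z)))"
        by (intro integrable_mult_right integrable_rho2)
      show "norm (?d z) \<le> h ^ N * (B * (1 / rho2 z))" for z
        using B[OF h, of z] by (simp add: norm_mult)
    qed
    also have "\<dots> = K * norm (complex_of_real h ^ N)"
      unfolding K_def integral_mult_right_zero using h by (simp add: norm_power mult_ac)
    finally show ?thesis .
  qed
  then show ?thesis
    by (intro bigoI[of _ K]) (auto simp: eventually_at_right_field intro: exI[of _ 1])
qed

section \<open>A bump function\<close>

text \<open>The polynomial in \<open>1 / x\<close> closes the family under differentiation: the
  derivative replaces \<open>p\<close> by \<open>X\<^sup>2 (p - p')\<close>, written with two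
  \<open>pCons 0\<close>.\<close>

definition flat_exp :: "real poly \<Rightarrow> real \<Rightarrow> complex" where
  "flat_exp p x = (if x > 0 then of_real (poly p (1 / x) * exp (- (1 / x))) else 0)"

lemma tendsto_poly_exp_minus: "((\<lambda>y::real. poly p y * exp (- y)) \<longlongrightarrow> 0) at_top"
proof -
  have "((\<lambda>y. \<Sum>i\<le>degree p. coeff p i * (y ^ i / exp y)) \<longlongrightarrow> (\<Sum>i\<le>degree p. coeff p i * 0)) at_top"
    by (intro tendsto_sum tendsto_mult tendsto_const tendsto_power_div_exp_0)
  then show ?thesis by (simp add: poly_altdef sum_distrib_right exp_minus divide_inverse mult.assoc)
qed

lemma tendsto_flat_exp: "(flat_exp p \<longlongrightarrow> 0) (at 0)"
proof -
  have "((\<lambda>x. poly p (1 / x) * exp (- (1 / x))) \<longlongrightarrow> 0) (at_right (0::real))"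
    using filterlim_compose[OF tendsto_poly_exp_minus filterlim_inverse_at_top_right, of p] by (simp add: inverse_eq_divide)
  then have "((\<lambda>x. complex_of_real (poly p (1 / x) * exp (- (1 / x)))) \<longlongrightarrow> of_real 0) (at_right 0)"
    by (rule tendsto_of_real)
  moreover have "\<forall>\<^sub>F x in at_right 0. complex_of_real (poly p (1 / x) * exp (- (1 / x))) = flat_exp p x"
    by (auto simp: eventually_at_right_field flat_exp_def intro: exI[of _ 1])
  ultimately have r: "(flat_exp p \<longlongrightarrow> 0) (at_right 0)" by (simp add: filterlim_cong)
  have "\<forall>\<^sub>F x in at_left 0. 0 = flat_exp p x"
    by (auto simp: eventually_at_left_field flat_exp_def intro: exI[of _ "-1"])
  then have "(flat_exp p \<longlongrightarrow> 0) (at_left 0)" by (rule tendsto_eventually[OF eventually_mono]) auto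
  with r show ?thesis by (simp add: filterlim_split_at)
qed

lemma flat_exp_vector_derivative:
  "(flat_exp p has_vector_derivative flat_exp (pCons 0 (pCons 0 (p - pderiv p))) x) (at x)"
proof (cases x "0 :: real" rule: linorder_cases)
  case less
  have "((\<lambda>_. 0) has_vector_derivative 0) (at x)" by simp
  then have "(flat_exp p has_vector_derivative 0) (at x)"
    by (rule has_vector_derivative_transform_within_open[where S = "{..<0}"]) (use less in \<open>auto simp: flat_exp_def\<close>)
  then show ?thesis using less by (simp add: flat_exp_def)
next
  case equal
  \<comment> \<open>Dividing by \<open>h\<close> multiplies the polynomial in \<open>1 / h\<close>
    by its variable, so up to the norm the difference quotient at the origin is
    \<open>flat_exp (pCons 0 p)\<close>, which tends to 0.\<close>
  have "((\<lambda>h. norm (flat_exp p (0 + h) - flat_exp p 0 - h *\<^sub>R 0) / norm h) \<longlongrightarrow> 0) (at 0)"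
  proof (rule Lim_transform_eventually)
    show "((\<lambda>h. norm (flat_exp (pCons 0 p) h)) \<longlongrightarrow> 0) (at 0)"
      using tendsto_norm[OF tendsto_flat_exp] by simp
    show "\<forall>\<^sub>F h in at 0. norm (flat_exp (pCons 0 p) h) = norm (flat_exp p (0 + h) - flat_exp p 0 - h *\<^sub>R 0) / norm h"
      by (auto simp: eventually_at flat_exp_def norm_mult norm_inverse divide_inverse abs_mult intro!: exI[of _ 1])
  qed
  then show ?thesis
    using equal by (simp add: has_vector_derivative_def has_derivative_at flat_exp_def bounded_linear_zero)
next
  case greater
  have "((\<lambda>x. poly p (1 / x) * exp (- (1 / x))) has_real_derivative
      poly (pCons 0 (pCons 0 (p - pderiv p))) (1 / x) * exp (- (1 / x))) (at x)"
    using greater by (auto intro!: derivative_eq_intros simp: field_simps power2_eq_square)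
  from has_vector_derivative_of_real[OF this]
  have "(flat_exp p has_vector_derivative of_real (poly (pCons 0 (pCons 0 (p - pderiv p))) (1 / x) * exp (- (1 / x)))) (at x)"
    by (rule has_vector_derivative_transform_within_open[where S = "{0<..}"]) (use greater in \<open>auto simp: flat_exp_def\<close>)
  then show ?thesis using greater by (simp add: flat_exp_def)
qed

lemma smooth_flat_exp: "smooth (flat_exp p)"
proof (rule smooth_coinduct[of _ "range flat_exp"])
  fix g b assume "g \<in> range flat_exp" "b \<in> (Basis :: real set)"
  then obtain p where "g = flat_exp p" "b = 1" by auto
  then show "partial b g \<in> range flat_exp"
    using partial_eq_vector_derivative[OF flat_exp_vector_derivative] by auto
next
  fix g :: "real \<Rightarrow> complex" assume "g \<in> range flat_exp"
  then obtain p where "g = flat_exp p" by auto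
  then show "g differentiable_on UNIV"
    using flat_exp_vector_derivative[of p]
    by (auto simp: differentiable_on_def has_vector_derivative_def differentiable_def)
qed auto

text \<open>A product of two one-sided flat exponentials is supported in the unit interval around
  \<open>c\<close>. At \<open>c\<close> both factors equal \<open>flat_exp 1 1\<close>, which
  explains the normalizing constant.\<close>

lemma bump_function:
  obtains f where "test_function f" "f (c::real) = 1"
proof -
  let ?u = "\<lambda>x. flat_exp 1 (1 - c + x) * flat_exp 1 (1 + c + - x)"
  define f where "f x = inverse (flat_exp 1 1 ^ 2) * ?u x" for x
  have "affine_map (\<lambda>x. 1 - c + x)" "affine_map (\<lambda>x. 1 + c + - x)"
    unfolding affine_map_def
    by (rule exI[of _ "\<lambda>x. x"], rule exI[of _ "1 - c"], simp add: bounded_linear_ident fun_eq_iff)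
      (rule exI[of _ "\<lambda>x. - x"], rule exI[of _ "1 + c"], simp add: bounded_linear_minus bounded_linear_ident fun_eq_iff)
  then have "smooth f" unfolding f_def
    by (intro smooth_mult smooth_const smooth_affine[OF smooth_flat_exp])
  moreover have "f x = 0" if "1 + \<bar>c\<bar> \<le> norm x" for x
  proof -
    have "1 - c + x \<le> 0 \<or> 1 + c + - x \<le> 0" using that by auto
    then show ?thesis by (auto simp: f_def flat_exp_def)
  qed
  ultimately have "test_function f" by (rule test_functionI)
  moreover have "f c = 1" by (simp add: f_def flat_exp_def power2_eq_square field_simps)
  ultimately show ?thesis by (rule that)
qed

section \<open>Uniqueness of asymptotic expansions\<close>

text \<open>Below \<open>n\<close> the coefficients agree by induction, so subtracting the
  expansions to order \<open>Suc n\<close> shows that \<open>h ^ n * (c n - d n)\<close> is of order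
  \<open>h ^ Suc n\<close>; division by \<open>h ^ n\<close> and \<open>h\<close> tending to 0
  remain.\<close>

lemma asymptotic_expansion_unique:
  fixes c d :: "nat \<Rightarrow> complex"
  assumes "\<And>N. (\<lambda>h. F h - (\<Sum>n<N. complex_of_real h ^ n * c n)) \<in> O[at_right 0](\<lambda>h. complex_of_real h ^ N)"
    and "\<And>N. (\<lambda>h. F h - (\<Sum>n<N. complex_of_real h ^ n * d n)) \<in> O[at_right 0](\<lambda>h. complex_of_real h ^ N)"
  shows "c n = d n"
proof (induction n rule: less_induct)
  case (less n)
  have "(\<lambda>h. (F h - (\<Sum>k<Suc n. complex_of_real h ^ k * d k)) - (F h - (\<Sum>k<Suc n. complex_of_real h ^ k * c k)))
      \<in> O[at_right 0](\<lambda>h. complex_of_real h ^ Suc n)"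
    by (intro sum_in_bigo assms)
  moreover have "(F h - (\<Sum>k<Suc n. complex_of_real h ^ k * d k)) - (F h - (\<Sum>k<Suc n. complex_of_real h ^ k * c k)) =
      complex_of_real h ^ n * (c n - d n)" for h
    using less by (simp add: algebra_simps)
  ultimately have "(\<lambda>h. complex_of_real h ^ n * (c n - d n)) \<in> O[at_right 0](\<lambda>h. complex_of_real h ^ Suc n)"
    by simp
  then obtain K where "\<forall>\<^sub>F h in at_right 0. norm (complex_of_real h ^ n * (c n - d n)) \<le> K * norm (complex_of_real h ^ Suc n)"
    by (rule landau_o.bigE)
  moreover have "\<forall>\<^sub>F h in at_right 0. (0::real) < h" by (simp add: eventually_at_right_less)
  ultimately have "\<forall>\<^sub>F h in at_right 0. norm (c n - d n) \<le> K * h"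
  proof eventually_elim
    case (elim h)
    have "h ^ n * norm (c n - d n) \<le> h ^ n * (K * h)" using elim by (simp add: norm_mult norm_power mult_ac)
    then show ?case using elim by simp
  qed
  moreover have "((\<lambda>h. K * h) \<longlongrightarrow> K * 0) (at_right 0)" by (intro tendsto_intros)
  ultimately have "norm (c n - d n) \<le> K * 0"
    by (intro tendsto_lowerbound[where F = "at_right (0::real)"]) auto
  then show ?case by simp
qed

section \<open>The expansion as an operator on formal series\<close>

text \<open>Multiplication by \<open>h\<close>. Both products to be compared commute with it in each
  factor, so the analysis is confined to pairs of functions free of \<open>h\<close>.\<close>

definition hshift :: "(nat, 'x) formal \<Rightarrow> (nat, 'x) formal" where
  "hshift F = (\<lambda>n. case n of 0 \<Rightarrow> (\<lambda>x. 0) | Suc m \<Rightarrow> F m)"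

lemma hshift_0 [simp]: "hshift F 0 = (\<lambda>x. 0)" and hshift_Suc [simp]: "hshift F (Suc n) = F n"
  by (simp_all add: hshift_def)

lemma sformal_hshift: "sformal F \<Longrightarrow> sformal (hshift F)"
  by (auto simp: sformal_def hshift_def smooth_const split: nat.split)

lemma single_Suc: "single (Suc r) w = hshift (single r w)"
  by (auto simp: single_def hshift_def fun_eq_iff split: nat.split)

lemma lift_op_hshift:
  assumes "\<And>k. lop (A k)"
  shows "lift_op A (hshift F) = hshift (lift_op A F)"
proof (rule ext, rule ext)
  fix n x
  show "lift_op A (hshift F) n x = hshift (lift_op A F) n x"
    by (cases n) (simp_all add: lift_op_def Suc_diff_le lop_zero_arg[OF assms])
qed

lemma mult_tensor_hshift_left:
  assumes "\<And>k. D k (\<lambda>x. 0) = (\<lambda>x. 0)"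
  shows "mult D (tensor (hshift F) G) = hshift (mult D (tensor F G))"
proof (rule ext, rule ext)
  fix n x
  show "mult D (tensor (hshift F) G) n x = hshift (mult D (tensor F G)) n x"
    by (cases n) (simp_all add: mult_def tensor_def assms case_prod_unfold sum.atMost_Suc_shift del: sum.atMost_Suc)
qed

lemma mult_tensor_hshift_right:
  assumes "\<And>k. D k (\<lambda>x. 0) = (\<lambda>x. 0)"
  shows "mult D (tensor F (hshift G)) = hshift (mult D (tensor F G))"
proof (rule ext, rule ext)
  fix n x
  show "mult D (tensor F (hshift G)) n x = hshift (mult D (tensor F G)) n x"
  proof (cases n)
    case (Suc m)
    have "(\<Sum>j\<le>Suc m - i. D (Suc m - i - j) (tensor F (hshift G) (i, j)) x) =
        (\<Sum>j\<le>m - i. D (m - i - j) (tensor F G (i, j)) x)" if "i \<le> m" for i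
    proof -
      have "Suc m - i = Suc (m - i)" using that by simp
      then show ?thesis
        by (simp add: tensor_def assms case_prod_unfold sum.atMost_Suc_shift del: sum.atMost_Suc)
    qed
    then show ?thesis using Suc by (simp add: mult_def) (simp add: tensor_def assms case_prod_unfold)
  qed (simp add: mult_def tensor_def assms case_prod_unfold)
qed

definition twisted :: "(nat \<times> nat, S \<times> S) formal \<Rightarrow> (nat, S) formal" where
  "twisted W = T (mult moyal (left_leg R (right_leg R W)))"

lemma formal_op_twisted: "formal_op (\<lambda>x. (x, x)) twisted"
  unfolding twisted_def[abs_def]
  using formal_op_compose[OF formal_op_T formal_op_compose[OF formal_op_mult_moyal
    formal_op_compose[OF formal_op_left_leg[OF formal_op_R] formal_op_right_leg[OF formal_op_R]]]]
  by (simp add: case_prod_unfold)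

lemma moyal_zero: "moyal k (\<lambda>x. 0) = (\<lambda>x. 0)"
  using local_op_zero_arg[OF local_op_moyal[of k "()"]] by simp

lemma twisted_tensor: "sformal F \<Longrightarrow> sformal G \<Longrightarrow> twisted (tensor F G) = T (mult moyal (tensor (R F) (R G)))"
  by (simp add: twisted_def right_leg_tensor[OF formal_op_R] left_leg_tensor[OF formal_op_R])

lemma twisted_hshift:
  assumes "sformal F" "sformal G"
  shows "twisted (tensor (hshift F) G) = hshift (twisted (tensor F G))"
    and "twisted (tensor F (hshift G)) = hshift (twisted (tensor F G))"
  by (simp_all add: twisted_tensor assms sformal_hshift lift_op_hshift lop_Rop lop_Top
      mult_tensor_hshift_left[of moyal] mult_tensor_hshift_right[of moyal] moyal_zero)

lemma formal_op_mult_bidifferential: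
  assumes "\<And>k. bidifferential (D k)"
  shows "formal_op (\<lambda>x. (x, x)) (mult D :: _ \<Rightarrow> (nat, 'a::euclidean_space) formal)"
  unfolding formal_op_def mult_def
proof (intro conjI allI affine_map_diag local_op_sum)
  fix n i j :: nat
  obtain I c where I: "finite I" "I \<subseteq> lists Basis" "\<And>bs. bs \<in> I \<Longrightarrow> smooth (c bs)"
    and D: "\<And>w. smooth w \<Longrightarrow> D (n - i - j) w = (\<lambda>x. \<Sum>bs\<in>I. c bs x * partials bs w (x, x))"
    using assms[of "n - i - j"] unfolding bidifferential_def by blast
  have "local_op (\<lambda>x. (x, x)) (\<lambda>(F :: (nat \<times> nat, 'a \<times> 'a) formal) x. \<Sum>bs\<in>I. c bs x * partials bs (F (i, j)) (x, x))"
    using I by (intro local_op_sum local_op.mult local_op.base) auto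
  then show "local_op (\<lambda>x. (x, x)) (\<lambda>(F :: (nat \<times> nat, 'a \<times> 'a) formal) x. D (n - i - j) (F (i, j)) x)"
    by (rule local_op.cong) (rule D, simp add: sformal_def)
qed

text \<open>Near the diagonal point, \<open>1 = b \<rho> + (1 - b)\<^sup>K\<close> with a geometric sum \<open>\<rho>\<close>, and the last term is not seen
  by an operator of order less than \<open>K\<close>.\<close>

lemma local_op_localize:
  assumes L: "local_op \<iota> L" and b: "smooth b" "b (\<iota> y) = 1"
    and zero: "\<And>F. sformal F \<Longrightarrow> L (\<lambda>r x. b x * F r x) y = 0"
    and F: "sformal F"
  shows "L F y = 0"
proof -
  obtain K I where "finite I \<and> (\<forall>F y. sformal F \<longrightarrow> (\<forall>r\<in>I. flat K (\<iota> y) (F r)) \<longrightarrow> L F y = 0)"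
    using local_op_flat[OF L] by (elim exE)
  then have K: "L F y = 0" if "sformal F" "\<And>r. flat K (\<iota> y) (F r)" for F
    using that by simp
  have b': "smooth (\<lambda>x. 1 - b x)" by (intro smooth_diff smooth_const b)
  define G where "G r x = (\<Sum>j<K. (1 - b x) ^ j) * F r x" for r x
  define H where "H r x = (1 - b x) ^ K * F r x" for r x
  have sG: "sformal G"
    unfolding sformal_def G_def[abs_def] using F
    by (intro allI smooth_mult smooth_sum smooth_power b') (auto simp: sformal_def)
  have sH: "sformal H"
    unfolding sformal_def H_def[abs_def] using F
    by (intro allI smooth_mult smooth_power b') (auto simp: sformal_def)
  have sbG: "sformal (\<lambda>r x. b x * G r x)"
    using sG b(1) by (auto simp: sformal_def intro: smooth_mult)
  have "L H y = 0"
  proof (rule K[OF sH])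
    fix r show "flat K (\<iota> y) (H r)"
      unfolding H_def[abs_def] using F
      by (intro flat_mult_left smooth_power b' flat_power) (auto simp: sformal_def b)
  qed
  moreover have "L (\<lambda>r x. b x * G r x) y = 0" by (rule zero[OF sG])
  moreover have "F = (\<lambda>r x. b x * G r x + H r x)"
  proof (rule ext, rule ext)
    fix r x
    have "1 - (1 - b x) ^ K = b x * (\<Sum>j<K. (1 - b x) ^ j)"
      using one_diff_power_eq[of "1 - b x" K] by simp
    then have "b x * (\<Sum>j<K. (1 - b x) ^ j) + (1 - b x) ^ K = 1"
      unfolding diff_eq_eq by (rule sym)
    then have "(b x * (\<Sum>j<K. (1 - b x) ^ j) + (1 - b x) ^ K) * F r x = F r x" by simp
    then show "F r x = b x * G r x + H r x" by (simp add: G_def H_def distrib_right mult.assoc)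
  qed
  ultimately show ?thesis using local_op_add_arg[OF L sbG sH] by simp
qed

lemma test_function_prod2:
  fixes f g :: "real \<Rightarrow> complex"
  assumes "test_function f" "test_function g"
  shows "test_function (\<lambda>x. f (fst x) * g (snd x))"
proof -
  obtain A where A: "A > 0" "\<And>x. A \<le> norm x \<Longrightarrow> f x = 0" using test_function_support[OF assms(1)] by metis
  obtain B where B: "B > 0" "\<And>x. B \<le> norm x \<Longrightarrow> g x = 0" using test_function_support[OF assms(2)] by metis
  have "f (fst x) * g (snd x) = 0" if "A + B \<le> norm x" for x
  proof -
    have "norm x \<le> norm (fst x) + norm (snd x)" using norm_Pair_le[of "fst x" "snd x"] by simp
    then have "A \<le> norm (fst x) \<or> B \<le> norm (snd x)" using that by linarith
    then show ?thesis using A B by auto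
  qed
  then show ?thesis
    by (rule test_functionI[OF smooth_prod2[OF test_function_smooth[OF assms(1)] test_function_smooth[OF assms(2)]]])
qed

text \<open>On pairs of test functions that separate the coordinates both sides are the coefficients
  of one asymptotic expansion. To pass to arbitrary series, exponentials are cut off by a smooth
  \<open>b\<close> equal to 1 at the point in question: the cut-off exponentials are such pairs, and
  \<open>local_op_localize\<close> removes the cut-off.\<close>

lemma star_expansion_twisted:
  assumes D: "star_expansion D" and W: "sformal W"
  shows "mult D W = twisted W"
proof (rule ext, rule ext)
  fix n and y :: S
  obtain a l where y: "y = (a, l)" by (cases y)
  have bi: "\<And>k. bidifferential (D k)" using D by (simp add: star_expansion_def)
  note mD = formal_op_mult_bidifferential[OF bi]
  have D0: "D k (\<lambda>x. 0) = (\<lambda>x. 0)" for k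
  proof -
    obtain I c where "\<And>w. smooth w \<Longrightarrow> D k w = (\<lambda>x. \<Sum>bs\<in>I. c bs x * partials bs w (x, x))"
      using bi[of k] by (auto simp: bidifferential_def)
    moreover have "partials bs (\<lambda>x. 0) = (\<lambda>x. 0)" for bs :: "(S \<times> S) list"
      by (induction bs) (simp_all add: partials_def partial_def)
    ultimately show ?thesis by (simp add: smooth_const)
  qed

  have base: "mult D (tensor (single 0 u) (single 0 v)) = twisted (tensor (single 0 u) (single 0 v))"
    if u: "u = (\<lambda>x. f (fst x) * \<phi> (snd x))" "test_function f" "test_function \<phi>"
      and v: "v = (\<lambda>x. g (fst x) * \<psi> (snd x))" "test_function g" "test_function \<psi>" for u v f \<phi> g \<psi>
  proof (rule ext, rule ext)
    fix m and x :: S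
    obtain a l where x: "x = (a, l)" by (cases x)
    have "mult D (tensor (single 0 u) (single 0 v)) m x = D m (\<lambda>(x, y). u x * v y) x"
    proof -
      have "(\<Sum>j\<le>m - i. D (m - i - j) (tensor (single 0 u) (single 0 v) (i, j)) x) =
          (if i = 0 then D m (\<lambda>(x, y). u x * v y) x else 0)" if "i \<le> m" for i
      proof -
        have "D (m - i - j) (tensor (single 0 u) (single 0 v) (i, j)) x =
            (if j = 0 then (if i = 0 then D m (\<lambda>(x, y). u x * v y) x else 0) else 0)" for j
          by (auto simp: tensor_def single_def D0 case_prod_unfold)
        then show ?thesis by simp
      qed
      then show ?thesis by (simp add: mult_def)
    qed
    also have "\<dots> = coef_val \<phi> \<psi> (\<lambda>n. (partial 1 ^^ n) f a / fact n) (\<lambda>n. (partial 1 ^^ n) g a / fact n) l m"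
    proof (rule asymptotic_expansion_unique)
      have "test_function u" "test_function v"
        unfolding u v by (intro test_function_prod2 u v)+
      then show "(\<lambda>h. star_integral h u v x - (\<Sum>n<N. complex_of_real h ^ n * D n (\<lambda>(x, y). u x * v y) x))
          \<in> O[at_right 0](\<lambda>h. complex_of_real h ^ N)" for N
        using D unfolding star_expansion_def by blast
      show "(\<lambda>h. star_integral h u v x - (\<Sum>n<N. complex_of_real h ^ n *
          coef_val \<phi> \<psi> (\<lambda>n. (partial 1 ^^ n) f a / fact n) (\<lambda>n. (partial 1 ^^ n) g a / fact n) l n))
          \<in> O[at_right 0](\<lambda>h. complex_of_real h ^ N)" for N
        unfolding u(1) v(1) x by (rule star_integral_asymptotics[OF u(2,3) v(2,3)])
    qed
    also have "\<dots> = twisted (tensor (single 0 u) (single 0 v)) m x"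
      unfolding u(1) v(1) x twisted_def
      by (rule coef_val_eq[symmetric]) (use u v in \<open>auto intro: test_function_smooth\<close>)
    finally show "mult D (tensor (single 0 u) (single 0 v)) m x = twisted (tensor (single 0 u) (single 0 v)) m x" .
  qed
  have shifted: "mult D (tensor (single i u) (single j v)) = twisted (tensor (single i u) (single j v))"
    if "smooth u" "smooth v" "mult D (tensor (single 0 u) (single 0 v)) = twisted (tensor (single 0 u) (single 0 v))"
    for i j and u v :: "S \<Rightarrow> complex"
  proof (induction i)
    case 0
    show ?case
      by (induction j) (simp_all add: that single_Suc mult_tensor_hshift_right[of D] D0 twisted_hshift sformal_single)
  next
    case (Suc i)
    then show ?case
      by (simp add: that single_Suc mult_tensor_hshift_left[of D] D0 twisted_hshift sformal_single)
  qed

  let ?L = "\<lambda>F y. mult D F n y + (- 1) * twisted F n y"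
  have L: "local_op (\<lambda>x. (x, x)) ?L"
    using mD formal_op_twisted unfolding formal_op_def
    by (intro local_op.add local_op.mult smooth_const) auto
  obtain f0 where f0: "test_function f0" "f0 a = 1" by (rule bump_function)
  obtain g0 where g0: "test_function g0" "g0 l = 1" by (rule bump_function)
  \<comment> \<open>A product of four one-variable bumps, so that multiplication of an exponential
    by \<open>b\<close> yields a tensor product of two functions to which \<open>base\<close> and
    \<open>shifted\<close> apply.\<close>
  define b where "b = (\<lambda>z::S \<times> S. f0 (fst (fst z)) * g0 (snd (fst z)) * (f0 (fst (snd z)) * g0 (snd (snd z))))"
  note w = smooth_prod2[OF test_function_smooth[OF f0(1)] test_function_smooth[OF g0(1)]]
  have sb: "smooth b"
    unfolding b_def
    by (rule smooth_mult[OF smooth_affine[OF w affine_map_fst] smooth_affine[OF w affine_map_snd]])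
  have "?L W y = 0"
  proof (rule local_op_localize[OF L sb _ _ W])
    show "b (y, y) = 1" by (simp add: b_def y f0 g0)
    fix F :: "(nat \<times> nat, S \<times> S) formal" assume F: "sformal F"
    have bop: "formal_op (\<lambda>x. x) (\<lambda>(F :: (nat \<times> nat, S \<times> S) formal) r x. b x * F r x)"
      unfolding formal_op_def by (intro conjI allI affine_map_id local_op.mult[OF sb] local_op_coeff)
    show "?L (\<lambda>r x. b x * F r x) y = 0"
    proof (rule local_op_exp[OF local_op_compose[OF affine_map_diag L bop] _ F])
      fix r :: "nat \<times> nat" and \<zeta> :: "S \<times> S"
      obtain i j where r: "r = (i, j)" by (cases r)
      obtain p q s t where z: "\<zeta> = ((p, q), (s, t))" by (metis surj_pair)
      define e where "e k w = (\<lambda>x::real. exp (complex_of_real (k * x)) * w x)" for k w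
      have e: "test_function (e k w)" if "test_function w" for k w
        unfolding e_def using smooth_exp_linear[of "\<lambda>x. k * x"] that by (intro test_function_mult) (auto intro: bounded_linear_mult_right)
      define u where "u = (\<lambda>x. e p f0 (fst x) * e q g0 (snd x))"
      define v where "v = (\<lambda>x. e s f0 (fst x) * e t g0 (snd x))"
      have eq: "(\<lambda>r' x. b x * single r (\<lambda>x. exp (complex_of_real (\<zeta> \<bullet> x))) r' x) = tensor (single i u) (single j v)"
        by (auto simp: fun_eq_iff r z tensor_def single_def u_def v_def e_def b_def inner_Pair exp_add mult_ac)
      have "mult D (tensor (single i u) (single j v)) = twisted (tensor (single i u) (single j v))"
        by (rule shifted[OF _ _ base[OF u_def e[OF f0(1)] e[OF g0(1)] v_def e[OF f0(1)] e[OF g0(1)]]])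
          (unfold u_def v_def, (intro smooth_prod2 test_function_smooth[OF e] f0 g0)+)
      then show "?L (\<lambda>r' x. b x * single r (\<lambda>x. exp (complex_of_real (\<zeta> \<bullet> x))) r' x) y = 0"
        unfolding eq by simp
    qed
  qed
  then show "mult D W n y = twisted W n y" by simp
qed

theorem corollary5p1:
  fixes D :: "nat \<Rightarrow> (S \<times> S \<Rightarrow> complex) \<Rightarrow> S \<Rightarrow> complex"
  assumes "star_expansion D"
  shows "\<exists>\<Delta> \<epsilon> \<sigma>. is_hopf_algebra D \<Delta> \<epsilon> \<sigma>"
  using is_hopf_algebra_intertwined[of D] star_expansion_twisted[OF assms] unfolding twisted_def by blast

end
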